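(* Let $\Phi_{z_0,\max}$ be a local Zhou weight related to $|f_0|^2e^{-2\varphi_0}$ near $z_0$. For any holomorphic function $G$ on $X$ near $z_0$, $$\nu(G,\Phi_{z_0,\max})+c_{z_0}(\Phi_{z_0,\max})\le c^G_{z_0}(\Phi_{z_0,\max})\le\nu(G,\Phi_{z_0,\max})-\sigma(\log|f_0|,\Phi_{z_0,\max})+1+\sigma(\varphi_0,\Phi_{z_0,\max}).$$ In particular, if $|f_0|^2e^{-2\varphi_0}\equiv1$, then $\nu(G,\Phi_{z_0,\max})+1=c^G_{z_0}(\Phi_{z_0,\max})$.
   Context: Let $\Omega\subset\mathbb{C}^n$ be open, $X\subset\Omega$ an analytic subset of pure dimension $d$, and $z_0\in X$ a (possibly singular) point such that $(X,z_0)$ is an irreducible germ of an analytic set. The coordinates $z=(z_1,\dots,z_n)$ of $\mathbb{C}^n$ are centred at $z_0$ and $|z|^2=\sum_{j=1}^n|z_j|^2$. $X_{\mathrm{reg}}$ and $X_{\mathrm{sing}}$ are the regular and singular parts of $X$. Volume: $dV_X=\frac{1}{2^dd!}\bigwedge^d\big(\sum_{j=1}^n\sqrt{-1}\,dz_j\wedge d\bar z_j\big)$ on $X_{\mathrm{reg}}$. A function is integrable near $z_0$ if it is integrable with respect to $dV_X$ on $U\cap X_{\mathrm{reg}}$ for some neighborhood $U$ of $z_0$ in $X$. A plurisubharmonic function on (an open subset of) $X$ is a Lebesgue measurable function that is plurisubharmonic on $X_{\mathrm{reg}}$ and bounded above near every point of $X_{\mathrm{sing}}$; its values on $X_{\mathrm{sing}}$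 are ignored. Let $f_0=(f_{0,1},\dots,f_{0,m})$ be a vector of holomorphic functions on $X$ near $z_0$, $|f_0|^2=\sum_i|f_{0,i}|^2$, and let $\varphi_0$ be a plurisubharmonic function near $z_0$ such that $|f_0|^2e^{-2\varphi_0}$ is integrable near $z_0$. Local Zhou weight: a plurisubharmonic function $\Phi$ near $z_0$ on $X$ is a local Zhou weight related to $|f_0|^2e^{-2\varphi_0}$ near $z_0$ if (i) $|f_0|^2e^{-2\varphi_0}|z|^{2N_0}e^{-2\Phi}$ is integrable near $z_0$ for large enough $N_0\gg0$; (ii) $|f_0|^2e^{-2\varphi_0}e^{-2\Phi}$ is not integrable near $z_0$; (iii) for any plurisubharmonic function $\varphi'\ge\Phi+O(1)$ near $z_0$ such that $|f_0|^2e^{-2\varphi_0}e^{-2\varphi'}$ is not integrable near $z_0$, one has $\varphi'=\Phi+O(1)$ near $z_0$. Relative type: $\sigma(\psi,\varphi)=\sup\{c\ge0:\psi\le c\varphi+O(1)\text{ on }U\setminus X_{\mathrm{sing}}\text{ for some open neighborhood }U\text{ of }z_0\text{ in }X\}\in[0,+\infty]$; $\nu(G,\Phi):=\sigma(\log|G|,\Phi)$ (with $\log0=-\infty$). Jumping number: $c^G_{z_0}(\Phi)=\sup\{c:|G|^2e^{-2c\Phi}\text{ is integrable near }z_0\}$, and $c_{z_0}(\Phi):=c^1_{z_0}(\Phi)$. *)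

theory Defs
  imports "HOL-Analysis.Analysis" "HOL-Combinatorics.Permutations"
begin

section \<open>Holomorphic functions of several variables and analytic sets\<close>

definition holo_on :: "(complex^'n \<Rightarrow> complex) \<Rightarrow> (complex^'n) set \<Rightarrow> bool" where
  "holo_on f U \<longleftrightarrow> (\<forall>p\<in>U. \<exists>a. (f has_derivative (\<lambda>v. \<Sum>j\<in>UNIV. a j * v $ j)) (at p))"

definition holo_map_on :: "(complex^'n \<Rightarrow> complex^'m) \<Rightarrow> (complex^'n) set \<Rightarrow> bool" where
  "holo_map_on F U \<longleftrightarrow> (\<forall>i. holo_on (\<lambda>z. F z $ i) U)"

definition analytic_subset :: "(complex^'n) set \<Rightarrow> (complex^'n) set \<Rightarrow> bool" where
  "analytic_subset W A \<longleftrightarrow> A \<subseteq> W \<and>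
     (\<forall>p\<in>W. \<exists>U S. open U \<and> p \<in> U \<and> U \<subseteq> W \<and> finite S \<and> (\<forall>g\<in>S. holo_on g U) \<and>
        A \<inter> U = {z\<in>U. \<forall>g\<in>S. g z = 0})"

definition irreducible_germ :: "(complex^'n) set \<Rightarrow> complex^'n \<Rightarrow> bool" where
  "irreducible_germ X p \<longleftrightarrow> p \<in> X \<and>
     (\<forall>W A B. open W \<and> p \<in> W \<and> analytic_subset W A \<and> analytic_subset W B \<and> X \<inter> W = A \<union> B \<longrightarrow>
        (\<exists>W'. open W' \<and> p \<in> W' \<and> W' \<subseteq> W \<and> (X \<inter> W' = A \<inter> W' \<or> X \<inter> W' = B \<inter> W')))"

text \<open>Holomorphic functions on \<open>X\<close> are those that extend locally to the ambient space.\<close>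

definition holo_near :: "(complex^'n) set \<Rightarrow> complex^'n \<Rightarrow> (complex^'n \<Rightarrow> complex) \<Rightarrow> bool" where
  "holo_near X p f \<longleftrightarrow>
     (\<exists>U g. open U \<and> p \<in> U \<and> holo_on g U \<and> (\<forall>z\<in>X \<inter> U. f z = g z))"


section \<open>Regular and singular part, dimension\<close>

text \<open>A set \<open>I\<close> of coordinate indices stands for the coordinate subspace
  \<open>\<complex>\<^sup>I\<close> of \<open>\<complex>\<^sup>n\<close>, of complex dimension \<open>card I\<close>; submanifolds of any
  dimension (including 0) are then described inside a single ambient type.\<close>

definition coord_space :: "'n::finite set \<Rightarrow> (complex^'n) set" where
  "coord_space I = {w. \<forall>j. j \<notin> I \<longrightarrow> w $ j = 0}"

text \<open>\<open>F : U \<rightarrow> V\<close> is biholomorphic with inverse \<open>G\<close> and straightens \<open>X \<inter> U\<close> to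
  \<open>\<complex>\<^sup>I \<inter> V\<close>; hence \<open>G\<close> restricted to \<open>\<complex>\<^sup>I \<inter> V\<close> is a holomorphic
  parametrization of \<open>X \<inter> U\<close>.\<close>

definition slice_chart ::
  "(complex^'n) set \<Rightarrow> 'n::finite set \<Rightarrow> (complex^'n) set \<Rightarrow> (complex^'n) set \<Rightarrow>
   (complex^'n \<Rightarrow> complex^'n) \<Rightarrow> (complex^'n \<Rightarrow> complex^'n) \<Rightarrow> bool" where
  "slice_chart X I U V F G \<longleftrightarrow>
     open U \<and> open V \<and> holo_map_on F U \<and> holo_map_on G V \<and>
     (\<forall>z\<in>U. F z \<in> V \<and> G (F z) = z) \<and> (\<forall>w\<in>V. G w \<in> U \<and> F (G w) = w) \<and>
     F ` (X \<inter> U) = coord_space I \<inter> V"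

definition submanifold_at :: "(complex^'n) set \<Rightarrow> nat \<Rightarrow> complex^'n \<Rightarrow> bool" where
  "submanifold_at X k p \<longleftrightarrow>
     p \<in> X \<and> (\<exists>I U V F G. slice_chart X I U V F G \<and> p \<in> U \<and> card I = k)"

definition reg_part :: "(complex^'n) set \<Rightarrow> (complex^'n) set" where
  "reg_part X = {p. \<exists>k. submanifold_at X k p}"

definition sing_part :: "(complex^'n) set \<Rightarrow> (complex^'n) set" where
  "sing_part X = X - reg_part X"

text \<open>The dimension of \<open>X\<close> at \<open>p\<close> is the upper limit, as \<open>q \<rightarrow> p\<close>, of its dimension at
  regular points \<open>q\<close>.\<close>

definition dim_at :: "(complex^'n) set \<Rightarrow> complex^'n \<Rightarrow> nat" where
  "dim_at X p = Max {k. \<forall>W. open W \<and> p \<in> W \<longrightarrow> (\<exists>q\<in>W. submanifold_at X k q)}"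

definition pure_dim :: "(complex^'n) set \<Rightarrow> nat \<Rightarrow> bool" where
  "pure_dim X d \<longleftrightarrow> (\<forall>p\<in>X. dim_at X p = d)"


section \<open>The volume of the regular part\<close>

text \<open>The 2-form \<open>\<Sum>\<^sub>j \<i> dz\<^sub>j \<and> d\<bar>z\<^sub>j\<close>.\<close>

definition kahler_form :: "complex^'n \<Rightarrow> complex^'n \<Rightarrow> complex" where
  "kahler_form v w = (\<Sum>j\<in>UNIV. \<i> * (v $ j * cnj (w $ j) - w $ j * cnj (v $ j)))"

text \<open>The real coordinate frame of \<open>\<complex>\<^sup>I\<close>: \<open>(i, False)\<close> indexes \<open>\<partial>/\<partial>x\<^sub>i\<close> and \<open>(i, True)\<close> indexes
  \<open>\<partial>/\<partial>y\<^sub>i\<close>.\<close>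

definition real_frame :: "'n::finite \<times> bool \<Rightarrow> complex^'n" where
  "real_frame s = axis (fst s) (if snd s then \<i> else 1)"

text \<open>The value of \<open>1/(2\<^sup>d d!) \<omega>\<^sup>d\<close>, \<open>\<omega>\<close> the form above and \<open>d = card I\<close>, on the images of
  \<open>\<partial>/\<partial>x\<^sub>i, \<partial>/\<partial>y\<^sub>i\<close> (\<open>i \<in> I\<close>) under the derivative of \<open>G\<close> at \<open>w\<close>.  Here
  \<open>\<omega>\<^sup>d(v\<^sub>1, \<dots>, v\<^sub>2\<^sub>d) = 2\<^sup>-\<^sup>d \<Sum>\<^sub>\<sigma> sgn \<sigma> \<Prod>\<^sub>k \<omega>(v\<^sub>\<sigma>\<^sub>(\<^sub>2\<^sub>k\<^sub>-\<^sub>1\<^sub>), v\<^sub>\<sigma>\<^sub>(\<^sub>2\<^sub>k\<^sub>)\<close>); the order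
  in which the pairs are listed is irrelevant.  The value is real (and positive in a chart).\<close>

definition vol_density ::
  "'n::finite set \<Rightarrow> (complex^'n \<Rightarrow> complex^'n) \<Rightarrow> complex^'n \<Rightarrow> real" where
  "vol_density I G w =
     (let d = card I; e = (\<lambda>s. frechet_derivative G (at w) (real_frame s)) in
      Re (1 / (2 ^ d * fact d) *
          (1 / 2 ^ d * (\<Sum>\<sigma> | \<sigma> permutes (I \<times> (UNIV :: bool set)).
             of_int (sign \<sigma>) * (\<Prod>i\<in>I. kahler_form (e (\<sigma> (i, False))) (e (\<sigma> (i, True))))))))"

definition coord_embed :: "'n::finite set \<Rightarrow> ('n \<Rightarrow> complex) \<Rightarrow> complex^'n" where
  "coord_embed I x = (\<chi> j. if j \<in> I then x j else 0)"

text \<open>The volume of the part of \<open>X\<close> covered by a chart, as a Borel measure on \<open>\<complex>\<^sup>n\<close>.\<close>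

definition chart_vol ::
  "'n::finite set \<Rightarrow> (complex^'n) set \<Rightarrow> (complex^'n \<Rightarrow> complex^'n) \<Rightarrow> (complex^'n) measure" where
  "chart_vol I V G =
     distr
       (density
         (restrict_space (Pi\<^sub>M I (\<lambda>_. lborel :: complex measure)) {x. coord_embed I x \<in> V})
         (\<lambda>x. ennreal (vol_density I G (coord_embed I x))))
       borel (\<lambda>x. G (coord_embed I x))"

text \<open>The measures of two charts agree on the overlap, being given by the same differential form,
  so their supremum in the lattice of measures is the measure on \<open>X\<^sub>r\<^sub>e\<^sub>g\<close> glued from them,
  extended by zero to \<open>\<complex>\<^sup>n\<close>.\<close>

definition vol_measure :: "(complex^'n) set \<Rightarrow> (complex^'n) measure" where
  "vol_measure X = Sup {chart_vol I V G | I U V F G. slice_chart X I U V F G}"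

text \<open>Lebesgue measurability is measurability for the completion.\<close>

definition integrable_near ::
  "(complex^'n) set \<Rightarrow> complex^'n \<Rightarrow> (complex^'n \<Rightarrow> ennreal) \<Rightarrow> bool" where
  "integrable_near X p h \<longleftrightarrow>
     (\<exists>U. open U \<and> p \<in> U \<and>
        h \<in> borel_measurable (restrict_space (completion (vol_measure X)) (U \<inter> reg_part X)) \<and>
        (\<integral>\<^sup>+ z \<in> U \<inter> reg_part X. h z \<partial>completion (vol_measure X)) < \<infinity>)"


section \<open>Plurisubharmonic functions\<close>

text \<open>The mean of a function over the unit circle, the difference of the integrals of its positive
  and negative parts.  It is used for functions bounded above, so that the minuend is finite.\<close>

definition circle_mean :: "(complex \<Rightarrow> ereal) \<Rightarrow> ereal" where
  "circle_mean v =
     (enn2ereal (\<integral>\<^sup>+ t \<in> {0..2*pi}. e2ennreal (v (cis t)) \<partial>lborel) -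
      enn2ereal (\<integral>\<^sup>+ t \<in> {0..2*pi}. e2ennreal (- v (cis t)) \<partial>lborel)) / ereal (2 * pi)"

text \<open>The sub-mean value inequality on the complex lines of every chart contained in \<open>U\<close>.\<close>

definition psh_on_reg ::
  "(complex^'n) set \<Rightarrow> (complex^'n) set \<Rightarrow> (complex^'n \<Rightarrow> ereal) \<Rightarrow> bool" where
  "psh_on_reg X U u \<longleftrightarrow>
     (\<forall>z\<in>U \<inter> reg_part X. u z < \<infinity>) \<and>
     (\<forall>t. openin (top_of_set (U \<inter> reg_part X)) {z \<in> U \<inter> reg_part X. u z < t}) \<and>
     (\<forall>I W V F G. slice_chart X I W V F G \<and> W \<subseteq> U \<longrightarrow>
        (\<forall>a\<in>coord_space I. \<forall>b\<in>coord_space I.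
           (\<forall>\<zeta>. cmod \<zeta> \<le> 1 \<longrightarrow> a + \<zeta> *s b \<in> V) \<longrightarrow>
           u (G a) \<le> circle_mean (\<lambda>\<zeta>. u (G (a + \<zeta> *s b)))))"

text \<open>As usual, plurisubharmonic functions are not identically \<open>-\<infinity>\<close> on any connected component.
  Values on the singular part play no role.\<close>

definition psh_on ::
  "(complex^'n) set \<Rightarrow> (complex^'n) set \<Rightarrow> (complex^'n \<Rightarrow> ereal) \<Rightarrow> bool" where
  "psh_on X U u \<longleftrightarrow>
     u \<in> borel_measurable (restrict_space (completion (vol_measure X)) (U \<inter> reg_part X)) \<and>
     psh_on_reg X U u \<and>
     (\<forall>C\<in>components (U \<inter> reg_part X). \<exists>z\<in>C. u z \<noteq> -\<infinity>) \<and>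
     (\<forall>p\<in>U \<inter> sing_part X. \<exists>W M. open W \<and> p \<in> W \<and>
        (\<forall>z\<in>W \<inter> U \<inter> reg_part X. u z \<le> ereal M))"

definition psh_near :: "(complex^'n) set \<Rightarrow> complex^'n \<Rightarrow> (complex^'n \<Rightarrow> ereal) \<Rightarrow> bool" where
  "psh_near X p u \<longleftrightarrow> (\<exists>U. open U \<and> p \<in> U \<and> psh_on X U u)"


section \<open>Local Zhou weights, relative types and jumping numbers\<close>

definition ereal_exp :: "ereal \<Rightarrow> ennreal" where
  "ereal_exp x = (case x of ereal r \<Rightarrow> ennreal (exp r) | PInfty \<Rightarrow> \<infinity> | MInfty \<Rightarrow> 0)"

definition log_norm :: "('a \<Rightarrow> 'b::real_normed_vector) \<Rightarrow> 'a \<Rightarrow> ereal" where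
  "log_norm f z = (if f z = 0 then -\<infinity> else ereal (ln (norm (f z))))"

text \<open>\<open>|f|\<^sup>2 e\<^sup>-\<^sup>2\<^sup>\<phi>\<close>\<close>

definition weight :: "('a \<Rightarrow> 'b::real_normed_vector) \<Rightarrow> ('a \<Rightarrow> ereal) \<Rightarrow> 'a \<Rightarrow> ennreal" where
  "weight f \<phi> z = ennreal ((norm (f z))\<^sup>2) * ereal_exp (ereal (-2) * \<phi> z)"

text \<open>\<open>u \<le> v + O(1)\<close> near \<open>p\<close>, outside the singular part\<close>

definition le_O1 ::
  "(complex^'n) set \<Rightarrow> complex^'n \<Rightarrow> (complex^'n \<Rightarrow> ereal) \<Rightarrow> (complex^'n \<Rightarrow> ereal) \<Rightarrow> bool" where
  "le_O1 X p u v \<longleftrightarrow>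
     (\<exists>U C. open U \<and> p \<in> U \<and> (\<forall>z\<in>U \<inter> reg_part X. u z \<le> v z + ereal C))"

definition local_zhou_weight ::
  "(complex^'n) set \<Rightarrow> complex^'n \<Rightarrow> (complex^'n \<Rightarrow> complex^'m) \<Rightarrow> (complex^'n \<Rightarrow> ereal) \<Rightarrow>
   (complex^'n \<Rightarrow> ereal) \<Rightarrow> bool" where
  "local_zhou_weight X p f \<phi> \<Phi> \<longleftrightarrow>
     psh_near X p \<Phi> \<and>
     (\<exists>N. \<forall>N0::nat\<ge>N. integrable_near X p
        (\<lambda>z. weight f \<phi> z * ennreal (norm (z - p) ^ (2 * N0)) * ereal_exp (ereal (-2) * \<Phi> z))) \<and>
     \<not> integrable_near X p (\<lambda>z. weight f \<phi> z * ereal_exp (ereal (-2) * \<Phi> z)) \<and>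
     (\<forall>\<phi>'. psh_near X p \<phi>' \<and> le_O1 X p \<Phi> \<phi>' \<and>
        \<not> integrable_near X p (\<lambda>z. weight f \<phi> z * ereal_exp (ereal (-2) * \<phi>' z)) \<longrightarrow>
        le_O1 X p \<Phi> \<phi>' \<and> le_O1 X p \<phi>' \<Phi>)"

definition rel_type ::
  "(complex^'n) set \<Rightarrow> complex^'n \<Rightarrow> (complex^'n \<Rightarrow> ereal) \<Rightarrow> (complex^'n \<Rightarrow> ereal) \<Rightarrow> ereal" where
  "rel_type X p \<psi> \<phi> = Sup (ereal ` {c. 0 \<le> c \<and> le_O1 X p \<psi> (\<lambda>z. ereal c * \<phi> z)})"

definition jumping_number ::
  "(complex^'n) set \<Rightarrow> complex^'n \<Rightarrow> (complex^'n \<Rightarrow> complex) \<Rightarrow> (complex^'n \<Rightarrow> ereal) \<Rightarrow> ereal" where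
  "jumping_number X p g \<Phi> =
     Sup (ereal ` {c. integrable_near X p (weight g (\<lambda>z. ereal c * \<Phi> z))})"

end

theory Submission
  imports Defs "HOL-Complex_Analysis.Complex_Analysis"
begin

text \<open>
  Write \<open>w = |f0|\<^sup>2 e\<^sup>-\<^sup>2\<^sup>\<phi>\<^sup>0\<close>.  The inequalities come from pointwise comparison of weights.  The maximality of
  the Zhou weight \<open>\<Phi>\<close> provides integrable weights to compare with.  If \<open>s > \<sigma>(\<psi>, \<Phi>)\<close>, then \<open>max \<Phi> (\<psi> / s)\<close> is plurisubharmonic,
  at least \<open>\<Phi>\<close>, and not \<open>\<le> \<Phi> + O(1)\<close>; so \<open>w e\<^sup>-\<^sup>2\<^sup>u\<close> is integrable for \<open>u = max \<Phi> (\<psi> / s)\<close>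
  (\<open>integrable_twist_max\<close>).

  Upper bound.  Take \<open>s\<^sub>1 > \<sigma>(log |G|, \<Phi>)\<close>, \<open>s\<^sub>2 > \<sigma>(\<phi>0, \<Phi>)\<close>, let \<open>|f0| \<le> C e\<^sup>a\<^sup>\<Phi>\<close>, and let
  \<open>|G|\<^sup>2 e\<^sup>-\<^sup>2\<^sup>c\<^sup>\<Phi>\<close> be integrable.  Where \<open>log |G| \<le> s\<^sub>1 \<Phi>\<close> or \<open>\<phi>0 \<le> s\<^sub>2 \<Phi>\<close>, the function \<open>w e\<^sup>-\<^sup>2\<^sup>\<Phi>\<close> is equal
  to one of the two integrable functions just found.  Where both fail, the bounds on \<open>|f0|\<close>, \<open>\<phi>0\<close> and
  \<open>|G|\<close> give \<open>w e\<^sup>-\<^sup>2\<^sup>\<Phi> \<le> const |G|\<^sup>2 e\<^sup>-\<^sup>2\<^sup>c\<^sup>\<Phi>\<close> as soon as \<open>c + a \<ge> 1 + s\<^sub>1 + s\<^sub>2\<close>.  As \<open>w e\<^sup>-\<^sup>2\<^sup>\<Phi>\<close> is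
  not integrable, \<open>c + a < 1 + s\<^sub>1 + s\<^sub>2\<close> (\<open>upper_bound_strict\<close>).  If \<open>w = 1\<close> almost everywhere, the same
  comparison with \<open>|G|\<close> alone gives \<open>c < 1 + s\<^sub>1\<close>; moreover \<open>e\<^sup>-\<^sup>2\<^sup>c\<^sup>\<Phi>\<close> is integrable for \<open>0 < c < 1\<close>, because
  otherwise maximality, applied to \<open>c \<Phi>\<close>, would bound \<open>\<Phi>\<close> below.

  Lower bound.  If \<open>|G| \<le> C e\<^sup>a\<^sup>\<Phi>\<close> and \<open>e\<^sup>-\<^sup>2\<^sup>b\<^sup>\<Phi>\<close> is integrable, so is \<open>|G|\<^sup>2 e\<^sup>-\<^sup>2\<^sup>(\<^sup>a\<^sup>+\<^sup>b\<^sup>)\<^sup>\<Phi>\<close>; passing to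
  suprema gives the claim when there is such a \<open>b\<close>.  When there is none, the left hand side is
  \<open>-\<infinity>\<close>, except that \<open>\<infinity> + (-\<infinity>) = \<infinity>\<close> for extended reals; so it has to be shown that
  \<open>\<sigma>(log |G|, \<Phi>) = \<infinity>\<close> forces \<open>G = 0\<close> on \<open>X\<close> near \<open>z0\<close> (\<open>rel_type_infinite_imp_zero\<close>).  This is the hard part.
  It combines two results.

  The first, \<open>no_small_multiples\<close>, is about maximality.  If \<open>\<epsilon> log |G| \<le> \<Phi> + O(1)\<close> for every \<open>\<epsilon> > 0\<close> and
  \<open>log |G|\<close> is finite somewhere in every open set, then a diagonal construction gives a function
  \<open>max \<Phi> (SUP k. \<epsilon>\<^sub>k log |G| - c\<^sub>k)\<close> that is not \<open>\<le> \<Phi> + O(1)\<close> although it exceeds \<open>\<Phi>\<close> so little that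
  \<open>w e\<^sup>-\<^sup>2\<^sup>u\<close>, for \<open>u\<close> this function, is still not integrable.

  The second, \<open>irreducible_vanishing\<close>, is the identity theorem on an irreducible germ, where irreducible
  means that the germ is not a union of two smaller analytic germs: if \<open>G\<close> vanishes on nonempty open parts of
  the regular part arbitrarily near \<open>z0\<close>, it vanishes near \<open>z0\<close>.  Here the equations of \<open>X\<close> are eliminated
  direction by direction, as in the local parametrization theorem, by taking norms over the roots of one
  of them.  After \<open>n - d\<close> steps \<open>G\<close> satisfies on \<open>X\<close> a polynomial equation whose coefficients depend only
  on the remaining directions.  Let \<open>a\<close> be the first coefficient that is not identically zero.  The equation
  reads \<open>G\<^sup>j h = 0\<close> with \<open>h = a\<close> where \<open>G = 0\<close>.  By irreducibility \<open>G\<close> or \<open>h\<close> vanishes on \<open>X\<close> near \<open>z0\<close>; in the second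
  case \<open>a\<close> vanishes on the parts of \<open>X\<close> on which \<open>G\<close> does, and together with the eliminated equations
  it would make their dimension less than \<open>d\<close>.

  That \<open>log |G|\<close> is plurisubharmonic is Jensen's inequality, \<open>log_norm_le_circle_mean\<close>.
\<close>

section \<open>Holomorphic functions of several variables\<close>

lemma norm_smult: "norm (c *s (x :: complex^'n)) = cmod c * norm x"
  by (simp add: norm_vec_def L2_set_right_distrib norm_mult)

lemma bounded_bilinear_smult: "bounded_bilinear (\<lambda>c (x :: complex^'n). c *s x)"
proof
  show "\<exists>K. \<forall>a (b :: complex^'n). norm (a *s b) \<le> norm a * norm b * K"
    by (rule exI[of _ 1]) (simp add: norm_smult)
qed (simp_all add: vec_eq_iff algebra_simps)

lemmas bounded_linear_smult_left = bounded_bilinear.bounded_linear_left[OF bounded_bilinear_smult]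
lemmas continuous_on_smult [continuous_intros] =
  bounded_bilinear.continuous_on[OF bounded_bilinear_smult]
lemmas tendsto_smult [tendsto_intros] = bounded_bilinear.tendsto[OF bounded_bilinear_smult]

text \<open>The complex linear maps to \<open>\<complex>\<close> are the \<open>\<lambda>v. \<Sum>j. a j * v $ j\<close>; complex linearity is easier to
carry through the rules for derivatives than the coefficients are.\<close>

lemma holo_on_iff:
  fixes f :: "complex^'n \<Rightarrow> complex"
  shows "holo_on f U \<longleftrightarrow>
    (\<forall>p\<in>U. \<exists>D. (f has_derivative D) (at p) \<and> (\<forall>c v. D (c *s v) = c * D v))"
proof
  assume "holo_on f U"
  thus "\<forall>p\<in>U. \<exists>D. (f has_derivative D) (at p) \<and> (\<forall>c v. D (c *s v) = c * D v)"
    unfolding holo_on_def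
    by (fastforce simp: sum_distrib_left algebra_simps)
next
  assume *: "\<forall>p\<in>U. \<exists>D. (f has_derivative D) (at p) \<and> (\<forall>c v. D (c *s v) = c * D v)"
  show "holo_on f U"
    unfolding holo_on_def
  proof
    fix p assume "p \<in> U"
    with * obtain D where D: "(f has_derivative D) (at p)" "\<And>c v. D (c *s v) = c * D v" by blast
    interpret D: linear D using has_derivative_linear[OF D(1)] .
    have "D v = (\<Sum>j\<in>UNIV. D (axis j 1) * v $ j)" for v
    proof -
      have "v = (\<Sum>j\<in>UNIV. v $ j *s axis j 1)"
        by (simp add: basis_expansion)
      hence "D v = D (\<Sum>j\<in>UNIV. v $ j *s axis j 1)" by simp
      also have "\<dots> = (\<Sum>j\<in>UNIV. D (axis j 1) * v $ j)" by (simp add: D.sum D(2) mult.commute)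
      finally show ?thesis .
    qed
    hence eq: "D = (\<lambda>v. \<Sum>j\<in>UNIV. D (axis j 1) * (v $ j))" by (intro ext)
    have "(f has_derivative (\<lambda>v. \<Sum>j\<in>UNIV. D (axis j 1) * (v $ j))) (at p)"
      by (rule has_derivative_eq_rhs[OF D(1) eq])
    thus "\<exists>a. (f has_derivative (\<lambda>v. \<Sum>j\<in>UNIV. a j * v $ j)) (at p)"
      by (rule exI[of _ "\<lambda>j. D (axis j 1)"])
  qed
qed

lemma holo_onE:
  assumes "holo_on f U" "p \<in> U"
  obtains D where "(f has_derivative D) (at p)" "\<And>c v. D (c *s v) = c * D v"
  using assms unfolding holo_on_iff by blast

lemma holo_on_subset: "holo_on f U \<Longrightarrow> V \<subseteq> U \<Longrightarrow> holo_on f V"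
  unfolding holo_on_def by blast

lemma holo_on_imp_continuous_on: "holo_on f U \<Longrightarrow> continuous_on U f"
  unfolding holo_on_def
  by (meson continuous_at_imp_continuous_on has_derivative_continuous)

lemma holo_on_const [intro]: "holo_on (\<lambda>_. c) U"
  unfolding holo_on_iff by (auto intro!: exI[of _ "\<lambda>_. 0"])

lemma holo_on_add: assumes "holo_on f U" "holo_on g U" shows "holo_on (\<lambda>z. f z + g z) U"
  unfolding holo_on_iff
proof
  fix p assume p: "p \<in> U"
  obtain D where D: "(f has_derivative D) (at p)" "\<And>c v. D (c *s v) = c * D v" using holo_onE[OF assms(1) p] by blast
  obtain E where E: "(g has_derivative E) (at p)" "\<And>c v. E (c *s v) = c * E v" using holo_onE[OF assms(2) p] by blast
  show "\<exists>D. ((\<lambda>z. f z + g z) has_derivative D) (at p) \<and> (\<forall>c v. D (c *s v) = c * D v)"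
    by (rule exI[of _ "\<lambda>v. D v + E v"]) (auto intro!: derivative_eq_intros D(1) E(1) simp: D(2) E(2) algebra_simps)
qed

lemma holo_on_mult: assumes "holo_on f U" "holo_on g U" shows "holo_on (\<lambda>z. f z * g z) U"
  unfolding holo_on_iff
proof
  fix p assume p: "p \<in> U"
  obtain D where D: "(f has_derivative D) (at p)" "\<And>c v. D (c *s v) = c * D v" using holo_onE[OF assms(1) p] by blast
  obtain E where E: "(g has_derivative E) (at p)" "\<And>c v. E (c *s v) = c * E v" using holo_onE[OF assms(2) p] by blast
  show "\<exists>D. ((\<lambda>z. f z * g z) has_derivative D) (at p) \<and> (\<forall>c v. D (c *s v) = c * D v)"
    by (rule exI[of _ "\<lambda>v. f p * E v + D v * g p"]) (auto intro!: derivative_eq_intros D(1) E(1) simp: D(2) E(2) algebra_simps)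
qed

lemma holo_on_sum: "finite A \<Longrightarrow> (\<And>i. i \<in> A \<Longrightarrow> holo_on (f i) U) \<Longrightarrow> holo_on (\<lambda>z. \<Sum>i\<in>A. f i z) U"
  by (induction rule: finite_induct) (auto intro: holo_on_add)

lemma holo_on_power: "holo_on f U \<Longrightarrow> holo_on (\<lambda>z. f z ^ n) U"
  by (induction n) (auto intro: holo_on_mult)

lemma holo_on_diff: "holo_on f U \<Longrightarrow> holo_on g U \<Longrightarrow> holo_on (\<lambda>z. f z - g z) U"
  using holo_on_add[of f U "\<lambda>z. (-1) * g z"] holo_on_mult[OF holo_on_const[of "-1" U], of g] by simp

lemma holo_on_comp_holomorphic:
  assumes "holo_on f U" "h holomorphic_on T" "open T" "f ` U \<subseteq> T"
  shows "holo_on (\<lambda>z. h (f z)) U"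
  unfolding holo_on_iff
proof
  fix p assume p: "p \<in> U"
  obtain D where D: "(f has_derivative D) (at p)" "\<And>c v. D (c *s v) = c * D v" using holo_onE[OF assms(1) p] by blast
  have "(h has_field_derivative deriv h (f p)) (at (f p))"
    using assms p by (intro holomorphic_derivI[of h T]) auto
  hence h: "(h has_derivative (\<lambda>x. deriv h (f p) * x)) (at (f p))" by (simp add: has_field_derivative_def)
  have "((\<lambda>z. h (f z)) has_derivative (\<lambda>v. deriv h (f p) * D v)) (at p)"
    using has_derivative_compose[OF D(1) h] .
  thus "\<exists>D. ((\<lambda>z. h (f z)) has_derivative D) (at p) \<and> (\<forall>c v. D (c *s v) = c * D v)"
    using D(2) by (auto intro!: exI[of _ "\<lambda>v. deriv h (f p) * D v"])
qed

lemma holo_on_linear: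
  assumes "\<And>x y. L (x + y) = L x + L y" "\<And>c x. L (c *s x) = c * L (x :: complex^'n)"
  shows "holo_on L U"
proof -
  have "L (r *\<^sub>R x) = r *\<^sub>R L x" for r x
  proof -
    have "r *\<^sub>R x = of_real r *s x" by (simp add: vec_eq_iff) (simp add: scaleR_conv_of_real)
    thus ?thesis using assms(2)[of "of_real r" x] by (simp add: scaleR_conv_of_real)
  qed
  hence "linear L" by (intro linearI) (auto simp: assms)
  hence "bounded_linear L" by (simp add: linear_conv_bounded_linear)
  thus ?thesis unfolding holo_on_iff
    using assms bounded_linear_imp_has_derivative by blast
qed

lemma holo_on_coord [intro]: "holo_on (\<lambda>z. z $ j) U"
  by (rule holo_on_linear) auto

lemma holo_on_inverse: "holo_on f U \<Longrightarrow> (\<And>z. z \<in> U \<Longrightarrow> f z \<noteq> 0) \<Longrightarrow> holo_on (\<lambda>z. inverse (f z)) U"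
  by (rule holo_on_comp_holomorphic[where T="-{0}"]) (auto intro!: holomorphic_intros)

lemma holo_on_divide: "holo_on f U \<Longrightarrow> holo_on g U \<Longrightarrow> (\<And>z. z \<in> U \<Longrightarrow> g z \<noteq> 0) \<Longrightarrow> holo_on (\<lambda>z. f z / g z) U"
  by (simp add: divide_inverse holo_on_mult holo_on_inverse)

lemma holo_map_onE:
  fixes Y :: "complex^'n \<Rightarrow> complex^'m"
  assumes "holo_map_on Y U" "p \<in> U"
  obtains D where "(Y has_derivative D) (at p)" "\<And>c v. D (c *s v) = c *s D v"
proof -
  have "\<exists>D. ((\<lambda>z. Y z $ i) has_derivative D) (at p) \<and> (\<forall>c v. D (c *s v) = c * D v)" for i
    using assms unfolding holo_map_on_def holo_on_iff by blast
  then obtain D where D: "\<And>i. ((\<lambda>z. Y z $ i) has_derivative D i) (at p)" "\<And>i c v. D i (c *s v) = c * D i v"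
    by metis
  have "(Y has_derivative (\<lambda>v. \<chi> i. D i v)) (at p)"
    unfolding has_derivative_componentwise_within[of Y]
    by (auto simp: Basis_vec_def inner_axis axis_eq_axis intro!: bounded_linear.has_derivative[OF bounded_linear_inner_left] D(1))
  thus ?thesis by (rule that) (simp add: vec_eq_iff D(2))
qed

lemma holo_map_on_imp_continuous_on: "holo_map_on Y U \<Longrightarrow> continuous_on U Y"
  using continuous_on_vec_lambda[of U "\<lambda>i z. Y z $ i"] holo_on_imp_continuous_on
  unfolding holo_map_on_def by (auto simp: vec_lambda_eta)

lemma holo_on_compose:
  fixes Y :: "complex^'n \<Rightarrow> complex^'m"
  assumes "holo_on f W" "holo_map_on Y U" "Y ` U \<subseteq> W"
  shows "holo_on (\<lambda>z. f (Y z)) U"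
  unfolding holo_on_iff
proof
  fix p assume p: "p \<in> U"
  obtain D where D: "(Y has_derivative D) (at p)" "\<And>c v. D (c *s v) = c *s D v"
    using holo_map_onE[OF assms(2) p] by blast
  obtain E where E: "(f has_derivative E) (at (Y p))" "\<And>c v. E (c *s v) = c * E v"
    using holo_onE[OF assms(1), of "Y p"] p assms(3) by blast
  show "\<exists>D. ((\<lambda>z. f (Y z)) has_derivative D) (at p) \<and> (\<forall>c v. D (c *s v) = c * D v)"
    using has_derivative_compose[OF D(1) E(1)] D(2) E(2) by auto
qed

lemma holo_map_on_add: "holo_map_on f U \<Longrightarrow> holo_map_on g U \<Longrightarrow> holo_map_on (\<lambda>z. f z + g z) U"
  unfolding holo_map_on_def by (auto intro: holo_on_add)

lemma holo_map_on_smult: "holo_on f U \<Longrightarrow> holo_map_on g U \<Longrightarrow> holo_map_on (\<lambda>z. f z *s g z) U"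
  unfolding holo_map_on_def by (auto intro: holo_on_mult)

lemma holo_map_on_const: "holo_map_on (\<lambda>_. c) U"
  unfolding holo_map_on_def by auto

lemma holo_map_on_id: "holo_map_on (\<lambda>z. z) U"
  unfolding holo_map_on_def by auto

lemma holo_map_on_sum: "finite A \<Longrightarrow> (\<And>i. i \<in> A \<Longrightarrow> holo_map_on (f i) U) \<Longrightarrow> holo_map_on (\<lambda>z. \<Sum>i\<in>A. f i z) U"
  by (induction rule: finite_induct) (auto intro: holo_map_on_add holo_map_on_const)

lemma holo_on_cong: "open U \<Longrightarrow> (\<And>z. z \<in> U \<Longrightarrow> f z = g z) \<Longrightarrow> holo_on f U \<Longrightarrow> holo_on g U"
  unfolding holo_on_def by (blast intro: has_derivative_transform_within_open)

text \<open>The derivative in \<open>holo_on\<close> is taken in the full neighbourhood filter, so holomorphy may be checked at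
one point at a time.\<close>

lemma holo_on_open_localI:
  assumes "\<And>z. z \<in> U \<Longrightarrow> \<exists>V. z \<in> V \<and> holo_on f V" shows "holo_on f U"
  using assms unfolding holo_on_def by blast

subsection \<open>Directional derivatives and Osgood's lemma\<close>

definition pd :: "complex^'n \<Rightarrow> (complex^'n \<Rightarrow> complex) \<Rightarrow> complex^'n \<Rightarrow> complex" where
  "pd v f z = deriv (\<lambda>\<zeta>. f (z + \<zeta> *s v)) 0"

lemma has_derivative_line:
  fixes f :: "complex^'n \<Rightarrow> complex"
  assumes "(f has_derivative D) (at (a + \<zeta> *s b))" "\<And>c v. D (c *s v) = c * D v"
  shows "((\<lambda>\<zeta>. f (a + \<zeta> *s b)) has_field_derivative D b) (at \<zeta>)"
proof -
  have "((\<lambda>\<zeta>. a + \<zeta> *s b) has_derivative (\<lambda>h. h *s b)) (at \<zeta>)"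
    using has_derivative_add[OF has_derivative_const[of a]
        bounded_linear_imp_has_derivative[OF bounded_linear_smult_left[of b]]] by simp
  from has_derivative_compose[OF this assms(1)]
  show ?thesis unfolding has_field_derivative_def
    by (rule has_derivative_eq_rhs) (auto simp: assms(2))
qed

lemma pd_eq:
  fixes f :: "complex^'n \<Rightarrow> complex"
  assumes "(f has_derivative D) (at z)" "\<And>c v. D (c *s v) = c * D v"
  shows "pd v f z = D v"
  unfolding pd_def using has_derivative_line[of f D z 0 v] assms
  by (intro DERIV_imp_deriv) simp

lemma holo_on_line_deriv:
  assumes "holo_on f U" "a + \<zeta> *s b \<in> U"
  shows "((\<lambda>\<zeta>. f (a + \<zeta> *s b)) has_field_derivative pd b f (a + \<zeta> *s b)) (at \<zeta>)"
proof -
  obtain D where D: "(f has_derivative D) (at (a + \<zeta> *s b))" "\<And>c v. D (c *s v) = c * D v"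
    using holo_onE[OF assms] by blast
  thus ?thesis using has_derivative_line[OF D] pd_eq[OF D] by simp
qed

lemma open_line: "open U \<Longrightarrow> open {\<zeta>. a + \<zeta> *s b \<in> (U :: (complex^'n) set)}"
proof -
  assume "open U"
  have "continuous_on UNIV (\<lambda>\<zeta>. a + \<zeta> *s b)" by (intro continuous_intros)
  from open_vimage[OF \<open>open U\<close> this] show ?thesis by (simp add: vimage_def)
qed

lemma holo_on_line:
  assumes "holo_on f U"
  shows "(\<lambda>\<zeta>. f (a + \<zeta> *s b)) holomorphic_on {\<zeta>. a + \<zeta> *s b \<in> U}"
  unfolding holomorphic_on_def field_differentiable_def
  using holo_on_line_deriv[OF assms] has_field_derivative_at_within by blast

text \<open>Taylor's formula on a complex line, with a constant that depends only on a bound for \<open>f\<close> on a ball and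
not on the line.  This uniformity is what Osgood's lemma and the holomorphy of \<open>pd v f\<close> need.  Only
holomorphy on lines is assumed, so that the formula can be used before \<open>f\<close> is known to be
holomorphic.\<close>

lemma line_taylor:
  fixes f :: "complex^'n \<Rightarrow> complex"
  assumes hol: "\<And>a b. (\<lambda>\<zeta>. f (a + \<zeta> *s b)) holomorphic_on {\<zeta>. a + \<zeta> *s b \<in> U}"
    and bd: "\<And>y. y \<in> ball z \<rho> \<Longrightarrow> y \<in> U \<and> norm (f y) \<le> M"
    and "\<rho> > 0" "cmod \<zeta> * norm v < \<rho> / 2"
  shows "norm (f (z + \<zeta> *s v) - f z - \<zeta> * pd v f z) \<le> 32 * M / \<rho>\<^sup>2 * (cmod \<zeta> * norm v)\<^sup>2"
proof (cases "v = 0")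
  case True thus ?thesis by (simp add: pd_def)
next
  case False
  define r where "r = \<rho> / (2 * norm v)"
  define \<phi> where "\<phi> = (\<lambda>\<zeta>. f (z + \<zeta> *s v))"
  have nv: "norm v > 0" using False by simp
  have r: "r > 0" using assms nv by (simp add: r_def)
  have inb: "z + x *s v \<in> ball z \<rho>" if "x \<in> ball 0 (2 * r)" for x
    using that nv by (simp add: dist_norm norm_smult r_def field_simps)
  have hol\<phi>: "\<phi> holomorphic_on ball 0 (2 * r)"
    unfolding \<phi>_def by (rule holomorphic_on_subset[OF hol]) (use inb bd in auto)
  have B: "cmod ((deriv ^^ Suc 1) \<phi> x) \<le> 8 * M / r\<^sup>2" if x: "x \<in> ball 0 r" for x
  proof -
    have sub: "cball x (r/2) \<subseteq> ball 0 (2 * r)"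
    proof
      fix y assume "y \<in> cball x (r/2)"
      hence "dist x y \<le> r / 2" by simp
      moreover have "dist 0 y \<le> dist 0 x + dist x y" by (rule dist_triangle)
      ultimately show "y \<in> ball 0 (2 * r)" using x r by (simp add: )
    qed
    have "cmod ((deriv ^^ 2) \<phi> x) \<le> fact 2 * M / (r/2) ^ 2"
    proof (rule Cauchy_inequality)
      show "\<phi> holomorphic_on ball x (r/2)"
        by (rule holomorphic_on_subset[OF hol\<phi>]) (use sub in auto)
      show "continuous_on (cball x (r/2)) \<phi>"
        by (rule continuous_on_subset[OF holomorphic_on_imp_continuous_on[OF hol\<phi>]]) (use sub in auto)
      fix y assume "norm (x - y) = r / 2"
      hence "y \<in> cball x (r/2)" by (simp add: dist_norm)
      hence "y \<in> ball 0 (2 * r)" using sub by blast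
      thus "norm (\<phi> y) \<le> M" unfolding \<phi>_def using inb bd by blast
    qed (use r in auto)
    also have "fact 2 * M / (r/2) ^ 2 = 8 * M / r\<^sup>2" by (simp add: field_simps power2_eq_square)
    finally show ?thesis by (simp add: numeral_2_eq_2)
  qed
  have \<zeta>: "\<zeta> \<in> ball 0 r" using assms nv by (simp add: r_def field_simps)
  have "cmod ((deriv ^^ 0) \<phi> \<zeta> - (\<Sum>i\<le>1. (deriv ^^ i) \<phi> 0 * (\<zeta> - 0) ^ i / fact i))
          \<le> 8 * M / r\<^sup>2 * cmod (\<zeta> - 0) ^ Suc 1 / fact 1"
  proof (rule complex_Taylor[of "ball 0 r"])
    fix i :: nat and x :: complex assume "x \<in> ball 0 r" "i \<le> 1"
    hence x: "x \<in> ball 0 (2 * r)" using r by auto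
    have "(deriv ^^ i) \<phi> holomorphic_on ball 0 (2 * r)"
      by (rule holomorphic_higher_deriv[OF hol\<phi>]) auto
    hence "((deriv ^^ i) \<phi> has_field_derivative (deriv ^^ Suc i) \<phi> x) (at x)"
      using x holomorphic_derivI[of "(deriv ^^ i) \<phi>" "ball 0 (2*r)"] by simp
    thus "((deriv ^^ i) \<phi> has_field_derivative (deriv ^^ Suc i) \<phi> x) (at x within ball 0 r)"
      by (rule has_field_derivative_at_within)
  qed (use B \<zeta> r in auto)
  also have "(\<Sum>i\<le>1. (deriv ^^ i) \<phi> 0 * (\<zeta> - 0) ^ i / fact i) = f z + pd v f z * \<zeta>"
    by (simp add: \<phi>_def pd_def)
  also have "8 * M / r\<^sup>2 * cmod (\<zeta> - 0) ^ Suc 1 / fact 1 = 32 * M / \<rho>\<^sup>2 * (cmod \<zeta> * norm v)\<^sup>2"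
    using nv assms by (simp add: r_def field_simps power2_eq_square)
  finally show ?thesis by (simp add: \<phi>_def algebra_simps)
qed

text \<open>The directional derivatives \<open>pd v f p\<close> give the derivative of \<open>f\<close>, with remainder controlled uniformly
by \<open>line_taylor\<close>, once they are additive in \<open>v\<close>.  Additivity follows from passing to the limit in
\<open>f (p + s (u + v)) - f p = (f (p + s u) - f p) + (f (p + s u + s v) - f (p + s u))\<close>, which requires
\<open>pd v f (p + s u) \<longlonglongrightarrow> pd v f p\<close> as \<open>s \<longlonglongrightarrow> 0\<close>.\<close>

theorem osgood:
  fixes f :: "complex^'n \<Rightarrow> complex"
  assumes U: "open U" and cont: "continuous_on U f"
    and hol: "\<And>a b. (\<lambda>\<zeta>. f (a + \<zeta> *s b)) holomorphic_on {\<zeta>. a + \<zeta> *s b \<in> U}"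
  shows "holo_on f U"
  unfolding holo_on_iff
proof
  fix p assume p: "p \<in> U"
  obtain e where e: "e > 0" "cball p e \<subseteq> U" using open_contains_cball U p by blast
  define \<rho> where "\<rho> = e / 2"
  have \<rho>: "\<rho> > 0" using e by (simp add: \<rho>_def)
  have "compact (f ` cball p e)"
    by (rule compact_continuous_image[OF continuous_on_subset[OF cont e(2)] compact_cball])
  then obtain M where M: "\<And>y. y \<in> cball p e \<Longrightarrow> norm (f y) \<le> M"
    using compact_imp_bounded bounded_iff by (metis imageI)
  define K where "K = 32 * M / \<rho>\<^sup>2"
  have "M \<ge> 0" using M[of p] e order_trans[OF norm_ge_zero] by auto
  hence K: "K \<ge> 0" by (simp add: K_def)
  have T: "norm (f (z + \<zeta> *s v) - f z - \<zeta> * pd v f z) \<le> K * (cmod \<zeta> * norm v)\<^sup>2"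
    if "z \<in> ball p \<rho>" "cmod \<zeta> * norm v < \<rho> / 2" for z \<zeta> v
    unfolding K_def
  proof (rule line_taylor[OF hol])
    fix y assume "y \<in> ball z \<rho>"
    hence "dist p y \<le> e" using that(1) dist_triangle[of p y z] by (simp add: \<rho>_def)
    thus "y \<in> U \<and> norm (f y) \<le> M" using M e(2) by auto
  qed (use that \<rho> in auto)
  have der: "((\<lambda>\<zeta>. f (p + \<zeta> *s v)) has_field_derivative pd v f p) (at 0)" for v
    unfolding pd_def
    by (rule holomorphic_derivI[OF hol[of p v] open_line[OF U]]) (use p in auto)
  have hom: "pd (c *s v) f p = c * pd v f p" for c v
  proof -
    have "((\<lambda>\<zeta>. f (p + (\<zeta> * c) *s v)) has_field_derivative pd v f p * c) (at 0)"
      by (rule DERIV_chain2[where g="\<lambda>\<zeta>. \<zeta> * c" and f="\<lambda>\<zeta>. f (p + \<zeta> *s v)"])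
         (use der[of v] in \<open>auto intro!: derivative_eq_intros\<close>)
    hence "deriv (\<lambda>\<zeta>. f (p + \<zeta> *s (c *s v))) 0 = pd v f p * c"
      by (intro DERIV_imp_deriv) (simp add: vector_smult_assoc)
    thus ?thesis by (simp add: pd_def)
  qed
  define s :: "nat \<Rightarrow> complex" where "s = (\<lambda>n. of_real (inverse (real (Suc n))))"
  have s0: "s \<longlonglongrightarrow> 0"
    using tendsto_of_real[OF LIMSEQ_inverse_real_of_nat, where 'a=complex]
    unfolding s_def of_real_0 .
  have sn0: "s n \<noteq> 0" for n by (simp add: s_def del: of_nat_Suc)
  have small: "\<forall>\<^sub>F n in sequentially. cmod (s n) * norm v < r" if "r > 0" for v :: "complex^'n" and r
  proof -
    have "(\<lambda>n. cmod (s n) * norm v) \<longlonglongrightarrow> 0 * norm v"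
      using tendsto_norm[OF s0] by (intro tendsto_mult tendsto_const) simp
    thus ?thesis using that by (simp add: order_tendsto_iff)
  qed
  have quot: "(\<lambda>n. (f (z n + s n *s v) - f (z n)) / s n - pd v f (z n)) \<longlonglongrightarrow> 0"
    if z: "\<forall>\<^sub>F n in sequentially. z n \<in> ball p \<rho>" for z v
  proof (rule Lim_null_comparison)
    show "\<forall>\<^sub>F n in sequentially. norm ((f (z n + s n *s v) - f (z n)) / s n - pd v f (z n))
            \<le> K * (cmod (s n) * (norm v)\<^sup>2)"
      using z small[OF half_gt_zero[OF \<rho>], of v]
    proof eventually_elim
      case (elim n)
      have "(f (z n + s n *s v) - f (z n)) / s n - pd v f (z n)
            = (f (z n + s n *s v) - f (z n) - s n * pd v f (z n)) / s n"
        using sn0[of n] by (simp add: field_simps)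
      also have "norm \<dots> \<le> K * (cmod (s n) * norm v)\<^sup>2 / cmod (s n)"
        using T[of "z n" "s n" v] elim by (simp add: norm_divide divide_right_mono)
      also have "\<dots> = K * (cmod (s n) * (norm v)\<^sup>2)" using sn0[of n] by (simp add: power2_eq_square)
      finally show ?case .
    qed
    have "(\<lambda>n. K * (cmod (s n) * (norm v)\<^sup>2)) \<longlonglongrightarrow> K * (cmod 0 * (norm v)\<^sup>2)"
      by (intro tendsto_intros s0)
    thus "(\<lambda>n. K * (cmod (s n) * (norm v)\<^sup>2)) \<longlonglongrightarrow> 0" by simp
  qed
  \<comment> \<open>with a fixed small step \<open>t\<close>, \<open>t * pd v f z\<close> is up to \<open>O(t\<^sup>2)\<close> the
  continuous function \<open>f (z + t v) - f z\<close> of \<open>z\<close>\<close>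
  have pdcont: "(\<lambda>n. pd v f (p + s n *s u)) \<longlonglongrightarrow> pd v f p" for u v
  proof (rule LIMSEQ_I)
    fix r :: real assume r: "r > 0"
    have "\<forall>\<^sub>F m in sequentially. cmod (s m) * norm v < \<rho>/2 \<and> cmod (s m) * norm v < r / (8 * (K + 1) * (norm v + 1))"
      using r K \<rho> by (intro eventually_conj small) (auto intro!: divide_pos_pos mult_pos_pos add_nonneg_pos)
    then obtain m where m: "cmod (s m) * norm v < \<rho>/2" "cmod (s m) * norm v < r / (8 * (K + 1) * (norm v + 1))"
      by (auto simp: eventually_sequentially)
    define t where "t = s m"
    have t: "t \<noteq> 0" by (simp add: t_def sn0)
    have c1: "(\<lambda>n. f (p + s n *s u + t *s v) - f (p + s n *s u)) \<longlonglongrightarrow> f (p + t *s v) - f p"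
    proof (intro tendsto_diff)
      have "p + t *s v \<in> U"
        using m(1) e \<rho> by (intro subsetD[OF e(2)]) (simp add: dist_norm norm_smult t_def \<rho>_def)
      hence "isCont f (p + t *s v)" using cont U by (simp add: continuous_on_eq_continuous_at)
      moreover have "(\<lambda>n. p + s n *s u + t *s v) \<longlonglongrightarrow> p + 0 *s u + t *s v"
        by (intro tendsto_intros s0)
      ultimately show "(\<lambda>n. f (p + s n *s u + t *s v)) \<longlonglongrightarrow> f (p + t *s v)"
        by (intro isCont_tendsto_compose[of _ f]) auto
      have "isCont f p" using cont U p by (simp add: continuous_on_eq_continuous_at)
      moreover have "(\<lambda>n. p + s n *s u) \<longlonglongrightarrow> p + 0 *s u"
        by (intro tendsto_intros s0)
      ultimately show "(\<lambda>n. f (p + s n *s u)) \<longlonglongrightarrow> f p"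
        by (intro isCont_tendsto_compose[of _ f]) auto
    qed
    have "\<forall>\<^sub>F n in sequentially. norm ((f (p + s n *s u + t *s v) - f (p + s n *s u)) - (f (p + t *s v) - f p)) < cmod t * r / 2"
      using c1[THEN tendstoD, of "cmod t * r / 2"] t r by (simp add: dist_norm)
    moreover have "\<forall>\<^sub>F n in sequentially. cmod (s n) * norm u < \<rho>" using small \<rho> by blast
    ultimately have "\<forall>\<^sub>F n in sequentially. norm (pd v f (p + s n *s u) - pd v f p) < r"
    proof eventually_elim
      case (elim n)
      let ?z = "p + s n *s u"
      let ?A = "f (?z + t *s v) - f ?z" and ?B = "f (p + t *s v) - f p"
      have 1: "norm (?A - t * pd v f ?z) \<le> K * (cmod t * norm v)\<^sup>2"
        using T[of ?z t v] elim(2) m(1) by (simp add: t_def dist_norm norm_smult)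
      have 2: "norm (?B - t * pd v f p) \<le> K * (cmod t * norm v)\<^sup>2"
        using T[of p t v] \<rho> m(1) by (simp add: t_def)
      have "t * (pd v f ?z - pd v f p) = (?A - ?B) - (?A - t * pd v f ?z) + (?B - t * pd v f p)"
        by (simp add: algebra_simps)
      hence "cmod t * norm (pd v f ?z - pd v f p)
          = norm ((?A - ?B) - (?A - t * pd v f ?z) + (?B - t * pd v f p))"
        by (metis norm_mult)
      also have "\<dots> \<le> norm (?A - ?B) + norm (?A - t * pd v f ?z) + norm (?B - t * pd v f p)"
        by (meson add_mono_thms_linordered_semiring(3) norm_triangle_ineq norm_triangle_ineq4 order_trans)
      also have "\<dots> < cmod t * r / 2 + 2 * (K * (cmod t * norm v)\<^sup>2)"
        using 1 2 elim(1) by (simp add: algebra_simps)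
      also have "K * (cmod t * norm v)\<^sup>2 = cmod t * (K * norm v * (cmod t * norm v))"
        by (simp add: power2_eq_square)
      also have "K * norm v * (cmod t * norm v) \<le> K * norm v * (r / (8 * (K + 1) * (norm v + 1)))"
        using m(2) K by (intro mult_left_mono) (auto simp: t_def)
      also have "\<dots> = (r / 8) * (K / (K + 1)) * (norm v / (norm v + 1))" by simp
      also have "\<dots> \<le> (r / 8) * 1 * 1"
        using K r norm_ge_zero[of v] by (intro mult_mono) (auto simp: divide_simps simp del: norm_ge_zero)
      finally have "cmod t * norm (pd v f ?z - pd v f p) < cmod t * r"
        using t r by (simp add: mult_left_mono field_simps)
      thus ?case using t by simp
    qed
    thus "\<exists>no. \<forall>n\<ge>no. norm (pd v f (p + s n *s u) - pd v f p) < r"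
      by (simp add: eventually_sequentially)
  qed
  have add: "pd (u + v) f p = pd u f p + pd v f p" for u v
  proof -
    have l1: "(\<lambda>n. (f (p + s n *s (u + v)) - f p) / s n - pd (u + v) f p) \<longlonglongrightarrow> 0"
      using quot[of "\<lambda>_. p" "u + v"] \<rho> by simp
    have l2: "(\<lambda>n. (f (p + s n *s u) - f p) / s n - pd u f p) \<longlonglongrightarrow> 0"
      using quot[of "\<lambda>_. p" u] \<rho> by simp
    have l3: "(\<lambda>n. (f (p + s n *s u + s n *s v) - f (p + s n *s u)) / s n - pd v f (p + s n *s u)) \<longlonglongrightarrow> 0"
    proof (rule quot)
      show "\<forall>\<^sub>F n in sequentially. p + s n *s u \<in> ball p \<rho>"
        using small[OF \<rho>, of u] by eventually_elim (simp add: dist_norm norm_smult)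
    qed
    have "(\<lambda>n. ((f (p + s n *s u) - f p) / s n - pd u f p) +
        ((f (p + s n *s u + s n *s v) - f (p + s n *s u)) / s n - pd v f (p + s n *s u))
        - ((f (p + s n *s (u + v)) - f p) / s n - pd (u + v) f p) + pd u f p + pd v f (p + s n *s u))
        \<longlonglongrightarrow> 0 + 0 - 0 + pd u f p + pd v f p"
      by (intro tendsto_intros l1 l2 l3 pdcont)
    moreover have "((f (p + s n *s u) - f p) / s n - pd u f p) +
        ((f (p + s n *s u + s n *s v) - f (p + s n *s u)) / s n - pd v f (p + s n *s u))
        - ((f (p + s n *s (u + v)) - f p) / s n - pd (u + v) f p) + pd u f p + pd v f (p + s n *s u) = pd (u + v) f p" for n
    proof -
      have "p + s n *s (u + v) = p + s n *s u + s n *s v"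
        by (simp add: vector_add_ldistrib algebra_simps)
      thus ?thesis by (simp add: diff_divide_distrib add.assoc)
    qed
    ultimately have "(\<lambda>_ :: nat. pd (u + v) f p) \<longlonglongrightarrow> 0 + 0 - 0 + pd u f p + pd v f p"
      by (simp only:)
    thus ?thesis by (simp add: LIMSEQ_const_iff)
  qed
  have lin: "bounded_linear (\<lambda>v. pd v f p)"
    unfolding linear_conv_bounded_linear[symmetric]
  proof (rule linearI)
    fix r :: real and v :: "complex^'n"
    have "r *\<^sub>R v = of_real r *s v" by (simp add: vec_eq_iff) (simp add: scaleR_conv_of_real)
    thus "pd (r *\<^sub>R v) f p = r *\<^sub>R pd v f p" by (simp add: hom scaleR_conv_of_real)
  qed (rule add)
  have "(f has_derivative (\<lambda>v. pd v f p)) (at p)"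
  proof (rule has_derivativeI_sandwich[where e="\<rho>/2" and H="\<lambda>y. K * norm (y - p)"])
    fix y assume y: "y \<noteq> p" "dist y p < \<rho> / 2"
    have "norm (f (p + 1 *s (y - p)) - f p - 1 * pd (y - p) f p) \<le> K * (cmod 1 * norm (y - p))\<^sup>2"
      by (rule T) (use y \<rho> in \<open>auto simp: dist_norm\<close>)
    thus "norm (f y - f p - pd (y - p) f p) / norm (y - p) \<le> K * norm (y - p)"
      using y by (simp add: divide_simps power2_eq_square mult.assoc)
  next
    have "((\<lambda>y. K * norm (y - p)) \<longlongrightarrow> K * norm (p - p)) (at p)" by (intro tendsto_intros)
    thus "((\<lambda>y. K * norm (y - p)) \<longlongrightarrow> 0) (at p)" by simp
  qed (use \<rho> lin in auto)
  thus "\<exists>D. (f has_derivative D) (at p) \<and> (\<forall>c v. D (c *s v) = c * D v)"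
    using hom by blast
qed

text \<open>Continuity and holomorphy on lines pass to locally uniform limits, and Osgood's lemma then applies.\<close>

lemma holo_on_uniform_limit:
  fixes g :: "complex^'n \<Rightarrow> complex"
  assumes U: "open U" and f: "\<And>n. holo_on (f n) U"
    and ul: "\<And>x. x \<in> U \<Longrightarrow> \<exists>d>0. cball x d \<subseteq> U \<and> uniform_limit (cball x d) f g sequentially"
  shows "holo_on g U"
proof (rule osgood[OF U])
  show "continuous_on U g"
    unfolding continuous_on_eq_continuous_at[OF U]
  proof
    fix x assume "x \<in> U"
    then obtain d where d: "d > 0" "cball x d \<subseteq> U" "uniform_limit (cball x d) f g sequentially"
      using ul by blast
    have "continuous_on (cball x d) g"
      by (rule uniform_limit_theorem[OF _ d(3)])
         (use continuous_on_subset[OF holo_on_imp_continuous_on[OF f] d(2)] in \<open>auto intro!: always_eventually\<close>)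
    hence "continuous_on (ball x d) g" by (rule continuous_on_subset) auto
    thus "isCont g x" using d(1) by (simp add: continuous_on_eq_continuous_at)
  qed
  fix a b
  show "(\<lambda>\<zeta>. g (a + \<zeta> *s b)) holomorphic_on {\<zeta>. a + \<zeta> *s b \<in> U}"
  proof (rule holomorphic_uniform_sequence[OF open_line[OF U] holo_on_line[OF f]])
    fix \<zeta> assume "\<zeta> \<in> {\<zeta>. a + \<zeta> *s b \<in> U}"
    then obtain d where d: "d > 0" "cball (a + \<zeta> *s b) d \<subseteq> U" "uniform_limit (cball (a + \<zeta> *s b) d) f g sequentially"
      using ul by blast
    define d' where "d' = d / (norm b + 1)"
    have d': "d' > 0" using d by (simp add: d'_def add_nonneg_pos)
    have inb: "a + \<xi> *s b \<in> cball (a + \<zeta> *s b) d" if "\<xi> \<in> cball \<zeta> d'" for \<xi>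
    proof -
      have "(a + \<zeta> *s b) - (a + \<xi> *s b) = (\<zeta> - \<xi>) *s b" by (simp add: vec_eq_iff algebra_simps)
      hence "dist (a + \<zeta> *s b) (a + \<xi> *s b) = cmod (\<zeta> - \<xi>) * norm b"
        by (simp only: dist_norm norm_smult)
      also have "\<dots> \<le> d' * (norm b + 1)" using that d' by (intro mult_mono) (auto simp: dist_norm)
      also have "\<dots> = d" using add_nonneg_pos[OF norm_ge_zero zero_less_one, of b] by (simp add: d'_def)
      finally show ?thesis by simp
    qed
    show "\<exists>d. 0 < d \<and> cball \<zeta> d \<subseteq> {\<zeta>. a + \<zeta> *s b \<in> U} \<and>
        uniform_limit (cball \<zeta> d) (\<lambda>n \<zeta>. f n (a + \<zeta> *s b)) (\<lambda>\<zeta>. g (a + \<zeta> *s b)) sequentially"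
    proof (intro exI conjI)
      show "uniform_limit (cball \<zeta> d') (\<lambda>n \<zeta>. f n (a + \<zeta> *s b)) (\<lambda>\<zeta>. g (a + \<zeta> *s b)) sequentially"
        unfolding uniform_limit_iff
      proof (intro allI impI)
        fix e :: real assume "e > 0"
        with d(3) have "\<forall>\<^sub>F n in sequentially. \<forall>x\<in>cball (a + \<zeta> *s b) d. dist (f n x) (g x) < e"
          unfolding uniform_limit_iff by blast
        thus "\<forall>\<^sub>F n in sequentially. \<forall>x\<in>cball \<zeta> d'. dist (f n (a + x *s b)) (g (a + x *s b)) < e"
          by (rule eventually_mono) (use inb in blast)
      qed
    qed (use d' d(2) inb in auto)
  qed
qed

text \<open>By \<open>line_taylor\<close> the difference quotients in the direction \<open>v\<close> converge to \<open>pd v f\<close> locally uniformly.\<close>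

lemma holo_on_pd:
  fixes f :: "complex^'n \<Rightarrow> complex"
  assumes U: "open U" and f: "holo_on f U"
  shows "holo_on (pd v f) U"
proof (rule holo_on_open_localI)
  fix p assume p: "p \<in> U"
  obtain e where e: "e > 0" "cball p e \<subseteq> U" using open_contains_cball U p by blast
  define \<rho> where "\<rho> = e / 2"
  have \<rho>: "\<rho> > 0" using e by (simp add: \<rho>_def)
  have "compact (f ` cball p e)"
    by (rule compact_continuous_image[OF continuous_on_subset[OF holo_on_imp_continuous_on[OF f] e(2)] compact_cball])
  then obtain M where M: "\<And>y. y \<in> cball p e \<Longrightarrow> norm (f y) \<le> M"
    using compact_imp_bounded bounded_iff by (metis imageI)
  define K where "K = 32 * M / \<rho>\<^sup>2"
  have "M \<ge> 0" using M[of p] e order_trans[OF norm_ge_zero] by auto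
  hence K: "K \<ge> 0" by (simp add: K_def)
  have T: "norm (f (z + \<zeta> *s v) - f z - \<zeta> * pd v f z) \<le> K * (cmod \<zeta> * norm v)\<^sup>2"
    if "z \<in> ball p \<rho>" "cmod \<zeta> * norm v < \<rho> / 2" for z \<zeta>
    unfolding K_def
  proof (rule line_taylor[OF holo_on_line[OF f]])
    fix y assume "y \<in> ball z \<rho>"
    hence "dist p y \<le> e" using that(1) dist_triangle[of p y z] by (simp add: \<rho>_def)
    thus "y \<in> U \<and> norm (f y) \<le> M" using M e(2) by auto
  qed (use that \<rho> in auto)
  obtain n0 :: nat where n0: "2 * norm v / \<rho> < real n0" using reals_Archimedean2 by blast
  define s :: "nat \<Rightarrow> complex" where "s = (\<lambda>n. of_real (inverse (real (Suc (n + n0)))))"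
  have sn0: "s n \<noteq> 0" for n by (simp add: s_def del: of_nat_Suc of_nat_add)
  have small: "cmod (s n) * norm v < \<rho> / 2" for n
  proof -
    have "2 * norm v / \<rho> < real (Suc (n + n0))" using n0 by simp
    moreover have "cmod (s n) = inverse (real (Suc (n + n0)))"
      unfolding s_def norm_of_real by simp
    ultimately show ?thesis using \<rho> by (simp only:) (simp add: field_simps del: of_nat_Suc of_nat_add)
  qed
  have s0: "s \<longlonglongrightarrow> 0"
    using tendsto_of_real[OF LIMSEQ_ignore_initial_segment[OF LIMSEQ_inverse_real_of_nat, of n0], where 'a=complex]
    unfolding s_def of_real_0 .
  have "holo_on (pd v f) (ball p \<rho>)"
  proof (rule holo_on_uniform_limit[where f="\<lambda>n z. inverse (s n) * (f (z + s n *s v) - f z)"])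
    fix n
    have "(\<lambda>z. z + s n *s v) ` ball p \<rho> \<subseteq> U"
    proof safe
      fix z assume z: "z \<in> ball p \<rho>"
      have "norm (p - (z + s n *s v)) \<le> norm (p - z) + norm (s n *s v)"
        by (metis diff_diff_eq norm_triangle_ineq4)
      also have "\<dots> \<le> e" using z small[of n] \<rho> by (simp add: dist_norm norm_smult \<rho>_def)
      finally show "z + s n *s v \<in> U" using e(2) by (auto simp: dist_norm)
    qed
    moreover have "ball p \<rho> \<subseteq> U" using e \<rho> by (auto simp: \<rho>_def)
    ultimately show "holo_on (\<lambda>z. inverse (s n) * (f (z + s n *s v) - f z)) (ball p \<rho>)"
      by (intro holo_on_mult holo_on_const holo_on_diff holo_on_compose[OF f] holo_map_on_add holo_map_on_id
          holo_map_on_const holo_on_subset[OF f])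
  next
    fix x assume x: "x \<in> ball p \<rho>"
    then obtain d where d: "d > 0" "cball x d \<subseteq> ball p \<rho>" using open_contains_cball open_ball by blast
    have "uniform_limit (cball x d) (\<lambda>n z. inverse (s n) * (f (z + s n *s v) - f z)) (pd v f) sequentially"
      unfolding uniform_limit_iff
    proof safe
      fix r :: real assume r: "r > 0"
      have "(\<lambda>n. K * (cmod (s n) * (norm v)\<^sup>2)) \<longlonglongrightarrow> K * (cmod 0 * (norm v)\<^sup>2)"
        by (intro tendsto_intros s0)
      hence "\<forall>\<^sub>F n in sequentially. K * (cmod (s n) * (norm v)\<^sup>2) < r"
        using r by (simp add: order_tendsto_iff)
      thus "\<forall>\<^sub>F n in sequentially. \<forall>z\<in>cball x d. dist (inverse (s n) * (f (z + s n *s v) - f z)) (pd v f z) < r"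
      proof eventually_elim
        case (elim n)
        show ?case
        proof
          fix z assume "z \<in> cball x d"
          hence z: "z \<in> ball p \<rho>" using d by blast
          have "inverse (s n) * (f (z + s n *s v) - f z) - pd v f z
            = (f (z + s n *s v) - f z - s n * pd v f z) / s n"
            using sn0[of n] by (simp add: field_simps)
          also have "norm \<dots> \<le> K * (cmod (s n) * norm v)\<^sup>2 / cmod (s n)"
            using T[OF z small[of n]] by (simp add: norm_divide divide_right_mono)
          also have "\<dots> = K * (cmod (s n) * (norm v)\<^sup>2)" using sn0[of n] by (simp add: power2_eq_square)
          finally show "dist (inverse (s n) * (f (z + s n *s v) - f z)) (pd v f z) < r"
            using elim by (simp add: dist_norm)
        qed
      qed
    qed
    thus "\<exists>d>0. cball x d \<subseteq> ball p \<rho> \<and>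
      uniform_limit (cball x d) (\<lambda>n z. inverse (s n) * (f (z + s n *s v) - f z)) (pd v f) sequentially"
      using d by blast
  qed auto
  thus "\<exists>V. p \<in> V \<and> holo_on (pd v f) V" using \<rho> by (auto intro!: exI[of _ "ball p \<rho>"])
qed

subsection \<open>Riemann sums\<close>

text \<open>The bound is in terms of the oscillation of \<open>h\<close> over steps of length \<open>1 / N\<close>.  It serves both for the
holomorphy of parameter integrals and for Jensen's inequality.\<close>

lemma riemann_sum_bound:
  fixes h :: "real \<Rightarrow> 'a :: banach"
  assumes c: "continuous_on {0..1} h" and N: "N > (0::nat)"
    and osc: "\<And>x y. x \<in> {0..1} \<Longrightarrow> y \<in> {0..1} \<Longrightarrow> \<bar>x - y\<bar> \<le> 1 / N \<Longrightarrow> norm (h x - h y) \<le> \<eta>"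
  shows "norm (integral {0..1} h - (1 / N) *\<^sub>R (\<Sum>i<N. h (real i / real N))) \<le> \<eta>"
proof -
  have "norm (integral {0..m / N} h - (1 / N) *\<^sub>R (\<Sum>i<m. h (real i / real N))) \<le> \<eta> * (real m / real N)" if "m \<le> N" for m :: nat
    using that
  proof (induction m)
    case (Suc m)
    let ?a = "real m / N" and ?b = "real (Suc m) / N"
    have ab: "0 \<le> ?a" "?a \<le> ?b" "?b \<le> 1" using Suc.prems N by (auto simp: divide_simps)
    have int: "h integrable_on {0..?b}"
      by (rule integrable_continuous_real, rule continuous_on_subset[OF c]) (use ab in auto)
    have cab: "continuous_on {?a..?b} h" by (rule continuous_on_subset[OF c]) (use ab in auto)
    have le: "norm (integral {?a..?b} (\<lambda>t. h t - h ?a)) \<le> \<eta> * (?b - ?a)"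
    proof (rule integral_bound[OF ab(2)])
      show "continuous_on {?a..?b} (\<lambda>t. h t - h ?a)" by (intro continuous_intros cab)
      fix t assume t: "t \<in> {?a..?b}"
      have "?b - ?a = 1 / N" by (simp add: divide_simps)
      moreover have "0 \<le> t" using t ab(1) by (meson atLeastAtMost_iff order_trans)
      ultimately show "norm (h t - h ?a) \<le> \<eta>" using t ab by (intro osc) auto
    qed
    have i1: "integral {?a..?b} (\<lambda>t. h t - h ?a) = integral {?a..?b} h - (1 / N) *\<^sub>R h ?a"
    proof -
      have "integral {?a..?b} (\<lambda>t. h t - h ?a) = integral {?a..?b} h - (?b - ?a) *\<^sub>R h ?a"
        using ab by (subst Henstock_Kurzweil_Integration.integral_diff)
          (use integrable_continuous_real[OF cab] in auto)
      moreover have "?b - ?a = 1 / N" by (simp add: divide_simps)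
      ultimately show ?thesis by simp
    qed
    have i2: "integral {0..?b} h = integral {0..?a} h + integral {?a..?b} h"
      using Henstock_Kurzweil_Integration.integral_combine[OF ab(1,2) int] by simp
    have eq: "integral {0..?b} h - (1 / N) *\<^sub>R (\<Sum>i<Suc m. h (real i / real N))
        = (integral {0..?a} h - (1 / N) *\<^sub>R (\<Sum>i<m. h (real i / real N)))
          + integral {?a..?b} (\<lambda>t. h t - h ?a)"
      unfolding i1 i2 by (simp add: scaleR_add_right)
    have "norm (integral {0..?b} h - (1 / N) *\<^sub>R (\<Sum>i<Suc m. h (real i / real N)))
        \<le> \<eta> * (real m / real N) + \<eta> * (?b - ?a)"
      unfolding eq using Suc.IH Suc.prems le
      by (intro norm_triangle_le add_mono) auto
    also have "\<dots> = \<eta> * (real (Suc m) / real N)" by (simp add: algebra_simps)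
    finally show ?case .
  qed simp
  from this[of N] N show ?thesis by simp
qed

text \<open>The Riemann sums are holomorphic in the parameter and converge locally uniformly.\<close>

lemma holo_on_integral:
  fixes H :: "complex^'n \<Rightarrow> real \<Rightarrow> complex"
  assumes U: "open U" and c: "continuous_on (U \<times> {0..1}) (\<lambda>(z, t). H z t)"
    and hol: "\<And>t. t \<in> {0..1} \<Longrightarrow> holo_on (\<lambda>z. H z t) U"
  shows "holo_on (\<lambda>z. integral {0..1} (H z)) U"
proof (rule holo_on_uniform_limit[OF U, where f="\<lambda>n z. (1 / real (Suc n)) *\<^sub>R (\<Sum>i<Suc n. H z (real i / real (Suc n)))"])
  fix n
  show "holo_on (\<lambda>z. (1 / real (Suc n)) *\<^sub>R (\<Sum>i<Suc n. H z (real i / real (Suc n)))) U"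
    unfolding scaleR_conv_of_real
    by (intro holo_on_mult holo_on_const holo_on_sum hol) (auto simp: divide_simps)
next
  fix x assume "x \<in> U"
  then obtain d where d: "d > 0" "cball x d \<subseteq> U" using open_contains_cball U by blast
  have "uniformly_continuous_on (cball x d \<times> {0..1}) (\<lambda>(z, t). H z t)"
    by (intro compact_uniformly_continuous continuous_on_subset[OF c] compact_Times) (use d in auto)
  have "uniform_limit (cball x d) (\<lambda>n z. (1 / real (Suc n)) *\<^sub>R (\<Sum>i<Suc n. H z (real i / real (Suc n))))
      (\<lambda>z. integral {0..1} (H z)) sequentially"
    unfolding uniform_limit_iff
  proof safe
    fix r :: real assume r: "r > 0"
    have "\<exists>\<delta>>0. \<forall>y\<in>cball x d \<times> {0..1}. \<forall>y'\<in>cball x d \<times> {0..1}. dist y' y < \<delta> \<longrightarrow>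
        dist (case y' of (z, t) \<Rightarrow> H z t) (case y of (z, t) \<Rightarrow> H z t) < r / 2"
      using \<open>uniformly_continuous_on _ _\<close> r unfolding uniformly_continuous_on_def by (meson half_gt_zero)
    then obtain \<delta> where \<delta>: "\<delta> > 0" "\<And>z t t'. z \<in> cball x d \<Longrightarrow> t \<in> {0..1} \<Longrightarrow> t' \<in> {0..1} \<Longrightarrow> \<bar>t' - t\<bar> < \<delta> \<Longrightarrow>
        norm (H z t' - H z t) < r / 2"
      by (fastforce simp: dist_Pair_Pair dist_norm)
    obtain n0 :: nat where n0: "1 / \<delta> < real n0" using reals_Archimedean2 by blast
    show "\<forall>\<^sub>F n in sequentially. \<forall>z\<in>cball x d.
        dist ((1 / real (Suc n)) *\<^sub>R (\<Sum>i<Suc n. H z (real i / real (Suc n)))) (integral {0..1} (H z)) < r"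
      unfolding eventually_sequentially
    proof (intro exI allI impI ballI)
      fix n z assume n: "n0 \<le> n" and z: "z \<in> cball x d"
      have le: "1 / real (Suc n) < \<delta>"
      proof -
        have "1 / \<delta> < real (Suc n)" using n n0 by simp
        thus ?thesis using \<delta>(1) by (simp add: field_simps)
      qed
      have "norm (integral {0..1} (H z) - (1 / real (Suc n)) *\<^sub>R (\<Sum>i<Suc n. H z (real i / real (Suc n)))) \<le> r / 2"
      proof (rule riemann_sum_bound[where N="Suc n" and h="H z"])
        have "continuous_on {0..1} (\<lambda>t. (\<lambda>(z, t). H z t) (z, t))"
          by (rule continuous_on_compose2[OF c]) (use z d in \<open>auto intro!: continuous_intros\<close>)
        thus "continuous_on {0..1} (H z)" by simp
        fix s t :: real assume "s \<in> {0..1}" "t \<in> {0..1}" "\<bar>s - t\<bar> \<le> 1 / real (Suc n)"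
        thus "norm (H z s - H z t) \<le> r / 2" using \<delta>(2)[OF z, of t s] le by (simp del: of_nat_Suc)
      qed auto
      thus "dist ((1 / real (Suc n)) *\<^sub>R (\<Sum>i<Suc n. H z (real i / real (Suc n)))) (integral {0..1} (H z)) < r"
        using r by (simp add: dist_norm norm_minus_commute del: of_nat_Suc)
    qed
  qed
  thus "\<exists>d>0. cball x d \<subseteq> U \<and> uniform_limit (cball x d) (\<lambda>n z. (1 / real (Suc n)) *\<^sub>R (\<Sum>i<Suc n. H z (real i / real (Suc n))))
      (\<lambda>z. integral {0..1} (H z)) sequentially" using d by blast
qed

section \<open>Roots in a disc depending holomorphically on parameters\<close>

text \<open>Lagrange interpolation at \<open>D + 1\<close> distinct points expresses the coefficients of a polynomial of degree at
most \<open>D\<close> linearly in its values, by a formula that is independent of the polynomial.\<close>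

lemma interpolation_coeffs:
  fixes x :: "nat \<Rightarrow> complex"
  assumes "inj x"
  shows "\<exists>c. \<forall>p m. degree p \<le> D \<longrightarrow> coeff p m = (\<Sum>t\<le>D. c m t * poly p (x t))"
proof -
  define l where "l = (\<lambda>t. \<Prod>s\<in>{..D} - {t}. smult (1 / (x t - x s)) [:- x s, 1:])"
  have l: "poly (l t) (x s) = (if s = t then 1 else 0)" if "s \<le> D" "t \<le> D" for s t
  proof (cases "s = t")
    case True
    have "poly (l t) (x s) = (\<Prod>s\<in>{..D} - {t}. 1)"
      unfolding l_def poly_prod
      by (rule prod.cong) (use assms True in \<open>auto dest: injD simp: divide_simps\<close>)
    thus ?thesis using True by simp
  next
    case False
    have "poly (l t) (x s) = 0" unfolding l_def poly_prod
      by (rule prod_zero) (use that False in auto)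
    thus ?thesis using False by simp
  qed
  have dl: "degree (l t) \<le> D" if "t \<le> D" for t
  proof -
    have "degree (l t) \<le> sum (degree \<circ> (\<lambda>s. smult (1 / (x t - x s)) [:- x s, 1:])) ({..D} - {t})"
      unfolding l_def by (rule degree_prod_sum_le) auto
    also have "\<dots> \<le> (\<Sum>s\<in>{..D} - {t}. 1)" by (intro sum_mono) auto
    also have "\<dots> = D" using that by simp
    finally show ?thesis .
  qed
  have "p = (\<Sum>t\<le>D. smult (poly p (x t)) (l t))" if "degree p \<le> D" for p
  proof (rule poly_eqI_degree[where A="x ` {..D}"])
    have card: "card (x ` {..D}) = Suc D" by (simp add: card_image inj_on_subset[OF assms])
    fix y assume "y \<in> x ` {..D}"
    then obtain s where s: "s \<le> D" "y = x s" by auto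
    have "(\<Sum>t\<le>D. poly p (x t) * poly (l t) (x s)) = (\<Sum>t\<le>D. if t = s then poly p (x s) else 0)"
      by (rule sum.cong) (use s l in auto)
    thus "poly p y = poly (\<Sum>t\<le>D. smult (poly p (x t)) (l t)) y" using s by (simp add: poly_sum)
  next
    have card: "card (x ` {..D}) = Suc D" by (simp add: card_image inj_on_subset[OF assms])
    show "card (x ` {..D}) > degree p" using card that by simp
    have "degree (\<Sum>t\<le>D. smult (poly p (x t)) (l t)) \<le> D"
      by (rule degree_sum_le) (auto intro: order_trans[OF degree_smult_le] dl)
    thus "card (x ` {..D}) > degree (\<Sum>t\<le>D. smult (poly p (x t)) (l t))" using card by simp
  qed
  hence "coeff p m = (\<Sum>t\<le>D. coeff (l t) m * poly p (x t))" if "degree p \<le> D" for p m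
  proof -
    have "coeff p m = coeff (\<Sum>t\<le>D. smult (poly p (x t)) (l t)) m"
      using \<open>\<And>p. degree p \<le> D \<Longrightarrow> p = _ p\<close>[OF that] by metis
    thus ?thesis by (simp add: coeff_sum mult.commute)
  qed
  thus ?thesis by (intro exI[of _ "\<lambda>m t. coeff (l t) m"]) blast
qed

text \<open>A polynomial with variable coefficients thus has holomorphic coefficients if its values at enough fixed
points are holomorphic.\<close>

lemma holo_on_coeff:
  fixes P :: "complex^'n \<Rightarrow> complex poly"
  assumes U: "open U" and deg: "\<And>z. z \<in> U \<Longrightarrow> degree (P z) \<le> D" and x: "inj x"
    and val: "\<And>t. t \<le> D \<Longrightarrow> holo_on (\<lambda>z. poly (P z) (x t)) U"
  shows "holo_on (\<lambda>z. coeff (P z) m) U"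
proof -
  obtain c where c: "\<And>p m. degree p \<le> D \<Longrightarrow> coeff p m = (\<Sum>t\<le>D. c m t * poly p (x t))"
    using interpolation_coeffs[OF x] by blast
  have "holo_on (\<lambda>z. \<Sum>t\<le>D. c m t * poly (P z) (x t)) U"
    by (intro holo_on_sum holo_on_mult holo_on_const val) auto
  thus ?thesis by (rule holo_on_cong[OF U, rotated]) (simp add: c[OF deg])
qed

text \<open>A ball is convex, so this says that \<open>h\<close> factors through the projection of the ball along \<open>u\<close>.\<close>

definition inv_dir :: "complex^'n \<Rightarrow> (complex^'n \<Rightarrow> 'b) \<Rightarrow> complex^'n \<Rightarrow> real \<Rightarrow> bool" where
  "inv_dir u h p R \<longleftrightarrow>
     (\<forall>z \<epsilon>. z \<in> ball p R \<and> z + \<epsilon> *s u \<in> ball p R \<longrightarrow> h (z + \<epsilon> *s u) = h z)"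

text \<open>The situation of the Weierstrass preparation theorem.  For base points \<open>z\<close> near \<open>p\<close> the function
\<open>\<zeta> \<mapsto> g (z + \<zeta> v)\<close> has no zero in the closed annulus \<open>r / 2 \<le> |\<zeta>| \<le> r\<close>.  An annulus is used instead of a
circle, and \<open>\<delta>\<close> is small compared with it, in order that moving the base point along \<open>v\<close>, which
translates the roots in the opposite sense, does not move a root out of the disc.\<close>

locale root_disc =
  fixes p v :: "complex^'n" and g :: "complex^'n \<Rightarrow> complex" and R r \<delta> :: real
  assumes holo_g: "holo_on g (ball p R)" and r_pos: "0 < r" and \<delta>_pos: "0 < \<delta>"
    and dom: "\<delta> + r * norm v < R" and small: "4 * \<delta> \<le> r * norm v"
    and nz: "\<And>z \<zeta>. z \<in> ball p \<delta> \<Longrightarrow> r / 2 \<le> cmod \<zeta> \<Longrightarrow> cmod \<zeta> \<le> r \<Longrightarrow> g (z + \<zeta> *s v) \<noteq> 0"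
begin

definition rts :: "complex^'n \<Rightarrow> complex set" where
  "rts z = {\<zeta>. cmod \<zeta> < r \<and> g (z + \<zeta> *s v) = 0}"

definition mu :: "complex^'n \<Rightarrow> complex \<Rightarrow> nat" where
  "mu z \<zeta> = nat (zorder (\<lambda>\<zeta>. g (z + \<zeta> *s v)) \<zeta>)"

lemma v_pos: "norm v > 0"
  using small r_pos \<delta>_pos by (smt (verit) mult_nonneg_nonpos norm_ge_zero)

lemma mem_ball_line:
  assumes "z \<in> ball p \<delta>" "cmod \<zeta> * norm v \<le> c"
  shows "z + \<zeta> *s v \<in> ball p (\<delta> + c)"
proof -
  have "norm (p - (z + \<zeta> *s v)) \<le> norm (p - z) + norm (\<zeta> *s v)"
    by (metis diff_diff_eq norm_triangle_ineq4)
  thus ?thesis using assms by (simp add: dist_norm norm_smult)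
qed

lemma mem_ball_R:
  assumes "z \<in> ball p \<delta>" "cmod \<zeta> \<le> r"
  shows "z + \<zeta> *s v \<in> ball p R"
  using mem_ball_line[OF assms(1), of \<zeta> "r * norm v"] assms(2) dom by (simp add: mult_right_mono)

lemma bigger_disc:
  assumes "\<delta> + r * norm v < R1" "R1 \<le> R"
  obtains r' where "r < r'" "\<And>z \<zeta>. z \<in> ball p \<delta> \<Longrightarrow> cmod \<zeta> < r' \<Longrightarrow> z + \<zeta> *s v \<in> ball p R1"
proof
  define r' where "r' = (R1 - \<delta>) / norm v"
  show "r < r'" using assms v_pos by (simp add: r'_def field_simps)
  show "z + \<zeta> *s v \<in> ball p R1" if "z \<in> ball p \<delta>" "cmod \<zeta> < r'" for z \<zeta>
    using mem_ball_line[OF that(1), of \<zeta> "R1 - \<delta>"] that(2) v_pos by (simp add: r'_def field_simps)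
qed

lemma holomorphic_line:
  assumes "holo_on F (ball p R1)" "\<And>\<zeta>. \<zeta> \<in> T \<Longrightarrow> z + \<zeta> *s v \<in> ball p R1"
  shows "(\<lambda>\<zeta>. F (z + \<zeta> *s v)) holomorphic_on T"
  by (rule holomorphic_on_subset[OF holo_on_line[OF assms(1)]]) (use assms(2) in auto)

lemma rts_half: "z \<in> ball p \<delta> \<Longrightarrow> \<zeta> \<in> rts z \<Longrightarrow> cmod \<zeta> < r / 2"
  using nz[of z \<zeta>] by (force simp: rts_def)

lemma finite_zeros:
  assumes z: "z \<in> ball p \<delta>" and r': "\<And>\<zeta>. cmod \<zeta> < r' \<Longrightarrow> z + \<zeta> *s v \<in> ball p R" "r < r''" "r'' < r'"
  shows "finite {\<zeta>\<in>cball 0 r''. g (z + \<zeta> *s v) = 0}"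
proof -
  have hol: "(\<lambda>\<zeta>. g (z + \<zeta> *s v)) holomorphic_on ball 0 r'"
    by (rule holomorphic_line[OF holo_g]) (use r' in auto)
  have nzr: "g (z + of_real r *s v) \<noteq> 0" using nz[OF z, of "of_real r"] r_pos by simp
  show ?thesis
  proof (cases "(\<lambda>\<zeta>. g (z + \<zeta> *s v)) constant_on ball 0 r'")
    case True
    have "of_real r \<in> ball (0::complex) r'" using r' r_pos by auto
    with True nzr have "\<forall>\<zeta>\<in>ball 0 r'. g (z + \<zeta> *s v) \<noteq> 0"
      unfolding constant_on_def by metis
    hence "{\<zeta>\<in>cball 0 r''. g (z + \<zeta> *s v) = 0} = {}" using r' by force
    thus ?thesis by (simp only: finite.emptyI)
  next
    case False
    show ?thesis
      by (rule holomorphic_compact_finite_zeros[OF hol]) (use False r' in auto)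
  qed
qed

lemma finite_rts: assumes z: "z \<in> ball p \<delta>" shows "finite (rts z)"
proof -
  obtain r' where r': "r < r'" "\<And>z \<zeta>. z \<in> ball p \<delta> \<Longrightarrow> cmod \<zeta> < r' \<Longrightarrow> z + \<zeta> *s v \<in> ball p R"
    using bigger_disc[OF dom] by auto
  have "finite {\<zeta>\<in>cball 0 ((r+r')/2). g (z + \<zeta> *s v) = 0}"
    by (rule finite_zeros[OF z r'(2)[OF z]]) (use r' in auto)
  thus ?thesis by (rule rev_finite_subset) (use r' in \<open>auto simp: rts_def\<close>)
qed

lemma zorder_pos:
  assumes z: "z \<in> ball p \<delta>" and \<zeta>: "\<zeta> \<in> rts z"
  shows "zorder (\<lambda>\<zeta>. g (z + \<zeta> *s v)) \<zeta> > 0"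
proof -
  obtain r' where r': "r < r'" "\<And>z \<zeta>. z \<in> ball p \<delta> \<Longrightarrow> cmod \<zeta> < r' \<Longrightarrow> z + \<zeta> *s v \<in> ball p R"
    using bigger_disc[OF dom] by auto
  have hol: "(\<lambda>\<zeta>. g (z + \<zeta> *s v)) holomorphic_on ball 0 r'"
    by (rule holomorphic_line[OF holo_g]) (use r'(2)[OF z] in auto)
  have nzr: "g (z + of_real r *s v) \<noteq> 0" using nz[OF z, of "of_real r"] r_pos by simp
  have ex: "\<exists>w\<in>ball 0 r'. g (z + w *s v) \<noteq> 0"
    using nzr r' r_pos by (intro bexI[of _ "of_real r"]) auto
  thus ?thesis using zorder_exist_zero[OF hol _ _ _ ex] \<zeta> r' by (auto simp: rts_def)
qed

lemma mu_pos: "z \<in> ball p \<delta> \<Longrightarrow> \<zeta> \<in> rts z \<Longrightarrow> mu z \<zeta> > 0"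
  using zorder_pos by (simp add: mu_def)

text \<open>The argument principle.  The right hand side makes sense without any reference to the roots, which
shows that it is holomorphic in \<open>z\<close> even where roots collide.\<close>

lemma root_sum_integral:
  assumes z: "z \<in> ball p \<delta>" and F: "holo_on F (ball p R1)" and R1: "\<delta> + r * norm v < R1" "R1 \<le> R"
  shows "(\<Sum>\<zeta>\<in>rts z. of_nat (mu z \<zeta>) * F (z + \<zeta> *s v)) = inverse (2 * pi * \<i>) *
    integral {0..1} (\<lambda>t. pd v g (z + circlepath 0 r t *s v) * F (z + circlepath 0 r t *s v)
       / g (z + circlepath 0 r t *s v) * (2 * pi * \<i> * r * exp (2 * pi * \<i> * t)))"
proof -
  define f where "f = (\<lambda>\<zeta>. g (z + \<zeta> *s v))"
  obtain r' where r': "r < r'" "\<And>z \<zeta>. z \<in> ball p \<delta> \<Longrightarrow> cmod \<zeta> < r' \<Longrightarrow> z + \<zeta> *s v \<in> ball p R1"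
    using bigger_disc[OF R1] by auto
  define r'' where "r'' = (r + r') / 2"
  have r'': "r < r''" "r'' < r'" using r' by (auto simp: r''_def)
  define S where "S = ball (0::complex) r''"
  have inS: "z + \<zeta> *s v \<in> ball p R1" "z + \<zeta> *s v \<in> ball p R" if "\<zeta> \<in> S" for \<zeta>
    using r'(2)[OF z, of \<zeta>] that r'' R1(2) by (auto simp: S_def)
  have fin: "finite {w \<in> S. f w = 0 \<or> w \<in> {}}"
  proof (rule finite_subset)
    show "finite {\<zeta>\<in>cball 0 r''. g (z + \<zeta> *s v) = 0}"
      by (rule finite_zeros[OF z _ r'']) (use r'(2)[OF z] R1(2) in force)
  qed (auto simp: S_def f_def)
  have "contour_integral (circlepath 0 r) (\<lambda>x. deriv f x * F (z + x *s v) / f x) = 2 * pi * \<i> *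
      (\<Sum>w\<in>{w \<in> S. f w = 0 \<or> w \<in> {}}. winding_number (circlepath 0 r) w * F (z + w *s v) * zorder f w)"
  proof (rule argument_principle)
    show "f holomorphic_on S - {}" unfolding f_def
      by (rule holomorphic_line[OF holo_g]) (use inS in auto)
    show "(\<lambda>x. F (z + x *s v)) holomorphic_on S"
      by (rule holomorphic_line[OF F]) (use inS in auto)
    show "path_image (circlepath 0 r) \<subseteq> S - {w \<in> S. f w = 0 \<or> w \<in> {}}"
      using nz[OF z] r_pos r'' by (auto simp: S_def f_def)
    show "\<forall>w. w \<notin> S \<longrightarrow> winding_number (circlepath 0 r) w = 0"
      by (intro allI impI winding_number_zero_outside[of _ "cball 0 r"]) (use r'' r_pos in \<open>auto simp: S_def\<close>)
  qed (use fin in \<open>auto simp: S_def\<close>)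
  also have "(\<Sum>w\<in>{w \<in> S. f w = 0 \<or> w \<in> {}}. winding_number (circlepath 0 r) w * F (z + w *s v) * zorder f w)
     = (\<Sum>w\<in>rts z. winding_number (circlepath 0 r) w * F (z + w *s v) * zorder f w)"
  proof (rule sum.mono_neutral_right[OF fin])
    show "rts z \<subseteq> {w \<in> S. f w = 0 \<or> w \<in> {}}" using r'' by (auto simp: rts_def S_def f_def)
    show "\<forall>w\<in>{w \<in> S. f w = 0 \<or> w \<in> {}} - rts z. winding_number (circlepath 0 r) w * F (z + w *s v) * zorder f w = 0"
    proof
      fix w assume w: "w \<in> {w \<in> S. f w = 0 \<or> w \<in> {}} - rts z"
      hence "cmod w \<ge> r" by (auto simp: rts_def f_def)
      moreover have "cmod w \<noteq> r" using nz[OF z, of w] w r_pos by (auto simp: f_def)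
      ultimately have "winding_number (circlepath 0 r) w = 0"
        by (intro winding_number_zero_outside[of _ "cball 0 r"]) (use r_pos in auto)
      thus "winding_number (circlepath 0 r) w * F (z + w *s v) * zorder f w = 0" by simp
    qed
  qed
  also have "\<dots> = (\<Sum>\<zeta>\<in>rts z. of_nat (mu z \<zeta>) * F (z + \<zeta> *s v))"
  proof (rule sum.cong[OF refl])
    fix \<zeta> assume \<zeta>: "\<zeta> \<in> rts z"
    have "winding_number (circlepath 0 r) \<zeta> = 1"
      by (rule winding_number_circlepath) (use \<zeta> in \<open>auto simp: rts_def\<close>)
    moreover have "complex_of_int (zorder f \<zeta>) = of_nat (mu z \<zeta>)"
      using zorder_pos[OF z \<zeta>] by (simp add: mu_def f_def)
    ultimately show "winding_number (circlepath 0 r) \<zeta> * F (z + \<zeta> *s v) * zorder f \<zeta> = of_nat (mu z \<zeta>) * F (z + \<zeta> *s v)"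
      by simp
  qed
  finally have 1: "contour_integral (circlepath 0 r) (\<lambda>x. deriv f x * F (z + x *s v) / f x)
     = 2 * pi * \<i> * (\<Sum>\<zeta>\<in>rts z. of_nat (mu z \<zeta>) * F (z + \<zeta> *s v))" .
  have 2: "contour_integral (circlepath 0 r) (\<lambda>x. deriv f x * F (z + x *s v) / f x) =
    integral {0..1} (\<lambda>t. pd v g (z + circlepath 0 r t *s v) * F (z + circlepath 0 r t *s v)
       / g (z + circlepath 0 r t *s v) * (2 * pi * \<i> * r * exp (2 * pi * \<i> * t)))"
    unfolding contour_integral_integral
  proof (rule integral_cong)
    fix t :: real assume t: "t \<in> {0..1}"
    have "circlepath 0 r t \<in> path_image (circlepath 0 r)" using t by (simp add: path_image_def)
    hence "circlepath 0 r t \<in> S" using r_pos r'' by (auto simp: S_def)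
    hence "deriv f (circlepath 0 r t) = pd v g (z + circlepath 0 r t *s v)"
      unfolding f_def by (intro DERIV_imp_deriv holo_on_line_deriv[OF holo_g] inS)
    thus "deriv f (circlepath 0 r t) * F (z + circlepath 0 r t *s v) / f (circlepath 0 r t)
        * vector_derivative (circlepath 0 r) (at t) =
      pd v g (z + circlepath 0 r t *s v) * F (z + circlepath 0 r t *s v)
       / g (z + circlepath 0 r t *s v) * (2 * pi * \<i> * r * exp (2 * pi * \<i> * t))"
      using t by (simp add: f_def vector_derivative_circlepath)
  qed
  have "(\<Sum>\<zeta>\<in>rts z. of_nat (mu z \<zeta>) * F (z + \<zeta> *s v)) = inverse (2 * pi * \<i>) *
      contour_integral (circlepath 0 r) (\<lambda>x. deriv f x * F (z + x *s v) / f x)"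
  proof -
    have cancel: "inverse c * (c * x) = x" if "c \<noteq> 0" for c x :: complex using that by simp
    show ?thesis unfolding 1 by (rule cancel[symmetric]) simp
  qed
  thus ?thesis unfolding 2 .
qed

lemma holo_on_root_sum:
  assumes F: "holo_on F (ball p R1)" and R1: "\<delta> + r * norm v < R1" "R1 \<le> R"
  shows "holo_on (\<lambda>z. \<Sum>\<zeta>\<in>rts z. of_nat (mu z \<zeta>) * F (z + \<zeta> *s v)) (ball p \<delta>)"
proof -
  define H where "H = (\<lambda>z t. pd v g (z + circlepath 0 r t *s v) * F (z + circlepath 0 r t *s v)
       / g (z + circlepath 0 r t *s v) * (2 * pi * \<i> * r * exp (2 * pi * \<i> * complex_of_real t)))"
  have cp: "cmod (circlepath 0 r t) = r" for t :: real
    using r_pos by (simp add: circlepath norm_mult)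
  have in1: "z + circlepath 0 r t *s v \<in> ball p R1" if "z \<in> ball p \<delta>" for z t
    using mem_ball_line[OF that, of "circlepath 0 r t" "r * norm v"] cp R1 by simp
  have in2: "z + circlepath 0 r t *s v \<in> ball p R" if "z \<in> ball p \<delta>" for z t
    using in1[OF that, of t] R1 by auto
  have nzc: "g (z + circlepath 0 r t *s v) \<noteq> 0" if "z \<in> ball p \<delta>" for z t
    using nz[OF that, of "circlepath 0 r t"] cp r_pos by simp
  have pdg: "holo_on (pd v g) (ball p R)" by (rule holo_on_pd[OF open_ball holo_g])
  have ccp: "continuous_on UNIV (circlepath 0 r)" 
    unfolding circlepath_def part_circlepath_def by (intro continuous_intros)
  have "holo_on (\<lambda>z. integral {0..1} (H z)) (ball p \<delta>)"
  proof (rule holo_on_integral)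
    have line: "continuous_on (ball p \<delta> \<times> {0..1}) (\<lambda>x. fst x + circlepath 0 r (snd x) *s v)"
      by (intro continuous_intros continuous_on_compose2[OF ccp]) auto
    have "continuous_on (ball p \<delta> \<times> {0..1}) (\<lambda>x. H (fst x) (snd x))"
      unfolding H_def
      by (intro continuous_intros continuous_on_compose2[OF holo_on_imp_continuous_on[OF pdg] line]
         continuous_on_compose2[OF holo_on_imp_continuous_on[OF F] line]
         continuous_on_compose2[OF holo_on_imp_continuous_on[OF holo_g] line])
         (use in1 in2 nzc in auto)
    thus "continuous_on (ball p \<delta> \<times> {0..1}) (\<lambda>(z, t). H z t)" by (simp add: case_prod_unfold)
    fix t :: real
    have m: "holo_map_on (\<lambda>z. z + circlepath 0 r t *s v) (ball p \<delta>)"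
      by (intro holo_map_on_add holo_map_on_id holo_map_on_const)
    show "holo_on (\<lambda>z. H z t) (ball p \<delta>)"
      unfolding H_def
      by (intro holo_on_mult holo_on_divide holo_on_const holo_on_compose[OF pdg m]
          holo_on_compose[OF F m] holo_on_compose[OF holo_g m]) (use in1 in2 nzc in auto)
  qed auto
  hence "holo_on (\<lambda>z. inverse (2 * pi * \<i>) * integral {0..1} (H z)) (ball p \<delta>)"
    by (intro holo_on_mult holo_on_const)
  thus ?thesis
    by (rule holo_on_cong[OF open_ball, rotated]) (use root_sum_integral[OF _ F R1] in \<open>simp add: H_def\<close>)
qed

text \<open>Take \<open>F = 1\<close> in \<open>holo_on_root_sum\<close>: a continuous integer valued function on a ball is constant.\<close>

lemma root_count:
  obtains N where "\<And>z. z \<in> ball p \<delta> \<Longrightarrow> (\<Sum>\<zeta>\<in>rts z. mu z \<zeta>) = N"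
proof -
  have "holo_on (\<lambda>z. \<Sum>\<zeta>\<in>rts z. of_nat (mu z \<zeta>) * (\<lambda>_. 1) (z + \<zeta> *s v)) (ball p \<delta>)"
    by (rule holo_on_root_sum[OF holo_on_const dom]) auto
  hence c: "continuous_on (ball p \<delta>) (\<lambda>z. complex_of_nat (\<Sum>\<zeta>\<in>rts z. mu z \<zeta>))"
    using holo_on_imp_continuous_on by (simp add: of_nat_sum)
  have "(\<lambda>z. complex_of_nat (\<Sum>\<zeta>\<in>rts z. mu z \<zeta>)) constant_on ball p \<delta>"
  proof (rule continuous_discrete_range_constant[OF _ c])
    fix x
    show "\<exists>e>0. \<forall>y. y \<in> ball p \<delta> \<and> complex_of_nat (\<Sum>\<zeta>\<in>rts y. mu y \<zeta>) \<noteq> complex_of_nat (\<Sum>\<zeta>\<in>rts x. mu x \<zeta>) \<longrightarrow>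
        e \<le> norm (complex_of_nat (\<Sum>\<zeta>\<in>rts y. mu y \<zeta>) - complex_of_nat (\<Sum>\<zeta>\<in>rts x. mu x \<zeta>))"
    proof (intro exI[of _ 1] conjI allI impI)
      have *: "1 \<le> norm (complex_of_nat a - complex_of_nat b)" if "complex_of_nat a \<noteq> complex_of_nat b" for a b
      proof -
        have e: "complex_of_nat a - complex_of_nat b = of_int (int a - int b)" by simp
        have "a \<noteq> b" using that by auto
        hence "real_of_int 1 \<le> real_of_int \<bar>int a - int b\<bar>" unfolding of_int_le_iff by arith
        thus ?thesis unfolding e norm_of_int by simp
      qed
      fix y assume "y \<in> ball p \<delta> \<and> complex_of_nat (\<Sum>\<zeta>\<in>rts y. mu y \<zeta>) \<noteq> complex_of_nat (\<Sum>\<zeta>\<in>rts x. mu x \<zeta>)"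
      thus "1 \<le> norm (complex_of_nat (\<Sum>\<zeta>\<in>rts y. mu y \<zeta>) - complex_of_nat (\<Sum>\<zeta>\<in>rts x. mu x \<zeta>))"
        by (blast intro: *)
    qed auto
  qed auto
  then obtain c where c: "\<And>z. z \<in> ball p \<delta> \<Longrightarrow> complex_of_nat (\<Sum>\<zeta>\<in>rts z. mu z \<zeta>) = c"
    unfolding constant_on_def by blast
  have "(\<Sum>\<zeta>\<in>rts z. mu z \<zeta>) = (\<Sum>\<zeta>\<in>rts p. mu p \<zeta>)" if "z \<in> ball p \<delta>" for z
    using c[OF that] c[of p] \<delta>_pos of_nat_eq_iff[where 'a=complex] by (metis centre_in_ball)
  thus ?thesis by (rule that)
qed

text \<open>The norm of \<open>A\<close> along the branched covering given by the zeros of \<open>g\<close>.  The values may lie in any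
commutative monoid; besides \<open>\<complex>\<close>, polynomials will be used.\<close>

definition norm_fun :: "(complex^'n \<Rightarrow> 'b :: comm_monoid_mult) \<Rightarrow> complex^'n \<Rightarrow> 'b" where
  "norm_fun A z = (\<Prod>\<zeta>\<in>rts z. A (z + \<zeta> *s v) ^ mu z \<zeta>)"

text \<open>Power sums over the roots are holomorphic by \<open>holo_on_root_sum\<close>, but the norm is a product.  It is, up
to sign, the constant coefficient of the polynomial \<open>Q z\<close> with roots \<open>F (z + \<zeta> v)\<close>.  At a point \<open>x\<close> of
modulus larger than all values of \<open>F\<close> that occur, the number \<open>poly (Q z) x\<close> is
\<open>x\<^sup>N exp (\<Sum>\<zeta>. mu z \<zeta> * Ln (1 - F (z + \<zeta> v) / x))\<close>, which is holomorphic in \<open>z\<close>; so \<open>holo_on_coeff\<close>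
applies.\<close>

lemma holo_on_norm_fun:
  assumes F: "holo_on F (ball p R)"
  shows "holo_on (norm_fun F) (ball p \<delta>)"
proof -
  define R1 where "R1 = (\<delta> + r * norm v + R) / 2"
  have R1: "\<delta> + r * norm v < R1" "R1 < R" using dom by (auto simp: R1_def)
  have "compact (F ` cball p R1)"
    by (rule compact_continuous_image[OF continuous_on_subset[OF holo_on_imp_continuous_on[OF F]] compact_cball])
       (use R1 in auto)
  then obtain M where M: "\<And>y. y \<in> cball p R1 \<Longrightarrow> norm (F y) \<le> M"
    using compact_imp_bounded bounded_iff by (metis imageI)
  obtain N where N: "\<And>z. z \<in> ball p \<delta> \<Longrightarrow> (\<Sum>\<zeta>\<in>rts z. mu z \<zeta>) = N" using root_count by blast
  define x where "x = (\<lambda>t::nat. complex_of_real (\<bar>M\<bar> + 1 + t))"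
  have x: "inj x" by (auto simp: x_def inj_def)
  have cx: "cmod (x t) = \<bar>M\<bar> + 1 + t" for t unfolding x_def norm_of_real by simp
  have xM: "cmod (x t) > M" for t unfolding cx by simp
  have x0: "x t \<noteq> 0" for t
  proof
    assume "x t = 0"
    hence "cmod (x t) = 0" by simp
    thus False unfolding cx by simp
  qed
  define Q where "Q = (\<lambda>z. \<Prod>\<zeta>\<in>rts z. [:- F (z + \<zeta> *s v), 1:] ^ mu z \<zeta>)"
  have inR1: "z + \<zeta> *s v \<in> ball p R1" if "z \<in> ball p \<delta>" "\<zeta> \<in> rts z" for z \<zeta>
    using mem_ball_line[OF that(1), of \<zeta> "r * norm v"] that(2) R1 by (auto simp: rts_def mult_right_mono)
  have degQ: "degree (Q z) \<le> N" if "z \<in> ball p \<delta>" for z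
  proof -
    have "degree (Q z) \<le> sum (degree \<circ> (\<lambda>\<zeta>. [:- F (z + \<zeta> *s v), 1:] ^ mu z \<zeta>)) (rts z)"
      unfolding Q_def by (rule degree_prod_sum_le[OF finite_rts[OF that]])
    also have "\<dots> \<le> (\<Sum>\<zeta>\<in>rts z. mu z \<zeta>)"
    proof (rule sum_mono)
      fix \<zeta>
      have "degree ([:- F (z + \<zeta> *s v), 1:] ^ mu z \<zeta>) \<le> degree [:- F (z + \<zeta> *s v), 1:] * mu z \<zeta>"
        by (rule degree_power_le)
      thus "(degree \<circ> (\<lambda>\<zeta>. [:- F (z + \<zeta> *s v), 1:] ^ mu z \<zeta>)) \<zeta> \<le> mu z \<zeta>" by simp
    qed
    finally show ?thesis using N[OF that] by simp
  qed
  have "holo_on (\<lambda>z. coeff (Q z) 0) (ball p \<delta>)"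
  proof (rule holo_on_coeff[OF open_ball degQ x])
    fix t
    define L where "L = (\<lambda>y. Ln (1 - F y / x t))"
    have in1: "1 - F y / x t \<in> ball 1 1" if "y \<in> ball p R1" for y
      using M[of y] xM[of t] x0[of t] that by (auto simp: dist_norm norm_divide divide_simps)
    have "holo_on L (ball p R1)"
      unfolding L_def
    proof (rule holo_on_comp_holomorphic[where T="ball 1 1" and h=Ln])
      show "Ln holomorphic_on ball 1 1"
      proof (rule holomorphic_on_Ln)
        have "z \<notin> \<real>\<^sub>\<le>\<^sub>0" if "z \<in> ball 1 1" for z :: complex
        proof -
          have "cmod (1 - z) < 1" using that by (simp add: dist_norm)
          hence "\<bar>Re (1 - z)\<bar> < 1" using abs_Re_le_cmod le_less_trans by blast
          hence "Re z > 0" by simp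
          thus ?thesis by (auto simp: complex_nonpos_Reals_iff)
        qed
        thus "ball 1 1 \<inter> \<real>\<^sub>\<le>\<^sub>0 = ({} :: complex set)" by blast
      qed
      show "holo_on (\<lambda>y. 1 - F y / x t) (ball p R1)"
        by (intro holo_on_diff holo_on_const holo_on_divide holo_on_subset[OF F]) (use R1 x0 in auto)
    qed (use in1 in auto)
    hence "holo_on (\<lambda>z. \<Sum>\<zeta>\<in>rts z. of_nat (mu z \<zeta>) * L (z + \<zeta> *s v)) (ball p \<delta>)"
      by (rule holo_on_root_sum) (use R1 in auto)
    hence "holo_on (\<lambda>z. x t ^ N * exp (\<Sum>\<zeta>\<in>rts z. of_nat (mu z \<zeta>) * L (z + \<zeta> *s v))) (ball p \<delta>)"
      by (intro holo_on_mult holo_on_const holo_on_comp_holomorphic[where h=exp and T=UNIV])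
         (auto intro: holomorphic_intros)
    thus "holo_on (\<lambda>z. poly (Q z) (x t)) (ball p \<delta>)"
    proof (rule holo_on_cong[OF open_ball, rotated])
      fix z assume z: "z \<in> ball p \<delta>"
      have "poly (Q z) (x t) = (\<Prod>\<zeta>\<in>rts z. (x t - F (z + \<zeta> *s v)) ^ mu z \<zeta>)"
        by (simp add: Q_def poly_prod)
      also have "\<dots> = (\<Prod>\<zeta>\<in>rts z. x t ^ mu z \<zeta> * exp (of_nat (mu z \<zeta>) * L (z + \<zeta> *s v)))"
      proof (rule prod.cong[OF refl])
        fix \<zeta> assume \<zeta>: "\<zeta> \<in> rts z"
        have "1 - F (z + \<zeta> *s v) / x t \<noteq> 0" using in1[OF inR1[OF z \<zeta>]] by auto
        hence "exp (L (z + \<zeta> *s v)) = 1 - F (z + \<zeta> *s v) / x t" by (simp add: L_def)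
        hence "exp (of_nat (mu z \<zeta>) * L (z + \<zeta> *s v)) = (1 - F (z + \<zeta> *s v) / x t) ^ mu z \<zeta>"
          by (simp add: exp_of_nat_mult)
        thus "(x t - F (z + \<zeta> *s v)) ^ mu z \<zeta> = x t ^ mu z \<zeta> * exp (of_nat (mu z \<zeta>) * L (z + \<zeta> *s v))"
          using x0[of t] by (simp add: power_mult_distrib[symmetric] right_diff_distrib)
      qed
      also have "\<dots> = x t ^ N * exp (\<Sum>\<zeta>\<in>rts z. of_nat (mu z \<zeta>) * L (z + \<zeta> *s v))"
        using N[OF z] by (simp add: prod.distrib power_sum[symmetric] exp_sum[OF finite_rts[OF z]])
      finally show "x t ^ N * exp (\<Sum>\<zeta>\<in>rts z. of_nat (mu z \<zeta>) * L (z + \<zeta> *s v)) = poly (Q z) (x t)" ..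
    qed
  qed
  hence "holo_on (\<lambda>z. (-1) ^ N * coeff (Q z) 0) (ball p \<delta>)" by (intro holo_on_mult holo_on_const)
  thus ?thesis
  proof (rule holo_on_cong[OF open_ball, rotated])
    fix z assume z: "z \<in> ball p \<delta>"
    have "coeff (Q z) 0 = (\<Prod>\<zeta>\<in>rts z. (- F (z + \<zeta> *s v)) ^ mu z \<zeta>)"
      by (simp add: poly_0_coeff_0[symmetric] Q_def poly_prod)
    also have "\<dots> = (\<Prod>\<zeta>\<in>rts z. (-1) ^ mu z \<zeta> * F (z + \<zeta> *s v) ^ mu z \<zeta>)"
      by (intro prod.cong refl) (subst power_minus, simp)
    also have "\<dots> = (-1) ^ N * norm_fun F z"
      using N[OF z] by (simp add: prod.distrib power_sum[symmetric] norm_fun_def)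
    finally show "(-1) ^ N * coeff (Q z) 0 = norm_fun F z"
      by (simp add: power_add[symmetric] mult.assoc[symmetric] flip: mult_2)
  qed
qed

lemma norm_fun_eq_0_iff:
  fixes F :: "complex^'n \<Rightarrow> complex"
  assumes z: "z \<in> ball p \<delta>"
  shows "norm_fun F z = 0 \<longleftrightarrow> (\<exists>\<zeta>\<in>rts z. F (z + \<zeta> *s v) = 0)"
  using finite_rts[OF z] mu_pos[OF z] by (auto simp: norm_fun_def)

text \<open>Translating the base point along \<open>v\<close> translates the roots, so the norm does not change.\<close>

lemma inv_dir_norm_fun: "inv_dir v (norm_fun A) p \<delta>"
  unfolding inv_dir_def
proof (intro allI impI)
  fix z \<epsilon> assume "z \<in> ball p \<delta> \<and> z + \<epsilon> *s v \<in> ball p \<delta>"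
  hence z: "z \<in> ball p \<delta>" "z + \<epsilon> *s v \<in> ball p \<delta>" by auto
  \<comment> \<open>the roots have modulus less than \<open>r / 2\<close>, and the translation has modulus less than \<open>r / 2\<close>\<close>
  have "norm (\<epsilon> *s v) \<le> dist (z + \<epsilon> *s v) p + dist p z"
    using dist_triangle[of "z + \<epsilon> *s v" z p] by (simp add: dist_norm)
  also have "\<dots> < 2 * \<delta>" using z by (simp add: dist_commute)
  finally have "cmod \<epsilon> * norm v < 2 * \<delta>" by (simp add: norm_smult)
  also have "\<dots> \<le> r / 2 * norm v" using small by simp
  finally have \<epsilon>: "cmod \<epsilon> < r / 2" using v_pos by simp
  have eq: "z + \<epsilon> *s v + (\<zeta> - \<epsilon>) *s v = z + \<zeta> *s v" for \<zeta> by (simp add: vec_eq_iff algebra_simps)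
  have eq': "z + (\<zeta> + \<epsilon>) *s v = z + \<epsilon> *s v + \<zeta> *s v" for \<zeta> by (simp add: vec_eq_iff algebra_simps)
  have mu_eq: "mu (z + \<epsilon> *s v) (\<zeta> - \<epsilon>) = mu z \<zeta>" for \<zeta>
    unfolding mu_def zorder_shift[of _ \<zeta>] zorder_shift[of _ "\<zeta> - \<epsilon>"]
    by (simp add: vec_eq_iff algebra_simps)
  show "norm_fun A (z + \<epsilon> *s v) = norm_fun A z"
    unfolding norm_fun_def
  proof (rule sym, rule prod.reindex_bij_witness[where i="\<lambda>\<zeta>. \<zeta> + \<epsilon>" and j="\<lambda>\<zeta>. \<zeta> - \<epsilon>"])
    fix \<zeta> assume \<zeta>: "\<zeta> \<in> rts z"
    show "\<zeta> - \<epsilon> + \<epsilon> = \<zeta>" by simp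
    have "cmod (\<zeta> - \<epsilon>) < r" using rts_half[OF z(1) \<zeta>] \<epsilon> norm_triangle_ineq4[of \<zeta> \<epsilon>] by simp
    thus "\<zeta> - \<epsilon> \<in> rts (z + \<epsilon> *s v)" using \<zeta> unfolding rts_def mem_Collect_eq eq by blast
    show "A (z + \<epsilon> *s v + (\<zeta> - \<epsilon>) *s v) ^ mu (z + \<epsilon> *s v) (\<zeta> - \<epsilon>) = A (z + \<zeta> *s v) ^ mu z \<zeta>"
      by (simp only: eq mu_eq)
  next
    fix \<zeta> assume \<zeta>: "\<zeta> \<in> rts (z + \<epsilon> *s v)"
    show "\<zeta> + \<epsilon> - \<epsilon> = \<zeta>" by simp
    have "cmod (\<zeta> + \<epsilon>) < r" using rts_half[OF z(2) \<zeta>] \<epsilon> norm_triangle_ineq[of \<zeta> \<epsilon>] by simp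
    thus "\<zeta> + \<epsilon> \<in> rts z" using \<zeta> unfolding rts_def mem_Collect_eq eq' by blast
  qed
qed

text \<open>If neither \<open>g\<close> nor \<open>A\<close> changes along \<open>u\<close>, the roots, their multiplicities and the factors of the norm are
the same.  Elimination thus keeps the directions eliminated before.\<close>

lemma inv_dir_norm_fun_other:
  assumes g: "inv_dir u g p R" and A: "inv_dir u A p R"
  shows "inv_dir u (norm_fun A) p \<delta>"
  unfolding inv_dir_def
proof (intro allI impI)
  fix z \<epsilon> assume "z \<in> ball p \<delta> \<and> z + \<epsilon> *s u \<in> ball p \<delta>"
  hence z: "z \<in> ball p \<delta>" "z + \<epsilon> *s u \<in> ball p \<delta>" by auto
  have swap: "z + \<epsilon> *s u + \<zeta> *s v = (z + \<zeta> *s v) + \<epsilon> *s u" for \<zeta> by simp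
  have geq: "g (z + \<epsilon> *s u + \<zeta> *s v) = g (z + \<zeta> *s v)" "A (z + \<epsilon> *s u + \<zeta> *s v) = A (z + \<zeta> *s v)"
    if "cmod \<zeta> < r" for \<zeta>
    using g A mem_ball_R[OF z(1), of \<zeta>] mem_ball_R[OF z(2), of \<zeta>] that
    unfolding inv_dir_def swap by auto
  have rts: "rts (z + \<epsilon> *s u) = rts z" using geq by (auto simp: rts_def)
  show "norm_fun A (z + \<epsilon> *s u) = norm_fun A z"
    unfolding norm_fun_def rts
  proof (rule prod.cong[OF refl])
    fix \<zeta> assume \<zeta>: "\<zeta> \<in> rts z"
    hence "\<zeta> \<in> ball 0 r" by (auto simp: rts_def)
    hence "eventually (\<lambda>w. w \<in> ball 0 r) (at \<zeta>)"
      by (intro eventually_at_in_open') auto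
    hence "zorder (\<lambda>w. g (z + \<epsilon> *s u + w *s v)) \<zeta> = zorder (\<lambda>w. g (z + w *s v)) \<zeta>"
      by (intro zorder_cong refl) (auto elim!: eventually_mono simp: geq)
    thus "A (z + \<epsilon> *s u + \<zeta> *s v) ^ mu (z + \<epsilon> *s u) \<zeta> = A (z + \<zeta> *s v) ^ mu z \<zeta>"
      using geq(2)[of \<zeta>] \<zeta> by (simp add: mu_def rts_def)
  qed
qed

end

section \<open>Elimination of directions\<close>

lemma inv_dir_subset: "inv_dir u h p R \<Longrightarrow> R' \<le> R \<Longrightarrow> inv_dir u h p R'"
  unfolding inv_dir_def by force

lemma holo_on_pd_iter: "open U \<Longrightarrow> holo_on g U \<Longrightarrow> holo_on ((pd v ^^ m) g) U"
  by (induction m) (auto intro: holo_on_pd)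

text \<open>Otherwise \<open>g\<close> would vanish on the whole disc through \<open>z\<close>, by its Taylor series, and in particular on the
annulus.\<close>

lemma (in root_disc) pd_iter_nonzero:
  assumes z: "z \<in> ball p \<delta>"
  shows "\<exists>m. (pd v ^^ m) g z \<noteq> 0"
proof (rule ccontr)
  assume *: "\<nexists>m. (pd v ^^ m) g z \<noteq> 0"
  obtain r' where r': "r < r'" "\<And>z \<zeta>. z \<in> ball p \<delta> \<Longrightarrow> cmod \<zeta> < r' \<Longrightarrow> z + \<zeta> *s v \<in> ball p R"
    using bigger_disc[OF dom] by auto
  define f where "f = (\<lambda>\<zeta>. g (z + \<zeta> *s v))"
  have hol: "f holomorphic_on ball 0 r'" unfolding f_def
    by (rule holomorphic_line[OF holo_g]) (use r'(2)[OF z] in auto)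
  have d: "(deriv ^^ m) f \<zeta> = (pd v ^^ m) g (z + \<zeta> *s v)" if "\<zeta> \<in> ball 0 r'" for m \<zeta>
    using that
  proof (induction m arbitrary: \<zeta>)
    case (Suc m)
    have "eventually (\<lambda>\<xi>. \<xi> \<in> ball 0 r') (nhds \<zeta>)"
      using Suc.prems by (intro eventually_nhds_in_open) auto
    hence "eventually (\<lambda>\<xi>. (deriv ^^ m) f \<xi> = (pd v ^^ m) g (z + \<xi> *s v)) (nhds \<zeta>)"
      by eventually_elim (rule Suc.IH)
    hence "deriv ((deriv ^^ m) f) \<zeta> = deriv (\<lambda>\<xi>. (pd v ^^ m) g (z + \<xi> *s v)) \<zeta>"
      by (intro deriv_cong_ev refl)
    also have "\<dots> = pd v ((pd v ^^ m) g) (z + \<zeta> *s v)"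
      by (intro DERIV_imp_deriv holo_on_line_deriv[OF holo_on_pd_iter[OF open_ball holo_g]])
         (use r'(2)[OF z] Suc.prems in auto)
    finally show ?case by simp
  qed (simp add: f_def)
  have "f (of_real r) = 0"
  proof (rule holomorphic_fun_eq_0_on_ball[OF hol])
    show "of_real r \<in> ball (0::complex) r'" using r' r_pos by simp
    fix n
    have "0 \<in> ball (0::complex) r'" using r'(1) r_pos by simp
    thus "(deriv ^^ n) f 0 = 0" using d[of 0 n] * by simp
  qed
  thus False using nz[OF z, of "of_real r"] r_pos by (simp add: f_def)
qed

text \<open>The function \<open>\<zeta> \<mapsto> g (p + \<zeta> v)\<close> is not identically zero, so it has no zero on a small closed annulus, and
then by compactness neither have the functions for nearby base points.\<close>

lemma root_disc_at:
  fixes g :: "complex^'n \<Rightarrow> complex"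
  assumes g: "holo_on g (ball p R)" and v: "v \<noteq> 0"
    and \<beta>: "p + \<beta> *s v \<in> ball p R" "g (p + \<beta> *s v) \<noteq> 0" and e: "e > 0"
  obtains r \<delta> where "root_disc p v g R r \<delta>" "\<delta> < e" "r < e"
proof -
  have R: "R > 0" using \<beta>(1) by (metis mem_ball dist_norm le_less_trans norm_ge_zero)
  have nv: "norm v > 0" using v by simp
  define S where "S = ball (0::complex) (R / norm v)"
  have inS: "p + \<zeta> *s v \<in> ball p R \<longleftrightarrow> \<zeta> \<in> S" for \<zeta>
    using nv by (simp add: S_def dist_norm norm_smult field_simps)
  have hol: "(\<lambda>\<zeta>. g (p + \<zeta> *s v)) holomorphic_on S"
    by (rule holomorphic_on_subset[OF holo_on_line[OF g]]) (use inS in auto)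
  have "\<forall>\<^sub>F w in at 0. g (p + w *s v) \<noteq> 0 \<and> w \<in> S"
    by (rule non_zero_neighbour_alt[OF hol, of _ \<beta>]) (use \<beta> inS nv R in \<open>auto simp: S_def\<close>)
  then obtain d where d: "d > 0" "\<And>w. w \<noteq> 0 \<Longrightarrow> cmod w < d \<Longrightarrow> g (p + w *s v) \<noteq> 0 \<and> w \<in> S"
    unfolding eventually_at by (auto simp: dist_norm)
  define r where "r = min (min (d / 2) (R / norm v / 2)) (e / 2)"
  have r: "r > 0" "r < d" "r < e" using d nv R e by (auto simp: r_def)
  have rv: "r * norm v < R"
  proof -
    have "r * norm v \<le> R / norm v / 2 * norm v" using nv by (intro mult_right_mono) (auto simp: r_def)
    also have "\<dots> = R / 2" using nv by simp
    finally show ?thesis using R by simp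
  qed
  define K where "K = (\<lambda>\<zeta>. p + \<zeta> *s v) ` {\<zeta>. r / 2 \<le> cmod \<zeta> \<and> cmod \<zeta> \<le> r}"
  have "compact {\<zeta>. r / 2 \<le> cmod \<zeta> \<and> cmod \<zeta> \<le> r}"
  proof -
    have "{\<zeta>. r / 2 \<le> cmod \<zeta> \<and> cmod \<zeta> \<le> r} = cball 0 r - ball 0 (r / 2)" by auto
    thus ?thesis by (simp add: compact_diff)
  qed
  hence K: "compact K" unfolding K_def
    by (intro compact_continuous_image continuous_intros)
  define B where "B = {x \<in> ball p R. g x \<noteq> 0}"
  have B: "open B"
  proof -
    have "open (ball p R \<inter> g -` (-{0}))"
      by (rule continuous_open_preimage[OF holo_on_imp_continuous_on[OF g]]) auto
    thus ?thesis by (simp add: B_def Int_def)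
  qed
  have KB: "K \<subseteq> B"
  proof
    fix x assume "x \<in> K"
    then obtain \<zeta> where \<zeta>: "x = p + \<zeta> *s v" "r / 2 \<le> cmod \<zeta>" "cmod \<zeta> \<le> r" by (auto simp: K_def)
    have "\<zeta> \<noteq> 0" using \<zeta> r by auto
    hence "g x \<noteq> 0 \<and> \<zeta> \<in> S" using d(2)[of \<zeta>] \<zeta> r by simp
    thus "x \<in> B" using inS \<zeta> by (auto simp: B_def)
  qed
  obtain \<epsilon> where \<epsilon>: "\<epsilon> > 0" "(\<Union>x\<in>K. ball x \<epsilon>) \<subseteq> B"
    using compact_subset_open_imp_ball_epsilon_subset[OF K B KB] by blast
  define \<delta> where "\<delta> = min (min \<epsilon> (e / 2)) (min ((R - r * norm v) / 2) (r * norm v / 4))"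
  have \<delta>: "\<delta> > 0" "\<delta> \<le> \<epsilon>" "\<delta> < e" "\<delta> + r * norm v < R" "4 * \<delta> \<le> r * norm v"
    using \<epsilon> e rv r(1) nv by (auto simp: \<delta>_def min_def field_simps)
  have "root_disc p v g R r \<delta>"
  proof
    fix z \<zeta> assume z: "z \<in> ball p \<delta>" and \<zeta>: "r / 2 \<le> cmod \<zeta>" "cmod \<zeta> \<le> r"
    have "p + \<zeta> *s v \<in> K" using \<zeta> by (auto simp: K_def)
    moreover have "z + \<zeta> *s v \<in> ball (p + \<zeta> *s v) \<epsilon>" using z \<delta>(2) by (simp add: dist_norm)
    ultimately have "z + \<zeta> *s v \<in> B" using \<epsilon>(2) by blast
    thus "g (z + \<zeta> *s v) \<noteq> 0" by (simp add: B_def)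
  qed (use g r \<delta> in auto)
  with \<delta>(3) r(3) show ?thesis using that by blast
qed

text \<open>A direction in which \<open>g\<close> is not identically zero is that of any point \<open>z0\<close> with \<open>g z0 \<noteq> 0\<close>; if \<open>z0 = p\<close>,
every direction will do.\<close>

lemma root_disc_exists:
  fixes g :: "complex^'n \<Rightarrow> complex"
  assumes g: "holo_on g (ball p R)" and z0: "z0 \<in> ball p R" "g z0 \<noteq> 0" and e: "e > 0"
  obtains v r \<delta> where "root_disc p v g R r \<delta>" "\<delta> < e"
proof (cases "z0 = p")
  case True
  have v: "axis undefined 1 \<noteq> (0 :: complex^'n)" by (simp add: axis_eq_0_iff)
  show ?thesis
    using root_disc_at[OF g v _ _ e, of 0] that z0 True by auto
next
  case False
  show ?thesis
    using root_disc_at[OF g _ _ _ e, of "z0 - p" 1] that z0 False by auto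
qed

definition zs :: "(complex^'n \<Rightarrow> complex) set \<Rightarrow> complex^'n \<Rightarrow> real \<Rightarrow> (complex^'n) set" where
  "zs S p R = {z \<in> ball p R. \<forall>g\<in>S. g z = 0}"

text \<open>The zero set of \<open>S'\<close> is the projection along \<open>v\<close> of that of \<open>S\<close>.  The last clause makes elimination
steps in different directions compatible.\<close>

definition elim_step where
  "elim_step p S R v g r S' \<delta> \<longleftrightarrow> g \<in> S \<and> root_disc p v g R r \<delta> \<and> finite S' \<and>
     (\<forall>h\<in>S'. holo_on h (ball p \<delta>)) \<and>
     zs S' p \<delta> = {z \<in> ball p \<delta>. \<exists>\<zeta>. cmod \<zeta> < r \<and> z + \<zeta> *s v \<in> zs S p R} \<and>
     (\<forall>h\<in>S'. inv_dir v h p \<delta>) \<and>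
     (\<forall>u. (\<forall>h\<in>S. inv_dir u h p R) \<longrightarrow> (\<forall>h\<in>S'. inv_dir u h p \<delta>))"

lemma card_nat_roots_le:
  fixes q :: "complex poly"
  assumes "q \<noteq> 0"
  shows "finite {t :: nat. poly q (of_nat t) = 0}" "card {t :: nat. poly q (of_nat t) = 0} \<le> degree q"
proof -
  have inj: "inj_on (of_nat :: nat \<Rightarrow> complex) {t. poly q (of_nat t) = 0}" by (simp add: inj_on_def)
  have sub: "of_nat ` {t :: nat. poly q (of_nat t) = 0} \<subseteq> {x. poly q x = 0}" by auto
  have fin: "finite {x. poly q x = 0}" by (rule poly_roots_finite[OF assms])
  show "finite {t :: nat. poly q (of_nat t) = 0}"
    using finite_imageD[OF finite_subset[OF sub fin] inj] .
  have "card {t :: nat. poly q (of_nat t) = 0} = card (of_nat ` {t :: nat. poly q (of_nat t) = 0} :: complex set)"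
    by (simp add: card_image[OF inj])
  also have "\<dots> \<le> card {x. poly q x = 0}" by (rule card_mono[OF fin sub])
  also have "\<dots> \<le> degree q" by (rule card_poly_roots_bound[OF assms])
  finally show "card {t :: nat. poly q (of_nat t) = 0} \<le> degree q" .
qed

text \<open>As \<open>S'\<close> take the norms of the linear combinations \<open>F t = \<Sum>i. t\<^sup>i g\<^sub>i\<close> of the functions of \<open>S\<close>, for
sufficiently many integers \<open>t\<close>.  All of them vanish at \<open>z\<close> iff the functions \<open>g\<^sub>i\<close> have a common zero
among the points \<open>z + \<zeta> v\<close>, \<open>\<zeta>\<close> a root of \<open>g\<close>: if at every root some \<open>g\<^sub>i\<close> is nonzero, then \<open>F t\<close> can
vanish there for at most \<open>l\<close> values of \<open>t\<close>, and there are at most \<open>N\<close> roots.\<close>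

lemma elim_step_exists:
  fixes p :: "complex^'n"
  assumes S: "finite S" "\<And>h. h \<in> S \<Longrightarrow> holo_on h (ball p R)"
    and g: "g \<in> S" "z0 \<in> ball p R" "g z0 \<noteq> 0" and e: "e > 0"
  obtains v r S' \<delta> where "elim_step p S R v g r S' \<delta>" "\<delta> < e"
proof -
  obtain v r \<delta> where rd: "root_disc p v g R r \<delta>" "\<delta> < e"
    using root_disc_exists[OF S(2)[OF g(1)] g(2,3) e] by blast
  interpret root_disc p v g R r \<delta> by (rule rd)
  obtain gs where gs: "set gs = S" using finite_list[OF S(1)] by blast
  define l where "l = length gs"
  have l: "l > 0" using gs g(1) by (auto simp: l_def)
  obtain N where N: "\<And>z. z \<in> ball p \<delta> \<Longrightarrow> (\<Sum>\<zeta>\<in>rts z. mu z \<zeta>) = N" using root_count by blast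
  define F where "F = (\<lambda>(t::nat) z. \<Sum>i<l. of_nat t ^ i * (gs ! i) z)"
  have holF: "holo_on (F t) (ball p R)" for t
    unfolding F_def by (intro holo_on_sum holo_on_mult holo_on_const S(2)) (auto simp: gs[symmetric] l_def)
  define S' where "S' = (\<lambda>t. norm_fun (F t)) ` {..N * l}"
  have "elim_step p S R v g r S' \<delta>"
    unfolding elim_step_def
  proof (intro conjI)
    show "\<forall>h\<in>S'. holo_on h (ball p \<delta>)" unfolding S'_def using holo_on_norm_fun[OF holF] by blast
    show "\<forall>h\<in>S'. inv_dir v h p \<delta>" unfolding S'_def using inv_dir_norm_fun by blast
    show "\<forall>u. (\<forall>h\<in>S. inv_dir u h p R) \<longrightarrow> (\<forall>h\<in>S'. inv_dir u h p \<delta>)"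
    proof (intro allI impI)
      fix u assume u: "\<forall>h\<in>S. inv_dir u h p R"
      have "inv_dir u (F t) p R" for t
        using u unfolding inv_dir_def F_def gs[symmetric] l_def by (auto intro!: sum.cong)
      thus "\<forall>h\<in>S'. inv_dir u h p \<delta>" unfolding S'_def using inv_dir_norm_fun_other u g(1) by blast
    qed
    show "zs S' p \<delta> = {z \<in> ball p \<delta>. \<exists>\<zeta>. cmod \<zeta> < r \<and> z + \<zeta> *s v \<in> zs S p R}"
    proof (rule set_eqI, rule iffI)
      fix z assume "z \<in> {z \<in> ball p \<delta>. \<exists>\<zeta>. cmod \<zeta> < r \<and> z + \<zeta> *s v \<in> zs S p R}"
      then obtain \<zeta> where z: "z \<in> ball p \<delta>" and \<zeta>: "cmod \<zeta> < r" "\<And>h. h \<in> S \<Longrightarrow> h (z + \<zeta> *s v) = 0"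
        by (auto simp: zs_def)
      have "\<zeta> \<in> rts z" using \<zeta> g(1) by (auto simp: rts_def)
      moreover have "F t (z + \<zeta> *s v) = 0" for t
        unfolding F_def by (intro sum.neutral) (use \<zeta>(2) in \<open>auto simp: gs[symmetric] l_def\<close>)
      ultimately have "norm_fun (F t) z = 0" for t using norm_fun_eq_0_iff[OF z] by blast
      thus "z \<in> zs S' p \<delta>" using z by (auto simp: zs_def S'_def)
    next
      fix z assume "z \<in> zs S' p \<delta>"
      hence z: "z \<in> ball p \<delta>" and 0: "\<And>t. t \<le> N * l \<Longrightarrow> norm_fun (F t) z = 0"
        by (auto simp: zs_def S'_def)
      have "\<exists>\<zeta>\<in>rts z. \<forall>h\<in>S. h (z + \<zeta> *s v) = 0"
      proof (rule ccontr)
        assume no: "\<not> (\<exists>\<zeta>\<in>rts z. \<forall>h\<in>S. h (z + \<zeta> *s v) = 0)"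
        define q where "q = (\<lambda>\<zeta>. \<Sum>i<l. monom ((gs ! i) (z + \<zeta> *s v)) i)"
        have cq: "coeff (q \<zeta>) i = (gs ! i) (z + \<zeta> *s v)" if "i < l" for \<zeta> i
          using that by (simp add: q_def coeff_sum if_distrib cong: if_cong)
        have q0: "q \<zeta> \<noteq> 0" if "\<zeta> \<in> rts z" for \<zeta>
        proof -
          obtain h where "h \<in> S" "h (z + \<zeta> *s v) \<noteq> 0" using no \<open>\<zeta> \<in> rts z\<close> by blast
          then obtain i where "i < l" "(gs ! i) (z + \<zeta> *s v) \<noteq> 0" 
            unfolding gs[symmetric] l_def by (metis in_set_conv_nth)
          thus ?thesis using cq[of i \<zeta>] by auto
        qed
        have dq: "degree (q \<zeta>) \<le> l" for \<zeta>
          unfolding q_def by (rule degree_sum_le) (auto intro: order_trans[OF degree_monom_le])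
        have pq: "poly (q \<zeta>) (of_nat t) = F t (z + \<zeta> *s v)" for \<zeta> t
          by (simp add: q_def F_def poly_sum poly_monom mult.commute)
        define bad where "bad = (\<Union>\<zeta>\<in>rts z. {t :: nat. poly (q \<zeta>) (of_nat t) = 0})"
        have "card bad \<le> (\<Sum>\<zeta>\<in>rts z. card {t :: nat. poly (q \<zeta>) (of_nat t) = 0})"
          unfolding bad_def by (rule card_UN_le[OF finite_rts[OF z]])
        also have "\<dots> \<le> (\<Sum>\<zeta>\<in>rts z. mu z \<zeta> * l)"
        proof (rule sum_mono)
          fix \<zeta> assume \<zeta>: "\<zeta> \<in> rts z"
          have "card {t :: nat. poly (q \<zeta>) (of_nat t) = 0} \<le> l"
            using card_nat_roots_le(2)[OF q0[OF \<zeta>]] dq order_trans by blast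
          also have "l \<le> mu z \<zeta> * l" using mu_pos[OF z \<zeta>] by simp
          finally show "card {t :: nat. poly (q \<zeta>) (of_nat t) = 0} \<le> mu z \<zeta> * l" .
        qed
        also have "\<dots> = N * l" using N[OF z] by (simp add: sum_distrib_right[symmetric])
        finally have "card bad < card {..N * l}" by simp
        moreover have "finite bad" unfolding bad_def using finite_rts[OF z] card_nat_roots_le(1) q0 by blast
        ultimately have "\<not> {..N * l} \<subseteq> bad" using card_mono[of bad "{..N * l}"] by force
        then obtain t where t: "t \<le> N * l" "t \<notin> bad" by auto
        with 0 norm_fun_eq_0_iff[OF z] obtain \<zeta> where "\<zeta> \<in> rts z" "F t (z + \<zeta> *s v) = 0" by blast
        with t(2) show False by (auto simp: bad_def pq)
      qed
      then obtain \<zeta> where \<zeta>: "\<zeta> \<in> rts z" "\<And>h. h \<in> S \<Longrightarrow> h (z + \<zeta> *s v) = 0" by blast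
      hence "cmod \<zeta> < r \<and> z + \<zeta> *s v \<in> zs S p R"
        using mem_ball_R[OF z, of \<zeta>] by (auto simp: zs_def rts_def)
      thus "z \<in> {z \<in> ball p \<delta>. \<exists>\<zeta>. cmod \<zeta> < r \<and> z + \<zeta> *s v \<in> zs S p R}" using z by blast
    qed
  qed (use g rd in \<open>auto simp: S'_def\<close>)
  with rd(2) show ?thesis using that by blast
qed

inductive tower :: "complex^'n \<Rightarrow> (complex^'n \<Rightarrow> complex) set \<Rightarrow> real \<Rightarrow>
    ((complex^'n) \<times> (complex^'n \<Rightarrow> complex)) list \<Rightarrow> (complex^'n \<Rightarrow> complex) set \<Rightarrow> real \<Rightarrow> bool"
  for p S R where
  tower_Nil: "tower p S R [] S R"
| tower_snoc: "tower p S R L S1 R1 \<Longrightarrow> elim_step p S1 R1 v g r S2 R2 \<Longrightarrow> tower p S R (L @ [(v, g)]) S2 R2"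

text \<open>The eliminated equations form a triangular system: \<open>g\<^sub>k\<close> does not depend on the earlier directions and has
finite order in its own.\<close>

definition triangular :: "((complex^'n) \<times> (complex^'n \<Rightarrow> complex)) list \<Rightarrow> complex^'n \<Rightarrow> real \<Rightarrow> bool" where
  "triangular L p R \<longleftrightarrow> (\<forall>k<length L. holo_on (snd (L ! k)) (ball p R) \<and>
     (\<forall>m<k. inv_dir (fst (L ! m)) (snd (L ! k)) p R) \<and>
     (\<forall>z\<in>ball p R. \<exists>m. (pd (fst (L ! k)) ^^ m) (snd (L ! k)) z \<noteq> 0))"

lemma triangular_subset: "triangular L p R \<Longrightarrow> R' \<le> R \<Longrightarrow> triangular L p R'"
  unfolding triangular_def
  by (auto intro: holo_on_subset inv_dir_subset)

lemma triangular_snoc: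
  assumes L: "triangular L p R" and rd: "root_disc p v g R r \<delta>"
    and inv: "\<And>k. k < length L \<Longrightarrow> inv_dir (fst (L ! k)) g p R"
  shows "triangular (L @ [(v, g)]) p \<delta>"
proof -
  interpret root_disc p v g R r \<delta> by (rule rd)
  have le: "\<delta> \<le> R" using dom r_pos v_pos by (smt (verit) mult_pos_pos)
  show ?thesis
    unfolding triangular_def
  proof (intro allI impI)
    fix k assume "k < length (L @ [(v, g)])"
    then consider "k < length L" | "k = length L" by fastforce
    thus "holo_on (snd ((L @ [(v, g)]) ! k)) (ball p \<delta>) \<and>
     (\<forall>m<k. inv_dir (fst ((L @ [(v, g)]) ! m)) (snd ((L @ [(v, g)]) ! k)) p \<delta>) \<and>
     (\<forall>z\<in>ball p \<delta>. \<exists>m. (pd (fst ((L @ [(v, g)]) ! k)) ^^ m) (snd ((L @ [(v, g)]) ! k)) z \<noteq> 0)"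
    proof cases
      case 1
      thus ?thesis using triangular_subset[OF L le] by (auto simp: triangular_def nth_append)
    next
      case 2
      have "holo_on g (ball p \<delta>)" by (rule holo_on_subset[OF holo_g subset_ball[OF le]])
      thus ?thesis using 2 inv_dir_subset[OF inv le] pd_iter_nonzero
        by (auto simp: nth_append)
    qed
  qed
qed

lemma tower_props:
  assumes "tower p S R L S1 R1" and S: "finite S" "\<And>h. h \<in> S \<Longrightarrow> holo_on h (ball p R)" "R > 0"
  shows "finite S1 \<and> (\<forall>h\<in>S1. holo_on h (ball p R1)) \<and> 0 < R1 \<and> R1 \<le> R \<and>
     zs S p R \<inter> ball p R1 \<subseteq> zs S1 p R1 \<and>
     (\<forall>h\<in>S1. \<forall>k<length L. inv_dir (fst (L ! k)) h p R1) \<and> triangular L p R1 \<and>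
     (\<forall>k<length L. \<forall>z\<in>zs S p R \<inter> ball p R1. snd (L ! k) z = 0)"
  using assms(1)
proof (induction rule: tower.induct)
  case tower_Nil
  show ?case using S by (auto simp: triangular_def)
next
  case (tower_snoc L S1 R1 v g r S2 R2)
  note es = tower_snoc.hyps(2)[unfolded elim_step_def]
  have rd: "root_disc p v g R1 r R2" and gS: "g \<in> S1" using es by auto
  interpret root_disc p v g R1 r R2 by (rule rd)
  have le: "R2 \<le> R1" using dom r_pos v_pos by (smt (verit) mult_pos_pos)
  have sub: "zs S p R \<inter> ball p R2 \<subseteq> zs S1 p R1" using tower_snoc.IH le by auto
  show ?case
  proof (intro conjI)
    show "zs S p R \<inter> ball p R2 \<subseteq> zs S2 p R2"
    proof
      fix z assume z: "z \<in> zs S p R \<inter> ball p R2"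
      hence "z + 0 *s v \<in> zs S1 p R1" using sub by auto
      thus "z \<in> zs S2 p R2" using es z r_pos by (metis (mono_tags, lifting) IntD2 mem_Collect_eq norm_zero)
    qed
    show "\<forall>h\<in>S2. \<forall>k<length (L @ [(v, g)]). inv_dir (fst ((L @ [(v, g)]) ! k)) h p R2"
    proof (intro ballI allI impI)
      fix h k assume h: "h \<in> S2" and "k < length (L @ [(v, g)])"
      then consider "k < length L" | "k = length L" by fastforce
      thus "inv_dir (fst ((L @ [(v, g)]) ! k)) h p R2"
        by cases (use es h tower_snoc.IH in \<open>auto simp: nth_append\<close>)
    qed
    show "triangular (L @ [(v, g)]) p R2"
      by (rule triangular_snoc[OF _ rd]) (use tower_snoc.IH gS in auto)
    show "\<forall>k<length (L @ [(v, g)]). \<forall>z\<in>zs S p R \<inter> ball p R2. snd ((L @ [(v, g)]) ! k) z = 0"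
    proof (intro ballI allI impI)
      fix z k assume z: "z \<in> zs S p R \<inter> ball p R2" and "k < length (L @ [(v, g)])"
      then consider "k < length L" | "k = length L" by fastforce
      thus "snd ((L @ [(v, g)]) ! k) z = 0"
      proof cases
        case 1 thus ?thesis using z le tower_snoc.IH by (auto simp: nth_append)
      next
        case 2 thus ?thesis using z sub gS by (auto simp: zs_def)
      qed
    qed
  qed (use es tower_snoc.IH le \<delta>_pos in auto)
qed

subsection \<open>A bound for the number of eliminated directions\<close>

lemma inv_dir_pd:
  fixes h :: "complex^'n \<Rightarrow> complex"
  assumes "inv_dir u h p R"
  shows "inv_dir u (pd v h) p R"
  unfolding inv_dir_def
proof (intro allI impI)
  fix z \<epsilon> assume z: "z \<in> ball p R \<and> z + \<epsilon> *s u \<in> ball p R"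
  have o: "open {\<zeta>. z + \<zeta> *s v \<in> ball p R}" "open {\<zeta>. (z + \<epsilon> *s u) + \<zeta> *s v \<in> ball p R}"
    by (rule open_line, simp)+
  have "\<forall>\<^sub>F \<zeta> in nhds 0. \<zeta> \<in> {\<zeta>. z + \<zeta> *s v \<in> ball p R} \<and> \<zeta> \<in> {\<zeta>. (z + \<epsilon> *s u) + \<zeta> *s v \<in> ball p R}"
    by (intro eventually_conj eventually_nhds_in_open o) (use z in auto)
  hence "\<forall>\<^sub>F \<zeta> in nhds 0. h (z + \<epsilon> *s u + \<zeta> *s v) = h (z + \<zeta> *s v)"
  proof eventually_elim
    case (elim \<zeta>)
    have eq: "z + \<epsilon> *s u + \<zeta> *s v = (z + \<zeta> *s v) + \<epsilon> *s u" by simp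
    show ?case using assms elim unfolding inv_dir_def eq mem_Collect_eq by blast
  qed
  thus "pd v h (z + \<epsilon> *s u) = pd v h z" unfolding pd_def by (intro deriv_cong_ev) auto
qed

lemma inv_dir_pd_iter:
  fixes h :: "complex^'n \<Rightarrow> complex"
  shows "inv_dir u h p R \<Longrightarrow> inv_dir u ((pd v ^^ m) h) p R"
  by (induction m) (auto intro: inv_dir_pd)

lemma pd_inv_dir_eq_0:
  fixes h :: "complex^'n \<Rightarrow> complex"
  assumes "inv_dir u h p R" "z \<in> ball p R"
  shows "pd u h z = 0"
proof -
  have o: "open {\<zeta>. z + \<zeta> *s u \<in> ball p R}" by (rule open_line, simp)
  have "\<forall>\<^sub>F \<zeta> in nhds 0. \<zeta> \<in> {\<zeta>. z + \<zeta> *s u \<in> ball p R}"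
    by (intro eventually_nhds_in_open o) (use assms in auto)
  hence "\<forall>\<^sub>F \<zeta> in nhds 0. h (z + \<zeta> *s u) = h z"
    by eventually_elim (use assms in \<open>auto simp: inv_dir_def\<close>)
  hence "deriv (\<lambda>\<zeta>. h (z + \<zeta> *s u)) 0 = deriv (\<lambda>\<zeta>. h z) 0" by (intro deriv_cong_ev) auto
  thus ?thesis by (simp add: pd_def)
qed

text \<open>In \<open>\<complex>\<^sup>n\<close> the image of \<open>\<complex>\<^sup>I\<close> under an injective linear map and \<open>l\<close> vectors, \<open>l + |I| > n\<close>, satisfy a
linear relation that involves the vectors.  The vectors may be dependent; so only \<open>n - |I| + 1\<close> of them
are used, all but the last in place of the missing coordinates.\<close>

lemma coord_space_meets_span:
  fixes A :: "complex^'n \<Rightarrow> complex^'n" and v :: "nat \<Rightarrow> complex^'n"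
  assumes add: "\<And>x y. A (x + y) = A x + A y" and hom: "\<And>c x. A (c *s x) = c *s A x"
    and inj: "\<And>x. x \<in> coord_space I \<Longrightarrow> A x = 0 \<Longrightarrow> x = 0"
    and card: "CARD('n) < l + card I"
  shows "\<exists>x c k. x \<in> coord_space I \<and> k < l \<and> c k \<noteq> 0 \<and> A x = (\<Sum>k<l. c k *s v k)"
proof -
  define l' where "l' = CARD('n) - card I"
  have cI: "card I \<le> CARD('n)" by (simp add: card_mono)
  have l': "l' < l" using card cI by (simp add: l'_def)
  have "card (- I) = card {..<l'}" by (simp add: l'_def Compl_eq_Diff_UNIV card_Diff_subset)
  then obtain \<beta> where \<beta>: "bij_betw \<beta> (- I) {..<l'}"
    using finite_same_card_bij[of "- I" "{..<l'}"] by auto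
  define \<pi> where "\<pi> = (\<lambda>x :: complex^'n. \<chi> j. if j \<in> I then x $ j else 0)"
  define \<Theta> where "\<Theta> = (\<lambda>x. A (\<pi> x) - (\<Sum>j\<in>-I. x $ j *s v (\<beta> j)))"
  have \<pi>: "\<pi> (x + y) = \<pi> x + \<pi> y" "\<pi> (c *s x) = c *s \<pi> x" "\<pi> x \<in> coord_space I" for x y c
    by (auto simp: \<pi>_def vec_eq_iff coord_space_def)
  have "linear \<Theta>"
  proof (rule linearI)
    fix x y :: "complex^'n" and r :: real
    show "\<Theta> (x + y) = \<Theta> x + \<Theta> y"
      unfolding \<Theta>_def \<pi>(1) add vector_add_component vec.scale_left_distrib sum.distrib by simp
    have r: "r *\<^sub>R y = of_real r *s y" for y :: "complex^'n"
      by (simp add: vec_eq_iff) (simp add: scaleR_conv_of_real)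
    show "\<Theta> (r *\<^sub>R x) = r *\<^sub>R \<Theta> x"
      unfolding r \<Theta>_def \<pi>(2) hom vec.scale_right_diff_distrib vec.scale_sum_right
        vector_smult_component vector_smult_assoc ..
  qed
  \<comment> \<open>if \<open>\<Theta>\<close> is onto, the last vector is in its range; otherwise \<open>\<Theta>\<close> has a kernel\<close>
  have "\<exists>x e. A (\<pi> x) = e *s v l' + (\<Sum>j\<in>-I. x $ j *s v (\<beta> j)) \<and> (e \<noteq> 0 \<or> (\<exists>j\<in>-I. x $ j \<noteq> 0))"
  proof (cases "inj \<Theta>")
    case True
    hence "surj \<Theta>" using linear_injective_imp_surjective[OF \<open>linear \<Theta>\<close>] by blast
    then obtain x where "\<Theta> x = v l'" by (metis surjD)
    thus ?thesis by (intro exI[of _ x] exI[of _ 1]) (simp add: \<Theta>_def algebra_simps)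
  next
    case False
    then obtain x where x: "\<Theta> x = 0" "x \<noteq> 0"
      using linear_injective_0[OF \<open>linear \<Theta>\<close>] by blast
    have "\<exists>j\<in>-I. x $ j \<noteq> 0"
    proof (rule ccontr)
      assume no: "\<not> (\<exists>j\<in>-I. x $ j \<noteq> 0)"
      hence "\<pi> x = x" by (auto simp: \<pi>_def vec_eq_iff)
      moreover have "(\<Sum>j\<in>-I. x $ j *s v (\<beta> j)) = 0" using no by (intro sum.neutral) auto
      ultimately have "A x = 0" "x \<in> coord_space I" using x \<pi>(3)[of x] by (auto simp: \<Theta>_def)
      thus False using inj x by blast
    qed
    thus ?thesis using x by (intro exI[of _ x] exI[of _ 0]) (simp add: \<Theta>_def)
  qed
  then obtain x e where x: "A (\<pi> x) = e *s v l' + (\<Sum>j\<in>-I. x $ j *s v (\<beta> j))"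
    and ne: "e \<noteq> 0 \<or> (\<exists>j\<in>-I. x $ j \<noteq> 0)" by blast
  define c where "c = (\<lambda>k. if k = l' then e else if k < l' then x $ inv_into (-I) \<beta> k else 0)"
  have inv: "inv_into (-I) \<beta> (\<beta> j) = j" if "j \<in> -I" for j
    using \<beta> that by (simp add: bij_betw_inv_into_left)
  have c\<beta>: "c (\<beta> j) = x $ j" "\<beta> j < l'" if "j \<in> -I" for j
    using bij_betw_apply[OF \<beta> that] inv[OF that] by (auto simp: c_def)
  have "(\<Sum>k<l. c k *s v k) = (\<Sum>k\<in>{..<Suc l'}. c k *s v k)"
    by (rule sum.mono_neutral_right) (use l' in \<open>auto simp: c_def\<close>)
  also have "\<dots> = e *s v l' + (\<Sum>k<l'. c k *s v k)" by (simp add: c_def)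
  also have "(\<Sum>k<l'. c k *s v k) = (\<Sum>j\<in>-I. c (\<beta> j) *s v (\<beta> j))"
    using sum.reindex_bij_betw[OF \<beta>, of "\<lambda>k. c k *s v k"] by simp
  also have "\<dots> = (\<Sum>j\<in>-I. x $ j *s v (\<beta> j))" by (intro sum.cong) (auto simp: c\<beta>)
  finally have "A (\<pi> x) = (\<Sum>k<l. c k *s v k)" using x by simp
  moreover have "\<exists>k<l. c k \<noteq> 0"
    using ne l' c\<beta> by (metis c_def less_trans)
  ultimately show ?thesis using \<pi>(3) by blast
qed

text \<open>The functions of a triangular system of length \<open>l\<close> have linearly independent differentials, after the
following preparation, so that a manifold on which they vanish has codimension at least \<open>l\<close>.  Replace
\<open>g\<^sub>k\<close> by the last of its derivatives in the direction \<open>v\<^sub>k\<close> that vanishes on \<open>X\<close> near a suitable point; the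
next derivative is nonzero there, and the invariance in the earlier directions is kept.  If the manifold
were too large, a tangent vector would be a nontrivial combination of the \<open>v\<^sub>k\<close>.  With \<open>j\<close> the largest
index that occurs, the differential of the function number \<open>j\<close> kills the tangent vector and the earlier
directions, but not \<open>v\<^sub>j\<close>.\<close>

lemma triangular_chart_bound:
  fixes X :: "(complex^'n) set"
  assumes tri: "triangular L p R" and chart: "slice_chart X I U V F G"
    and q: "q \<in> X" "q \<in> U" "q \<in> ball p R" and N: "open N" "q \<in> N"
    and van: "\<And>k z. k < length L \<Longrightarrow> z \<in> X \<inter> N \<Longrightarrow> snd (L ! k) z = 0"
  shows "length L + card I \<le> CARD('n)"
proof (rule ccontr)
  assume "\<not> length L + card I \<le> CARD('n)"
  hence big: "CARD('n) < length L + card I" by simp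
  define v where "v = (\<lambda>k. fst (L ! k))"
  define g where "g = (\<lambda>k. snd (L ! k))"
  have ch: "open U" "open V" "holo_map_on F U" "holo_map_on G V"
     "\<And>z. z \<in> U \<Longrightarrow> F z \<in> V \<and> G (F z) = z" "\<And>w. w \<in> V \<Longrightarrow> G w \<in> U \<and> F (G w) = w"
     "F ` (X \<inter> U) = coord_space I \<inter> V"
    using chart unfolding slice_chart_def by auto
  have hol: "holo_on (g k) (ball p R)" and invg: "\<And>m. m < k \<Longrightarrow> inv_dir (v m) (g k) p R"
    and ord: "\<And>z. z \<in> ball p R \<Longrightarrow> \<exists>m. (pd (v k) ^^ m) (g k) z \<noteq> 0" if "k < length L" for k
    using tri that unfolding triangular_def v_def g_def by auto
  \<comment> \<open>one function at a time, moving the point a little and shrinking its neighbourhood\<close>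
  have key: "\<exists>q' N' ms. open N' \<and> q' \<in> X \<inter> N' \<and> N' \<subseteq> N \<inter> U \<inter> ball p R \<and>
     (\<forall>j<k. \<forall>z\<in>X \<inter> N'. (pd (v j) ^^ ms j) (g j) z = 0 \<and> (pd (v j) ^^ Suc (ms j)) (g j) z \<noteq> 0)"
    if "k \<le> length L" for k
    using that
  proof (induction k)
    case 0
    show ?case by (intro exI[of _ q] exI[of _ "N \<inter> U \<inter> ball p R"]) (use q N ch(1) in auto)
  next
    case (Suc k)
    obtain q' N' ms where IH: "open N'" "q' \<in> X \<inter> N'" "N' \<subseteq> N \<inter> U \<inter> ball p R"
     "\<And>j z. j < k \<Longrightarrow> z \<in> X \<inter> N' \<Longrightarrow> (pd (v j) ^^ ms j) (g j) z = 0 \<and> (pd (v j) ^^ Suc (ms j)) (g j) z \<noteq> 0"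
      using Suc.IH[OF Suc_leD[OF Suc.prems]] by blast
    have k: "k < length L" using Suc.prems by simp
    define P where "P = (\<lambda>m. \<exists>z\<in>X \<inter> N'. (pd (v k) ^^ m) (g k) z \<noteq> 0)"
    obtain m where "P m" using ord[OF k, of q'] IH(2,3) unfolding P_def by blast
    define m0 where "m0 = (LEAST m. P m)"
    have Pm0: "P m0" unfolding m0_def by (rule LeastI[of P, OF \<open>P m\<close>])
    have "\<not> P 0" using van[OF k] IH(3) by (auto simp: P_def g_def)
    hence "m0 \<noteq> 0" using Pm0 by metis
    then obtain m1 where m1: "m0 = Suc m1" using not0_implies_Suc by blast
    have "\<not> P m1" using not_less_Least[of m1 P] m1 by (simp add: m0_def)
    obtain z0 where z0: "z0 \<in> X \<inter> N'" "(pd (v k) ^^ Suc m1) (g k) z0 \<noteq> 0" using Pm0 m1 by (auto simp: P_def)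
    define N'' where "N'' = N' \<inter> ((pd (v k) ^^ Suc m1) (g k)) -` (-{0})"
    have "open N''" unfolding N''_def
      by (rule continuous_open_preimage[OF continuous_on_subset[OF holo_on_imp_continuous_on[OF holo_on_pd_iter[OF open_ball hol[OF k]]]]])
         (use IH in auto)
    show ?case
    proof (intro exI[of _ z0] exI[of _ N''] exI[of _ "ms(k := m1)"] conjI allI impI ballI)
      fix j z assume j: "j < Suc k" and z: "z \<in> X \<inter> N''"
      have zN: "z \<in> X \<inter> N'" using z by (auto simp: N''_def)
      show "(pd (v j) ^^ (ms(k := m1)) j) (g j) z = 0"
        using IH(4)[of j z] zN \<open>\<not> P m1\<close> j unfolding P_def by (cases "j = k") auto
      show "(pd (v j) ^^ Suc ((ms(k := m1)) j)) (g j) z \<noteq> 0"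
        using IH(4)[of j z] zN z j unfolding N''_def by (cases "j = k") auto
    qed (use \<open>open N''\<close> z0 IH(3) in \<open>auto simp: N''_def\<close>)
  qed
  obtain q' N' ms where q': "open N'" "q' \<in> X \<inter> N'" "N' \<subseteq> N \<inter> U \<inter> ball p R"
     "\<And>j z. j < length L \<Longrightarrow> z \<in> X \<inter> N' \<Longrightarrow> (pd (v j) ^^ ms j) (g j) z = 0 \<and> (pd (v j) ^^ Suc (ms j)) (g j) z \<noteq> 0"
    using key[OF order_refl] by blast
  define h where "h = (\<lambda>j. (pd (v j) ^^ ms j) (g j))"
  have holh: "holo_on (h j) (ball p R)" if "j < length L" for j
    unfolding h_def by (rule holo_on_pd_iter[OF open_ball hol[OF that]])
  define w where "w = F q'"
  have q'U: "q' \<in> U" "q' \<in> ball p R" using q' by auto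
  have w: "w \<in> V" "G w = q'" "w \<in> coord_space I"
    using ch(5)[OF q'U(1)] ch(7) q' q'U by (auto simp: w_def)
  obtain A where A: "(G has_derivative A) (at w)" "\<And>c x. A (c *s x) = c *s A x"
    using holo_map_onE[OF ch(4) w(1)] by blast
  obtain B where B: "(F has_derivative B) (at q')" "\<And>c x. B (c *s x) = c *s B x"
    using holo_map_onE[OF ch(3) q'U(1)] by blast
  have "((\<lambda>x. F (G x)) has_derivative (\<lambda>x. B (A x))) (at w)"
    using has_derivative_compose[OF A(1)] B(1) w(2) by simp
  moreover have "((\<lambda>x. F (G x)) has_derivative (\<lambda>x. x)) (at w)"
    by (rule has_derivative_transform_within_open[OF has_derivative_ident ch(2) w(1)]) (use ch(6) in auto)
  ultimately have BA: "(\<lambda>x. B (A x)) = (\<lambda>x. x)" by (rule has_derivative_unique)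
  have "linear A" using has_derivative_linear[OF A(1)] .
  have "linear B" using has_derivative_linear[OF B(1)] .
  have injA: "x = 0" if "A x = 0" for x
    using fun_cong[OF BA, of x] that linear_0[OF \<open>linear B\<close>] by simp
  obtain x c k where x: "x \<in> coord_space I" "k < length L" "c k \<noteq> 0" "A x = (\<Sum>k<length L. c k *s v k)"
    using coord_space_meets_span[of A I "length L" v] linear_add[OF \<open>linear A\<close>] A(2) injA big by blast
  define j where "j = Max {k. k < length L \<and> c k \<noteq> 0}"
  have fin: "finite {k. k < length L \<and> c k \<noteq> 0}" by simp
  have "j \<in> {k. k < length L \<and> c k \<noteq> 0}" unfolding j_def by (rule Max_in) (use x in auto)
  hence j: "j < length L" "c j \<noteq> 0" by auto
  have jmax: "c k = 0" if "k < length L" "k > j" for k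
  proof (rule ccontr)
    assume "c k \<noteq> 0"
    hence "k \<le> j" unfolding j_def using that by (intro Max_ge[OF fin]) auto
    thus False using that by simp
  qed
  obtain D where D: "(h j has_derivative D) (at q')" "\<And>c v. D (c *s v) = c * D v"
    using holo_onE[OF holh[OF j(1)] q'U(2)] by blast
  have "linear D" using has_derivative_linear[OF D(1)] .
  have "((\<lambda>x. h j (G x)) has_derivative (\<lambda>x. D (A x))) (at w)"
    using has_derivative_compose[OF A(1)] D(1) w(2) by simp
  hence d1: "((\<lambda>\<zeta>. h j (G (w + \<zeta> *s x))) has_field_derivative D (A x)) (at 0)"
    using has_derivative_line[of "\<lambda>x. h j (G x)" "\<lambda>x. D (A x)" w 0 x] A(2) D(2) by simp
  have cont: "isCont G w" using A(1) has_derivative_continuous by blast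
  have "open (V \<inter> G -` N')"
    by (rule continuous_open_preimage[OF holo_map_on_imp_continuous_on[OF ch(4)] ch(2) q'(1)])
  hence "open {\<zeta>. w + \<zeta> *s x \<in> V \<inter> G -` N'}" by (rule open_line)
  hence "\<forall>\<^sub>F \<zeta> in nhds 0. \<zeta> \<in> {\<zeta>. w + \<zeta> *s x \<in> V \<inter> G -` N'}"
    by (intro eventually_nhds_in_open) (use w q' in auto)
  hence "\<forall>\<^sub>F \<zeta> in nhds 0. h j (G (w + \<zeta> *s x)) = 0"
  proof eventually_elim
    case (elim \<zeta>)
    have "w + \<zeta> *s x \<in> coord_space I \<inter> V" using w x elim by (auto simp: coord_space_def)
    then obtain y where "y \<in> X \<inter> U" "F y = w + \<zeta> *s x" using ch(7) by (metis imageE)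
    moreover from this have "G (w + \<zeta> *s x) = y" using ch(5)[of y] by (metis IntD2)
    ultimately have "G (w + \<zeta> *s x) \<in> X \<inter> N'" using elim by auto
    thus ?case using q'(4)[OF j(1)] by (simp add: h_def)
  qed
  hence "deriv (\<lambda>\<zeta>. h j (G (w + \<zeta> *s x))) 0 = deriv (\<lambda>\<zeta>. 0) 0" by (intro deriv_cong_ev) auto
  hence "D (A x) = 0" using DERIV_imp_deriv[OF d1] by simp
  also have "D (A x) = (\<Sum>k<length L. c k * D (v k))"
    unfolding x(4) linear_sum[OF \<open>linear D\<close>] by (simp add: D(2))
  also have "\<dots> = (\<Sum>k<length L. if k = j then c j * D (v j) else 0)"
  proof (rule sum.cong[OF refl])
    fix k assume k: "k \<in> {..<length L}"
    have "D (v k) = 0" if "k < j"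
    proof -
      have "pd (v k) (h j) q' = 0"
        unfolding h_def by (rule pd_inv_dir_eq_0[OF inv_dir_pd_iter[OF invg[OF j(1) that]] q'U(2)])
      thus ?thesis using pd_eq[OF D] by simp
    qed
    thus "c k * D (v k) = (if k = j then c j * D (v j) else 0)"
      using jmax[of k] k by (cases k j rule: linorder_cases) auto
  qed
  also have "\<dots> = c j * D (v j)" using j(1) by simp
  finally have "D (v j) = 0" using j(2) by simp
  moreover have "pd (v j) (h j) q' \<noteq> 0" using q'(4)[OF j(1)] q'(2) by (simp add: h_def)
  ultimately show False using pd_eq[OF D] by simp
qed

subsection \<open>The characteristic polynomial of a function\<close>

lemma holo_on_poly:
  fixes P :: "complex^'n \<Rightarrow> complex poly"
  assumes "open U" "\<And>m. holo_on (\<lambda>z. coeff (P z) m) U" "holo_on f U" "\<And>z. z \<in> U \<Longrightarrow> degree (P z) = D"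
  shows "holo_on (\<lambda>z. poly (P z) (f z)) U"
proof (rule holo_on_cong[OF assms(1)])
  show "holo_on (\<lambda>z. \<Sum>m\<le>D. coeff (P z) m * f z ^ m) U"
    by (intro holo_on_sum holo_on_mult holo_on_power assms) auto
qed (simp add: poly_altdef assms(4))

text \<open>Start with \<open>[:- G, 1:]\<close> and take the norm in every step.  In the end \<open>P z\<close> is the characteristic
polynomial of \<open>G\<close> on the points lying over \<open>z\<close>.  A point of the zero set is its own root \<open>\<zeta> = 0\<close>, so that
\<open>G\<close> satisfies the equation there.\<close>

lemma tower_charpoly:
  fixes G :: "complex^'n \<Rightarrow> complex"
  assumes "tower p S R L S1 R1" and S: "finite S" "\<And>h. h \<in> S \<Longrightarrow> holo_on h (ball p R)" "R > 0"
    and G: "holo_on G (ball p R)"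
  shows "\<exists>P D. (\<forall>z\<in>ball p R1. degree (P z) = D \<and> lead_coeff (P z) = 1) \<and>
      (\<forall>m. holo_on (\<lambda>z. coeff (P z) m) (ball p R1)) \<and>
      (\<forall>k<length L. inv_dir (fst (L ! k)) P p R1) \<and>
      (\<forall>z\<in>zs S p R \<inter> ball p R1. poly (P z) (G z) = 0)"
  using assms(1)
proof (induction rule: tower.induct)
  case tower_Nil
  have "holo_on (\<lambda>z. coeff [:- G z, 1:] m) (ball p R)" for m
  proof (cases m)
    case 0
    have "holo_on (\<lambda>z. 0 - G z) (ball p R)" by (intro holo_on_diff holo_on_const G)
    thus ?thesis using 0 by simp
  next
    case (Suc m')
    thus ?thesis by (cases m') auto
  qed
  thus ?case by (intro exI[of _ "\<lambda>z. [:- G z, 1:]"] exI[of _ 1]) auto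
next
  case (tower_snoc L S1 R1 v g r S2 R2)
  note es = tower_snoc.hyps(2)[unfolded elim_step_def]
  note tp = tower_props[OF tower_snoc.hyps(1) S]
  have rd: "root_disc p v g R1 r R2" and gS: "g \<in> S1" using es by auto
  interpret root_disc p v g R1 r R2 by (rule rd)
  have le: "R2 \<le> R1" using dom r_pos v_pos by (smt (verit) mult_pos_pos)
  obtain P D where P: "\<And>z. z \<in> ball p R1 \<Longrightarrow> degree (P z) = D \<and> lead_coeff (P z) = 1"
      "\<And>m. holo_on (\<lambda>z. coeff (P z) m) (ball p R1)"
      "\<And>k. k < length L \<Longrightarrow> inv_dir (fst (L ! k)) P p R1"
      "\<And>z. z \<in> zs S p R \<inter> ball p R1 \<Longrightarrow> poly (P z) (G z) = 0"
    using tower_snoc.IH by blast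
  obtain N where N: "\<And>z. z \<in> ball p R2 \<Longrightarrow> (\<Sum>\<zeta>\<in>rts z. mu z \<zeta>) = N" using root_count by blast
  have pt: "z + \<zeta> *s v \<in> ball p R1" if "z \<in> ball p R2" "\<zeta> \<in> rts z" for z \<zeta>
    using mem_ball_R[OF that(1), of \<zeta>] that(2) by (auto simp: rts_def)
  have nzP: "P z \<noteq> 0" if "z \<in> ball p R1" for z using P(1)[OF that] by auto
  have deg: "degree (norm_fun P z) = D * N" if z: "z \<in> ball p R2" for z
  proof -
    have "degree (norm_fun P z) = (\<Sum>\<zeta>\<in>rts z. degree (P (z + \<zeta> *s v) ^ mu z \<zeta>))"
      unfolding norm_fun_def by (rule degree_prod_eq_sum_degree) (use nzP pt[OF z] in auto)
    also have "\<dots> = (\<Sum>\<zeta>\<in>rts z. D * mu z \<zeta>)"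
      by (intro sum.cong refl) (use P(1) pt[OF z] nzP in \<open>auto simp: degree_power_eq\<close>)
    also have "\<dots> = D * N" using N[OF z] by (simp add: sum_distrib_left[symmetric])
    finally show ?thesis .
  qed
  have lc: "lead_coeff (norm_fun P z) = 1" if z: "z \<in> ball p R2" for z
  proof -
    have "lead_coeff (norm_fun P z) = (\<Prod>\<zeta>\<in>rts z. lead_coeff (P (z + \<zeta> *s v)) ^ mu z \<zeta>)"
      unfolding norm_fun_def lead_coeff_prod lead_coeff_power ..
    also have "\<dots> = 1"
    proof (intro prod.neutral ballI)
      fix \<zeta> assume "\<zeta> \<in> rts z"
      hence 1: "lead_coeff (P (z + \<zeta> *s v)) = 1" using P(1)[OF pt[OF z]] by blast
      show "lead_coeff (P (z + \<zeta> *s v)) ^ mu z \<zeta> = 1" unfolding 1 by simp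
    qed
    finally show ?thesis .
  qed
  show ?case
  proof (intro exI[of _ "norm_fun P"] exI[of _ "D * N"] conjI ballI allI impI)
    fix m
    show "holo_on (\<lambda>z. coeff (norm_fun P z) m) (ball p R2)"
    proof (rule holo_on_coeff[where x=of_nat and D="D * N"])
      fix t
      have "holo_on (norm_fun (\<lambda>z. poly (P z) (of_nat t))) (ball p R2)"
        by (intro holo_on_norm_fun holo_on_poly[OF open_ball P(2) holo_on_const]) (use P(1) in auto)
      moreover have "norm_fun (\<lambda>z. poly (P z) (of_nat t)) = (\<lambda>z. poly (norm_fun P z) (of_nat t))"
        by (simp add: norm_fun_def poly_prod fun_eq_iff)
      ultimately show "holo_on (\<lambda>z. poly (norm_fun P z) (of_nat t)) (ball p R2)" by simp
    qed (use deg in \<open>auto simp: inj_def\<close>)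
  next
    fix k assume "k < length (L @ [(v, g)])"
    then consider "k < length L" | "k = length L" by fastforce
    thus "inv_dir (fst ((L @ [(v, g)]) ! k)) (norm_fun P) p R2"
    proof cases
      case 1
      hence "inv_dir (fst (L ! k)) g p R1" using tp gS by blast
      thus ?thesis using 1 inv_dir_norm_fun_other P(3) by (auto simp: nth_append)
    next
      case 2 thus ?thesis using inv_dir_norm_fun by simp
    qed
  next
    fix z assume z: "z \<in> zs S p R \<inter> ball p R2"
    have "z \<in> zs S1 p R1" using tp z le by auto
    hence "g z = 0" using gS by (auto simp: zs_def)
    hence 0: "0 \<in> rts z" using r_pos by (simp add: rts_def)
    have "poly (P z) (G z) = 0" using P(4) z le by auto
    moreover have "mu z 0 > 0" using mu_pos 0 z by blast
    ultimately have "poly (P (z + 0 *s v) ^ mu z 0) (G z) = 0" by simp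
    thus "poly (norm_fun P z) (G z) = 0"
      unfolding norm_fun_def poly_prod using finite_rts 0 z by (intro prod_zero bexI[OF _ 0]) auto
  qed (use deg lc in auto)
qed

subsection \<open>Sheets\<close>

text \<open>A linear change of coordinates taking the given independent vectors to coordinate vectors.\<close>

lemma frame_extension:
  fixes v :: "nat \<Rightarrow> complex^'n"
  assumes ind: "\<And>c. (\<Sum>k<m. c k *s v k) = 0 \<Longrightarrow> \<forall>k<m. c k = 0"
  obtains A A' :: "complex^'n \<Rightarrow> complex^'n" and t :: "nat \<Rightarrow> 'n"
  where "\<And>x y. A (x + y) = A x + A y" "\<And>c x. A (c *s x) = c *s A x"
    "\<And>x y. A' (x + y) = A' x + A' y" "\<And>c x. A' (c *s x) = c *s A' x"
    "\<And>x. A (A' x) = x" "\<And>x. A' (A x) = x" "inj_on t {..<m}" "\<And>k. k < m \<Longrightarrow> A' (axis (t k) 1) = v k"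
proof -
  have inj: "inj_on v {..<m}"
  proof (rule inj_onI)
    fix i j assume ij: "i \<in> {..<m}" "j \<in> {..<m}" "v i = v j"
    show "i = j"
    proof (rule ccontr)
      assume ne: "i \<noteq> j"
      define c where "c = (\<lambda>k. if k = i then 1 else if k = j then -1 else (0::complex))"
      have "(\<Sum>k<m. c k *s v k) = (\<Sum>k\<in>{i,j}. c k *s v k)"
        by (rule sum.mono_neutral_right) (use ij in \<open>auto simp: c_def\<close>)
      also have "\<dots> = 0" using ne ij(3) by (simp add: c_def vec_eq_iff)
      finally have "c i = 0" using ind[of c] ij by auto
      thus False by (simp add: c_def)
    qed
  qed
  define B where "B = v ` {..<m}"
  have indB: "vec.independent B"
  proof (rule vec.independent_if_scalars_zero)
    fix f x assume s: "(\<Sum>x\<in>B. f x *s x) = 0" and x: "x \<in> B"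
    have "(\<Sum>k<m. f (v k) *s v k) = 0"
      using s unfolding B_def sum.reindex[OF inj] by (simp add: o_def)
    from ind[OF this] show "f x = 0" using x by (auto simp: B_def)
  qed (simp add: B_def)
  define E where "E = vec.extend_basis B"
  have E: "B \<subseteq> E" "vec.independent E" "vec.span E = UNIV"
    using vec.extend_basis_superset[OF indB] vec.independent_extend_basis[OF indB] vec.span_extend_basis[OF indB]
    by (auto simp: E_def)
  have finE: "finite E" using vec.finiteI_independent[OF E(2)] .
  have "card E = CARD('n)"
    using vec.dim_eq_card[of E UNIV] E vec_dim_card by (metis vec.span_UNIV)
  then obtain b where b: "bij_betw b E (UNIV :: 'n set)"
    using finite_same_card_bij[OF finE] by (metis finite)
  define e where "e = inv_into E b"
  have e: "bij_betw e UNIV E" unfolding e_def by (rule bij_betw_inv_into[OF b])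
  define A' where "A' = (\<lambda>x :: complex^'n. \<Sum>j\<in>UNIV. x $ j *s e j)"
  have A'add: "A' (x + y) = A' x + A' y" for x y
    by (simp add: A'_def vec.scale_left_distrib sum.distrib)
  have A'hom: "A' (c *s x) = c *s A' x" for c x
    by (simp add: A'_def vec.scale_sum_right vector_smult_assoc)
  have "surj A'"
  proof (rule surjI[where f="\<lambda>y. SOME x. A' x = y"])
    fix y
    have "y \<in> range (\<lambda>u. \<Sum>v\<in>E. u v *s v)" using E(3) vec.span_finite[OF finE] by auto
    then obtain u where "y = (\<Sum>v\<in>E. u v *s v)" by auto
    hence "A' (\<chi> j. u (e j)) = y"
      unfolding A'_def using sum.reindex_bij_betw[OF e, of "\<lambda>v. u v *s v"] by simp
    thus "A' (SOME x. A' x = y) = y" by (rule someI)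
  qed
  have linA': "linear A'"
  proof (rule linearI)
    fix r :: real and x
    have r: "r *\<^sub>R y = of_real r *s y" for y :: "complex^'n"
      by (simp add: vec_eq_iff) (simp add: scaleR_conv_of_real)
    show "A' (r *\<^sub>R x) = r *\<^sub>R A' x" by (simp add: r A'hom)
  qed (rule A'add)
  have "inj A'" by (rule linear_surjective_imp_injective[OF linA' \<open>surj A'\<close> refl])
  define A where "A = inv A'"
  have A: "A (A' x) = x" "A' (A x) = x" for x
    using \<open>inj A'\<close> \<open>surj A'\<close> by (simp_all add: A_def surj_f_inv_f)
  show ?thesis
  proof (rule that[where A=A and A'=A' and t="\<lambda>k. b (v k)"])
    show "A (x + y) = A x + A y" for x y using A'add[of "A x" "A y"] A by metis
    show "A (c *s x) = c *s A x" for c x using A'hom[of c "A x"] A by metis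
    have vE: "v ` {..<m} \<subseteq> E" using E(1) by (simp add: B_def)
    show "inj_on (\<lambda>k. b (v k)) {..<m}"
      using comp_inj_on[OF inj inj_on_subset[OF bij_betw_imp_inj_on[OF b] vE]] by (simp add: o_def)
    show "A' (axis (b (v k)) 1) = v k" if "k < m" for k
    proof -
      have "v k \<in> E" using vE that by auto
      hence ek: "e (b (v k)) = v k" using b by (simp add: e_def bij_betw_inv_into_left)
      have "A' (axis (b (v k)) 1) = (\<Sum>j\<in>UNIV. if j = b (v k) then e j else 0)"
        unfolding A'_def by (intro sum.cong refl) (auto simp: axis_def vec_eq_iff)
      thus ?thesis using ek by simp
    qed
  qed (use A A'add A'hom in auto)
qed

lemma holo_map_on_linear:
  fixes A :: "complex^'n \<Rightarrow> complex^'m"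
  assumes "\<And>x y. A (x + y) = A x + A y" "\<And>c x. A (c *s x) = c *s A x"
  shows "holo_map_on A U"
  unfolding holo_map_on_def
  by (intro allI holo_on_linear) (simp_all add: assms)

lemma holo_map_on_compose:
  assumes "holo_map_on f W" "holo_map_on Y U" "Y ` U \<subseteq> W"
  shows "holo_map_on (\<lambda>z. f (Y z)) U"
  using assms unfolding holo_map_on_def by (auto intro: holo_on_compose[OF _ assms(2,3)])

text \<open>The points of \<open>Z\<close> near the points \<open>z + \<Sum>k. \<rho> k z v\<^sub>k\<close>, \<open>z \<in> B\<close>, are these points and no others.  Since
\<open>B\<close> is open in all of \<open>\<complex>\<^sup>n\<close>, the base point \<open>z\<close> is redundant; this avoids choosing a complement of the
directions until \<open>sheet_submanifold\<close>.\<close>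

definition sheet :: "(complex^'n) set \<Rightarrow> (nat \<Rightarrow> complex^'n) \<Rightarrow> nat \<Rightarrow> bool" where
  "sheet Z v m \<longleftrightarrow> (\<exists>B \<rho> \<epsilon>. open B \<and> B \<noteq> {} \<and> \<epsilon> > 0 \<and> (\<forall>k<m. holo_on (\<rho> k) B) \<and>
     (\<forall>z\<in>B. \<forall>\<zeta>. (\<forall>k<m. cmod (\<zeta> k - \<rho> k z) < \<epsilon>) \<longrightarrow>
        (z + (\<Sum>k<m. \<zeta> k *s v k) \<in> Z \<longleftrightarrow> (\<forall>k<m. \<zeta> k = \<rho> k z))))"

lemma finite_uniform_eventually:
  fixes P :: "nat \<Rightarrow> 'a \<Rightarrow> bool"
  assumes "\<And>k. k < m \<Longrightarrow> eventually (P k) F"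
  shows "eventually (\<lambda>x. \<forall>k<m. P k x) F"
  using assms eventually_ball_finite_distrib[of "{..<m}" "\<lambda>x k. P k x" F] by (simp add: Ball_def)

text \<open>A sheet is the graph of a holomorphic map over a complement of the span of the directions \<open>v\<^sub>k\<close>, so
subtracting this map straightens it.  The directions are independent because \<open>\<zeta>\<close> is determined by the
point, for a given base point.\<close>

lemma sheet_submanifold:
  fixes X :: "(complex^'n) set"
  assumes sh: "sheet Z v m" and Z: "Z = X \<inter> ball p R"
  obtains q where "q \<in> Z" "submanifold_at X (CARD('n) - m) q"
proof -
  obtain B \<rho> \<epsilon> where B: "open B" "B \<noteq> {}" and \<epsilon>: "\<epsilon> > 0" and hol': "\<forall>k<m. holo_on (\<rho> k) B"
    and mem': "\<forall>z\<in>B. \<forall>\<zeta>. (\<forall>k<m. cmod (\<zeta> k - \<rho> k z) < \<epsilon>) \<longrightarrow>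
        (z + (\<Sum>k<m. \<zeta> k *s v k) \<in> Z \<longleftrightarrow> (\<forall>k<m. \<zeta> k = \<rho> k z))"
    using sh unfolding sheet_def by (elim exE conjE)
  have hol: "holo_on (\<rho> k) B" if "k < m" for k using hol' that by blast
  have mem: "z + (\<Sum>k<m. \<zeta> k *s v k) \<in> Z \<longleftrightarrow> (\<forall>k<m. \<zeta> k = \<rho> k z)"
    if "z \<in> B" "\<And>k. k < m \<Longrightarrow> cmod (\<zeta> k - \<rho> k z) < \<epsilon>" for z \<zeta>
    using mem' that by blast
  obtain z1 where z1: "z1 \<in> B" using B by blast
  have "\<forall>\<^sub>F z in nhds z1. z \<in> B \<and> (\<forall>k<m. cmod (\<rho> k z - \<rho> k z1) < \<epsilon> / 2)"
  proof (intro eventually_conj finite_uniform_eventually)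
    show "\<forall>\<^sub>F z in nhds z1. z \<in> B" by (rule eventually_nhds_in_open[OF B(1) z1])
    fix k assume "k < m"
    hence "isCont (\<rho> k) z1"
      using holo_on_imp_continuous_on[OF hol] B z1 by (simp add: continuous_on_eq_continuous_at)
    hence "((\<rho> k) \<longlongrightarrow> \<rho> k z1) (nhds z1)" by (simp add: isCont_def tendsto_at_iff_tendsto_nhds)
    from tendstoD[OF this, of "\<epsilon>/2"] show "\<forall>\<^sub>F z in nhds z1. cmod (\<rho> k z - \<rho> k z1) < \<epsilon> / 2"
      using \<epsilon> by (simp add: dist_norm)
  qed
  then obtain \<eta> where \<eta>: "\<eta> > 0" "\<And>z. dist z z1 < \<eta> \<Longrightarrow> z \<in> B \<and> (\<forall>k<m. cmod (\<rho> k z - \<rho> k z1) < \<epsilon> / 2)"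
    unfolding eventually_nhds_metric by blast
  \<comment> \<open>a small multiple \<open>\<tau> c\<close> of a relation could be added to \<open>\<rho>\<close> without changing the point\<close>
  have ind: "(\<Sum>k<m. c k *s v k) = 0 \<Longrightarrow> \<forall>k<m. c k = 0" for c
  proof -
    assume s: "(\<Sum>k<m. c k *s v k) = 0"
    define C where "C = 1 + (\<Sum>k<m. cmod (c k))"
    have C: "C > 0" by (simp add: C_def add_pos_nonneg sum_nonneg)
    have cC: "cmod (c k) < C" if "k < m" for k
      using member_le_sum[of k "{..<m}" "\<lambda>k. cmod (c k)"] that by (simp add: C_def)
    define \<tau> :: complex where "\<tau> = of_real (\<epsilon> / C)"
    define \<zeta> where "\<zeta> = (\<lambda>k. \<rho> k z1 + \<tau> * c k)"
    have nt: "cmod \<tau> = \<epsilon> / C" unfolding \<tau>_def norm_of_real using \<epsilon> C by simp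
    have "cmod (\<zeta> k - \<rho> k z1) < \<epsilon>" if "k < m" for k
      using cC[OF that] \<epsilon> C by (simp add: \<zeta>_def norm_mult nt field_simps)
    from mem[OF z1 this] have iff: "z1 + (\<Sum>k<m. \<zeta> k *s v k) \<in> Z \<longleftrightarrow> (\<forall>k<m. \<zeta> k = \<rho> k z1)" .
    have "(\<Sum>k<m. \<zeta> k *s v k) = (\<Sum>k<m. \<rho> k z1 *s v k) + \<tau> *s (\<Sum>k<m. c k *s v k)"
      unfolding \<zeta>_def vec.scale_left_distrib sum.distrib vec.scale_sum_right vector_smult_assoc ..
    hence "z1 + (\<Sum>k<m. \<zeta> k *s v k) \<in> Z"
      using s mem[OF z1, of "\<lambda>k. \<rho> k z1"] \<epsilon> by simp
    hence "\<forall>k<m. \<tau> * c k = 0" using iff by (simp add: \<zeta>_def)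
    moreover have "\<tau> \<noteq> 0" using nt \<epsilon> C by auto
    ultimately show "\<forall>k<m. c k = 0" by simp
  qed
  obtain A A' :: "complex^'n \<Rightarrow> complex^'n" and t :: "nat \<Rightarrow> 'n"
    where A: "\<And>x y. A (x + y) = A x + A y" "\<And>c x. A (c *s x) = c *s A x"
    "\<And>x y. A' (x + y) = A' x + A' y" "\<And>c x. A' (c *s x) = c *s A' x"
    "\<And>x. A (A' x) = x" "\<And>x. A' (A x) = x" and t: "inj_on t {..<m}" and At: "\<And>k. k < m \<Longrightarrow> A' (axis (t k) 1) = v k"
  proof (rule frame_extension[of v m, OF ind])
    fix c assume "(\<Sum>k<m. c k *s v k) = 0" thus "(\<Sum>k<m. c k *s v k) = 0" .
  qed blast
  have holA: "holo_map_on A U" "holo_map_on A' U" for U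
    using A by (auto intro!: holo_map_on_linear)
  have A0: "A' 0 = 0" "A 0 = 0" using A(4)[of 0 0] A(2)[of 0 0] by simp_all
  have A'sum: "A' (\<Sum>k\<in>K. f k) = (\<Sum>k\<in>K. A' (f k))" if "finite K" for K :: "nat set" and f
    using that by (induction rule: finite_induct) (simp_all add: A0 A)
  \<comment> \<open>the chart: after the linear change of coordinates \<open>A\<close> centred at \<open>q\<close>, subtract \<open>\<Psi>\<close>, which depends only
  on the coordinates in \<open>I\<close> and has values in the others\<close>
  define I where "I = - t ` {..<m}"
  define \<pi> where "\<pi> = (\<lambda>x :: complex^'n. \<chi> j. if j \<in> I then x $ j else 0)"
  have \<pi>: "\<pi> (x + y) = \<pi> x + \<pi> y" "\<pi> (c *s x) = c *s \<pi> x" for x y c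
    by (auto simp: \<pi>_def vec_eq_iff)
  have tI: "t k \<notin> I" if "k < m" for k using that by (auto simp: I_def)
  define \<kappa> where "\<kappa> = (\<lambda>x. z1 + A' (\<pi> x))"
  have hol\<kappa>: "holo_map_on \<kappa> U" for U
    unfolding \<kappa>_def
    by (intro holo_map_on_add holo_map_on_const holo_map_on_compose[OF holA(2)[of UNIV]] holo_map_on_linear \<pi>) auto
  define \<psi> where "\<psi> = (\<lambda>k x. \<rho> k (\<kappa> x) - \<rho> k z1)"
  define \<Psi> where "\<Psi> = (\<lambda>x. \<Sum>k<m. \<psi> k x *s axis (t k) 1)"
  have \<Psi>t: "\<Psi> x $ t k = \<psi> k x" if "k < m" for x k
  proof -
    have "\<Psi> x $ t k = (\<Sum>j<m. if j = k then \<psi> k x else 0)"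
      unfolding \<Psi>_def sum_component
      by (intro sum.cong refl) (use t that in \<open>auto simp: axis_def inj_on_def\<close>)
    thus ?thesis using that by simp
  qed
  have \<Psi>I: "\<Psi> x $ j = 0" if "j \<in> I" for x j
    unfolding \<Psi>_def sum_component by (intro sum.neutral) (use that tI in \<open>auto simp: axis_def\<close>)
  have \<pi>\<Psi>: "\<pi> (x + \<Psi> y) = \<pi> x" "\<pi> (x - \<Psi> y) = \<pi> x" for x y
    by (auto simp: \<pi>_def vec_eq_iff \<Psi>I)
  hence \<Psi>\<Psi>: "\<Psi> (x + \<Psi> y) = \<Psi> x" "\<Psi> (x - \<Psi> y) = \<Psi> x" "\<kappa> (x + \<Psi> y) = \<kappa> x" "\<kappa> (x - \<Psi> y) = \<kappa> x" for x y
    by (simp_all add: \<Psi>_def \<psi>_def \<kappa>_def)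
  define q where "q = z1 + (\<Sum>k<m. \<rho> k z1 *s v k)"
  have q: "q \<in> Z" using mem[OF z1, of "\<lambda>k. \<rho> k z1"] \<epsilon> by (simp add: q_def)
  define F where "F = (\<lambda>y. A (y - q) - \<Psi> (A (y - q)))"
  define G where "G = (\<lambda>w. q + A' (w + \<Psi> w))"
  define D where "D = \<kappa> -` (ball z1 \<eta>)"
  have D: "open D"
    unfolding D_def
    by (rule open_vimage[OF open_ball]) (rule holo_map_on_imp_continuous_on[OF hol\<kappa>])
  have \<kappa>B: "\<kappa> ` D \<subseteq> B" using \<eta>(2) by (auto simp: D_def dist_commute)
  have hol\<psi>: "holo_on (\<psi> k) D" if "k < m" for k
    unfolding \<psi>_def by (intro holo_on_diff holo_on_const holo_on_compose[OF hol[OF that] hol\<kappa> \<kappa>B])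
  have hol\<Psi>: "holo_map_on \<Psi> D"
    unfolding \<Psi>_def by (intro holo_map_on_sum holo_map_on_smult holo_map_on_const hol\<psi>) auto
  have holG: "holo_map_on G D"
    unfolding G_def
    by (intro holo_map_on_add holo_map_on_const holo_map_on_compose[OF holA(2)[of UNIV]] holo_map_on_id hol\<Psi>) auto
  define aff where "aff = (\<lambda>y. A (y + (- q)))"
  have holaff: "holo_map_on aff U" for U unfolding aff_def
    by (intro holo_map_on_compose[OF holA(1)[of UNIV]] holo_map_on_add holo_map_on_id holo_map_on_const) auto
  define W where "W = D \<inter> (\<Inter>k<m. {x. cmod (x $ t k) < \<epsilon> / 2})"
  have W: "open W" unfolding W_def
    by (intro open_Int D open_INT ballI open_Collect_less continuous_intros) auto
  define U where "U = aff -` W \<inter> ball p R"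
  define V where "V = {w \<in> D. w + \<Psi> w \<in> W \<and> G w \<in> ball p R}"
  have oU: "open U" unfolding U_def
    by (intro open_Int open_vimage W holo_map_on_imp_continuous_on[OF holaff] open_ball)
  have oV: "open V"
  proof -
    have c1: "continuous_on D (\<lambda>w. w + \<Psi> w)"
      by (intro continuous_intros holo_map_on_imp_continuous_on[OF hol\<Psi>])
    have "V = (D \<inter> (\<lambda>w. w + \<Psi> w) -` W) \<inter> (D \<inter> G -` ball p R)" by (auto simp: V_def)
    thus ?thesis
      using continuous_open_preimage[OF c1 D W]
        continuous_open_preimage[OF holo_map_on_imp_continuous_on[OF holG] D open_ball] by auto
  qed
  have F: "F y = aff y - \<Psi> (aff y)" for y by (simp add: F_def aff_def)
  have affG: "aff (G w) = w + \<Psi> w" for w by (simp add: aff_def G_def A)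
  have FG: "F (G w) = w" for w by (simp add: F affG \<Psi>\<Psi>)
  have GF: "G (F y) = y" for y
  proof -
    have "A' (aff y) = y - q" by (simp add: aff_def A)
    thus ?thesis by (simp add: F G_def \<Psi>\<Psi>)
  qed
  have WD: "W \<subseteq> D" by (auto simp: W_def)
  have DD: "w + \<Psi> w' \<in> D \<longleftrightarrow> w \<in> D" "w - \<Psi> w' \<in> D \<longleftrightarrow> w \<in> D" for w w'
    by (simp_all add: D_def \<Psi>\<Psi>)
  have FV: "F y \<in> V" if "y \<in> U" for y
    using that WD by (auto simp: V_def U_def F \<Psi>\<Psi> DD GF[unfolded F])
  have GU: "G w \<in> U" if "w \<in> V" for w
    using that by (auto simp: V_def U_def affG)
  have memF: "y \<in> Z \<longleftrightarrow> F y \<in> coord_space I" if y: "y \<in> U" for y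
  proof -
    define x where "x = aff y"
    have x: "x \<in> D" "\<And>k. k < m \<Longrightarrow> cmod (x $ t k) < \<epsilon> / 2" using y by (auto simp: U_def W_def x_def)
    have "x = \<pi> x + (\<Sum>k<m. (x $ t k) *s axis (t k) 1)"
      unfolding vec_eq_iff
    proof
      fix j
      show "x $ j = (\<pi> x + (\<Sum>k<m. (x $ t k) *s axis (t k) 1)) $ j"
      proof (cases "j \<in> I")
        case True
        have "(\<Sum>k<m. (x $ t k) *s axis (t k) (1::complex)) $ j = 0"
          unfolding sum_component by (intro sum.neutral) (use True tI in \<open>auto simp: axis_def\<close>)
        thus ?thesis using True by (simp add: \<pi>_def)
      next
        case False
        then obtain i where i: "i < m" "j = t i" by (auto simp: I_def)
        have "(\<Sum>k<m. (x $ t k) *s axis (t k) (1::complex)) $ j = (\<Sum>k<m. if k = i then x $ t i else 0)"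
          unfolding sum_component i(2)
          by (intro sum.cong refl) (use t i in \<open>auto simp: axis_def inj_on_def\<close>)
        thus ?thesis using False i by (simp add: \<pi>_def)
      qed
    qed
    hence "A' x = A' (\<pi> x + (\<Sum>k<m. (x $ t k) *s axis (t k) 1))" by (rule arg_cong)
    also have "\<dots> = A' (\<pi> x) + (\<Sum>k<m. A' ((x $ t k) *s axis (t k) 1))"
      unfolding A(3) by (subst A'sum) auto
    also have "(\<Sum>k<m. A' ((x $ t k) *s axis (t k) 1)) = (\<Sum>k<m. (x $ t k) *s v k)"
      by (intro sum.cong refl) (simp add: A(4) At)
    finally have "A' x = A' (\<pi> x) + (\<Sum>k<m. (x $ t k) *s v k)" .
    moreover have "A' x = y - q" by (simp add: x_def aff_def A)
    ultimately have "y = q + A' (\<pi> x) + (\<Sum>k<m. (x $ t k) *s v k)" by (simp add: algebra_simps)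
    hence yeq: "y = \<kappa> x + (\<Sum>k<m. (\<rho> k z1 + x $ t k) *s v k)"
      by (simp add: \<kappa>_def q_def vec.scale_left_distrib sum.distrib)
    have \<kappa>x: "\<kappa> x \<in> B" using \<kappa>B x(1) by auto
    have close: "cmod ((\<rho> k z1 + x $ t k) - \<rho> k (\<kappa> x)) < \<epsilon>" if "k < m" for k
    proof -
      have "cmod (\<rho> k (\<kappa> x) - \<rho> k z1) < \<epsilon> / 2"
        using \<eta>(2)[of "\<kappa> x"] x(1) that by (auto simp: D_def dist_commute)
      moreover have e: "(\<rho> k z1 + x $ t k) - \<rho> k (\<kappa> x) = x $ t k - (\<rho> k (\<kappa> x) - \<rho> k z1)" by simp
      ultimately show ?thesis unfolding e
        using x(2)[OF that] norm_triangle_ineq4[of "x $ t k" "\<rho> k (\<kappa> x) - \<rho> k z1"] by linarith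
    qed
    have "y \<in> Z \<longleftrightarrow> (\<forall>k<m. \<rho> k z1 + x $ t k = \<rho> k (\<kappa> x))"
      unfolding yeq by (rule mem[OF \<kappa>x close])
    also have "\<dots> \<longleftrightarrow> (\<forall>k<m. (x - \<Psi> x) $ t k = 0)"
      by (auto simp: \<Psi>t \<psi>_def algebra_simps)
    also have "\<dots> \<longleftrightarrow> F y \<in> coord_space I"
      by (auto simp: F x_def[symmetric] coord_space_def I_def)
    finally show ?thesis .
  qed
  have "slice_chart X I U V F G"
    unfolding slice_chart_def
  proof (intro conjI ballI)
    show "holo_map_on F U"
    proof -
      have "holo_map_on (\<lambda>y. aff y + (-1) *s \<Psi> (aff y)) U"
        by (intro holo_map_on_add holo_map_on_smult holo_on_const holaff holo_map_on_compose[OF hol\<Psi> holaff])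
           (use WD in \<open>auto simp: U_def\<close>)
      moreover have "(\<lambda>y. aff y + (-1) *s \<Psi> (aff y)) = F" by (auto simp: F fun_eq_iff vec_eq_iff)
      ultimately show ?thesis by simp
    qed
    show "holo_map_on G V"
      using holG unfolding holo_map_on_def by (auto intro: holo_on_subset simp: V_def)
    show "F ` (X \<inter> U) = coord_space I \<inter> V"
    proof (intro equalityI subsetI)
      fix w assume "w \<in> F ` (X \<inter> U)"
      then obtain y where y: "y \<in> X" "y \<in> U" "w = F y" by auto
      hence "y \<in> Z" using Z by (auto simp: U_def)
      thus "w \<in> coord_space I \<inter> V" using memF[OF y(2)] FV y by auto
    next
      fix w assume w: "w \<in> coord_space I \<inter> V"
      hence "G w \<in> U" using GU by auto
      hence "G w \<in> X" using memF[of "G w"] w FG Z by auto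
      thus "w \<in> F ` (X \<inter> U)" using \<open>G w \<in> U\<close> FG[of w] by (metis IntI imageI)
    qed
  qed (use oU oV FV GU FG GF in auto)
  moreover have "q \<in> U"
  proof -
    have l0: "aff q = 0" by (simp add: aff_def A0)
    have p0: "\<pi> 0 = 0" by (simp add: \<pi>_def vec_eq_iff)
    have "0 \<in> W" using \<eta>(1) \<epsilon> by (simp add: W_def D_def \<kappa>_def p0 A0)
    thus ?thesis using q Z l0 by (auto simp: U_def)
  qed
  moreover have "card I = CARD('n) - m"
    unfolding I_def using card_image[OF t] by (simp add: Compl_eq_Diff_UNIV card_Diff_subset)
  ultimately have "submanifold_at X (CARD('n) - m) q"
    using q Z unfolding submanifold_at_def by blast
  thus ?thesis using that q by blast
qed

lemma holo_map_on_subset: "holo_map_on f U \<Longrightarrow> V \<subseteq> U \<Longrightarrow> holo_map_on f V"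
  unfolding holo_map_on_def using holo_on_subset by blast

text \<open>Among finitely many relatively closed sets covering \<open>B\<close> one contains a nonempty open set.\<close>

lemma finite_closed_cover_open:
  fixes B :: "'a :: topological_space set"
  assumes "finite T" "open B" "B \<noteq> {}" "B \<subseteq> (\<Union>\<tau>\<in>T. C \<tau>)" "\<And>\<tau>. \<tau> \<in> T \<Longrightarrow> open (B - C \<tau>)"
  shows "\<exists>\<tau>\<in>T. \<exists>B'. open B' \<and> B' \<noteq> {} \<and> B' \<subseteq> B \<inter> C \<tau>"
  using assms
proof (induction T arbitrary: B rule: finite_induct)
  case (insert \<tau> T)
  show ?case
  proof (cases "B - C \<tau> = {}")
    case True
    thus ?thesis using insert.prems by (intro bexI[of _ \<tau>] exI[of _ B]) auto
  next
    case False
    have "\<exists>\<tau>'\<in>T. \<exists>B'. open B' \<and> B' \<noteq> {} \<and> B' \<subseteq> (B - C \<tau>) \<inter> C \<tau>'"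
    proof (rule insert.IH)
      fix \<sigma> assume "\<sigma> \<in> T"
      have "B - C \<tau> - C \<sigma> = (B - C \<tau>) \<inter> (B - C \<sigma>)" by auto
      thus "open (B - C \<tau> - C \<sigma>)" using insert.prems(4) \<open>\<sigma> \<in> T\<close> by auto
    qed (use False insert.prems in auto)
    thus ?thesis by blast
  qed
qed simp

lemma finite_separated:
  fixes T :: "'a :: metric_space set"
  assumes "finite T"
  obtains s where "s > 0" "\<And>x y. x \<in> T \<Longrightarrow> y \<in> T \<Longrightarrow> x \<noteq> y \<Longrightarrow> s \<le> dist x y"
proof -
  define D where "D = (\<lambda>(x, y). dist x y) ` {(x, y) \<in> T \<times> T. x \<noteq> y}"
  have fin: "finite D" unfolding D_def
    by (intro finite_imageI finite_subset[OF _ finite_cartesian_product[OF assms assms]]) auto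
  show ?thesis
  proof (rule that[of "Min (insert 1 D)"])
    show "Min (insert 1 D) > 0" using fin by (subst Min_gr_iff) (auto simp: D_def)
    fix x y assume "x \<in> T" "y \<in> T" "x \<noteq> y"
    hence "dist x y \<in> insert 1 D" by (force simp: D_def)
    thus "Min (insert 1 D) \<le> dist x y" using fin by (intro Min_le) auto
  qed
qed

text \<open>Lifting a sheet from the projection to the set itself.  Choose a base point where the number of distinct
roots of \<open>g\<close> over the sheet is maximal.  Near it the roots neither split nor merge, so they are
holomorphic functions \<open>\<tau> + \<sigma> \<tau> z\<close> of the base point, one for each root \<open>\<tau>\<close> over the chosen point.  Every
point of the sheet lies under a common zero of \<open>S\<close> given by one of them.  The conditions that it be given by
\<open>\<tau>\<close> are closed and cover the base, so one \<open>\<tau>\<close> serves for an open set of base points.\<close>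

lemma sheet_step:
  fixes p :: "complex^'n"
  assumes es: "elim_step p S R v g r S' \<delta>" and S: "finite S" "\<And>h. h \<in> S \<Longrightarrow> holo_on h (ball p R)"
    and sh: "sheet (zs S' p \<delta>) vs m"
  shows "sheet (zs S p R) (vs(m := v)) (Suc m)"
proof -
  have rd: "root_disc p v g R r \<delta>" and gS: "g \<in> S"
    and zsS': "zs S' p \<delta> = {z \<in> ball p \<delta>. \<exists>\<zeta>. cmod \<zeta> < r \<and> z + \<zeta> *s v \<in> zs S p R}"
    using es unfolding elim_step_def by blast+
  interpret root_disc p v g R r \<delta> by (rule rd)
  obtain B \<rho> \<epsilon> where B: "open B" "B \<noteq> {}" and \<epsilon>: "\<epsilon> > 0" and hol': "\<forall>k<m. holo_on (\<rho> k) B"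
    and mem': "\<forall>z\<in>B. \<forall>\<zeta>. (\<forall>k<m. cmod (\<zeta> k - \<rho> k z) < \<epsilon>) \<longrightarrow>
        (z + (\<Sum>k<m. \<zeta> k *s vs k) \<in> zs S' p \<delta> \<longleftrightarrow> (\<forall>k<m. \<zeta> k = \<rho> k z))"
    using sh unfolding sheet_def by (elim exE conjE)
  have hol: "holo_on (\<rho> k) B" if "k < m" for k using hol' that by blast
  have mem: "z + (\<Sum>k<m. \<zeta> k *s vs k) \<in> zs S' p \<delta> \<longleftrightarrow> (\<forall>k<m. \<zeta> k = \<rho> k z)"
    if "z \<in> B" "\<And>k. k < m \<Longrightarrow> cmod (\<zeta> k - \<rho> k z) < \<epsilon>" for z \<zeta>
    using mem' that by blast
  define y where "y = (\<lambda>z. z + (\<Sum>k<m. \<rho> k z *s vs k))"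
  have holy: "holo_map_on y B"
    unfolding y_def by (intro holo_map_on_add holo_map_on_id holo_map_on_sum holo_map_on_smult holo_map_on_const hol) auto
  have yZ: "y z \<in> zs S' p \<delta>" if "z \<in> B" for z
    using mem[OF that, of "\<lambda>k. \<rho> k z"] \<epsilon> by (simp add: y_def)
  have yb: "y z \<in> ball p \<delta>" if "z \<in> B" for z using yZ[OF that] by (simp add: zs_def)
  obtain N where N: "\<And>z. z \<in> ball p \<delta> \<Longrightarrow> (\<Sum>\<zeta>\<in>rts z. mu z \<zeta>) = N" using root_count by blast
  have card_le: "card (rts (y z)) \<le> N" if "z \<in> B" for z
  proof -
    have "card (rts (y z)) = (\<Sum>\<zeta>\<in>rts (y z). 1)" by simp
    also have "\<dots> \<le> (\<Sum>\<zeta>\<in>rts (y z). mu (y z) \<zeta>)"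
      using mu_pos[OF yb[OF that]] by (intro sum_mono) (simp add: Suc_leI)
    finally show ?thesis using N[OF yb[OF that]] by simp
  qed
  obtain zB where "zB \<in> B" using B by blast
  have "\<exists>x. x \<in> B \<and> (\<forall>y'. y' \<in> B \<longrightarrow> card (rts (y y')) \<le> card (rts (y x)))"
    by (rule ex_has_greatest_nat[where P="\<lambda>z. z \<in> B" and k=zB and f="\<lambda>z. card (rts (y z))" and b="Suc N"])
       (use \<open>zB \<in> B\<close> card_le in \<open>auto simp: less_Suc_eq_le\<close>)
  then obtain z1 where z1: "z1 \<in> B" and max: "\<And>z. z \<in> B \<Longrightarrow> card (rts (y z)) \<le> card (rts (y z1))" by blast
  define T where "T = rts (y z1)"
  have finT: "finite T" unfolding T_def by (rule finite_rts[OF yb[OF z1]])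
  have Thalf: "cmod \<tau> < r / 2" if "\<tau> \<in> T" for \<tau> using rts_half[OF yb[OF z1]] that by (simp add: T_def)
  obtain s where s: "s > 0" "\<And>x y. x \<in> T \<Longrightarrow> y \<in> T \<Longrightarrow> x \<noteq> y \<Longrightarrow> s \<le> dist x y"
    using finite_separated[OF finT] by blast
  define e where "e = min (s / 3) (r / 4)"
  have e: "e > 0" "3 * e \<le> s" "e \<le> r / 4" using s r_pos by (auto simp: e_def)
  \<comment> \<open>a disc around each root \<open>\<tau>\<close>, so small that the discs around different roots are far apart\<close>
  have "\<forall>\<tau>\<in>T. \<exists>R' r' \<delta>'. root_disc (y z1 + \<tau> *s v) v g R' r' \<delta>' \<and> r' < e"
  proof
    fix \<tau> assume \<tau>: "\<tau> \<in> T"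
    define x where "x = y z1 + \<tau> *s v"
    define R' where "R' = R - dist p x"
    have "x \<in> ball p R" unfolding x_def
      by (rule mem_ball_R[OF yb[OF z1]]) (use Thalf[OF \<tau>] r_pos in simp)
    hence R': "R' > 0" by (simp add: R'_def)
    have sub: "ball x R' \<subseteq> ball p R"
    proof
      fix w assume "w \<in> ball x R'"
      thus "w \<in> ball p R" using dist_triangle[of p w x] by (simp add: R'_def)
    qed
    define b where "b = min (s / 2) (min (r / 4) (R' / (2 * norm v)))"
    have b: "b > 0" "b < s" "b \<le> r / 4" "b * norm v < R'"
    proof -
      show "b > 0" "b < s" "b \<le> r / 4" using s r_pos R' v_pos by (auto simp: b_def min_def)
      have "b * norm v \<le> R' / (2 * norm v) * norm v" by (intro mult_right_mono) (auto simp: b_def)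
      also have "\<dots> < R'" using v_pos R' by simp
      finally show "b * norm v < R'" .
    qed
    define \<beta> where "\<beta> = complex_of_real b"
    have n\<beta>: "cmod \<beta> = b" using b by (simp add: \<beta>_def)
    have "x + \<beta> *s v \<in> ball x R'" using b n\<beta> by (simp add: dist_norm norm_smult)
    moreover have "g (x + \<beta> *s v) \<noteq> 0"
    proof
      assume "g (x + \<beta> *s v) = 0"
      moreover have "x + \<beta> *s v = y z1 + (\<tau> + \<beta>) *s v" by (simp add: x_def vec.scale_left_distrib)
      moreover have "cmod (\<tau> + \<beta>) < r"
        using norm_triangle_ineq[of \<tau> \<beta>] Thalf[OF \<tau>] n\<beta> b r_pos by linarith
      ultimately have "\<tau> + \<beta> \<in> T" by (simp add: T_def rts_def)
      moreover have "\<tau> + \<beta> \<noteq> \<tau>" using n\<beta> b by auto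
      ultimately have "s \<le> dist (\<tau> + \<beta>) \<tau>" using s(2) \<tau> by blast
      thus False using n\<beta> b by (simp add: dist_norm)
    qed
    moreover have "v \<noteq> 0" using v_pos by auto
    ultimately show "\<exists>R' r' \<delta>'. root_disc (y z1 + \<tau> *s v) v g R' r' \<delta>' \<and> r' < e"
      unfolding x_def[symmetric]
      using root_disc_at[OF holo_on_subset[OF holo_g sub] _ _ _ e(1)] by metis
  qed
  then obtain RR rr dd where loc: "\<And>\<tau>. \<tau> \<in> T \<Longrightarrow> root_disc (y z1 + \<tau> *s v) v g (RR \<tau>) (rr \<tau>) (dd \<tau>)"
      "\<And>\<tau>. \<tau> \<in> T \<Longrightarrow> rr \<tau> < e"
    by metis
  define Q where "Q = (\<lambda>\<tau> z. {\<zeta>. cmod \<zeta> < rr \<tau> \<and> g (y z + \<tau> *s v + \<zeta> *s v) = 0})"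
  define B1 where "B1 = B \<inter> y -` (\<Inter>\<tau>\<in>T. ball (y z1) (dd \<tau>))"
  have dd: "dd \<tau> > 0" "rr \<tau> > 0" if "\<tau> \<in> T" for \<tau>
    using loc(1)[OF that] by (simp_all add: root_disc_def)
  have B1: "open B1" unfolding B1_def
    by (rule continuous_open_preimage[OF holo_map_on_imp_continuous_on[OF holy] B(1)]) (use finT in auto)
  have z1B1: "z1 \<in> B1" using z1 dd by (simp add: B1_def)
  have B1B: "B1 \<subseteq> B" by (auto simp: B1_def)
  have xloc: "y z + \<tau> *s v \<in> ball (y z1 + \<tau> *s v) (dd \<tau>)" if "z \<in> B1" "\<tau> \<in> T" for z \<tau>
    using that by (simp add: B1_def)
  have Qrts: "Q \<tau> z = root_disc.rts v g (rr \<tau>) (y z + \<tau> *s v)" if "\<tau> \<in> T" for \<tau> z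
    unfolding Q_def root_disc.rts_def[OF loc(1)[OF that]] ..
  have locN: "\<exists>N'>0. \<forall>z\<in>B1. (\<Sum>\<zeta>\<in>Q \<tau> z. root_disc.mu v g (y z + \<tau> *s v) \<zeta>) = N'" if \<tau>: "\<tau> \<in> T" for \<tau>
  proof -
    interpret loc: root_disc "y z1 + \<tau> *s v" v g "RR \<tau>" "rr \<tau>" "dd \<tau>" by (rule loc(1)[OF \<tau>])
    obtain N' where N': "\<And>z. z \<in> ball (y z1 + \<tau> *s v) (dd \<tau>) \<Longrightarrow> (\<Sum>\<zeta>\<in>loc.rts z. loc.mu z \<zeta>) = N'"
      using loc.root_count by blast
    have 0: "0 \<in> loc.rts (y z1 + \<tau> *s v)" using \<tau> dd[OF \<tau>] by (simp add: loc.rts_def T_def rts_def)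
    have "0 < loc.mu (y z1 + \<tau> *s v) 0" by (rule loc.mu_pos[OF _ 0]) (use dd[OF \<tau>] in simp)
    also have "\<dots> \<le> (\<Sum>\<zeta>\<in>loc.rts (y z1 + \<tau> *s v). loc.mu (y z1 + \<tau> *s v) \<zeta>)"
      by (rule member_le_sum[OF 0]) (use loc.finite_rts dd[OF \<tau>] in auto)
    also have "\<dots> = N'" by (rule N') (use dd[OF \<tau>] in simp)
    finally have "N' > 0" .
    thus ?thesis using N'[OF xloc[OF _ \<tau>]] Qrts[OF \<tau>] by auto
  qed
  have Qne: "Q \<tau> z \<noteq> {}" if "\<tau> \<in> T" "z \<in> B1" for \<tau> z
    using locN[OF that(1)] that(2) by force
  have Qin: "\<tau> + \<zeta> \<in> rts (y z)" if "\<tau> \<in> T" "\<zeta> \<in> Q \<tau> z" for \<tau> \<zeta> z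
  proof -
    have "cmod (\<tau> + \<zeta>) < r"
      using norm_triangle_ineq[of \<tau> \<zeta>] Thalf[OF that(1)] loc(2)[OF that(1)] that(2) e r_pos
      by (auto simp: Q_def)
    moreover have eq: "y z + \<tau> *s v + \<zeta> *s v = y z + (\<tau> + \<zeta>) *s v" by (simp add: vec.scale_left_distrib)
    ultimately show ?thesis using that(2) unfolding Q_def rts_def mem_Collect_eq eq by blast
  qed
  have Qsmall: "cmod \<zeta> < e" if "\<tau> \<in> T" "\<zeta> \<in> Q \<tau> z" for \<tau> \<zeta> z
    using that loc(2)[OF that(1)] by (auto simp: Q_def)
  have near: "\<tau> = \<tau>'" if "\<tau> \<in> T" "\<tau>' \<in> T" "cmod ((\<tau> + \<zeta>) - (\<tau>' + \<zeta>')) < e" "cmod \<zeta> < e" "cmod \<zeta>' < e" for \<tau> \<tau>' \<zeta> \<zeta>'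
  proof (rule ccontr)
    assume "\<tau> \<noteq> \<tau>'"
    hence h1: "s \<le> cmod (\<tau> - \<tau>')" using s(2)[OF that(1,2)] by (simp add: dist_norm)
    have eq: "\<tau> - \<tau>' = ((\<tau> + \<zeta>) - (\<tau>' + \<zeta>')) - \<zeta> + \<zeta>'" by (simp add: algebra_simps)
    have h2: "cmod (\<tau> - \<tau>') \<le> cmod ((\<tau> + \<zeta>) - (\<tau>' + \<zeta>') - \<zeta>) + cmod \<zeta>'"
      unfolding eq by (rule norm_triangle_ineq)
    have h3: "cmod ((\<tau> + \<zeta>) - (\<tau>' + \<zeta>') - \<zeta>) \<le> cmod ((\<tau> + \<zeta>) - (\<tau>' + \<zeta>')) + cmod \<zeta>"
      by (rule norm_triangle_ineq4)
    show False using h1 h2 h3 that(3-5) e(2) by linarith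
  qed
  define \<sigma> where "\<sigma> = (\<lambda>\<tau> z. SOME \<zeta>. \<zeta> \<in> Q \<tau> z)"
  have \<sigma>: "\<sigma> \<tau> z \<in> Q \<tau> z" if "\<tau> \<in> T" "z \<in> B1" for \<tau> z
  proof -
    have "\<exists>\<zeta>. \<zeta> \<in> Q \<tau> z" using Qne[OF that] by blast
    thus ?thesis unfolding \<sigma>_def by (rule someI_ex)
  qed
  \<comment> \<open>by maximality there are no other roots than those chosen in the small discs\<close>
  have img: "(\<lambda>\<tau>. \<tau> + \<sigma> \<tau> z) ` T = rts (y z)" if z: "z \<in> B1" for z
  proof (rule card_seteq)
    show "finite (rts (y z))" by (rule finite_rts[OF yb]) (use z B1B in auto)
    show "(\<lambda>\<tau>. \<tau> + \<sigma> \<tau> z) ` T \<subseteq> rts (y z)" using Qin \<sigma>[OF _ z] by blast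
    have "inj_on (\<lambda>\<tau>. \<tau> + \<sigma> \<tau> z) T"
    proof (rule inj_onI)
      fix \<tau> \<tau>' assume t: "\<tau> \<in> T" "\<tau>' \<in> T" "\<tau> + \<sigma> \<tau> z = \<tau>' + \<sigma> \<tau>' z"
      show "\<tau> = \<tau>'"
        by (rule near[OF t(1,2) _ Qsmall[OF t(1) \<sigma>[OF t(1) z]] Qsmall[OF t(2) \<sigma>[OF t(2) z]]])
           (use t(3) e(1) in simp)
    qed
    hence "card ((\<lambda>\<tau>. \<tau> + \<sigma> \<tau> z) ` T) = card T" by (rule card_image)
    thus "card (rts (y z)) \<le> card ((\<lambda>\<tau>. \<tau> + \<sigma> \<tau> z) ` T)"
      using max[of z] z B1B by (auto simp: T_def)
  qed
  have single: "Q \<tau> z = {\<sigma> \<tau> z}" if \<tau>: "\<tau> \<in> T" and z: "z \<in> B1" for \<tau> z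
  proof -
    have "\<zeta> = \<sigma> \<tau> z" if \<zeta>: "\<zeta> \<in> Q \<tau> z" for \<zeta>
    proof -
      obtain \<tau>' where \<tau>': "\<tau>' \<in> T" "\<tau> + \<zeta> = \<tau>' + \<sigma> \<tau>' z" using Qin[OF \<tau> \<zeta>] img[OF z] by blast
      have "\<tau> = \<tau>'" using near[OF \<tau> \<tau>'(1), of \<zeta> "\<sigma> \<tau>' z"] \<tau>'(2) e(1) Qsmall[OF \<tau> \<zeta>] Qsmall[OF \<tau>'(1) \<sigma>[OF \<tau>'(1) z]] by simp
      thus ?thesis using \<tau>' by simp
    qed
    thus ?thesis using \<sigma>[OF \<tau> z] by blast
  qed
  have hol\<sigma>: "holo_on (\<sigma> \<tau>) B1" if \<tau>: "\<tau> \<in> T" for \<tau>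
  proof -
    interpret loc: root_disc "y z1 + \<tau> *s v" v g "RR \<tau>" "rr \<tau>" "dd \<tau>" by (rule loc(1)[OF \<tau>])
    \<comment> \<open>the linear form \<open>l\<close> with \<open>l v = 1\<close> turns the only root in the disc, counted \<open>N'\<close> times, into a root sum\<close>
    obtain j where j: "v $ j \<noteq> 0" using v_pos by (metis norm_zero less_irrefl vec_eq_iff zero_index)
    define l where "l = (\<lambda>w :: complex^'n. inverse (v $ j) * w $ j)"
    have holl: "holo_on l U" for U unfolding l_def by (intro holo_on_mult holo_on_const holo_on_coord)
    obtain N' where N': "N' > 0" "\<And>z. z \<in> B1 \<Longrightarrow> (\<Sum>\<zeta>\<in>Q \<tau> z. loc.mu (y z + \<tau> *s v) \<zeta>) = N'"
      using locN[OF \<tau>] by blast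
    have hm: "holo_map_on (\<lambda>z. y z + \<tau> *s v) B1"
      by (intro holo_map_on_add holo_map_on_const holo_map_on_subset[OF holy B1B])
    have "holo_on (\<lambda>x. \<Sum>\<zeta>\<in>loc.rts x. of_nat (loc.mu x \<zeta>) * l (x + \<zeta> *s v)) (ball (y z1 + \<tau> *s v) (dd \<tau>))"
      by (rule loc.holo_on_root_sum[OF holl loc.dom order_refl])
    hence "holo_on (\<lambda>z. inverse (of_nat N') * (\<Sum>\<zeta>\<in>loc.rts (y z + \<tau> *s v). of_nat (loc.mu (y z + \<tau> *s v) \<zeta>) * l (y z + \<tau> *s v + \<zeta> *s v)) - l (y z + \<tau> *s v)) B1"
      by (intro holo_on_diff holo_on_mult holo_on_const holo_on_compose[OF holl hm subset_UNIV]
          holo_on_compose[OF _ hm, where f="\<lambda>x. \<Sum>\<zeta>\<in>loc.rts x. of_nat (loc.mu x \<zeta>) * l (x + \<zeta> *s v)"]) (use xloc \<tau> in auto)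
    thus ?thesis
    proof (rule holo_on_cong[OF B1, rotated])
      fix z assume z: "z \<in> B1"
      have "loc.rts (y z + \<tau> *s v) = {\<sigma> \<tau> z}" using single[OF \<tau> z] Qrts[OF \<tau>] by simp
      moreover have "loc.mu (y z + \<tau> *s v) (\<sigma> \<tau> z) = N'" using N'(2)[OF z] single[OF \<tau> z] by simp
      moreover have "l (y z + \<tau> *s v + \<sigma> \<tau> z *s v) = l (y z + \<tau> *s v) + \<sigma> \<tau> z"
        using j by (simp add: l_def algebra_simps)
      ultimately have S1: "(\<Sum>\<zeta>\<in>loc.rts (y z + \<tau> *s v). of_nat (loc.mu (y z + \<tau> *s v) \<zeta>) * l (y z + \<tau> *s v + \<zeta> *s v))
          = of_nat N' * (l (y z + \<tau> *s v) + \<sigma> \<tau> z)" by simp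
      have S2: "inverse (complex_of_nat N') * (of_nat N' * w) = w" for w using N'(1) by simp
      show "inverse (of_nat N') * (\<Sum>\<zeta>\<in>loc.rts (y z + \<tau> *s v). of_nat (loc.mu (y z + \<tau> *s v) \<zeta>) * l (y z + \<tau> *s v + \<zeta> *s v)) - l (y z + \<tau> *s v) = \<sigma> \<tau> z"
        unfolding S1 S2 by simp
    qed
  qed
  \<comment> \<open>the lift of the sheet that belongs to \<open>\<tau>\<close>, and the base points for which it lies in the zero set of \<open>S\<close>\<close>
  define Y where "Y = (\<lambda>\<tau> z. y z + (\<tau> + \<sigma> \<tau> z) *s v)"
  define C where "C = (\<lambda>\<tau>. {z \<in> B1. Y \<tau> z \<in> zs S p R})"
  have rtsY: "\<tau> + \<sigma> \<tau> z \<in> rts (y z)" if "\<tau> \<in> T" "z \<in> B1" for \<tau> z using img[OF that(2)] that(1) by blast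
  have Yb: "Y \<tau> z \<in> ball p R" if "\<tau> \<in> T" "z \<in> B1" for \<tau> z
    unfolding Y_def by (rule mem_ball_R[OF yb]) (use that B1B rtsY[OF that] in \<open>auto simp: rts_def\<close>)
  have holY: "holo_map_on (Y \<tau>) B1" if "\<tau> \<in> T" for \<tau>
  proof -
    have "holo_map_on y B1" by (rule holo_map_on_subset[OF holy B1B])
    thus ?thesis unfolding Y_def
      by (intro holo_map_on_add holo_map_on_smult holo_map_on_const holo_on_add holo_on_const hol\<sigma>[OF that])
  qed
  have "\<exists>\<tau>\<in>T. \<exists>B'. open B' \<and> B' \<noteq> {} \<and> B' \<subseteq> B1 \<inter> C \<tau>"
  proof (rule finite_closed_cover_open[OF finT B1])
    show "B1 \<subseteq> (\<Union>\<tau>\<in>T. C \<tau>)"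
    proof
      fix z assume z: "z \<in> B1"
      hence "y z \<in> zs S' p \<delta>" using yZ B1B by blast
      then obtain \<zeta> where \<zeta>: "cmod \<zeta> < r" "y z + \<zeta> *s v \<in> zs S p R" unfolding zsS' by blast
      hence "\<zeta> \<in> rts (y z)" using gS by (auto simp: rts_def zs_def)
      then obtain \<tau> where "\<tau> \<in> T" "\<zeta> = \<tau> + \<sigma> \<tau> z" using img[OF z] by blast
      thus "z \<in> (\<Union>\<tau>\<in>T. C \<tau>)" using z \<zeta> by (auto simp: C_def Y_def)
    qed
    fix \<tau> assume \<tau>: "\<tau> \<in> T"
    have "B1 - C \<tau> = (\<Union>h\<in>S. B1 \<inter> (\<lambda>z. h (Y \<tau> z)) -` (- {0}))"
      using Yb[OF \<tau>] by (auto simp: C_def zs_def)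
    also have "open \<dots>"
    proof (rule open_UN, rule ballI)
      fix h assume h: "h \<in> S"
      have "holo_on (\<lambda>z. h (Y \<tau> z)) B1"
        by (rule holo_on_compose[OF S(2)[OF h] holY[OF \<tau>]]) (use Yb[OF \<tau>] in auto)
      thus "open (B1 \<inter> (\<lambda>z. h (Y \<tau> z)) -` (- {0}))"
        by (intro continuous_open_preimage[OF holo_on_imp_continuous_on B1]) auto
    qed
    finally show "open (B1 - C \<tau>)" .
  qed (use z1B1 in auto)
  then obtain \<tau> B2 where \<tau>: "\<tau> \<in> T" and B2: "open B2" "B2 \<noteq> {}" "B2 \<subseteq> B1" "B2 \<subseteq> C \<tau>" by auto
  obtain z2 where z2: "z2 \<in> B2" using B2 by blast
  \<comment> \<open>the tolerance \<open>\<epsilon>'\<close> of the new sheet: nearby points must project into the ball of radius \<open>\<delta>\<close>\<close>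
  define d where "d = \<delta> - dist p (y z2)"
  have d: "d > 0" using yb[of z2] z2 B2 B1B by (auto simp: d_def)
  define K where "K = 1 + (\<Sum>k<m. norm (vs k))"
  have K: "K > 0" unfolding K_def by (intro add_pos_nonneg sum_nonneg) auto
  define \<epsilon>' where "\<epsilon>' = min (min \<epsilon> e) (d / (2 * K))"
  have \<epsilon>': "\<epsilon>' > 0" "\<epsilon>' \<le> \<epsilon>" "\<epsilon>' \<le> e" "\<epsilon>' * K \<le> d / 2"
  proof -
    show "\<epsilon>' > 0" "\<epsilon>' \<le> \<epsilon>" "\<epsilon>' \<le> e" using \<epsilon> e d K by (auto simp: \<epsilon>'_def)
    have "\<epsilon>' * K \<le> d / (2 * K) * K" using K by (intro mult_right_mono) (auto simp: \<epsilon>'_def)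
    thus "\<epsilon>' * K \<le> d / 2" using K by simp
  qed
  define B3 where "B3 = B2 \<inter> y -` ball (y z2) (d / 2)"
  have B3: "open B3" unfolding B3_def
    by (rule continuous_open_preimage[OF continuous_on_subset[OF holo_map_on_imp_continuous_on[OF holy]] B2(1)])
       (use B2 B1B in auto)
  have B3s: "B3 \<subseteq> B2" "B3 \<subseteq> B1" "B3 \<subseteq> B" using B2 B1B by (auto simp: B3_def)
  define \<rho>' where "\<rho>' = \<rho>(m := (\<lambda>z. \<tau> + \<sigma> \<tau> z))"
  show ?thesis
    unfolding sheet_def
  proof (rule exI[of _ B3], rule exI[of _ \<rho>'], rule exI[of _ \<epsilon>'], intro conjI allI impI ballI)
    show "B3 \<noteq> {}" using z2 d by (auto simp: B3_def)
    fix k assume "k < Suc m"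
    then consider "k < m" | "k = m" by linarith
    thus "holo_on (\<rho>' k) B3"
    proof cases
      case 1 thus ?thesis using holo_on_subset[OF hol[OF 1] B3s(3)] by (simp add: \<rho>'_def)
    next
      case 2
      have "holo_on (\<lambda>z. \<tau> + \<sigma> \<tau> z) B1" by (intro holo_on_add holo_on_const hol\<sigma>[OF \<tau>])
      thus ?thesis using 2 holo_on_subset[OF _ B3s(2)] by (simp add: \<rho>'_def)
    qed
  next
    fix z \<zeta> assume z: "z \<in> B3" and cl: "\<forall>k<Suc m. cmod (\<zeta> k - \<rho>' k z) < \<epsilon>'"
    have cl1: "cmod (\<zeta> k - \<rho> k z) < \<epsilon>'" if "k < m" for k
      using cl[rule_format, of k] that by (simp add: \<rho>'_def)
    have cl2: "cmod (\<zeta> m - (\<tau> + \<sigma> \<tau> z)) < \<epsilon>'" using cl[rule_format, of m] by (simp add: \<rho>'_def)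
    define y' where "y' = z + (\<Sum>k<m. \<zeta> k *s vs k)"
    have sum: "z + (\<Sum>k<Suc m. \<zeta> k *s (vs(m := v)) k) = y' + \<zeta> m *s v"
      by (simp add: y'_def)
    have zz: "z \<in> B" "z \<in> B1" "z \<in> C \<tau>" using z B3s B2 by auto
    show "z + (\<Sum>k<Suc m. \<zeta> k *s (vs(m := v)) k) \<in> zs S p R \<longleftrightarrow> (\<forall>k<Suc m. \<zeta> k = \<rho>' k z)"
    proof
      assume eq: "\<forall>k<Suc m. \<zeta> k = \<rho>' k z"
      hence "\<zeta> k = \<rho> k z" if "k < m" for k using that by (simp add: \<rho>'_def)
      hence "y' = y z" by (simp add: y'_def y_def)
      moreover have "\<zeta> m = \<tau> + \<sigma> \<tau> z" using eq by (simp add: \<rho>'_def)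
      ultimately have "y' + \<zeta> m *s v = Y \<tau> z" by (simp add: Y_def)
      thus "z + (\<Sum>k<Suc m. \<zeta> k *s (vs(m := v)) k) \<in> zs S p R"
        unfolding sum using zz by (simp add: C_def)
    next
      assume "z + (\<Sum>k<Suc m. \<zeta> k *s (vs(m := v)) k) \<in> zs S p R"
      hence inZ: "y' + \<zeta> m *s v \<in> zs S p R" unfolding sum .
      have "norm (y' - y z) = norm (\<Sum>k<m. (\<zeta> k - \<rho> k z) *s vs k)"
        by (simp add: y'_def y_def vec.scale_left_diff_distrib sum_subtractf)
      also have "\<dots> \<le> (\<Sum>k<m. norm ((\<zeta> k - \<rho> k z) *s vs k))" by (rule norm_sum)
      also have "\<dots> \<le> (\<Sum>k<m. \<epsilon>' * norm (vs k))"
        unfolding norm_smult by (intro sum_mono mult_right_mono[OF less_imp_le[OF cl1]]) auto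
      also have "\<dots> \<le> \<epsilon>' * K" using \<epsilon>'(1) by (simp add: K_def sum_distrib_left[symmetric])
      finally have "dist y' (y z) \<le> d / 2" using \<epsilon>'(4) by (simp add: dist_norm)
      moreover have "dist (y z2) (y z) < d / 2" using z by (simp add: B3_def)
      ultimately have "y' \<in> ball p \<delta>"
        using dist_triangle[of p y' "y z2"] dist_triangle[of "y z2" y' "y z"] by (simp add: d_def dist_commute)
      moreover have "cmod (\<zeta> m) < r"
      proof -
        have "cmod (\<tau> + \<sigma> \<tau> z) < r / 2" using rts_half[OF yb[OF zz(1)] rtsY[OF \<tau> zz(2)]] .
        moreover have "cmod (\<zeta> m) \<le> cmod (\<zeta> m - (\<tau> + \<sigma> \<tau> z)) + cmod (\<tau> + \<sigma> \<tau> z)"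
          using norm_triangle_ineq[of "\<zeta> m - (\<tau> + \<sigma> \<tau> z)" "\<tau> + \<sigma> \<tau> z"] by simp
        ultimately show ?thesis using cl2 \<epsilon>'(3) e(3) r_pos by linarith
      qed
      ultimately have "y' \<in> zs S' p \<delta>" unfolding zsS' using inZ by blast
      moreover have "cmod (\<zeta> k - \<rho> k z) < \<epsilon>" if "k < m" for k
        using cl1[OF that] \<epsilon>'(2) by linarith
      ultimately have eq1: "\<forall>k<m. \<zeta> k = \<rho> k z" using mem[OF zz(1), of \<zeta>] unfolding y'_def by blast
      hence "y' = y z" by (simp add: y'_def y_def)
      hence "\<zeta> m \<in> rts (y z)" using inZ gS \<open>cmod (\<zeta> m) < r\<close> by (auto simp: rts_def zs_def)
      then obtain \<tau>' where \<tau>': "\<tau>' \<in> T" "\<zeta> m = \<tau>' + \<sigma> \<tau>' z" using img[OF zz(2)] by blast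
      have "\<tau>' = \<tau>"
        by (rule near[OF \<tau>'(1) \<tau>, of "\<sigma> \<tau>' z" "\<sigma> \<tau> z"])
           (use cl2 \<tau>' \<epsilon>'(3) Qsmall \<tau> \<sigma>[OF _ zz(2)] in auto)
      hence "\<zeta> m = \<tau> + \<sigma> \<tau> z" using \<tau>'(2) by simp
      thus "\<forall>k<Suc m. \<zeta> k = \<rho>' k z" using eq1 by (auto simp: \<rho>'_def less_Suc_eq)
    qed
  qed (use B3 \<epsilon>' in auto)
qed

lemma tower_sheet:
  assumes "tower p S R L S1 R1" and S: "finite S" "\<And>h. h \<in> S \<Longrightarrow> holo_on h (ball p R)" "R > 0"
    and sh: "sheet (zs S1 p R1) v m"
  shows "\<exists>v'. sheet (zs S p R) v' (m + length L)"
  using assms(1) sh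
proof (induction arbitrary: v m rule: tower.induct)
  case tower_Nil
  thus ?case by auto
next
  case (tower_snoc L S1 R1 v1 g r S2 R2)
  note tp = tower_props[OF tower_snoc.hyps(1) S]
  have "sheet (zs S1 p R1) (v(m := v1)) (Suc m)"
    by (rule sheet_step[OF tower_snoc.hyps(2)]) (use tp tower_snoc.prems in auto)
  from tower_snoc.IH[OF this] show ?case by simp
qed

text \<open>If no equation is left after \<open>l\<close> steps, the whole ball is a sheet with no directions, and lifting it back
gives points where \<open>X\<close> is a manifold of codimension \<open>l\<close>.\<close>

lemma tower_full_submanifold:
  fixes X :: "(complex^'n) set"
  assumes t: "tower p S R L S1 R1" and S: "finite S" "\<And>h. h \<in> S \<Longrightarrow> holo_on h (ball p R)" "R > 0"
    and full: "\<And>h z. h \<in> S1 \<Longrightarrow> z \<in> ball p R1 \<Longrightarrow> h z = 0"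
    and X: "X \<inter> ball p R = zs S p R"
  obtains q where "q \<in> ball p R" "submanifold_at X (CARD('n) - length L) q"
proof -
  have R1: "R1 > 0" using tower_props[OF t S] by blast
  have "zs S1 p R1 = ball p R1" using full by (auto simp: zs_def)
  hence sh: "sheet (zs S1 p R1) (\<lambda>_. 0) 0" unfolding sheet_def
    by (intro exI[of _ "ball p R1"] exI[of _ "\<lambda>_ _. 0"] exI[of _ 1]) (use R1 in auto)
  obtain v' where v': "sheet (zs S p R) v' (0 + length L)" using tower_sheet[OF t S sh] by blast
  obtain q where "q \<in> zs S p R" "submanifold_at X (CARD('n) - (0 + length L)) q"
    by (rule sheet_submanifold[OF v' X[symmetric]])
  thus ?thesis by (intro that[of q]) (auto simp: zs_def)
qed

subsection \<open>Holomorphic functions on an irreducible germ\<close>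

lemma submanifold_at_le: "submanifold_at X k (q :: complex^'n) \<Longrightarrow> k \<le> CARD('n)"
  unfolding submanifold_at_def by (auto intro!: card_mono)

text \<open>The set whose maximum is \<open>dim_at X p\<close>.\<close>

definition near_dims :: "(complex^'n) set \<Rightarrow> complex^'n \<Rightarrow> nat set" where
  "near_dims X p = {k. \<forall>W. open W \<and> p \<in> W \<longrightarrow> (\<exists>q\<in>W. submanifold_at X k q)}"

lemma finite_near_dims: "finite (near_dims X (p :: complex^'n))"
proof (rule finite_subset)
  show "near_dims X p \<subseteq> {..CARD('n)}" 
    unfolding near_dims_def using submanifold_at_le by (force dest: spec[of _ UNIV])
qed simp

lemma near_dims_le: "pure_dim X d \<Longrightarrow> p \<in> X \<Longrightarrow> k \<in> near_dims X p \<Longrightarrow> k \<le> d"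
  unfolding pure_dim_def dim_at_def near_dims_def[symmetric]
  using Max_ge[OF finite_near_dims] by metis

lemma reg_dim_in_near_dims:
  assumes "pure_dim X d" "q \<in> reg_part X"
  shows "d \<in> near_dims X q"
proof -
  obtain k where k: "submanifold_at X k q" using assms(2) by (auto simp: reg_part_def)
  hence "k \<in> near_dims X q" by (auto simp: near_dims_def)
  hence "Max (near_dims X q) \<in> near_dims X q" using finite_near_dims by (intro Max_in) auto
  moreover have "q \<in> X" using k by (simp add: submanifold_at_def)
  ultimately show ?thesis using assms(1) by (simp add: pure_dim_def dim_at_def near_dims_def[symmetric])
qed

text \<open>Elimination can be continued for \<open>n - d\<close> steps: if no equation were left earlier,
\<open>tower_full_submanifold\<close> would give points of dimension larger than \<open>d\<close>.  It cannot be continued further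
on a part of \<open>X\<close> of dimension \<open>d\<close>, by \<open>triangular_chart_bound\<close>.  So no function of the remaining directions
that is not identically zero vanishes on such a part.  The lowest coefficient \<open>a\<close> of the characteristic
polynomial of \<open>G\<close> would vanish on the parts where \<open>G = 0\<close>, if \<open>X\<close> were contained in the zero set of the second factor \<open>h\<close> of
\<open>poly (P z) (G z) = G\<^sup>j h\<close>.\<close>

lemma irreducible_vanishing:
  fixes X :: "(complex^'n) set"
  assumes \<Omega>: "open \<Omega>" "analytic_subset \<Omega> X" and dim: "pure_dim X d"
    and irr: "irreducible_germ X p" and G: "holo_near X p G"
    and van: "\<And>W. open W \<Longrightarrow> p \<in> W \<Longrightarrow>
        \<exists>q N. q \<in> W \<inter> reg_part X \<and> open N \<and> q \<in> N \<and> (\<forall>z\<in>X \<inter> N. G z = 0)"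
  shows "\<exists>W. open W \<and> p \<in> W \<and> (\<forall>z\<in>X \<inter> W. G z = 0)"
proof (rule ccontr)
  assume contra: "\<not> ?thesis"
  have pX: "p \<in> X" using irr by (simp add: irreducible_germ_def)
  hence "p \<in> \<Omega>" using \<Omega>(2) by (auto simp: analytic_subset_def)
  with \<Omega>(2) obtain U2 S where U2': "open U2 \<and> p \<in> U2 \<and> U2 \<subseteq> \<Omega> \<and> finite S \<and> (\<forall>g\<in>S. holo_on g U2) \<and>
      X \<inter> U2 = {z\<in>U2. \<forall>g\<in>S. g z = 0}"
    unfolding analytic_subset_def by meson
  hence U2: "open U2" "p \<in> U2" "finite S" "X \<inter> U2 = {z\<in>U2. \<forall>g\<in>S. g z = 0}"
    and U2S: "\<And>g. g \<in> S \<Longrightarrow> holo_on g U2"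
    by simp_all
  obtain U1 gg where U1': "open U1 \<and> p \<in> U1 \<and> holo_on gg U1 \<and> (\<forall>z\<in>X \<inter> U1. G z = gg z)"
    using G unfolding holo_near_def by meson
  hence U1: "open U1" "p \<in> U1" "holo_on gg U1" and U1G: "\<And>z. z \<in> X \<inter> U1 \<Longrightarrow> G z = gg z"
    by simp_all
  \<comment> \<open>a ball in which the dimensions of \<open>X\<close> at its manifold points are at most \<open>d\<close>\<close>
  have "\<exists>W. open W \<and> p \<in> W \<and> (k \<notin> near_dims X p \<longrightarrow> (\<forall>q\<in>W. \<not> submanifold_at X k q))" for k
  proof (cases "k \<in> near_dims X p")
    case True thus ?thesis by (intro exI[of _ UNIV]) auto
  next
    case False thus ?thesis unfolding near_dims_def by blast
  qed
  then obtain Wk where Wk: "\<And>k. open (Wk k)" "\<And>k. p \<in> Wk k"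
      "\<And>k q. k \<notin> near_dims X p \<Longrightarrow> q \<in> Wk k \<Longrightarrow> \<not> submanifold_at X k q" by metis
  have "open (U1 \<inter> U2 \<inter> (\<Inter>k\<le>CARD('n). Wk k))"
    using U1(1) U2(1) Wk(1) by (intro open_Int open_INT) auto
  moreover have "p \<in> U1 \<inter> U2 \<inter> (\<Inter>k\<le>CARD('n). Wk k)" using U1(2) U2(2) Wk(2) by auto
  ultimately obtain R where R: "R > 0" "ball p R \<subseteq> U1 \<inter> U2 \<inter> (\<Inter>k\<le>CARD('n). Wk k)"
    by (rule openE)
  have dimR: "k \<le> d" if "submanifold_at X k q" "q \<in> ball p R" for k q
  proof -
    have "q \<in> Wk k" using R(2) that submanifold_at_le[OF that(1)] by auto
    hence "k \<in> near_dims X p" using Wk(3) that by blast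
    thus ?thesis by (rule near_dims_le[OF dim pX])
  qed
  have XS: "X \<inter> ball p R = zs S p R" using U2(4) R(2) by (auto simp: zs_def)
  have S: "finite S" "\<And>h. h \<in> S \<Longrightarrow> holo_on h (ball p R)" "R > 0"
    using U2(3) R holo_on_subset[OF U2S] by auto
  have hgg: "holo_on gg (ball p R)" using U1(3) R(2) by (auto intro: holo_on_subset)
  have Ggg: "G z = gg z" if "z \<in> X" "z \<in> ball p R" for z using U1G R(2) that by auto
  have dn: "d \<le> CARD('n)"
  proof -
    obtain q N where "q \<in> UNIV \<inter> reg_part X" using van[of UNIV] by auto
    hence "d \<in> near_dims X q" using reg_dim_in_near_dims[OF dim] by auto
    then obtain q' where "submanifold_at X d q'" unfolding near_dims_def by auto
    thus ?thesis by (rule submanifold_at_le)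
  qed
  have "\<exists>L S1 R1. tower p S R L S1 R1 \<and> length L = l" if "l \<le> CARD('n) - d" for l
    using that
  proof (induction l)
    case 0
    show ?case using tower_Nil[of p S R] by auto
  next
    case (Suc l)
    then obtain L S1 R1 where t: "tower p S R L S1 R1" "length L = l" by auto
    note tp = tower_props[OF t(1) S]
    have "\<exists>h\<in>S1. \<exists>z\<in>ball p R1. h z \<noteq> 0"
    proof (rule ccontr)
      assume full: "\<not> (\<exists>h\<in>S1. \<exists>z\<in>ball p R1. h z \<noteq> 0)"
      obtain q where "q \<in> ball p R" "submanifold_at X (CARD('n) - length L) q"
        using tower_full_submanifold[OF t(1) S _ XS] full by blast
      hence "CARD('n) - l \<le> d" using dimR t(2) by blast
      thus False using Suc.prems by linarith
    qed
    then obtain h z where h: "h \<in> S1" "z \<in> ball p R1" "h z \<noteq> 0" by blast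
    have S1: "finite S1" "\<And>h. h \<in> S1 \<Longrightarrow> holo_on h (ball p R1)" using tp by auto
    obtain v r S' \<delta> where "elim_step p S1 R1 v h r S' \<delta>"
      using elim_step_exists[OF S1 h zero_less_one] by blast
    from tower_snoc[OF t(1) this] show ?case using t(2) by fastforce
  qed
  then obtain L S1 R1 where t: "tower p S R L S1 R1" and lenL: "length L = CARD('n) - d" by blast
  note tp = tower_props[OF t S]
  obtain P D where P: "\<And>z. z \<in> ball p R1 \<Longrightarrow> degree (P z) = D" "\<And>z. z \<in> ball p R1 \<Longrightarrow> lead_coeff (P z) = 1"
      "\<And>m. holo_on (\<lambda>z. coeff (P z) m) (ball p R1)"
      "\<And>k. k < length L \<Longrightarrow> inv_dir (fst (L ! k)) P p R1"
      "\<And>z. z \<in> zs S p R \<inter> ball p R1 \<Longrightarrow> poly (P z) (gg z) = 0"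
    using tower_charpoly[OF t S hgg] by blast
  have R1: "R1 > 0" "R1 \<le> R" using tp by auto
  have sub: "ball p R1 \<subseteq> ball p R" using R1 by auto
  have memX: "z \<in> X \<longleftrightarrow> (\<forall>g\<in>S. g z = 0)" if "z \<in> ball p R1" for z
  proof -
    have "z \<in> ball p R" using sub that by blast
    thus ?thesis using XS by (auto simp: zs_def set_eq_iff)
  qed
  have memZ: "z \<in> zs S p R \<inter> ball p R1" if "z \<in> X" "z \<in> ball p R1" for z
  proof -
    have "z \<in> X \<inter> ball p R" using sub that by blast
    thus ?thesis unfolding XS using that by blast
  qed
  \<comment> \<open>the polynomial is monic, so not all of its coefficients are identically zero\<close>
  define nonzero where "nonzero = (\<lambda>m. \<exists>z\<in>ball p R1. coeff (P z) m \<noteq> 0)"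
  have "nonzero D" unfolding nonzero_def using P(1)[of p] P(2)[of p] R1 by (intro bexI[of _ p]) auto
  define j where "j = (LEAST m. nonzero m)"
  have nj: "nonzero j" unfolding j_def by (rule LeastI[of nonzero, OF \<open>nonzero D\<close>])
  have jD: "j \<le> D" unfolding j_def by (rule Least_le[of nonzero, OF \<open>nonzero D\<close>])
  have below: "coeff (P z) m = 0" if "m < j" "z \<in> ball p R1" for m z
    using not_less_Least[of m nonzero] that by (auto simp: j_def nonzero_def)
  define a where "a = (\<lambda>z. coeff (P z) j)"
  define h where "h = (\<lambda>z. \<Sum>m\<le>D - j. coeff (P z) (m + j) * gg z ^ m)"
  have holgg1: "holo_on gg (ball p R1)" by (rule holo_on_subset[OF hgg sub])
  have holh: "holo_on h (ball p R1)"
    unfolding h_def by (intro holo_on_sum holo_on_mult holo_on_power P(3) holgg1) auto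
  have fact: "poly (P z) (gg z) = gg z ^ j * h z" if z: "z \<in> ball p R1" for z
  proof -
    have "poly (P z) (gg z) = (\<Sum>m\<le>D. coeff (P z) m * gg z ^ m)" by (simp add: poly_altdef P(1)[OF z])
    also have "\<dots> = (\<Sum>m\<in>{j..D}. coeff (P z) m * gg z ^ m)"
      by (rule sum.mono_neutral_right) (use below z in auto)
    also have "\<dots> = (\<Sum>m\<le>D - j. coeff (P z) (m + j) * gg z ^ (m + j))"
      by (rule sum.reindex_bij_witness[where i="\<lambda>m. m + j" and j="\<lambda>m. m - j"]) (use jD in auto)
    also have "\<dots> = gg z ^ j * h z"
      by (simp add: h_def sum_distrib_left power_add mult_ac)
    finally show ?thesis .
  qed
  define A where "A = {z \<in> ball p R1. z \<in> X \<and> gg z = 0}"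
  define B where "B = {z \<in> ball p R1. z \<in> X \<and> h z = 0}"
  \<comment> \<open>the two analytic subsets to which irreducibility is applied\<close>
  have an: "analytic_subset (ball p R1) {z \<in> ball p R1. z \<in> X \<and> f z = 0}" if "holo_on f (ball p R1)" for f
    unfolding analytic_subset_def
  proof (intro conjI ballI)
    fix p' assume "p' \<in> ball p R1"
    show "\<exists>U S. open U \<and> p' \<in> U \<and> U \<subseteq> ball p R1 \<and> finite S \<and> (\<forall>g\<in>S. holo_on g U) \<and>
        {z \<in> ball p R1. z \<in> X \<and> f z = 0} \<inter> U = {z \<in> U. \<forall>g\<in>S. g z = 0}"
    proof (intro exI[of _ "ball p R1"] exI[of _ "insert f S"] conjI)
      show "\<forall>g\<in>insert f S. holo_on g (ball p R1)" using that S(2) holo_on_subset[OF _ sub] by blast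
      show "{z \<in> ball p R1. z \<in> X \<and> f z = 0} \<inter> ball p R1 = {z \<in> ball p R1. \<forall>g\<in>insert f S. g z = 0}"
        using memX by auto
    qed (use \<open>p' \<in> ball p R1\<close> S(1) in auto)
  qed auto
  have un: "X \<inter> ball p R1 = A \<union> B"
  proof -
    have "gg z = 0 \<or> h z = 0" if z: "z \<in> X" "z \<in> ball p R1" for z
    proof -
      have "z \<in> zs S p R \<inter> ball p R1" by (rule memZ[OF z])
      from P(5)[OF this] have "gg z ^ j * h z = 0" using fact[OF z(2)] by simp
      thus ?thesis by auto
    qed
    thus ?thesis unfolding A_def B_def by blast
  qed
  have anA: "analytic_subset (ball p R1) A" unfolding A_def by (rule an, rule holgg1)
  have anB: "analytic_subset (ball p R1) B" unfolding B_def by (rule an, rule holh)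
  have pre: "open (ball p R1) \<and> p \<in> ball p R1 \<and> analytic_subset (ball p R1) A \<and> analytic_subset (ball p R1) B \<and>
      X \<inter> ball p R1 = A \<union> B"
    using un anA anB R1(1) by simp
  obtain W' where W': "open W'" "p \<in> W'" "W' \<subseteq> ball p R1" "X \<inter> W' = A \<inter> W' \<or> X \<inter> W' = B \<inter> W'"
    using irr[unfolded irreducible_germ_def, THEN conjunct2, THEN spec, THEN spec, THEN spec, THEN mp, OF pre]
    by (elim exE conjE)
  have "X \<inter> W' \<noteq> A \<inter> W'"
  proof
    assume eq: "X \<inter> W' = A \<inter> W'"
    have "G z = 0" if "z \<in> X \<inter> W'" for z
    proof -
      have "z \<in> A" using that eq by blast
      thus ?thesis using Ggg[of z] subsetD[OF sub] by (auto simp: A_def)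
    qed
    thus False using contra W' by blast
  qed
  hence XB: "X \<inter> W' = B \<inter> W'" using W'(4) by blast
  obtain z0 where z0: "z0 \<in> ball p R1" "a z0 \<noteq> 0" using nj by (auto simp: nonzero_def a_def)
  have hola: "holo_on a (ball p R1)" unfolding a_def by (rule P(3))
  obtain v r \<delta> where rd: "root_disc p v a R1 r \<delta>"
    using root_disc_exists[OF hola z0 zero_less_one] by blast
  have inva: "inv_dir (fst (L ! k)) a p R1" if "k < length L" for k
    using P(4)[OF that] unfolding inv_dir_def a_def by auto
  \<comment> \<open>one equation more than a set of dimension \<open>d\<close> can satisfy\<close>
  have tri: "triangular (L @ [(v, a)]) p \<delta>"
    by (rule triangular_snoc[OF _ rd inva]) (use tp in auto)
  have \<delta>: "\<delta> > 0" using rd by (simp add: root_disc_def)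
  obtain q N where q: "q \<in> (W' \<inter> ball p \<delta>) \<inter> reg_part X" and N: "open N" "q \<in> N" "\<And>z. z \<in> X \<inter> N \<Longrightarrow> G z = 0"
  proof -
    have "open (W' \<inter> ball p \<delta>)" "p \<in> W' \<inter> ball p \<delta>" using W'(1,2) \<delta> by auto
    from van[OF this] show ?thesis using that by blast
  qed
  define N' where "N' = N \<inter> W' \<inter> ball p \<delta>"
  have N': "open N'" "q \<in> N'" using N W' q by (auto simp: N'_def)
  have "d \<in> near_dims X q" using reg_dim_in_near_dims[OF dim] q by auto
  then obtain q' where q': "q' \<in> N'" "submanifold_at X d q'" using N' unfolding near_dims_def by blast
  then obtain I U V F Gc where ch: "q' \<in> X" "slice_chart X I U V F Gc" "q' \<in> U" "card I = d"
    unfolding submanifold_at_def by blast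
  have "length (L @ [(v, a)]) + card I \<le> CARD('n)"
  proof (rule triangular_chart_bound[OF tri ch(2,1,3) _ N'(1) q'(1)])
    show "q' \<in> ball p \<delta>" using q'(1) by (simp add: N'_def)
    fix k z assume k: "k < length (L @ [(v, a)])" and z: "z \<in> X \<inter> N'"
    have zb: "z \<in> ball p R1" using z W'(3) by (auto simp: N'_def)
    have g0: "gg z = 0" using N(3)[of z] Ggg[of z] z subsetD[OF sub zb] by (auto simp: N'_def)
    consider "k < length L" | "k = length L" using k by fastforce
    thus "snd ((L @ [(v, a)]) ! k) z = 0"
    proof cases
      case 1
      have "z \<in> zs S p R \<inter> ball p R1" using memZ zb z by blast
      thus ?thesis using tp 1 by (auto simp: nth_append)
    next
      case 2
      have "z \<in> B" using XB z by (auto simp: N'_def)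
      hence "h z = 0" by (simp add: B_def)
      moreover have "h z = (\<Sum>m\<le>D - j. if m = 0 then a z else 0)"
        unfolding h_def by (intro sum.cong refl) (simp add: g0 a_def)
      ultimately have "a z = 0" by simp
      thus ?thesis using 2 by simp
    qed
  qed
  thus False using lenL dn ch(4) by simp
qed

section \<open>Circle means\<close>

lemma circle_mean_mono:
  assumes "\<And>\<zeta>. cmod \<zeta> = 1 \<Longrightarrow> u \<zeta> \<le> v \<zeta>"
  shows "circle_mean u \<le> circle_mean v"
proof -
  have "(\<integral>\<^sup>+ t \<in> {0..2*pi}. e2ennreal (u (cis t)) \<partial>lborel) \<le> (\<integral>\<^sup>+ t \<in> {0..2*pi}. e2ennreal (v (cis t)) \<partial>lborel)"
    by (intro nn_integral_mono mult_right_mono e2ennreal_mono assms) auto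
  moreover have "(\<integral>\<^sup>+ t \<in> {0..2*pi}. e2ennreal (- v (cis t)) \<partial>lborel) \<le> (\<integral>\<^sup>+ t \<in> {0..2*pi}. e2ennreal (- u (cis t)) \<partial>lborel)"
    by (intro nn_integral_mono mult_right_mono e2ennreal_mono) (auto intro: assms)
  ultimately show ?thesis
    unfolding circle_mean_def
    by (intro ereal_divide_right_mono ereal_minus_mono) (auto simp: less_eq_ennreal.rep_eq)
qed

text \<open>The function in \<open>circle_mean\<close> is arbitrary, so constants are pulled out by means of the simple functions
below the integrand instead of the theorem for measurable functions.\<close>

lemma nn_integral_cmult_ge:
  fixes f :: "'a \<Rightarrow> ennreal"
  shows "c * (\<integral>\<^sup>+ x. f x \<partial>M) \<le> (\<integral>\<^sup>+ x. c * f x \<partial>M)"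
proof -
  have "c * (\<integral>\<^sup>+ x. f x \<partial>M) = (SUP g\<in>{g. simple_function M g \<and> g \<le> f}. c * integral\<^sup>S M g)"
    unfolding nn_integral_def by (simp add: SUP_mult_left_ennreal)
  also have "\<dots> \<le> (\<integral>\<^sup>+ x. c * f x \<partial>M)"
  proof (rule SUP_least)
    fix g assume g: "g \<in> {g. simple_function M g \<and> g \<le> f}"
    hence sg: "simple_function M g" "\<And>x. g x \<le> f x" by (auto simp: le_fun_def)
    have "c * integral\<^sup>S M g = integral\<^sup>S M (\<lambda>x. c * g x)" using sg(1) by simp
    also have "\<dots> = (\<integral>\<^sup>+ x. c * g x \<partial>M)"
      by (rule nn_integral_eq_simple_integral[symmetric]) (use sg(1) in auto)
    also have "\<dots> \<le> (\<integral>\<^sup>+ x. c * f x \<partial>M)" by (intro nn_integral_mono mult_left_mono sg(2)) auto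
    finally show "c * integral\<^sup>S M g \<le> (\<integral>\<^sup>+ x. c * f x \<partial>M)" .
  qed
  finally show ?thesis .
qed

lemma nn_integral_cmult_pos:
  fixes f :: "'a \<Rightarrow> ennreal"
  assumes "c > 0"
  shows "(\<integral>\<^sup>+ x. ennreal c * f x \<partial>M) = ennreal c * (\<integral>\<^sup>+ x. f x \<partial>M)"
proof (rule antisym)
  show "ennreal c * (\<integral>\<^sup>+ x. f x \<partial>M) \<le> (\<integral>\<^sup>+ x. ennreal c * f x \<partial>M)" by (rule nn_integral_cmult_ge)
  have inv: "ennreal (1 / c) * (ennreal c * y) = y" "ennreal c * (ennreal (1 / c) * y) = y" for y
    using assms by (simp_all add: mult.assoc[symmetric] ennreal_mult[symmetric])
  have "ennreal (1 / c) * (\<integral>\<^sup>+ x. ennreal c * f x \<partial>M) \<le> (\<integral>\<^sup>+ x. ennreal (1 / c) * (ennreal c * f x) \<partial>M)"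
    by (rule nn_integral_cmult_ge)
  hence "ennreal (1 / c) * (\<integral>\<^sup>+ x. ennreal c * f x \<partial>M) \<le> (\<integral>\<^sup>+ x. f x \<partial>M)" by (simp only: inv)
  hence "ennreal c * (ennreal (1 / c) * (\<integral>\<^sup>+ x. ennreal c * f x \<partial>M)) \<le> ennreal c * (\<integral>\<^sup>+ x. f x \<partial>M)"
    by (intro mult_left_mono) auto
  thus "(\<integral>\<^sup>+ x. ennreal c * f x \<partial>M) \<le> ennreal c * (\<integral>\<^sup>+ x. f x \<partial>M)" by (simp only: inv)
qed

lemma e2ennreal_cmult: "c > 0 \<Longrightarrow> e2ennreal (ereal c * x) = ennreal c * e2ennreal x"
proof (cases x)
  case (real r)
  assume c: "c > 0"
  show ?thesis
  proof (cases "r \<ge> 0")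
    case True thus ?thesis using c real by (simp add: e2ennreal_ereal ennreal_mult)
  next
    case False
    hence "c * r \<le> 0" using c by (simp add: mult_nonneg_nonpos)
    thus ?thesis using False real by (simp add: e2ennreal_ereal ennreal_neg)
  qed
qed (auto simp: ennreal_mult_top e2ennreal_neg)

lemma circle_mean_scale:
  assumes c: "c > 0"
  shows "circle_mean (\<lambda>\<zeta>. ereal c * v \<zeta>) = ereal c * circle_mean v"
proof -
  have i: "(\<integral>\<^sup>+ t \<in> {0..2*pi}. e2ennreal (ereal c * w t) \<partial>lborel) = ennreal c * (\<integral>\<^sup>+ t \<in> {0..2*pi}. e2ennreal (w t) \<partial>lborel)" for w
    by (simp add: e2ennreal_cmult[OF c] mult.assoc nn_integral_cmult_pos[OF c])
  have neg: "- (ereal c * x) = ereal c * (- x)" for x by simp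
  have e: "enn2ereal (ennreal c * y) = ereal c * enn2ereal y" for y
    using c by (simp add: times_ennreal.rep_eq)
  show ?thesis
    unfolding circle_mean_def neg i e
    using c by (cases "enn2ereal (\<integral>\<^sup>+ t \<in> {0..2*pi}. e2ennreal (v (cis t)) \<partial>lborel)";
       cases "enn2ereal (\<integral>\<^sup>+ t \<in> {0..2*pi}. e2ennreal (- v (cis t)) \<partial>lborel)") (auto simp: field_simps)
qed

text \<open>The positive part has finite mean because \<open>v\<close> is bounded above, and the negative part is infinite on an
arc of positive length.\<close>

lemma circle_mean_minf:
  assumes b: "\<And>\<zeta>. cmod \<zeta> = 1 \<Longrightarrow> v \<zeta> \<le> ereal B" and \<tau>: "0 < \<tau>" "\<tau> \<le> 2 * pi"
    and m: "\<And>t. 0 \<le> t \<Longrightarrow> t \<le> \<tau> \<Longrightarrow> v (cis t) = -\<infinity>"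
  shows "circle_mean v = -\<infinity>"
proof -
  have "(\<integral>\<^sup>+ t \<in> {0..2*pi}. e2ennreal (v (cis t)) \<partial>lborel) \<le> (\<integral>\<^sup>+ t \<in> {0..2*pi}. ennreal B \<partial>lborel)"
  proof (intro nn_integral_mono mult_right_mono)
    fix t show "e2ennreal (v (cis t)) \<le> ennreal B"
      using e2ennreal_mono[OF b[of "cis t"]] by (simp add: e2ennreal_ereal)
  qed auto
  also have "\<dots> < \<infinity>" by (simp add: nn_integral_cmult_indicator ennreal_mult_less_top)
  finally have f: "(\<integral>\<^sup>+ t \<in> {0..2*pi}. e2ennreal (v (cis t)) \<partial>lborel) < \<infinity>" .
  have "\<infinity> = (\<infinity> :: ennreal) * emeasure lborel {0..\<tau>}" using \<tau> by (simp add: ennreal_top_mult)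
  also have "\<dots> = (\<integral>\<^sup>+ t \<in> {0..\<tau>}. \<infinity> \<partial>lborel)"
    by (rule nn_integral_cmult_indicator[symmetric]) simp
  also have "\<dots> \<le> (\<integral>\<^sup>+ t \<in> {0..2*pi}. e2ennreal (- v (cis t)) \<partial>lborel)"
    by (intro nn_integral_mono) (use m \<tau> in \<open>auto simp: indicator_def\<close>)
  finally have g: "(\<integral>\<^sup>+ t \<in> {0..2*pi}. e2ennreal (- v (cis t)) \<partial>lborel) = \<infinity>" by (simp add: top_unique)
  obtain r where "enn2ereal (\<integral>\<^sup>+ t \<in> {0..2*pi}. e2ennreal (v (cis t)) \<partial>lborel) = ereal r"
    using f by (cases "\<integral>\<^sup>+ t \<in> {0..2*pi}. e2ennreal (v (cis t)) \<partial>lborel" rule: ennreal_cases) auto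
  thus ?thesis unfolding circle_mean_def g by simp
qed

text \<open>Rotating the circle by a multiple of \<open>2 \<pi> / N\<close> permutes the \<open>N\<close> sample points.\<close>

lemma prod_shift_periodic:
  fixes P :: "nat \<Rightarrow> 'a :: comm_monoid_mult"
  assumes "\<And>k. P (k + N) = P k"
  shows "(\<Prod>k<N. P (k + j)) = (\<Prod>k<N. P k)"
proof (induction j)
  case (Suc j)
  show ?case
  proof (cases N)
    case (Suc n)
    have "(\<Prod>k<Suc n. P (k + Suc j)) = (\<Prod>k<n. P (Suc k + j)) * P (j + N)"
      using Suc by (simp add: add.commute)
    also have "\<dots> = (\<Prod>k<Suc n. P (k + j))"
      unfolding prod.lessThan_Suc_shift assms by (simp add: mult.commute)
    finally show ?thesis using Suc.IH Suc by simp
  qed simp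
qed simp

text \<open>Jensen's inequality.  The product of \<open>N\<close> rotated copies of \<open>f\<close> has the value \<open>f 0 ^ N\<close> at the
  centre, and on the circle \<open>1 / N\<close> times the logarithm of its modulus is a Riemann sum for the circle mean;
  so the maximum principle gives the inequality without any discussion of the zeros of \<open>f\<close>.  The term
  \<open>\<epsilon>\<close> makes the integrand continuous.\<close>

lemma ln_le_integral_regularized:
  assumes f: "f holomorphic_on S" "open S" "cball 0 1 \<subseteq> S" and f0: "f 0 \<noteq> 0" and \<epsilon>: "\<epsilon> > 0"
  defines "h \<equiv> \<lambda>t. ln ((cmod (f (cis (2 * pi * t))))\<^sup>2 + \<epsilon>) / 2"
  shows "ln (cmod (f 0)) \<le> integral {0..1} h"
proof -
  have contf: "continuous_on S f" by (rule holomorphic_on_imp_continuous_on[OF f(1)])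
  have cisS: "cis t \<in> S" for t using f(3) by (simp add: subset_iff)
  have pos: "(cmod z)\<^sup>2 + \<epsilon> > 0" for z using \<epsilon> by (simp add: add_nonneg_pos)
  have conth: "continuous_on UNIV h"
    unfolding h_def
    by (intro continuous_intros continuous_on_compose2[OF contf]) (use cisS pos in \<open>auto simp: less_imp_neq[symmetric]\<close>)
  have le: "ln (cmod (f 0)) \<le> integral {0..1} h + 2 * \<eta>" if \<eta>: "\<eta> > 0" for \<eta>
  proof -
    have "uniformly_continuous_on {0..1} h"
      by (rule compact_uniformly_continuous[OF continuous_on_subset[OF conth]]) auto
    then obtain d where d: "d > 0" "\<And>s t. s \<in> {0..1} \<Longrightarrow> t \<in> {0..1} \<Longrightarrow> \<bar>s - t\<bar> < d \<Longrightarrow> \<bar>h s - h t\<bar> < \<eta>"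
      unfolding uniformly_continuous_on_def dist_real_def using \<eta> by metis
    obtain n :: nat where n: "1 / d < real n" using reals_Archimedean2 by blast
    define N where "N = Suc n"
    have N: "N > 0" "1 / real N < d"
    proof -
      have "1 / d < real N" using n by (simp add: N_def)
      thus "1 / real N < d" using d(1) by (simp add: N_def field_simps)
    qed (simp add: N_def)
    have riem: "\<bar>integral {0..1} h - (1 / real N) *\<^sub>R (\<Sum>i<N. h (real i / real N))\<bar> \<le> \<eta>"
      unfolding real_norm_def[symmetric]
    proof (rule riemann_sum_bound[OF continuous_on_subset[OF conth] N(1)])
      fix x y :: real assume "x \<in> {0..1}" "y \<in> {0..1}" "\<bar>x - y\<bar> \<le> 1 / real N"
      thus "norm (h x - h y) \<le> \<eta>" using d(2)[of x y] N(2) by simp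
    qed simp
    hence riem': "(\<Sum>i<N. h (real i / real N)) \<le> N * (integral {0..1} h + \<eta>)"
      using N(1) by (simp add: field_simps abs_le_iff)
    define P where "P = (\<lambda>\<zeta>. \<Prod>k<N. f (cis (2 * pi * (real k / real N)) * \<zeta>))"
    have rotS: "cis a * \<zeta> \<in> S" if "cmod \<zeta> \<le> 1" for a \<zeta>
      using f(3) that by (auto simp: norm_mult subset_iff)
    have fexp: "cmod (f (cis (2 * pi * t))) \<le> exp (h t)" for t
    proof -
      have sq: "exp (ln y / 2) = sqrt y" if "y > 0" for y :: real
      proof -
        have "ln y / 2 = ln (sqrt y)" using that by (simp add: ln_sqrt)
        thus ?thesis using that by simp
      qed
      have "exp (h t) = sqrt ((cmod (f (cis (2 * pi * t))))\<^sup>2 + \<epsilon>)"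
        unfolding h_def by (rule sq[OF pos])
      thus ?thesis using \<epsilon> by (simp add: real_le_rsqrt)
    qed
    define B where "B = exp (N * (integral {0..1} h + 2 * \<eta>))"
    have "norm (P 0) \<le> B"
    proof (rule maximum_modulus_frontier[where S="cball 0 1" and f=P])
      have "continuous_on (cball 0 1) P"
        unfolding P_def by (intro continuous_intros continuous_on_compose2[OF contf]) (use rotS in auto)
      thus "continuous_on (closure (cball 0 1)) P" by simp
      have "(\<lambda>\<zeta>. f (cis a * \<zeta>)) holomorphic_on ball 0 1" for a
      proof -
        have "(f \<circ> (\<lambda>\<zeta>. cis a * \<zeta>)) holomorphic_on ball 0 1"
        proof (rule holomorphic_on_compose_gen[OF _ f(1)])
          show "(\<lambda>\<zeta>. cis a * \<zeta>) ` ball 0 1 \<subseteq> S" using rotS less_imp_le by fastforce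
        qed (intro holomorphic_intros)
        thus ?thesis by (simp add: o_def)
      qed
      thus "P holomorphic_on interior (cball 0 1)"
        unfolding P_def by (auto intro!: holomorphic_intros)
      fix \<zeta> :: complex assume "\<zeta> \<in> frontier (cball 0 1)"
      hence \<zeta>: "cmod \<zeta> = 1" by simp
      define \<alpha> where "\<alpha> = Arg2pi \<zeta> / (2 * pi)"
      have \<alpha>: "0 \<le> \<alpha>" "\<alpha> < 1"
        using Arg2pi_ge_0[of \<zeta>] Arg2pi_lt_2pi[of \<zeta>] by (auto simp: \<alpha>_def)
      have "2 * pi * \<alpha> = Arg2pi \<zeta>" by (simp add: \<alpha>_def)
      moreover have "cis (Arg2pi \<zeta>) = \<zeta>"
        unfolding cis_conv_exp by (metis Arg2pi_eq \<zeta> mult_1 of_real_1)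
      ultimately have \<alpha>\<zeta>: "\<zeta> = cis (2 * pi * \<alpha>)" by simp
      define j where "j = nat \<lfloor>\<alpha> * N\<rfloor>"
      define \<theta> where "\<theta> = \<alpha> - real j / N"
      have jj: "real j \<le> \<alpha> * N" "\<alpha> * N < real j + 1"
        using \<alpha>(1) N(1) by (auto simp: j_def of_nat_nat)
      have "real j / N \<le> \<alpha>" "\<alpha> < (real j + 1) / N"
        using jj N(1) by (simp_all add: pos_divide_le_eq pos_less_divide_eq)
      hence \<theta>: "0 \<le> \<theta>" "\<theta> < 1 / N" by (simp_all add: \<theta>_def add_divide_distrib)
      define Q where "Q = (\<lambda>k. f (cis (2 * pi * (\<theta> + real k / N))))"
      have per: "Q (k + N) = Q k" for k
      proof -
        have "2 * pi * (\<theta> + real (k + N) / N) = 2 * pi * (\<theta> + real k / N) + 2 * pi"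
          using N(1) by (simp add: field_simps)
        thus ?thesis by (simp add: Q_def cis_mult[symmetric])
      qed
      have "P \<zeta> = (\<Prod>k<N. Q (k + j))"
        unfolding P_def Q_def
      proof (rule prod.cong[OF refl])
        fix k
        have "2 * pi * (real k / N) + 2 * pi * \<alpha> = 2 * pi * (\<theta> + real (k + j) / N)"
          by (simp add: \<theta>_def field_simps add_divide_distrib)
        thus "f (cis (2 * pi * (real k / real N)) * \<zeta>) = f (cis (2 * pi * (\<theta> + real (k + j) / real N)))"
          by (simp add: \<alpha>\<zeta> cis_mult)
      qed
      also have "\<dots> = (\<Prod>k<N. Q k)" by (rule prod_shift_periodic[of Q N, OF per])
      finally have "norm (P \<zeta>) = (\<Prod>k<N. cmod (Q k))" by (simp add: prod_norm)
      also have "\<dots> \<le> (\<Prod>k<N. exp (h (real k / N) + \<eta>))"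
      proof (rule prod_mono, safe)
        fix k assume k: "k < N"
        have "cmod (Q k) \<le> exp (h (\<theta> + real k / N))" unfolding Q_def by (rule fexp)
        also have "\<dots> \<le> exp (h (real k / N) + \<eta>)"
        proof -
          have "real k + 1 \<le> N" using k by simp
          hence "real k / N + 1 / N \<le> 1" using N(1) by (simp add: divide_simps)
          hence "\<bar>h (\<theta> + real k / N) - h (real k / N)\<bar> < \<eta>"
            using \<theta> N k by (intro d(2)) auto
          thus ?thesis by simp
        qed
        finally show "cmod (Q k) \<le> exp (h (real k / N) + \<eta>)" .
      qed simp
      also have "\<dots> = exp ((\<Sum>k<N. h (real k / N)) + N * \<eta>)" by (simp add: exp_sum[symmetric] sum.distrib)
      also have "\<dots> \<le> B" unfolding B_def using riem' by (simp add: algebra_simps)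
      finally show "norm (P \<zeta>) \<le> B" .
    qed auto
    hence "cmod (f 0) ^ N \<le> B" by (simp add: P_def norm_power)
    hence "ln (cmod (f 0) ^ N) \<le> ln B" using f0 by (intro ln_mono) (auto simp: B_def)
    hence "N * ln (cmod (f 0)) \<le> N * (integral {0..1} h + 2 * \<eta>)" using f0 by (simp add: ln_realpow B_def)
    thus ?thesis using N(1) by simp
  qed
  show ?thesis
  proof (rule field_le_epsilon)
    fix e :: real assume "e > 0"
    thus "ln (cmod (f 0)) \<le> integral {0..1} h + e" using le[of "e / 2"] by simp
  qed
qed

text \<open>The right hand side is the positive part of \<open>ln x\<close> up to an error that is independent of \<open>x\<close>.\<close>

lemma ln_regularized_le:
  fixes x \<epsilon> :: real
  assumes "\<epsilon> > 0" "x \<ge> 0"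
  shows "ln (x\<^sup>2 + \<epsilon>) / 2 \<le> (if x \<le> 1 then 0 else ln x) + \<epsilon> / 2"
proof (cases "x \<le> 1")
  case True
  have "x\<^sup>2 \<le> 1" using True assms by (simp add: power_le_one)
  hence "ln (x\<^sup>2 + \<epsilon>) \<le> ln (1 + \<epsilon>)" using assms by (intro ln_mono) (auto simp: add_nonneg_pos)
  also have "\<dots> \<le> \<epsilon>" using assms by (intro ln_add_one_self_le_self) auto
  finally show ?thesis using True by simp
next
  case False
  hence x: "x > 1" by simp
  have x2: "x\<^sup>2 \<ge> 1" using x by (simp add: one_le_power)
  have "x\<^sup>2 + \<epsilon> \<le> x\<^sup>2 * (1 + \<epsilon>)" using x2 assms by (simp add: distrib_left mult_le_cancel_right1)
  hence "ln (x\<^sup>2 + \<epsilon>) \<le> ln (x\<^sup>2 * (1 + \<epsilon>))" using assms by (intro ln_mono) (auto simp: add_nonneg_pos)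
  also have "\<dots> = 2 * ln x + ln (1 + \<epsilon>)" using x assms by (simp add: ln_mult ln_realpow)
  also have "ln (1 + \<epsilon>) \<le> \<epsilon>" using assms by (intro ln_add_one_self_le_self) auto
  finally show ?thesis using False by simp
qed

lemma SUP_ln_regularized:
  fixes x :: real
  assumes x: "x \<ge> 0"
  shows "(SUP n. ennreal (- (ln (x\<^sup>2 + 1 / Suc n) / 2))) = e2ennreal (if x = 0 then \<infinity> else ereal (- ln x))"
proof (cases "x = 0")
  case True
  have "(SUP n. ennreal (- (ln (x\<^sup>2 + 1 / Suc n) / 2))) = \<infinity>"
    unfolding infinity_ennreal_def
  proof (rule ennreal_SUP_eq_top)
    fix k :: nat
    obtain n :: nat where n: "exp (2 * real k) < n" using reals_Archimedean2 by blast
    have "2 * real k = ln (exp (2 * real k))" by simp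
    also have "\<dots> \<le> ln (real (Suc n))" using n by (intro ln_mono) auto
    finally have "real k \<le> - (ln (x\<^sup>2 + 1 / Suc n) / 2)" using True by (simp add: ln_div)
    hence "of_nat k \<le> ennreal (- (ln (x\<^sup>2 + 1 / Suc n) / 2))"
      by (metis ennreal_leI ennreal_of_nat_eq_real_of_nat)
    thus "\<exists>n\<in>UNIV. of_nat k \<le> ennreal (- (ln (x\<^sup>2 + 1 / real (Suc n)) / 2))" by blast
  qed
  thus ?thesis using True by simp
next
  case False
  hence x: "x > 0" using assms by simp
  have inc: "incseq (\<lambda>n. ennreal (- (ln (x\<^sup>2 + 1 / Suc n) / 2)))"
  proof (rule incseq_SucI)
    fix n
    have "ln (x\<^sup>2 + 1 / Suc (Suc n)) \<le> ln (x\<^sup>2 + 1 / Suc n)"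
      using x by (intro ln_mono) (auto simp: add_pos_pos frac_le)
    thus "ennreal (- (ln (x\<^sup>2 + 1 / Suc n) / 2)) \<le> ennreal (- (ln (x\<^sup>2 + 1 / Suc (Suc n)) / 2))"
      by (intro ennreal_leI) simp
  qed
  have "(\<lambda>n. ennreal (- (ln (x\<^sup>2 + 1 / Suc n) / 2))) \<longlonglongrightarrow> ennreal (- (ln (x\<^sup>2 + 0) / 2))"
    by (intro tendsto_ennrealI tendsto_intros LIMSEQ_Suc[OF lim_const_over_n]) (use x in auto)
  moreover have "ln (x\<^sup>2 + 0) / 2 = ln x" using x by (simp add: ln_realpow)
  ultimately have "(\<lambda>n. ennreal (- (ln (x\<^sup>2 + 1 / Suc n) / 2))) \<longlonglongrightarrow> ennreal (- ln x)" by simp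
  from LIMSEQ_unique[OF LIMSEQ_SUP[OF inc] this] show ?thesis
    using False by (simp add: e2ennreal_ereal)
qed

text \<open>Let \<open>\<epsilon>\<close> tend to zero in \<open>ln_le_integral_regularized\<close>.  The positive and negative parts have to be
treated separately, as they are in \<open>circle_mean\<close>: the positive parts are dominated uniformly
(\<open>ln_regularized_le\<close>), the negative parts converge monotonically (\<open>SUP_ln_regularized\<close>).\<close>

theorem log_norm_le_circle_mean:
  assumes f: "f holomorphic_on S" "open S" "cball 0 1 \<subseteq> S"
  shows "log_norm f 0 \<le> circle_mean (log_norm f)"
proof (cases "f 0 = 0")
  case True thus ?thesis by (simp add: log_norm_def)
next
  case f0: False
  have contf: "continuous_on S f" by (rule holomorphic_on_imp_continuous_on[OF f(1)])
  have cisS: "cis t \<in> S" for t using f(3) by (simp add: subset_iff)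
  have contc: "continuous_on UNIV (\<lambda>t. f (cis t))"
    by (intro continuous_on_compose2[OF contf] continuous_intros) (use cisS in auto)
  have meas_f [measurable]: "(\<lambda>t. f (cis t)) \<in> borel_measurable borel"
    by (rule borel_measurable_continuous_onI[OF contc])
  have meas [measurable]: "(\<lambda>t. log_norm f (cis t)) \<in> borel_measurable borel"
    unfolding log_norm_def by measurable
  define x where "x = (\<lambda>t. cmod (f (cis (2 * pi * t))))"
  have [measurable]: "x \<in> borel_measurable borel" unfolding x_def by measurable
  have x0: "x t \<ge> 0" for t by (simp add: x_def)
  define L where "L = ln (cmod (f 0))"
  define a where "a = (\<lambda>(n::nat) t. ln ((x t)\<^sup>2 + 1 / Suc n) / 2)"
  have [measurable]: "a n \<in> borel_measurable borel" for n unfolding a_def by measurable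
  define I where "I = (\<lambda>F. \<integral>\<^sup>+ t. F t * indicator {0..1::real} t \<partial>lborel)"
  define P where "P = I (\<lambda>t. e2ennreal (log_norm f (cis (2 * pi * t))))"
  define Q where "Q = I (\<lambda>t. e2ennreal (- log_norm f (cis (2 * pi * t))))"
  have pos: "(x t)\<^sup>2 + 1 / Suc n > 0" for t n by (simp add: add_nonneg_pos)
  have conta: "continuous_on {0..1} (a n)" for n
    unfolding a_def x_def
    by (intro continuous_intros continuous_on_compose2[OF contc]) (use pos in \<open>auto simp: x_def less_imp_neq[symmetric]\<close>)
  have A: "I (\<lambda>t. ennreal (a n t)) \<noteq> \<infinity>" "I (\<lambda>t. ennreal (- a n t)) \<noteq> \<infinity>"
    "L \<le> enn2real (I (\<lambda>t. ennreal (a n t))) - enn2real (I (\<lambda>t. ennreal (- a n t)))" for n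
  proof -
    have int: "integrable lborel (\<lambda>t. indicator {0..1} t *\<^sub>R a n t)"
      using borel_integrable_atLeastAtMost'[OF conta] by (simp add: set_integrable_def)
    have e: "ennreal (indicator {0..1} t *\<^sub>R a n t) = ennreal (a n t) * indicator {0..1} t"
      "ennreal (- (indicator {0..1} t *\<^sub>R a n t)) = ennreal (- a n t) * indicator {0..1} t" for t
      by (auto simp: indicator_def)
    show "I (\<lambda>t. ennreal (a n t)) \<noteq> \<infinity>" "I (\<lambda>t. ennreal (- a n t)) \<noteq> \<infinity>"
      using int unfolding real_integrable_def e I_def by auto
    have "L \<le> integral {0..1} (a n)"
      unfolding L_def a_def x_def by (rule ln_le_integral_regularized[OF f f0]) simp
    also have "\<dots> = (\<integral>t. indicator {0..1} t *\<^sub>R a n t \<partial>lborel)"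
      using set_borel_integral_eq_integral(2)[OF borel_integrable_atLeastAtMost'[OF conta]]
      by (simp add: set_lebesgue_integral_def)
    also have "\<dots> = enn2real (I (\<lambda>t. ennreal (a n t))) - enn2real (I (\<lambda>t. ennreal (- a n t)))"
      unfolding real_lebesgue_integral_def[OF int] e I_def ..
    finally show "L \<le> enn2real (I (\<lambda>t. ennreal (a n t))) - enn2real (I (\<lambda>t. ennreal (- a n t)))" .
  qed
  have ep: "e2ennreal (log_norm f (cis (2 * pi * t))) = ennreal (if x t \<le> 1 then 0 else ln (x t))" for t
  proof -
    show ?thesis
    proof (cases "f (cis (2 * pi * t)) = 0")
      case True thus ?thesis by (simp add: log_norm_def x_def e2ennreal_neg)
    next
      case False
      hence "e2ennreal (log_norm f (cis (2 * pi * t))) = ennreal (ln (x t))"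
        by (simp add: log_norm_def x_def e2ennreal_ereal)
      moreover have "ln (x t) \<le> 0" if "x t \<le> 1" using that False by (simp add: x_def)
      ultimately show ?thesis by (simp add: ennreal_neg)
    qed
  qed
  have em: "e2ennreal (- log_norm f (cis (2 * pi * t))) = (SUP n. ennreal (- a n t))" for t
    using SUP_ln_regularized[OF x0[of t]] by (simp add: a_def log_norm_def x_def)
  have B: "I (\<lambda>t. ennreal (a n t)) \<le> P + ennreal (1 / Suc n / 2)" for n
  proof -
    have "I (\<lambda>t. ennreal (a n t)) \<le> I (\<lambda>t. e2ennreal (log_norm f (cis (2 * pi * t))) + ennreal (1 / Suc n / 2))"
      unfolding I_def
    proof (intro nn_integral_mono mult_right_mono)
      fix t
      have "a n t \<le> (if x t \<le> 1 then 0 else ln (x t)) + 1 / Suc n / 2"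
        unfolding a_def by (rule ln_regularized_le) (use x0 in auto)
      hence "ennreal (a n t) \<le> ennreal ((if x t \<le> 1 then 0 else ln (x t)) + 1 / Suc n / 2)" by (rule ennreal_leI)
      also have "\<dots> = ennreal (if x t \<le> 1 then 0 else ln (x t)) + ennreal (1 / Suc n / 2)"
        by (rule ennreal_plus) auto
      finally show "ennreal (a n t) \<le> e2ennreal (log_norm f (cis (2 * pi * t))) + ennreal (1 / Suc n / 2)"
        unfolding ep .
    qed auto
    also have "\<dots> = P + ennreal (1 / Suc n / 2)"
      unfolding I_def P_def distrib_right ep
      by (subst nn_integral_add) (auto simp: nn_integral_cmult_indicator)
    finally show ?thesis .
  qed
  have inc: "incseq (\<lambda>n t. ennreal (- a n t) * indicator {0..1} t)"
  proof (rule incseq_SucI, rule le_funI, rule mult_right_mono)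
    fix n t
    have "ln ((x t)\<^sup>2 + 1 / Suc (Suc n)) \<le> ln ((x t)\<^sup>2 + 1 / Suc n)"
    proof (rule ln_mono)
      show "0 < (x t)\<^sup>2 + 1 / Suc (Suc n)" by (rule pos)
    qed (simp add: frac_le)
    thus "ennreal (- a n t) \<le> ennreal (- a (Suc n) t)" unfolding a_def by (intro ennreal_leI) simp
  qed auto
  have C: "Q = (SUP n. I (\<lambda>t. ennreal (- a n t)))"
  proof -
    have "Q = (\<integral>\<^sup>+ t. (SUP n. ennreal (- a n t) * indicator {0..1} t) \<partial>lborel)"
      unfolding Q_def I_def em by (simp add: SUP_mult_right_ennreal)
    also have "\<dots> = (SUP n. I (\<lambda>t. ennreal (- a n t)))"
      unfolding I_def by (rule nn_integral_monotone_convergence_SUP[OF inc]) measurable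
    finally show ?thesis .
  qed
  have Pfin: "P < \<infinity>"
  proof -
    have "compact (f ` cball 0 1)" by (rule compact_continuous_image[OF continuous_on_subset[OF contf f(3)] compact_cball])
    then obtain M where M: "\<And>z. z \<in> cball 0 1 \<Longrightarrow> cmod (f z) \<le> M"
      using compact_imp_bounded bounded_iff by (metis imageI)
    have "P \<le> I (\<lambda>_. ennreal \<bar>ln \<bar>M\<bar>\<bar>)"
      unfolding P_def I_def ep
    proof (intro nn_integral_mono mult_right_mono ennreal_leI)
      fix t
      have "x t \<le> \<bar>M\<bar>" using M[of "cis (2 * pi * t)"] by (simp add: x_def)
      hence "ln (x t) \<le> ln \<bar>M\<bar>" if "x t > 1" using that by (intro ln_mono) auto
      thus "(if x t \<le> 1 then 0 else ln (x t)) \<le> \<bar>ln \<bar>M\<bar>\<bar>" by auto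
    qed auto
    also have "\<dots> < \<infinity>" by (simp add: I_def nn_integral_cmult_indicator ennreal_mult_less_top)
    finally show ?thesis .
  qed
  define pr where "pr = enn2real P"
  have Pr: "P = ennreal pr" "pr \<ge> 0" using Pfin by (auto simp: pr_def)
  have q_le: "enn2real (I (\<lambda>t. ennreal (- a n t))) \<le> pr - L" for n
  proof (rule field_le_epsilon)
    fix e :: real assume e: "e > 0"
    obtain k :: nat where k: "1 / e < k" using reals_Archimedean2 by blast
    define m where "m = max n k"
    have "1 / e < real (Suc m)" using k by (simp add: m_def)
    hence me: "1 / Suc m / 2 < e" using e by (simp add: field_simps)
    have "I (\<lambda>t. ennreal (- a n t)) \<le> I (\<lambda>t. ennreal (- a m t))"
      unfolding I_def by (intro nn_integral_mono le_funD[OF incseqD[OF inc]]) (simp add: m_def)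
    hence "enn2real (I (\<lambda>t. ennreal (- a n t))) \<le> enn2real (I (\<lambda>t. ennreal (- a m t)))"
      using A(2)[of m] by (intro enn2real_mono) (auto simp: less_top)
    also have "\<dots> \<le> enn2real (I (\<lambda>t. ennreal (a m t))) - L" using A(3)[of m] by simp
    also have "enn2real (I (\<lambda>t. ennreal (a m t))) \<le> enn2real (ennreal pr + ennreal (1 / Suc m / 2))"
      using B[of m] Pr by (intro enn2real_mono) auto
    also have "\<dots> = pr + 1 / Suc m / 2" using Pr(2) by (simp add: ennreal_plus[symmetric] del: ennreal_plus)
    finally show "enn2real (I (\<lambda>t. ennreal (- a n t))) \<le> pr - L + e" using me by simp
  qed
  have Qle: "Q \<le> ennreal (pr - L)"
    unfolding C
  proof (rule SUP_least)
    fix n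
    have "I (\<lambda>t. ennreal (- a n t)) = ennreal (enn2real (I (\<lambda>t. ennreal (- a n t))))"
      using A(2)[of n] by (simp add: less_top)
    also have "\<dots> \<le> ennreal (pr - L)" by (rule ennreal_leI[OF q_le])
    finally show "I (\<lambda>t. ennreal (- a n t)) \<le> ennreal (pr - L)" .
  qed
  have prL: "pr - L \<ge> 0" using q_le[of 0] enn2real_nonneg order_trans by blast
  define qr where "qr = enn2real Q"
  have Qfin: "Q < \<infinity>" using Qle by (auto simp: order.strict_iff_order top_unique)
  have Qr: "Q = ennreal qr" "qr \<ge> 0" "qr \<le> pr - L"
    using Qfin Qle prL by (auto simp: qr_def enn2real_leI)
  have scale: "(\<integral>\<^sup>+ t \<in> {0..2*pi}. g (cis t) \<partial>lborel) = ennreal (2 * pi) * I (\<lambda>t. g (cis (2 * pi * t)))"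
    if [measurable]: "(\<lambda>t. g (cis t)) \<in> borel_measurable borel" for g :: "complex \<Rightarrow> ennreal"
  proof -
    have "(\<integral>\<^sup>+ t \<in> {0..2*pi}. g (cis t) \<partial>lborel) =
       ennreal \<bar>2 * pi\<bar> * (\<integral>\<^sup>+ t. g (cis (0 + 2 * pi * t)) * indicator {0..2*pi} (0 + 2 * pi * t) \<partial>lborel)"
      by (rule nn_integral_real_affine[where f="\<lambda>t. g (cis t) * indicator {0..2*pi} t"]) auto
    also have "(\<integral>\<^sup>+ t. g (cis (0 + 2 * pi * t)) * indicator {0..2*pi} (0 + 2 * pi * t) \<partial>lborel) = I (\<lambda>t. g (cis (2 * pi * t)))"
    proof -
      have npi: "\<not> pi \<le> 0" using pi_gt_zero by linarith
      show ?thesis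
        unfolding I_def by (intro nn_integral_cong) (auto simp: indicator_def zero_le_mult_iff npi)
    qed
    finally show ?thesis by simp
  qed
  have "circle_mean (log_norm f) = (enn2ereal (ennreal (2 * pi) * P) - enn2ereal (ennreal (2 * pi) * Q)) / ereal (2 * pi)"
    unfolding circle_mean_def P_def Q_def
    by (subst (1 2) scale[symmetric]) auto
  also have "\<dots> = ereal (pr - qr)"
    using Pr Qr by (simp add: ennreal_mult[symmetric] field_simps)
  finally show ?thesis using Qr(3) f0 by (simp add: log_norm_def L_def)
qed

section \<open>Measurability and integrability near a point\<close>

text \<open>Even if \<open>X\<close> has no regular point, the supremum \<open>vol_measure X\<close> is over a nonempty set of measures, and so
its sigma-algebra is that of the Borel sets.\<close>

lemma slice_chart_empty: "slice_chart X {} {} {} (\<lambda>z. z) (\<lambda>z. z)"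
  by (simp add: slice_chart_def holo_map_on_def holo_on_def)

lemma sets_vol_measure: "sets (vol_measure X) = sets borel"
proof -
  let ?A = "{chart_vol I V G | I U V F G. slice_chart X I U V F G}"
  have ne: "?A \<noteq> {}" using slice_chart_empty[of X] by blast
  have sp: "space m = UNIV" "sets m = sets borel" if "m \<in> ?A" for m
    using that by (auto simp: chart_vol_def)
  have "sets (Sup ?A) = sigma_sets UNIV (\<Union>m\<in>?A. sets m)"
    by (rule sets_Sup_eq[OF sp(1) ne])
  also have "(\<Union>m\<in>?A. sets m) = (\<Union>m\<in>?A. sets borel)" by (rule SUP_cong[OF refl sp(2)])
  also have "\<dots> = sets borel" by (simp only: UN_constant ne if_False)
  also have "sigma_sets UNIV (sets borel) = sets borel"
    using sets.sigma_sets_eq[of borel] by simp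
  finally show ?thesis by (simp add: vol_measure_def)
qed

lemma space_vol_measure: "space (vol_measure X) = UNIV"
  using sets_eq_imp_space_eq[OF sets_vol_measure] by simp

lemma borel_in_completion: "A \<in> sets borel \<Longrightarrow> A \<in> sets (completion (vol_measure X))"
  by (simp add: sets_completionI_sets sets_vol_measure)

lemma open_Int_reg_part_sets:
  assumes "open U" "reg_part X \<in> sets borel"
  shows "U \<inter> reg_part X \<in> sets (completion (vol_measure X))"
  by (rule borel_in_completion[OF sets.Int[OF borel_open[OF assms(1)] assms(2)]])

lemma mem_reg_part_iff: "p \<in> reg_part X \<longleftrightarrow> p \<in> X \<and> (\<exists>I U V F G. slice_chart X I U V F G \<and> p \<in> U)"
  unfolding reg_part_def submanifold_at_def by blast

lemma reg_part_eq: "reg_part X = X \<inter> \<Union>{U. \<exists>I V F G. slice_chart X I U V F G}"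
  unfolding set_eq_iff mem_reg_part_iff Int_iff Union_iff mem_Collect_eq by blast

lemma analytic_subset_borel:
  assumes "open \<Omega>" "analytic_subset \<Omega> X" shows "X \<in> sets borel"
proof -
  have "open (\<Omega> - X)"
    unfolding open_subopen[of "\<Omega> - X"]
  proof
    fix p assume p: "p \<in> \<Omega> - X"
    then obtain U S where U': "open U \<and> p \<in> U \<and> U \<subseteq> \<Omega> \<and> finite S \<and> (\<forall>g\<in>S. holo_on g U) \<and>
        X \<inter> U = {z\<in>U. \<forall>g\<in>S. g z = 0}"
      using assms(2) unfolding analytic_subset_def by (meson DiffD1)
    hence U: "open U" "p \<in> U" "U \<subseteq> \<Omega>" "X \<inter> U = {z\<in>U. \<forall>g\<in>S. g z = 0}" and hol: "\<And>g. g \<in> S \<Longrightarrow> holo_on g U"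
      by simp_all
    have "\<not> (\<forall>g\<in>S. g p = 0)" using p U(2,4) by blast
    then obtain g where g: "g \<in> S" "g p \<noteq> 0" by blast
    define T where "T = U \<inter> g -` (-{0})"
    have "open T" unfolding T_def
      by (rule continuous_open_preimage[OF holo_on_imp_continuous_on[OF hol[OF g(1)]] U(1)]) auto
    moreover have "T \<subseteq> \<Omega> - X" using U(3,4) g(1) by (auto simp: T_def)
    moreover have "p \<in> T" using U(2) g(2) by (simp add: T_def)
    ultimately show "\<exists>T. open T \<and> p \<in> T \<and> T \<subseteq> \<Omega> - X" by blast
  qed
  hence "\<Omega> - (\<Omega> - X) \<in> sets borel" using assms(1) by (intro sets.Diff borel_open)
  moreover have "\<Omega> - (\<Omega> - X) = X" using assms(2) by (auto simp: analytic_subset_def)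
  ultimately show ?thesis by simp
qed

lemma reg_part_borel:
  assumes "open \<Omega>" "analytic_subset \<Omega> X" shows "reg_part X \<in> sets borel"
  unfolding reg_part_eq
  by (intro sets.Int analytic_subset_borel[OF assms] borel_open open_Union) (auto simp: slice_chart_def)

definition meas_near :: "(complex^'n) set \<Rightarrow> complex^'n \<Rightarrow> (complex^'n \<Rightarrow> 'b :: topological_space) \<Rightarrow> bool" where
  "meas_near X p h \<longleftrightarrow> (\<exists>U. open U \<and> p \<in> U \<and>
     h \<in> borel_measurable (restrict_space (completion (vol_measure X)) (U \<inter> reg_part X)))"

lemma meas_nearE:
  assumes "meas_near X p f" "meas_near X p g"
  obtains U where "open U" "p \<in> U"
    "f \<in> borel_measurable (restrict_space (completion (vol_measure X)) (U \<inter> reg_part X))"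
    "g \<in> borel_measurable (restrict_space (completion (vol_measure X)) (U \<inter> reg_part X))"
proof -
  obtain U1 where 1: "open U1" "p \<in> U1" "f \<in> borel_measurable (restrict_space (completion (vol_measure X)) (U1 \<inter> reg_part X))"
    using assms(1) by (auto simp: meas_near_def)
  obtain U2 where 2: "open U2" "p \<in> U2" "g \<in> borel_measurable (restrict_space (completion (vol_measure X)) (U2 \<inter> reg_part X))"
    using assms(2) by (auto simp: meas_near_def)
  show ?thesis
  proof (rule that[of "U1 \<inter> U2"])
    show "f \<in> borel_measurable (restrict_space (completion (vol_measure X)) (U1 \<inter> U2 \<inter> reg_part X))"
      by (rule measurable_restrict_mono[OF 1(3)]) auto
    show "g \<in> borel_measurable (restrict_space (completion (vol_measure X)) (U1 \<inter> U2 \<inter> reg_part X))"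
      by (rule measurable_restrict_mono[OF 2(3)]) auto
  qed (use 1 2 in auto)
qed

lemma meas_near_compose:
  "meas_near X p f \<Longrightarrow> h \<in> borel_measurable borel \<Longrightarrow> meas_near X p (\<lambda>z. h (f z))"
  unfolding meas_near_def by (auto intro: measurable_compose[of _ _ borel])

lemma meas_near_mult:
  fixes f g :: "complex^'n \<Rightarrow> ennreal"
  assumes "meas_near X p f" "meas_near X p g" shows "meas_near X p (\<lambda>z. f z * g z)"
  using meas_nearE[OF assms] by (metis (mono_tags, lifting) borel_measurable_times_ennreal meas_near_def)

lemma integrable_near_meas: "integrable_near X p h \<Longrightarrow> meas_near X p h"
  unfolding integrable_near_def meas_near_def by blast

lemma integrable_near_add:
  assumes R: "reg_part X \<in> sets borel" and f: "integrable_near X p f" and g: "integrable_near X p g"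
  shows "integrable_near X p (\<lambda>z. f z + g z)"
proof -
  let ?M = "completion (vol_measure X)"
  obtain U1 where 1: "open U1" "p \<in> U1" "f \<in> borel_measurable (restrict_space ?M (U1 \<inter> reg_part X))"
      "(\<integral>\<^sup>+ z \<in> U1 \<inter> reg_part X. f z \<partial>?M) < \<infinity>"
    using f by (auto simp: integrable_near_def)
  obtain U2 where 2: "open U2" "p \<in> U2" "g \<in> borel_measurable (restrict_space ?M (U2 \<inter> reg_part X))"
      "(\<integral>\<^sup>+ z \<in> U2 \<inter> reg_part X. g z \<partial>?M) < \<infinity>"
    using g by (auto simp: integrable_near_def)
  define A where "A = (U1 \<inter> U2) \<inter> reg_part X"
  have A: "A \<in> sets ?M" unfolding A_def by (rule open_Int_reg_part_sets[OF open_Int[OF 1(1) 2(1)] R])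
  have fA: "f \<in> borel_measurable (restrict_space ?M A)"
    by (rule measurable_restrict_mono[OF 1(3)]) (auto simp: A_def)
  have gA: "g \<in> borel_measurable (restrict_space ?M A)"
    by (rule measurable_restrict_mono[OF 2(3)]) (auto simp: A_def)
  have fi: "(\<lambda>z. f z * indicator A z) \<in> borel_measurable ?M" "(\<lambda>z. g z * indicator A z) \<in> borel_measurable ?M"
    using fA gA A borel_measurable_restrict_space_iff_ennreal[of A ?M] by (auto simp: space_vol_measure)
  have "(\<integral>\<^sup>+ z \<in> A. (f z + g z) \<partial>?M) = (\<integral>\<^sup>+ z \<in> A. f z \<partial>?M) + (\<integral>\<^sup>+ z \<in> A. g z \<partial>?M)"
    unfolding distrib_right by (rule nn_integral_add[OF fi])
  also have "\<dots> \<le> (\<integral>\<^sup>+ z \<in> U1 \<inter> reg_part X. f z \<partial>?M) + (\<integral>\<^sup>+ z \<in> U2 \<inter> reg_part X. g z \<partial>?M)"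
    by (intro add_mono nn_integral_mono mult_left_mono) (auto simp: A_def indicator_def)
  also have "\<dots> < \<infinity>" using 1 2 by simp
  finally have "(\<integral>\<^sup>+ z \<in> A. (f z + g z) \<partial>?M) < \<infinity>" .
  moreover have "(\<lambda>z. f z + g z) \<in> borel_measurable (restrict_space ?M A)" using fA gA by measurable
  ultimately show ?thesis
    unfolding integrable_near_def using 1 2 by (intro exI[of _ "U1 \<inter> U2"]) (auto simp: A_def)
qed

text \<open>A majorization almost everywhere is what is available for a weight that equals 1 almost everywhere.\<close>

lemma integrable_near_dominated:
  assumes f: "integrable_near X p f" and h: "meas_near X p h" and W: "open W" "p \<in> W"
    and le: "AE z in vol_measure X. z \<in> W \<inter> reg_part X \<longrightarrow> h z \<le> f z"
  shows "integrable_near X p h"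
proof -
  let ?M = "completion (vol_measure X)"
  obtain U1 where 1: "open U1" "p \<in> U1" "f \<in> borel_measurable (restrict_space ?M (U1 \<inter> reg_part X))"
      "(\<integral>\<^sup>+ z \<in> U1 \<inter> reg_part X. f z \<partial>?M) < \<infinity>"
    using f by (auto simp: integrable_near_def)
  obtain U2 where 2: "open U2" "p \<in> U2" "h \<in> borel_measurable (restrict_space ?M (U2 \<inter> reg_part X))"
    using h by (auto simp: meas_near_def)
  define U where "U = U1 \<inter> U2 \<inter> W"
  have "(\<integral>\<^sup>+ z \<in> U \<inter> reg_part X. h z \<partial>?M) \<le> (\<integral>\<^sup>+ z \<in> U1 \<inter> reg_part X. f z \<partial>?M)"
  proof (rule nn_integral_mono_AE)
    show "AE z in ?M. h z * indicator (U \<inter> reg_part X) z \<le> f z * indicator (U1 \<inter> reg_part X) z"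
      using AE_completion[OF le] by eventually_elim (auto simp: U_def indicator_def)
  qed
  also have "\<dots> < \<infinity>" by (rule 1(4))
  finally have "(\<integral>\<^sup>+ z \<in> U \<inter> reg_part X. h z \<partial>?M) < \<infinity>" .
  moreover have "h \<in> borel_measurable (restrict_space ?M (U \<inter> reg_part X))"
    by (rule measurable_restrict_mono[OF 2(3)]) (auto simp: U_def)
  ultimately show ?thesis unfolding integrable_near_def using 1 2 W
    by (intro exI[of _ U]) (auto simp: U_def)
qed

lemma integrable_near_cmult:
  assumes R: "reg_part X \<in> sets borel" and f: "integrable_near X p f"
  shows "integrable_near X p (\<lambda>z. ennreal c * f z)"
proof -
  let ?M = "completion (vol_measure X)"
  obtain U where U: "open U" "p \<in> U" "f \<in> borel_measurable (restrict_space ?M (U \<inter> reg_part X))"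
      "(\<integral>\<^sup>+ z \<in> U \<inter> reg_part X. f z \<partial>?M) < \<infinity>"
    using f by (auto simp: integrable_near_def)
  have A: "U \<inter> reg_part X \<in> sets ?M" by (rule open_Int_reg_part_sets[OF U(1) R])
  have fi: "(\<lambda>z. f z * indicator (U \<inter> reg_part X) z) \<in> borel_measurable ?M"
    using U(3) A borel_measurable_restrict_space_iff_ennreal[of "U \<inter> reg_part X" ?M] by (auto simp: space_vol_measure)
  have "(\<integral>\<^sup>+ z \<in> U \<inter> reg_part X. (ennreal c * f z) \<partial>?M) = ennreal c * (\<integral>\<^sup>+ z \<in> U \<inter> reg_part X. f z \<partial>?M)"
    unfolding mult.assoc by (rule nn_integral_cmult[OF fi])
  also have "\<dots> < \<infinity>" using U(4) by (simp add: ennreal_mult_less_top)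
  finally have "(\<integral>\<^sup>+ z \<in> U \<inter> reg_part X. (ennreal c * f z) \<partial>?M) < \<infinity>" .
  moreover have "(\<lambda>z. ennreal c * f z) \<in> borel_measurable (restrict_space ?M (U \<inter> reg_part X))"
    using U(3) by measurable
  ultimately show ?thesis unfolding integrable_near_def using U by blast
qed

section \<open>Plurisubharmonic functions on the regular part\<close>

lemma slice_chart_restrict:
  assumes "slice_chart X I W V F G" "open U"
  shows "slice_chart X I (W \<inter> U) (V \<inter> G -` U) F G"
proof -
  have c: "open W" "open V" "holo_map_on F W" "holo_map_on G V"
     "\<And>z. z \<in> W \<Longrightarrow> F z \<in> V \<and> G (F z) = z" "\<And>w. w \<in> V \<Longrightarrow> G w \<in> W \<and> F (G w) = w"
     "F ` (X \<inter> W) = coord_space I \<inter> V"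
    using assms(1) unfolding slice_chart_def by auto
  have "open (V \<inter> G -` U)"
    by (rule continuous_open_preimage[OF holo_map_on_imp_continuous_on[OF c(4)] c(2) assms(2)])
  moreover have "F ` (X \<inter> (W \<inter> U)) = coord_space I \<inter> (V \<inter> G -` U)"
  proof (intro equalityI subsetI)
    fix w assume "w \<in> F ` (X \<inter> (W \<inter> U))"
    thus "w \<in> coord_space I \<inter> (V \<inter> G -` U)" using c(5,7) by force
  next
    fix w assume w: "w \<in> coord_space I \<inter> (V \<inter> G -` U)"
    then obtain z where "z \<in> X \<inter> W" "w = F z" using c(7) by (metis IntD1 IntD2 IntI imageE)
    thus "w \<in> F ` (X \<inter> (W \<inter> U))" using c(5)[of z] w by auto
  qed
  ultimately show ?thesis
    unfolding slice_chart_def using c assms(2) holo_map_on_subset[OF c(3)] holo_map_on_subset[OF c(4)] by auto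
qed

text \<open>Charts can be made small, and their domain contains a ball around the parameter of a given point.\<close>

lemma chart_ball:
  assumes "q \<in> U" "q \<in> reg_part X" "open U"
  obtains I W V F G w0 r where "slice_chart X I W V F G" "W \<subseteq> U" "w0 \<in> coord_space I" "r > 0"
    "ball w0 r \<subseteq> V" "G w0 = q"
proof -
  obtain I W V F G where ch: "slice_chart X I W V F G" "q \<in> W" "q \<in> X"
    using assms(2) by (auto simp: mem_reg_part_iff)
  have ch': "slice_chart X I (W \<inter> U) (V \<inter> G -` U) F G" by (rule slice_chart_restrict[OF ch(1) assms(3)])
  have Fq: "F q \<in> coord_space I \<inter> (V \<inter> G -` U)" "G (F q) = q"
    using ch' ch(2,3) assms(1) unfolding slice_chart_def by blast+
  obtain r where r: "r > 0" "ball (F q) r \<subseteq> V \<inter> G -` U"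
    using ch' Fq(1) unfolding slice_chart_def by (meson IntD2 openE)
  show ?thesis using that[OF ch' _ _ r] Fq by auto
qed

lemma chart_points:
  assumes "slice_chart X I W V F G" "w \<in> coord_space I" "w \<in> V"
  shows "G w \<in> X" "G w \<in> W" "G w \<in> reg_part X"
proof -
  have "w \<in> F ` (X \<inter> W)" using assms unfolding slice_chart_def by blast
  then obtain z where "z \<in> X \<inter> W" "w = F z" by blast
  moreover have "G (F z) = z" if "z \<in> W" for z using assms(1) that unfolding slice_chart_def by blast
  ultimately show 1: "G w \<in> X" "G w \<in> W" by auto
  show "G w \<in> reg_part X" using 1 assms(1) unfolding mem_reg_part_iff by blast
qed

lemma openin_chart_image:
  assumes ch: "slice_chart X I W V F G" and WU: "W \<subseteq> U" and B: "open B" "B \<subseteq> V"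
  shows "openin (top_of_set (U \<inter> reg_part X)) (G ` (coord_space I \<inter> B))"
proof -
  have c: "open W" "holo_map_on F W"
     "\<And>z. z \<in> W \<Longrightarrow> F z \<in> V \<and> G (F z) = z" "\<And>w. w \<in> V \<Longrightarrow> G w \<in> W \<and> F (G w) = w"
     "F ` (X \<inter> W) = coord_space I \<inter> V"
    using ch unfolding slice_chart_def by auto
  have o: "open (W \<inter> F -` B)"
    by (rule continuous_open_preimage[OF holo_map_on_imp_continuous_on[OF c(2)] c(1) B(1)])
  have "G ` (coord_space I \<inter> B) = (U \<inter> reg_part X) \<inter> (W \<inter> F -` B)"
  proof (intro equalityI subsetI)
    fix z assume "z \<in> G ` (coord_space I \<inter> B)"
    then obtain w where w: "z = G w" "w \<in> coord_space I" "w \<in> B" by blast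
    hence "w \<in> V" using B(2) by blast
    thus "z \<in> (U \<inter> reg_part X) \<inter> (W \<inter> F -` B)"
      using chart_points[OF ch w(2)] c(4)[of w] WU w by auto
  next
    fix z assume z: "z \<in> (U \<inter> reg_part X) \<inter> (W \<inter> F -` B)"
    hence "z \<in> X \<inter> W" by (simp add: mem_reg_part_iff)
    hence "F z \<in> coord_space I" using c(5) by blast
    hence "F z \<in> coord_space I \<inter> B" using z by simp
    moreover have "G (F z) = z" using z c(3) by blast
    ultimately show "z \<in> G ` (coord_space I \<inter> B)" by (metis imageI)
  qed
  thus ?thesis using o by (simp add: openin_open_Int)
qed

lemma coord_space_line: "a \<in> coord_space I \<Longrightarrow> b \<in> coord_space I \<Longrightarrow> a + \<zeta> *s b \<in> coord_space I"
  by (simp add: coord_space_def)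

lemma convex_coord_space: "convex (coord_space I)"
  unfolding convex_def coord_space_def by simp

lemma psh_on_reg_mean:
  assumes "psh_on_reg X U u" "slice_chart X I W V F G" "W \<subseteq> U" "a \<in> coord_space I" "b \<in> coord_space I"
    "\<And>\<zeta>. cmod \<zeta> \<le> 1 \<Longrightarrow> a + \<zeta> *s b \<in> V"
  shows "u (G a) \<le> circle_mean (\<lambda>\<zeta>. u (G (a + \<zeta> *s b)))"
  using assms unfolding psh_on_reg_def by blast

text \<open>A plurisubharmonic function that is not identically \<open>-\<infinity>\<close> on any component is not
  identically \<open>-\<infinity>\<close> on any open set: a circle that has an arc in the interior of the set where
  \<open>u = -\<infinity>\<close> has mean \<open>-\<infinity>\<close>, so that this interior is also closed.\<close>

lemma psh_on_finite_somewhere: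
  assumes psh: "psh_on X U u" and U: "open U"
    and N: "openin (top_of_set (U \<inter> reg_part X)) N" "N \<noteq> {}"
  shows "\<exists>z\<in>N. u z \<noteq> -\<infinity>"
proof (rule ccontr)
  assume all: "\<not> (\<exists>z\<in>N. u z \<noteq> -\<infinity>)"
  let ?T = "top_of_set (U \<inter> reg_part X)"
  have reg: "psh_on_reg X U u" and comp: "\<And>C. C \<in> components (U \<inter> reg_part X) \<Longrightarrow> \<exists>z\<in>C. u z \<noteq> -\<infinity>"
    using psh unfolding psh_on_def by auto
  define Z where "Z = \<Union>{N. openin ?T N \<and> (\<forall>z\<in>N. u z = -\<infinity>)}"
  have oZ: "openin ?T Z" unfolding Z_def by (rule openin_Union) auto
  have uZ: "u z = -\<infinity>" if "z \<in> Z" for z using that by (auto simp: Z_def)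
  have ZI: "N' \<subseteq> Z" if "openin ?T N'" "\<And>z. z \<in> N' \<Longrightarrow> u z = -\<infinity>" for N' using that by (auto simp: Z_def)
  have nbhd: "\<exists>P. openin ?T P \<and> q \<in> P \<and> (P \<inter> Z = {} \<or> P \<subseteq> Z)" if q: "q \<in> U \<inter> reg_part X" for q
  proof -
    obtain I W V F G w0 r where ch: "slice_chart X I W V F G" "W \<subseteq> U" "w0 \<in> coord_space I" "r > 0"
      "ball w0 r \<subseteq> V" "G w0 = q"
      using chart_ball[of q U X] q U by blast
    have hG: "continuous_on V G" using ch(1) holo_map_on_imp_continuous_on unfolding slice_chart_def by blast
    have "u q < \<infinity>" using reg q unfolding psh_on_reg_def by blast
    then obtain t where t: "u q < ereal t" by (metis less_PInf_Ex_of_nat ereal_infty_less(1) less_ereal.simps(1) ereal_dense2)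
    have "openin ?T {z \<in> U \<inter> reg_part X. u z < ereal t}" using reg unfolding psh_on_reg_def by blast
    then obtain T where T: "open T" "{z \<in> U \<inter> reg_part X. u z < ereal t} = (U \<inter> reg_part X) \<inter> T"
      unfolding openin_open by blast
    have "open (V \<inter> G -` T)"
      by (rule continuous_open_preimage[OF hG _ T(1)]) (use ch(1) in \<open>auto simp: slice_chart_def\<close>)
    moreover have "w0 \<in> V \<inter> G -` T" using ch T(2) q t by auto
    ultimately obtain s0 where s0: "s0 > 0" "ball w0 s0 \<subseteq> V \<inter> G -` T" by (meson openE)
    define s where "s = min r s0"
    have s: "s > 0" "ball w0 s \<subseteq> V" "ball w0 s \<subseteq> G -` T" using s0 ch(4,5) by (auto simp: s_def)
    have bd: "u (G w) < ereal t" if "w \<in> coord_space I" "w \<in> ball w0 s" for w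
    proof -
      have "w \<in> V" using s that by blast
      hence "G w \<in> (U \<inter> reg_part X) \<inter> T" using chart_points[OF ch(1) that(1)] ch(2) s that by blast
      thus ?thesis using T(2) by blast
    qed
    define P where "P = G ` (coord_space I \<inter> ball w0 (s / 4))"
    have oP: "openin ?T P" unfolding P_def
      by (rule openin_chart_image[OF ch(1,2)]) (use s in auto)
    have qP: "q \<in> P" using ch(3,6) s(1) by (auto simp: P_def)
    have "P \<subseteq> Z" if ne: "P \<inter> Z \<noteq> {}"
    proof (rule ZI[OF oP])
      obtain w where w: "w \<in> coord_space I" "w \<in> ball w0 (s / 4)" "G w \<in> Z" using ne by (auto simp: P_def)
      obtain TZ where TZ: "open TZ" "Z = (U \<inter> reg_part X) \<inter> TZ" using oZ unfolding openin_open by blast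
      have "open (V \<inter> G -` TZ)"
        by (rule continuous_open_preimage[OF hG _ TZ(1)]) (use ch(1) in \<open>auto simp: slice_chart_def\<close>)
      moreover have "w \<in> V \<inter> G -` TZ" using w TZ(2) s by auto
      ultimately obtain \<eta> where \<eta>: "\<eta> > 0" "ball w \<eta> \<subseteq> V \<inter> G -` TZ" by (meson openE)
      fix z assume "z \<in> P"
      then obtain a where a: "a \<in> coord_space I" "a \<in> ball w0 (s / 4)" "z = G a" by (auto simp: P_def)
      define b where "b = w - a"
      have b: "b \<in> coord_space I" using a w by (simp add: b_def coord_space_def)
      have nb: "norm b < s / 2"
        using dist_triangle[of w a w0] a w by (simp add: b_def dist_norm norm_minus_commute)
      have line: "a + \<zeta> *s b \<in> ball w0 s" if "cmod \<zeta> \<le> 1" for \<zeta>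
      proof -
        have "norm (\<zeta> *s b) \<le> 1 * norm b" unfolding norm_smult using that by (intro mult_right_mono) auto
        moreover have "dist w0 (a + \<zeta> *s b) \<le> dist w0 a + norm (\<zeta> *s b)"
          using dist_triangle[of w0 "a + \<zeta> *s b" a] by (simp add: dist_norm)
        ultimately show ?thesis using a(2) nb s(1) by simp
      qed
      have lin: "a + \<zeta> *s b \<in> coord_space I" for \<zeta> by (rule coord_space_line[OF a(1) b])
      have lineV: "a + \<zeta> *s b \<in> V" if "cmod \<zeta> \<le> 1" for \<zeta> using line[OF that] s by blast
      have "((\<lambda>t. cis t) \<longlongrightarrow> cis 0) (at_right 0)" by (intro tendsto_intros)
      hence "\<forall>\<^sub>F t in at_right 0. dist (cis t) (cis 0) < \<eta> / (norm b + 1)"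
        by (rule tendstoD) (use \<eta> in \<open>auto intro!: divide_pos_pos add_nonneg_pos\<close>)
      then obtain \<tau>0 where \<tau>0: "\<tau>0 > 0" "\<And>t. 0 < t \<Longrightarrow> t < \<tau>0 \<Longrightarrow> cmod (cis t - 1) < \<eta> / (norm b + 1)"
        unfolding eventually_at_right_field by (auto simp: dist_norm)
      define \<tau> where "\<tau> = min (\<tau>0 / 2) 1"
      have pi1: "1 \<le> 2 * pi" using pi_gt3 by simp
      have "circle_mean (\<lambda>\<zeta>. u (G (a + \<zeta> *s b))) = -\<infinity>"
      proof (rule circle_mean_minf[where B=t and \<tau>=\<tau>])
        fix \<zeta> :: complex assume "cmod \<zeta> = 1"
        thus "u (G (a + \<zeta> *s b)) \<le> ereal t" using bd[OF lin line] by (simp add: less_imp_le)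
      next
        fix x :: real assume x: "0 \<le> x" "x \<le> \<tau>"
        have "cmod (cis x - 1) < \<eta> / (norm b + 1)"
        proof (cases "x = 0")
          case True thus ?thesis using \<eta>(1) by (simp add: add_nonneg_pos)
        next
          case False thus ?thesis using \<tau>0 x by (intro \<tau>0(2)) (auto simp: \<tau>_def)
        qed
        hence "cmod (cis x - 1) * (norm b + 1) < \<eta>" by (simp add: pos_less_divide_eq add_nonneg_pos)
        moreover have "cmod (cis x - 1) * norm b \<le> cmod (cis x - 1) * (norm b + 1)" by (intro mult_left_mono) auto
        moreover have "a + cis x *s b - w = (cis x - 1) *s b" by (simp add: b_def vec_eq_iff algebra_simps)
        hence "dist w (a + cis x *s b) = cmod (cis x - 1) * norm b"
          by (metis dist_commute dist_norm norm_smult)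
        ultimately have "a + cis x *s b \<in> ball w \<eta>" by simp
        hence "G (a + cis x *s b) \<in> TZ" using \<eta>(2) by blast
        moreover have "G (a + cis x *s b) \<in> U \<inter> reg_part X"
          using chart_points[OF ch(1) lin lineV, of "cis x"] ch(2) by auto
        ultimately have "G (a + cis x *s b) \<in> Z" using TZ(2) by blast
        thus "u (G (a + cis x *s b)) = -\<infinity>" by (rule uZ)
      qed (use \<tau>0 pi1 in \<open>auto simp: \<tau>_def\<close>)
      moreover have "u (G a) \<le> circle_mean (\<lambda>\<zeta>. u (G (a + \<zeta> *s b)))"
        by (rule psh_on_reg_mean[OF reg ch(1,2) a(1) b lineV])
      ultimately show "u z = -\<infinity>" using a(3) by simp
    qed
    thus ?thesis using oP qP by blast
  qed
  have cZ: "openin ?T ((U \<inter> reg_part X) - Z)"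
  proof (subst openin_subopen, safe)
    fix q assume q: "q \<in> U" "q \<in> reg_part X" "q \<notin> Z"
    then obtain P where P: "openin ?T P" "q \<in> P" "P \<inter> Z = {} \<or> P \<subseteq> Z" using nbhd by blast
    hence "P \<subseteq> U \<inter> reg_part X - Z" using q openin_subset[OF P(1)] by auto
    thus "\<exists>T. openin ?T T \<and> q \<in> T \<and> T \<subseteq> U \<inter> reg_part X - Z" using P by blast
  qed
  obtain q where q: "q \<in> N" using N(2) by blast
  have qU: "q \<in> U \<inter> reg_part X" using openin_subset[OF N(1)] q by auto
  have qZ: "q \<in> Z" using ZI[OF N(1)] all q by blast
  define C where "C = connected_component_set (U \<inter> reg_part X) q"
  have C: "C \<in> components (U \<inter> reg_part X)" using qU by (auto simp: C_def components_def)
  have CU: "C \<subseteq> U \<inter> reg_part X" unfolding C_def by (rule connected_component_subset)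
  have "C \<subseteq> Z"
  proof (rule ccontr)
    assume nC: "\<not> C \<subseteq> Z"
    obtain T1 where T1: "open T1" "Z = (U \<inter> reg_part X) \<inter> T1" using oZ unfolding openin_open by blast
    obtain T2 where T2: "open T2" "(U \<inter> reg_part X) - Z = (U \<inter> reg_part X) \<inter> T2"
      using cZ unfolding openin_open by blast
    have T1C: "x \<in> T1 \<longleftrightarrow> x \<in> Z" if "x \<in> C" for x using T1(2) CU that by blast
    have T2C: "x \<in> T2 \<longleftrightarrow> x \<notin> Z" if "x \<in> C" for x using T2(2) CU that by blast
    have "connected C" by (simp add: C_def)
    moreover have "T1 \<inter> T2 \<inter> C = {}" using T1C T2C by blast
    moreover have "C \<subseteq> T1 \<union> T2" using T1C T2C by blast
    ultimately have "T1 \<inter> C = {} \<or> T2 \<inter> C = {}" using connectedD[OF _ T1(1) T2(1)] by blast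
    moreover have "q \<in> C" using qU by (simp add: C_def)
    ultimately show False using T1C T2C qZ nC by blast
  qed
  thus False using comp[OF C] uZ by blast
qed

text \<open>The part of \<open>psh_on\<close> that is inherited by smaller sets and by scaled functions and maxima: everything
but the requirement not to be identically \<open>-\<infinity>\<close> on a component.\<close>

definition sub_psh :: "(complex^'n) set \<Rightarrow> (complex^'n) set \<Rightarrow> (complex^'n \<Rightarrow> ereal) \<Rightarrow> bool" where
  "sub_psh X U u \<longleftrightarrow>
     u \<in> borel_measurable (restrict_space (completion (vol_measure X)) (U \<inter> reg_part X)) \<and>
     psh_on_reg X U u \<and>
     (\<forall>p\<in>U \<inter> sing_part X. \<exists>W M. open W \<and> p \<in> W \<and> (\<forall>z\<in>W \<inter> U \<inter> reg_part X. u z \<le> ereal M))"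

lemma psh_on_iff_sub_psh:
  "psh_on X U u \<longleftrightarrow> sub_psh X U u \<and> (\<forall>C\<in>components (U \<inter> reg_part X). \<exists>z\<in>C. u z \<noteq> -\<infinity>)"
  unfolding psh_on_def sub_psh_def by blast

lemma sub_pshI:
  assumes "u \<in> borel_measurable (restrict_space (completion (vol_measure X)) (U \<inter> reg_part X))"
    "\<And>z. z \<in> U \<inter> reg_part X \<Longrightarrow> u z < \<infinity>"
    "\<And>t. openin (top_of_set (U \<inter> reg_part X)) {z \<in> U \<inter> reg_part X. u z < t}"
    "\<And>I W V F G a b. slice_chart X I W V F G \<Longrightarrow> W \<subseteq> U \<Longrightarrow> a \<in> coord_space I \<Longrightarrow> b \<in> coord_space I \<Longrightarrow>
       (\<And>\<zeta>. cmod \<zeta> \<le> 1 \<Longrightarrow> a + \<zeta> *s b \<in> V) \<Longrightarrow> u (G a) \<le> circle_mean (\<lambda>\<zeta>. u (G (a + \<zeta> *s b)))"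
    "\<And>p. p \<in> U \<inter> sing_part X \<Longrightarrow> \<exists>W M. open W \<and> p \<in> W \<and> (\<forall>z\<in>W \<inter> U \<inter> reg_part X. u z \<le> ereal M)"
  shows "sub_psh X U u"
  unfolding sub_psh_def psh_on_reg_def
  by (intro conjI ballI allI impI; (elim conjE)?; rule assms;
    (assumption | (erule allE, erule mp, assumption) | simp)?)

lemma sub_pshD:
  assumes "sub_psh X U u"
  shows "u \<in> borel_measurable (restrict_space (completion (vol_measure X)) (U \<inter> reg_part X))"
    "\<And>z. z \<in> U \<inter> reg_part X \<Longrightarrow> u z < \<infinity>"
    "\<And>t. openin (top_of_set (U \<inter> reg_part X)) {z \<in> U \<inter> reg_part X. u z < t}"
    "\<And>I W V F G a b. slice_chart X I W V F G \<Longrightarrow> W \<subseteq> U \<Longrightarrow> a \<in> coord_space I \<Longrightarrow> b \<in> coord_space I \<Longrightarrow>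
       (\<And>\<zeta>. cmod \<zeta> \<le> 1 \<Longrightarrow> a + \<zeta> *s b \<in> V) \<Longrightarrow> u (G a) \<le> circle_mean (\<lambda>\<zeta>. u (G (a + \<zeta> *s b)))"
    "\<And>p. p \<in> U \<inter> sing_part X \<Longrightarrow> \<exists>W M. open W \<and> p \<in> W \<and> (\<forall>z\<in>W \<inter> U \<inter> reg_part X. u z \<le> ereal M)"
proof -
  note u = assms[unfolded sub_psh_def psh_on_reg_def]
  show "u \<in> borel_measurable (restrict_space (completion (vol_measure X)) (U \<inter> reg_part X))"
    "\<And>z. z \<in> U \<inter> reg_part X \<Longrightarrow> u z < \<infinity>"
    "\<And>t. openin (top_of_set (U \<inter> reg_part X)) {z \<in> U \<inter> reg_part X. u z < t}"
    using u by simp_all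
  show "u (G a) \<le> circle_mean (\<lambda>\<zeta>. u (G (a + \<zeta> *s b)))"
    if "slice_chart X I W V F G" "W \<subseteq> U" "a \<in> coord_space I" "b \<in> coord_space I"
      "\<And>\<zeta>. cmod \<zeta> \<le> 1 \<Longrightarrow> a + \<zeta> *s b \<in> V" for I W V F G a b
    by (rule u[THEN conjunct2, THEN conjunct1, THEN conjunct2, THEN conjunct2, rule_format, OF conjI[OF that(1,2)] that(3,4)])
      (rule that(5))
  show "\<exists>W M. open W \<and> p \<in> W \<and> (\<forall>z\<in>W \<inter> U \<inter> reg_part X. u z \<le> ereal M)"
    if "p \<in> U \<inter> sing_part X" for p
    by (rule u[THEN conjunct2, THEN conjunct2, rule_format, OF that])
qed

lemma sub_psh_subset:
  assumes u: "sub_psh X U u" and VU: "V \<subseteq> U"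
  shows "sub_psh X V u"
proof (rule sub_pshI)
  show "u \<in> borel_measurable (restrict_space (completion (vol_measure X)) (V \<inter> reg_part X))"
    by (rule measurable_restrict_mono[OF sub_pshD(1)[OF u]]) (use VU in auto)
  fix t
  obtain T where T: "open T" "{z \<in> U \<inter> reg_part X. u z < t} = (U \<inter> reg_part X) \<inter> T"
    using sub_pshD(3)[OF u, of t] unfolding openin_open by blast
  have "{z \<in> V \<inter> reg_part X. u z < t} = (V \<inter> reg_part X) \<inter> T" using T(2) VU by blast
  thus "openin (top_of_set (V \<inter> reg_part X)) {z \<in> V \<inter> reg_part X. u z < t}"
    using T(1) by (simp add: openin_open_Int)
next
  fix p assume p: "p \<in> V \<inter> sing_part X"
  hence "p \<in> U \<inter> sing_part X" using VU by blast
  then obtain W M where "open W" "p \<in> W" "\<forall>z\<in>W \<inter> U \<inter> reg_part X. u z \<le> ereal M"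
    using sub_pshD(5)[OF u] by blast
  thus "\<exists>W M. open W \<and> p \<in> W \<and> (\<forall>z\<in>W \<inter> V \<inter> reg_part X. u z \<le> ereal M)" using VU by blast
next
  show "u z < \<infinity>" if "z \<in> V \<inter> reg_part X" for z
    by (rule sub_pshD(2)[OF u]) (use that VU in blast)
next
  fix I W Y F G a b
  assume h: "slice_chart X I W Y F G" "W \<subseteq> V" "a \<in> coord_space I" "b \<in> coord_space I"
    "\<And>\<zeta>. cmod \<zeta> \<le> 1 \<Longrightarrow> a + \<zeta> *s b \<in> Y"
  show "u (G a) \<le> circle_mean (\<lambda>\<zeta>. u (G (a + \<zeta> *s b)))"
    by (rule sub_pshD(4)[OF u h(1) order_trans[OF h(2) VU] h(3,4)]) (rule h(5))
qed

lemma sub_psh_max: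
  assumes u: "sub_psh X U u" and v: "sub_psh X U v"
  shows "sub_psh X U (\<lambda>z. max (u z) (v z))"
proof (rule sub_pshI)
  show "(\<lambda>z. max (u z) (v z)) \<in> borel_measurable (restrict_space (completion (vol_measure X)) (U \<inter> reg_part X))"
    using sub_pshD(1)[OF u] sub_pshD(1)[OF v] by measurable
  show "max (u z) (v z) < \<infinity>" if "z \<in> U \<inter> reg_part X" for z
    using sub_pshD(2)[OF u that] sub_pshD(2)[OF v that] by (simp add: max_def)
  fix t
  have "{z \<in> U \<inter> reg_part X. max (u z) (v z) < t} = {z \<in> U \<inter> reg_part X. u z < t} \<inter> {z \<in> U \<inter> reg_part X. v z < t}"
    by auto
  thus "openin (top_of_set (U \<inter> reg_part X)) {z \<in> U \<inter> reg_part X. max (u z) (v z) < t}"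
    using openin_Int[OF sub_pshD(3)[OF u] sub_pshD(3)[OF v]] by simp
next
  fix I W V F G a b
  assume h: "slice_chart X I W V F G" "W \<subseteq> U" "a \<in> coord_space I" "b \<in> coord_space I"
    "\<And>\<zeta>. cmod \<zeta> \<le> 1 \<Longrightarrow> a + \<zeta> *s b \<in> V"
  have "u (G a) \<le> circle_mean (\<lambda>\<zeta>. u (G (a + \<zeta> *s b)))" by (rule sub_pshD(4)[OF u h])
  also have "\<dots> \<le> circle_mean (\<lambda>\<zeta>. max (u (G (a + \<zeta> *s b))) (v (G (a + \<zeta> *s b))))"
    by (rule circle_mean_mono) simp
  finally have 1: "u (G a) \<le> circle_mean (\<lambda>\<zeta>. max (u (G (a + \<zeta> *s b))) (v (G (a + \<zeta> *s b))))" .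
  have "v (G a) \<le> circle_mean (\<lambda>\<zeta>. v (G (a + \<zeta> *s b)))" by (rule sub_pshD(4)[OF v h])
  also have "\<dots> \<le> circle_mean (\<lambda>\<zeta>. max (u (G (a + \<zeta> *s b))) (v (G (a + \<zeta> *s b))))"
    by (rule circle_mean_mono) simp
  finally show "max (u (G a)) (v (G a)) \<le> circle_mean (\<lambda>\<zeta>. max (u (G (a + \<zeta> *s b))) (v (G (a + \<zeta> *s b))))"
    using 1 by simp
next
  fix p assume p: "p \<in> U \<inter> sing_part X"
  obtain W1 M1 where 1: "open W1" "p \<in> W1" "\<And>z. z \<in> W1 \<inter> U \<inter> reg_part X \<Longrightarrow> u z \<le> ereal M1"
    using sub_pshD(5)[OF u p] by blast
  obtain W2 M2 where 2: "open W2" "p \<in> W2" "\<And>z. z \<in> W2 \<inter> U \<inter> reg_part X \<Longrightarrow> v z \<le> ereal M2"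
    using sub_pshD(5)[OF v p] by blast
  have "max (u z) (v z) \<le> ereal (max M1 M2)" if "z \<in> (W1 \<inter> W2) \<inter> U \<inter> reg_part X" for z
  proof -
    have "u z \<le> ereal M1" "v z \<le> ereal M2" using 1(3)[of z] 2(3)[of z] that by auto
    thus ?thesis by (metis ereal_max max.mono)
  qed
  thus "\<exists>W M. open W \<and> p \<in> W \<and> (\<forall>z\<in>W \<inter> U \<inter> reg_part X. max (u z) (v z) \<le> ereal M)"
    using 1(1,2) 2(1,2) by (intro exI[of _ "W1 \<inter> W2"] exI[of _ "max M1 M2"]) auto
qed

lemma ereal_cmult_less_iff: "c > 0 \<Longrightarrow> ereal c * x < t \<longleftrightarrow> x < ereal (1 / c) * t"
  by (cases x; cases t) (auto simp: field_simps)

lemma sub_psh_scale: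
  assumes u: "sub_psh X U u" and c: "c > 0"
  shows "sub_psh X U (\<lambda>z. ereal c * u z)"
proof (rule sub_pshI)
  show "(\<lambda>z. ereal c * u z) \<in> borel_measurable (restrict_space (completion (vol_measure X)) (U \<inter> reg_part X))"
    using sub_pshD(1)[OF u] by measurable
  show "ereal c * u z < \<infinity>" if "z \<in> U \<inter> reg_part X" for z
    using sub_pshD(2)[OF u that] c by (cases "u z") auto
  fix t
  show "openin (top_of_set (U \<inter> reg_part X)) {z \<in> U \<inter> reg_part X. ereal c * u z < t}"
    unfolding ereal_cmult_less_iff[OF c] by (rule sub_pshD(3)[OF u])
next
  fix I W V F G a b
  assume h: "slice_chart X I W V F G" "W \<subseteq> U" "a \<in> coord_space I" "b \<in> coord_space I"
    "\<And>\<zeta>. cmod \<zeta> \<le> 1 \<Longrightarrow> a + \<zeta> *s b \<in> V"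
  show "ereal c * u (G a) \<le> circle_mean (\<lambda>\<zeta>. ereal c * u (G (a + \<zeta> *s b)))"
    unfolding circle_mean_scale[OF c] using sub_pshD(4)[OF u h] c by (intro ereal_mult_left_mono) auto
next
  fix p assume p: "p \<in> U \<inter> sing_part X"
  obtain W M where 1: "open W" "p \<in> W" "\<And>z. z \<in> W \<inter> U \<inter> reg_part X \<Longrightarrow> u z \<le> ereal M"
    using sub_pshD(5)[OF u p] by blast
  have "ereal c * u z \<le> ereal (c * M)" if "z \<in> W \<inter> U \<inter> reg_part X" for z
    using 1(3)[OF that] c by (cases "u z") auto
  thus "\<exists>W M. open W \<and> p \<in> W \<and> (\<forall>z\<in>W \<inter> U \<inter> reg_part X. ereal c * u z \<le> ereal M)"
    using 1(1,2) by blast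
qed

text \<open>A supremum of plurisubharmonic functions need not be upper semicontinuous.  Here it is, because
\<open>u k \<le> - k\<close>: above any level only finitely many of the functions matter.\<close>

lemma sub_psh_SUP:
  fixes u :: "nat \<Rightarrow> complex^'n \<Rightarrow> ereal"
  assumes u: "\<And>k. sub_psh X U (u k)" and le: "\<And>k z. z \<in> U \<inter> reg_part X \<Longrightarrow> u k z \<le> - ereal k"
  shows "sub_psh X U (\<lambda>z. SUP k. u k z)"
proof (rule sub_pshI)
  have le0: "(SUP k. u k z) \<le> 0" if "z \<in> U \<inter> reg_part X" for z
    by (rule SUP_least, rule order_trans[OF le[OF that]]) simp
  show "(\<lambda>z. SUP k. u k z) \<in> borel_measurable (restrict_space (completion (vol_measure X)) (U \<inter> reg_part X))"
    by (rule borel_measurable_SUP) (simp, rule sub_pshD(1)[OF u])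
  show "(SUP k. u k z) < \<infinity>" if "z \<in> U \<inter> reg_part X" for z
    using le0[OF that] by (rule le_less_trans) simp
  fix t
  let ?T = "top_of_set (U \<inter> reg_part X)"
  show "openin ?T {z \<in> U \<inter> reg_part X. (SUP k. u k z) < t}"
  proof (subst openin_subopen, safe)
    fix q assume q: "q \<in> U" "q \<in> reg_part X" "(SUP k. u k q) < t"
    then obtain s where s: "(SUP k. u k q) < s" "s < t" using dense by blast
    obtain K :: nat where K: "- ereal (real K) \<le> s"
    proof (cases s)
      case (real r)
      obtain K :: nat where "- r \<le> real K" using real_arch_simple by blast
      thus ?thesis using that[of K] real by simp
    qed (use s that in auto)
    define P where "P = (\<Inter>k\<in>{..K}. {z \<in> U \<inter> reg_part X. u k z < s})"
    have "openin ?T P" unfolding P_def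
      by (rule openin_INT2) (simp, simp, rule sub_pshD(3)[OF u])
    moreover have "u k q < s" for k
      by (rule le_less_trans[OF _ s(1)]) (rule SUP_upper, simp)
    hence "q \<in> P" unfolding P_def using q by simp
    moreover have "P \<subseteq> {z \<in> U \<inter> reg_part X. (SUP k. u k z) < t}"
    proof
      fix z assume z: "z \<in> P"
      hence zU: "z \<in> U \<inter> reg_part X" by (auto simp: P_def)
      have "u k z \<le> s" for k
      proof (cases "k \<le> K")
        case True thus ?thesis using z by (auto simp: P_def intro: less_imp_le)
      next
        case False
        have "u k z \<le> - ereal k" by (rule le[OF zU])
        also have "\<dots> \<le> - ereal (real K)" using False by simp
        finally show ?thesis using K by simp
      qed
      hence "(SUP k. u k z) \<le> s" by (rule SUP_least)
      thus "z \<in> {z \<in> U \<inter> reg_part X. (SUP k. u k z) < t}" using zU s(2) by auto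
    qed
    ultimately show "\<exists>P. openin ?T P \<and> q \<in> P \<and> P \<subseteq> {z \<in> U \<inter> reg_part X. (SUP k. u k z) < t}" by blast
  qed
next
  fix I W V F G a b
  assume h: "slice_chart X I W V F G" "W \<subseteq> U" "a \<in> coord_space I" "b \<in> coord_space I"
    "\<And>\<zeta>. cmod \<zeta> \<le> 1 \<Longrightarrow> a + \<zeta> *s b \<in> V"
  show "(SUP k. u k (G a)) \<le> circle_mean (\<lambda>\<zeta>. SUP k. u k (G (a + \<zeta> *s b)))"
  proof (rule SUP_least)
    fix k
    have "u k (G a) \<le> circle_mean (\<lambda>\<zeta>. u k (G (a + \<zeta> *s b)))" by (rule sub_pshD(4)[OF u h])
    also have "\<dots> \<le> circle_mean (\<lambda>\<zeta>. SUP k. u k (G (a + \<zeta> *s b)))"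
      by (rule circle_mean_mono) (rule SUP_upper, simp)
    finally show "u k (G a) \<le> circle_mean (\<lambda>\<zeta>. SUP k. u k (G (a + \<zeta> *s b)))" .
  qed
next
  fix p assume "p \<in> U \<inter> sing_part X"
  have "(SUP k. u k z) \<le> ereal 0" if "z \<in> U \<inter> reg_part X" for z
    by (rule SUP_least, rule order_trans[OF le[OF that]]) simp
  thus "\<exists>W M. open W \<and> p \<in> W \<and> (\<forall>z\<in>W \<inter> U \<inter> reg_part X. (SUP k. u k z) \<le> ereal M)"
    by (intro exI[of _ UNIV] exI[of _ 0]) auto
qed

lemma borel_measurable_continuous_on_reg:
  fixes f :: "complex^'n \<Rightarrow> 'b :: topological_space"
  assumes "continuous_on A f"
  shows "f \<in> borel_measurable (restrict_space (completion (vol_measure X)) A)"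
proof -
  have "f \<in> borel_measurable (restrict_space borel A)"
    by (rule borel_measurable_continuous_on_restrict[OF assms])
  moreover have "sets (restrict_space borel A) \<subseteq> sets (restrict_space (completion (vol_measure X)) A)"
    unfolding sets_restrict_space using borel_in_completion by (intro image_mono subsetI)
  ultimately show ?thesis
    using measurable_mono[of borel borel "restrict_space borel A" "restrict_space (completion (vol_measure X)) A"]
    by (auto simp: space_restrict_space space_vol_measure)
qed

lemma log_norm_less_iff: "log_norm f z < ereal r \<longleftrightarrow> norm (f z) < exp r"
proof (cases "f z = 0")
  case False
  hence "exp (ln (norm (f z))) = norm (f z)" by simp
  hence "ln (norm (f z)) < r \<longleftrightarrow> norm (f z) < exp r" using exp_less_cancel_iff[of "ln (norm (f z))" r] by simp
  thus ?thesis using False by (simp add: log_norm_def)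
qed (simp add: log_norm_def)

lemma log_norm_less_infinity: "log_norm f z < \<infinity>"
  by (simp add: log_norm_def)

text \<open>On a complex line in a chart \<open>f\<close> is a holomorphic function of one variable, and the sub-mean value
inequality is Jensen's.\<close>

lemma sub_psh_log_norm:
  fixes g :: "complex^'n \<Rightarrow> complex"
  assumes U: "open U" and g: "holo_on g U" and eq: "\<And>z. z \<in> X \<inter> U \<Longrightarrow> f z = g z"
  shows "sub_psh X U (log_norm f)"
proof (rule sub_pshI)
  have contg: "continuous_on U g" by (rule holo_on_imp_continuous_on[OF g])
  have eqR: "f z = g z" if "z \<in> U \<inter> reg_part X" for z using that eq by (auto simp: mem_reg_part_iff)
  have "continuous_on (U \<inter> reg_part X) f"
    by (rule continuous_on_eq[OF continuous_on_subset[OF contg Int_lower1] eqR[symmetric]])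
  hence [measurable]: "f \<in> borel_measurable (restrict_space (completion (vol_measure X)) (U \<inter> reg_part X))"
    by (rule borel_measurable_continuous_on_reg)
  show "log_norm f \<in> borel_measurable (restrict_space (completion (vol_measure X)) (U \<inter> reg_part X))"
    unfolding log_norm_def by measurable
  show "log_norm f z < \<infinity>" for z by (rule log_norm_less_infinity)
  fix t :: ereal
  let ?T = "top_of_set (U \<inter> reg_part X)"
  show "openin ?T {z \<in> U \<inter> reg_part X. log_norm f z < t}"
  proof (cases t)
    case (real r)
    have "open (U \<inter> (\<lambda>z. norm (g z)) -` {..<exp r})"
      by (intro continuous_open_preimage U continuous_intros contg)
    moreover have "{z \<in> U \<inter> reg_part X. log_norm f z < t} = (U \<inter> reg_part X) \<inter> (U \<inter> (\<lambda>z. norm (g z)) -` {..<exp r})"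
      using eqR by (auto simp: real log_norm_less_iff)
    ultimately show ?thesis by (simp add: openin_open_Int)
  next
    case PInf
    have "{z \<in> U \<inter> reg_part X. log_norm f z < t} = U \<inter> reg_part X"
      using PInf log_norm_less_infinity[of f] by auto
    thus ?thesis by simp
  qed simp
next
  fix I W V F G a b
  assume h: "slice_chart X I W V F G" "W \<subseteq> U" "a \<in> coord_space I" "b \<in> coord_space I"
    "\<And>\<zeta>. cmod \<zeta> \<le> 1 \<Longrightarrow> a + \<zeta> *s b \<in> V"
  have c: "open V" "holo_map_on G V" "\<And>w. w \<in> V \<Longrightarrow> G w \<in> W" using h(1) unfolding slice_chart_def by auto
  have "holo_on (\<lambda>w. g (G w)) V" by (rule holo_on_compose[OF g c(2)]) (use c(3) h(2) in blast)
  from holo_on_line[OF this, of a b]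
  have hol: "(\<lambda>\<zeta>. g (G (a + \<zeta> *s b))) holomorphic_on {\<zeta>. a + \<zeta> *s b \<in> V}" .
  have feq: "f (G (a + \<zeta> *s b)) = g (G (a + \<zeta> *s b))" if "cmod \<zeta> \<le> 1" for \<zeta>
  proof (rule eq)
    show "G (a + \<zeta> *s b) \<in> X \<inter> U"
      using chart_points[OF h(1) coord_space_line[OF h(3,4)] h(5)[OF that]] h(2) by blast
  qed
  have "log_norm f (G a) = log_norm (\<lambda>\<zeta>. g (G (a + \<zeta> *s b))) 0"
    using feq[of 0] by (simp add: log_norm_def)
  also have "\<dots> \<le> circle_mean (log_norm (\<lambda>\<zeta>. g (G (a + \<zeta> *s b))))"
    by (rule log_norm_le_circle_mean[OF hol open_line[OF c(1)]]) (use h(5) in auto)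
  also have "\<dots> \<le> circle_mean (\<lambda>\<zeta>. log_norm f (G (a + \<zeta> *s b)))"
    by (rule circle_mean_mono) (simp add: log_norm_def feq)
  finally show "log_norm f (G a) \<le> circle_mean (\<lambda>\<zeta>. log_norm f (G (a + \<zeta> *s b)))" .
next
  fix p assume p: "p \<in> U \<inter> sing_part X"
  have contg: "continuous_on U g" by (rule holo_on_imp_continuous_on[OF g])
  define W where "W = U \<inter> (\<lambda>z. norm (g z)) -` {..<norm (g p) + 1}"
  have "open W" unfolding W_def by (intro continuous_open_preimage U continuous_intros contg)
  moreover have "p \<in> W" using p by (simp add: W_def)
  moreover have "log_norm f z \<le> ereal (ln (norm (g p) + 1))" if "z \<in> W \<inter> U \<inter> reg_part X" for z
  proof -
    have "f z = g z" using that eq by (auto simp: mem_reg_part_iff)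
    hence "norm (f z) < exp (ln (norm (g p) + 1))" using that by (simp add: W_def add_nonneg_pos)
    thus ?thesis unfolding log_norm_less_iff[symmetric] by (rule less_imp_le)
  qed
  ultimately show "\<exists>W M. open W \<and> p \<in> W \<and> (\<forall>z\<in>W \<inter> U \<inter> reg_part X. log_norm f z \<le> ereal M)" by blast
qed

text \<open>The maximum is finite where the first function is, and by \<open>psh_on_finite_somewhere\<close> there are such points
in every component of the smaller neighbourhood.\<close>

lemma psh_near_max:
  assumes u: "psh_near X p u" and v: "sub_psh X V v" "open V" "p \<in> V"
  shows "psh_near X p (\<lambda>z. max (u z) (v z))"
proof -
  obtain U where U: "open U" "p \<in> U" "psh_on X U u" using u by (auto simp: psh_near_def)
  let ?W = "U \<inter> V"
  have "sub_psh X ?W (\<lambda>z. max (u z) (v z))"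
    by (rule sub_psh_max[OF sub_psh_subset[OF U(3)[unfolded psh_on_iff_sub_psh, THEN conjunct1]] sub_psh_subset[OF v(1)]])
      simp_all
  moreover have "\<exists>z\<in>C. max (u z) (v z) \<noteq> -\<infinity>" if C: "C \<in> components (?W \<inter> reg_part X)" for C
  proof -
    obtain q where q: "q \<in> C" using in_components_nonempty[OF C] by blast
    have qW: "q \<in> ?W" "q \<in> reg_part X" using in_components_subset[OF C] q by auto
    obtain I W V' F G w0 r where ch: "slice_chart X I W V' F G" "W \<subseteq> ?W" "w0 \<in> coord_space I" "r > 0"
      "ball w0 r \<subseteq> V'" "G w0 = q"
      using chart_ball[OF qW open_Int[OF U(1) v(2)]] by blast
    define N where "N = G ` (coord_space I \<inter> ball w0 r)"
    have oN: "openin (top_of_set (U \<inter> reg_part X)) N"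
      unfolding N_def by (rule openin_chart_image[OF ch(1)]) (use ch in auto)
    have "holo_map_on G V'" using ch(1) unfolding slice_chart_def by blast
    hence "continuous_on (coord_space I \<inter> ball w0 r) G"
      using holo_map_on_imp_continuous_on continuous_on_subset ch(5) by blast
    hence "connected N" unfolding N_def
      by (intro connected_continuous_image convex_connected convex_Int convex_coord_space convex_ball)
    moreover have "q \<in> N" using ch(3,4,6) by (auto simp: N_def)
    moreover have "N \<subseteq> ?W \<inter> reg_part X" unfolding N_def
    proof (rule image_subsetI)
      fix w assume "w \<in> coord_space I \<inter> ball w0 r"
      hence "w \<in> coord_space I" "w \<in> V'" using ch(5) by blast+
      from chart_points[OF ch(1) this] show "G w \<in> ?W \<inter> reg_part X" using ch(2) by blast
    qed
    ultimately have "N \<subseteq> C" using q by (intro components_maximal[OF C]) auto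
    moreover obtain z where "z \<in> N" "u z \<noteq> -\<infinity>"
      using psh_on_finite_somewhere[OF U(3,1) oN] \<open>q \<in> N\<close> by blast
    ultimately show ?thesis by (intro bexI[of _ z]) (auto simp: max_def)
  qed
  ultimately have "psh_on X ?W (\<lambda>z. max (u z) (v z))" by (simp add: psh_on_iff_sub_psh)
  thus ?thesis unfolding psh_near_def using U v by (intro exI[of _ ?W]) auto
qed

lemma psh_near_scale:
  assumes u: "psh_near X p u" and c: "c > 0"
  shows "psh_near X p (\<lambda>z. ereal c * u z)"
proof -
  obtain U where U: "open U" "p \<in> U" "psh_on X U u" using u by (auto simp: psh_near_def)
  have "ereal c * x \<noteq> -\<infinity>" if "x \<noteq> -\<infinity>" for x using that c by (cases x) auto
  hence "psh_on X U (\<lambda>z. ereal c * u z)"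
    using U(3) sub_psh_scale[OF _ c] unfolding psh_on_iff_sub_psh by blast
  thus ?thesis using U by (auto simp: psh_near_def)
qed

lemma sub_psh_bounded_above:
  assumes u: "sub_psh X U u" "open U" "p \<in> U" "p \<in> X"
  obtains W M where "open W" "p \<in> W" "\<And>z. z \<in> W \<inter> reg_part X \<Longrightarrow> u z \<le> ereal M"
proof (cases "p \<in> reg_part X")
  case True
  hence "u p < \<infinity>" using sub_pshD(2)[OF u(1)] u(3) by blast
  then obtain t where t: "u p < ereal t"
    using ereal_dense2[of "u p" \<infinity>] by blast
  obtain T where T: "open T" "{z \<in> U \<inter> reg_part X. u z < ereal t} = (U \<inter> reg_part X) \<inter> T"
    using sub_pshD(3)[OF u(1), of "ereal t"] unfolding openin_open by blast
  show ?thesis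
  proof (rule that[of "U \<inter> T" t])
    show "p \<in> U \<inter> T" using T(2) True u(3) t by blast
    fix z assume "z \<in> U \<inter> T \<inter> reg_part X"
    hence "u z < ereal t" using T(2) by blast
    thus "u z \<le> ereal t" by simp
  qed (use u T in auto)
next
  case False
  hence "p \<in> U \<inter> sing_part X" using u by (simp add: sing_part_def)
  then obtain W M where "open W" "p \<in> W" "\<forall>z\<in>W \<inter> U \<inter> reg_part X. u z \<le> ereal M"
    using sub_pshD(5)[OF u(1)] by blast
  thus ?thesis using u by (intro that[of "W \<inter> U" M]) auto
qed

section \<open>Weights\<close>

lemma ereal_exp_simps [simp]:
  "ereal_exp (ereal r) = ennreal (exp r)" "ereal_exp \<infinity> = \<infinity>" "ereal_exp (-\<infinity>) = 0"
proof -
  show "ereal_exp (ereal r) = ennreal (exp r)" by (simp add: ereal_exp_def)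
  show "ereal_exp \<infinity> = \<infinity>" unfolding ereal_exp_def infinity_ereal_def by simp
  show "ereal_exp (-\<infinity>) = 0" unfolding ereal_exp_def MInfty_eq_minfinity[symmetric] by (simp only: ereal.case)
qed

lemma ereal_exp_mono: "x \<le> y \<Longrightarrow> ereal_exp x \<le> ereal_exp y"
  by (cases x; cases y) (auto intro: ennreal_leI)

lemma ereal_exp_antimono: "x \<le> y \<Longrightarrow> ereal_exp (ereal (-2) * y) \<le> ereal_exp (ereal (-2) * x)"
  by (rule ereal_exp_mono) (cases x; cases y; auto)

lemma ereal_exp_shift:
  "ereal_exp (ereal (-2) * x) = ennreal (exp (2 * C)) * ereal_exp (ereal (-2) * (x + ereal C))"
proof (cases x)
  case (real r)
  have "ennreal (exp (2 * C)) * ennreal (exp (-2 * (r + C))) = ennreal (exp (2 * C) * exp (-2 * (r + C)))"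
    by (rule ennreal_mult[symmetric]) auto
  also have "exp (2 * C) * exp (-2 * (r + C)) = exp (-2 * r)" by (simp add: exp_add[symmetric])
  finally show ?thesis by (simp add: real)
qed (auto simp: ennreal_mult_top)

lemma borel_measurable_ereal_exp [measurable]: "ereal_exp \<in> borel_measurable borel"
proof -
  have "ereal_exp = (\<lambda>x. if x = \<infinity> then \<infinity> else if x = -\<infinity> then 0 else ennreal (exp (real_of_ereal x)))"
  proof
    fix x show "ereal_exp x = (if x = \<infinity> then \<infinity> else if x = -\<infinity> then 0 else ennreal (exp (real_of_ereal x)))"
      by (cases x) simp_all
  qed
  moreover have "(\<lambda>x::ereal. if x = \<infinity> then \<infinity> else if x = -\<infinity> then 0 else ennreal (exp (real_of_ereal x))) \<in> borel_measurable borel"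
    by measurable
  ultimately show ?thesis by simp
qed

lemma weight_0: "f z = 0 \<Longrightarrow> weight f \<phi> z = 0"
  by (simp add: weight_def)

lemma weight_infinity: "f z \<noteq> 0 \<Longrightarrow> \<phi> z = -\<infinity> \<Longrightarrow> weight f \<phi> z = \<infinity>"
  by (simp add: weight_def ennreal_mult_top)

lemma weight_real:
  assumes "f z \<noteq> 0" "\<phi> z = ereal r"
  shows "weight f \<phi> z = ennreal (exp (2 * ln (norm (f z)) - 2 * r))"
proof -
  have "exp (2 * ln (norm (f z))) = norm (f z) ^ 2"
    using assms(1) by (simp add: exp_double)
  hence "exp (2 * ln (norm (f z)) - 2 * r) = norm (f z) ^ 2 * exp (-2 * r)"
    by (simp add: exp_diff exp_minus field_simps)
  thus ?thesis using assms(2) by (simp add: weight_def ennreal_mult)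
qed

lemma psh_near_sub_psh:
  assumes "psh_near X p u" obtains U where "open U" "p \<in> U" "sub_psh X U u"
  using assms by (auto simp: psh_near_def psh_on_iff_sub_psh)

lemma psh_near_meas: "psh_near X p u \<Longrightarrow> meas_near X p u"
  unfolding psh_near_def psh_on_def meas_near_def by blast

lemma holo_near_sub_psh:
  assumes "holo_near X p f" obtains U where "open U" "p \<in> U" "sub_psh X U (log_norm f)"
  using assms sub_psh_log_norm unfolding holo_near_def by metis

lemma holo_near_meas:
  assumes "holo_near X p f" shows "meas_near X p f"
proof -
  obtain U g where U: "open U" "p \<in> U" "holo_on g U" "\<And>z. z \<in> X \<inter> U \<Longrightarrow> f z = g z"
    using assms unfolding holo_near_def by metis
  have eq: "g z = f z" if "z \<in> U \<inter> reg_part X" for z using that U(4)[of z] by (auto simp: mem_reg_part_iff)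
  have "continuous_on (U \<inter> reg_part X) f"
    by (rule continuous_on_eq[OF continuous_on_subset[OF holo_on_imp_continuous_on[OF U(3)] Int_lower1] eq])
  thus ?thesis unfolding meas_near_def using borel_measurable_continuous_on_reg U by blast
qed

lemma weight_meas_near:
  fixes f :: "complex^'n \<Rightarrow> complex"
  assumes f: "meas_near X p f" and \<phi>: "meas_near X p \<phi>"
  shows "meas_near X p (weight f \<phi>)"
proof -
  have "meas_near X p (\<lambda>z. ennreal ((norm (f z))\<^sup>2) * ereal_exp (ereal (-2) * \<phi> z))"
    by (intro meas_near_mult meas_near_compose[OF f] meas_near_compose[OF \<phi>]) measurable
  thus ?thesis by (simp add: weight_def[abs_def])
qed

lemma le_O1_I: "open U \<Longrightarrow> p \<in> U \<Longrightarrow> (\<And>z. z \<in> U \<inter> reg_part X \<Longrightarrow> u z \<le> v z + ereal C) \<Longrightarrow> le_O1 X p u v"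
  unfolding le_O1_def by blast

lemma not_le_O1_rel_type:
  assumes "rel_type X p \<psi> \<phi> < ereal s" "0 \<le> s" shows "\<not> le_O1 X p \<psi> (\<lambda>z. ereal s * \<phi> z)"
proof
  assume "le_O1 X p \<psi> (\<lambda>z. ereal s * \<phi> z)"
  hence "ereal s \<le> rel_type X p \<psi> \<phi>" unfolding rel_type_def using assms(2) by (intro Sup_upper) auto
  thus False using assms(1) by simp
qed

lemma rel_type_0_mem:
  assumes "sub_psh X U \<psi>" "open U" "p \<in> U" "p \<in> X"
  shows "le_O1 X p \<psi> (\<lambda>z. ereal 0 * \<phi> z)"
proof -
  obtain W M where "open W" "p \<in> W" "\<And>z. z \<in> W \<inter> reg_part X \<Longrightarrow> \<psi> z \<le> ereal M"
    using sub_psh_bounded_above[OF assms] by metis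
  thus ?thesis by (intro le_O1_I[of W p X _ _ M]) (simp_all add: zero_ereal_def[symmetric])
qed

lemma rel_type_nonneg:
  assumes "sub_psh X U \<psi>" "open U" "p \<in> U" "p \<in> X" shows "0 \<le> rel_type X p \<psi> \<phi>"
  unfolding rel_type_def zero_ereal_def using rel_type_0_mem[OF assms, of \<phi>] by (intro Sup_upper) auto

text \<open>Both sets must be nonempty: \<open>\<infinity> + (-\<infinity>) = \<infinity>\<close> for extended reals.\<close>

lemma Sup_ereal_add_le:
  assumes "A \<noteq> {}" "B \<noteq> {}" and le: "\<And>a b. a \<in> A \<Longrightarrow> b \<in> B \<Longrightarrow> ereal (a + b) \<le> L"
  shows "Sup (ereal ` A) + Sup (ereal ` B) \<le> L"
proof (cases L)
  case (real r)
  obtain a0 b0 where ab: "a0 \<in> A" "b0 \<in> B" using assms by auto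
  have B: "Sup (ereal ` B) \<le> ereal (r - a)" if "a \<in> A" for a
    using le[OF that] real by (intro Sup_least) (auto simp: algebra_simps)
  have "ereal b0 \<le> Sup (ereal ` B)" using ab by (intro Sup_upper) auto
  then obtain s where s: "Sup (ereal ` B) = ereal s" using B[OF ab(1)] by (cases "Sup (ereal ` B)") auto
  have "Sup (ereal ` A) \<le> ereal (r - s)" using B s by (intro Sup_least) (auto simp: algebra_simps)
  thus ?thesis using s real by (cases "Sup (ereal ` A)") auto
next
  case MInf
  thus ?thesis using assms le by (metis ex_in_conv ereal_infty_less_eq(2) MInfty_neq_ereal(2))
qed simp

text \<open>Where \<open>log |G| > s \<Phi>\<close>, the weight \<open>|G|\<^sup>2 e\<^sup>-\<^sup>2\<^sup>c\<^sup>\<Phi>\<close> is at least \<open>e\<^sup>2\<^sup>(\<^sup>s\<^sup>-\<^sup>c\<^sup>)\<^sup>\<Phi>\<close>, which dominates \<open>e\<^sup>2\<^sup>t\<^sup>\<Phi>\<close> up to a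
constant when \<open>t \<ge> s - c\<close> and \<open>\<Phi>\<close> is bounded above.\<close>

lemma weight_comparison:
  fixes G :: "complex^'n \<Rightarrow> complex"
  assumes g: "ereal s * \<Phi> z < log_norm G z" and M: "\<Phi> z \<le> ereal M" "M \<ge> 0" and e: "t + c - s \<ge> 0"
    and inf: "\<Phi> z = -\<infinity> \<Longrightarrow> c > 0" and A: "\<And>x. \<Phi> z = ereal x \<Longrightarrow> A \<le> ennreal (exp (2 * (C + t * x)))"
  shows "A \<le> ennreal (exp (2 * (C + (t + c - s) * M))) * weight G (\<lambda>z. ereal c * \<Phi> z) z"
proof -
  have G0: "G z \<noteq> 0" using g by (auto simp: log_norm_def)
  show ?thesis
  proof (cases "\<Phi> z")
    case (real x)
    define l where "l = ln (norm (G z))"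
    have l: "s * x < l" using g G0 real by (simp add: log_norm_def l_def)
    have "(t + c - s) * x \<le> (t + c - s) * M" using M(1) real e by (intro mult_left_mono) auto
    hence "2 * (C + t * x) \<le> 2 * (C + (t + c - s) * M) + (2 * l - 2 * (c * x))"
      using l by (simp add: algebra_simps)
    hence "exp (2 * (C + t * x)) \<le> exp (2 * (C + (t + c - s) * M)) * exp (2 * l - 2 * (c * x))"
      by (simp add: exp_add[symmetric])
    hence "A \<le> ennreal (exp (2 * (C + (t + c - s) * M)) * exp (2 * l - 2 * (c * x)))"
      using A[OF real] by (meson ennreal_leI order_trans)
    also have "\<dots> = ennreal (exp (2 * (C + (t + c - s) * M))) * ennreal (exp (2 * l - 2 * (c * x)))"
      by (rule ennreal_mult) auto
    also have "ennreal (exp (2 * l - 2 * (c * x))) = weight G (\<lambda>z. ereal c * \<Phi> z) z"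
      using weight_real[of G z "\<lambda>z. ereal c * \<Phi> z" "c * x", OF G0] real by (simp add: l_def)
    finally show ?thesis .
  next
    case MInf
    hence "weight G (\<lambda>z. ereal c * \<Phi> z) z = \<infinity>" using inf by (intro weight_infinity[of G z, OF G0]) simp
    thus ?thesis by (simp add: ennreal_mult_top)
  qed (use M in auto)
qed

section \<open>Comparison of weights\<close>

locale zhou_setting =
  fixes X :: "(complex^'n) set" and z0 :: "complex^'n" and f0 :: "complex^'n \<Rightarrow> complex^'m"
    and \<phi>0 \<Phi> :: "complex^'n \<Rightarrow> ereal"
  assumes reg_borel: "reg_part X \<in> sets borel" and z0: "z0 \<in> X"
    and \<phi>0: "psh_near X z0 \<phi>0"
    and int: "integrable_near X z0 (weight f0 \<phi>0)"
    and zhou: "local_zhou_weight X z0 f0 \<phi>0 \<Phi>"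
begin

abbreviation twist :: "(complex^'n \<Rightarrow> ereal) \<Rightarrow> complex^'n \<Rightarrow> ennreal" where
  "twist u \<equiv> (\<lambda>z. weight f0 \<phi>0 z * ereal_exp (ereal (-2) * u z))"

lemma \<Phi>: "psh_near X z0 \<Phi>"
  using zhou by (simp add: local_zhou_weight_def)

lemma not_integrable: "\<not> integrable_near X z0 (twist \<Phi>)"
  using zhou by (simp add: local_zhou_weight_def)

lemma maximal:
  assumes "psh_near X z0 u" "le_O1 X z0 \<Phi> u" "\<not> integrable_near X z0 (twist u)"
  shows "le_O1 X z0 u \<Phi>"
  using zhou assms unfolding local_zhou_weight_def by blast

lemma meas_twist:
  assumes u: "meas_near X z0 u" shows "meas_near X z0 (twist u)"
proof (rule meas_near_mult[OF integrable_near_meas[OF int]])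
  show "meas_near X z0 (\<lambda>z. ereal_exp (ereal (-2) * u z))"
    by (rule meas_near_compose[OF u, of "\<lambda>x. ereal_exp (ereal (-2) * x)"]) measurable
qed

lemma \<Phi>_bounded_above:
  obtains W M where "open W" "z0 \<in> W" "M \<ge> 0" "\<And>z. z \<in> W \<inter> reg_part X \<Longrightarrow> \<Phi> z \<le> ereal M"
proof -
  obtain U where U: "open U" "z0 \<in> U" "sub_psh X U \<Phi>" using psh_near_sub_psh[OF \<Phi>] by metis
  obtain W M where W: "open W" "z0 \<in> W" "\<And>z. z \<in> W \<inter> reg_part X \<Longrightarrow> \<Phi> z \<le> ereal M"
    using sub_psh_bounded_above[OF U(3,1,2) z0] by metis
  have "\<Phi> z \<le> ereal (max M 0)" if "z \<in> W \<inter> reg_part X" for z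
    by (rule order_trans[OF W(3)[OF that]]) simp
  thus ?thesis using that[of W "max M 0"] W by simp
qed

text \<open>The only use of maximality in the upper bound: the maximum is not \<open>\<le> \<Phi> + O(1)\<close>, because otherwise
\<open>\<psi> \<le> s \<Phi> + O(1)\<close>.\<close>

lemma integrable_twist_max:
  assumes \<psi>: "sub_psh X V \<psi>" "open V" "z0 \<in> V" and s: "s > 0" "\<not> le_O1 X z0 \<psi> (\<lambda>z. ereal s * \<Phi> z)"
  shows "integrable_near X z0 (twist (\<lambda>z. max (\<Phi> z) (ereal (1 / s) * \<psi> z)))" (is "integrable_near X z0 (twist ?u)")
proof (rule ccontr)
  assume not: "\<not> integrable_near X z0 (twist ?u)"
  have psh: "psh_near X z0 ?u"
    by (rule psh_near_max[OF \<Phi> sub_psh_scale[OF \<psi>(1)] \<psi>(2,3)]) (use s in simp)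
  have "le_O1 X z0 \<Phi> ?u" by (rule le_O1_I[of UNIV _ _ _ _ 0]) auto
  from maximal[OF psh this not] obtain U C where U: "open U" "z0 \<in> U"
    and le: "\<And>z. z \<in> U \<inter> reg_part X \<Longrightarrow> ?u z \<le> \<Phi> z + ereal C" unfolding le_O1_def by metis
  have "\<psi> z \<le> ereal s * \<Phi> z + ereal (s * C)" if "z \<in> U \<inter> reg_part X" for z
  proof -
    have "ereal (1 / s) * \<psi> z \<le> \<Phi> z + ereal C" using le[OF that] by simp
    thus ?thesis using s(1) by (cases "\<psi> z"; cases "\<Phi> z") (auto simp: field_simps)
  qed
  hence "le_O1 X z0 \<psi> (\<lambda>z. ereal s * \<Phi> z)" by (rule le_O1_I[OF U])
  thus False using s(2) by contradiction
qed

text \<open>Otherwise \<open>w e\<^sup>-\<^sup>2\<^sup>\<Phi>\<close> would be dominated by the integrable function \<open>w\<close>.\<close>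

lemma \<Phi>_unbounded_below:
  assumes W: "open W" "z0 \<in> W" shows "\<exists>z\<in>W \<inter> reg_part X. \<Phi> z < ereal K"
proof (rule ccontr)
  assume "\<not> ?thesis"
  hence ge: "ereal K \<le> \<Phi> z" if "z \<in> W \<inter> reg_part X" for z using that not_less by blast
  have "integrable_near X z0 (twist \<Phi>)"
  proof (rule integrable_near_dominated[OF integrable_near_cmult[OF reg_borel int] meas_twist[OF psh_near_meas[OF \<Phi>]] W])
    have "twist \<Phi> z \<le> ennreal (exp (-2 * K)) * weight f0 \<phi>0 z" if "z \<in> W \<inter> reg_part X" for z
    proof -
      have "ereal_exp (ereal (-2) * \<Phi> z) \<le> ereal_exp (ereal (-2) * ereal K)"
        by (rule ereal_exp_antimono[OF ge[OF that]])
      hence "twist \<Phi> z \<le> weight f0 \<phi>0 z * ennreal (exp (-2 * K))" by (intro mult_left_mono) auto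
      thus ?thesis by (simp add: mult.commute)
    qed
    thus "AE z in vol_measure X. z \<in> W \<inter> reg_part X \<longrightarrow> twist \<Phi> z \<le> ennreal (exp (-2 * K)) * weight f0 \<phi>0 z"
      by (intro AE_I2) blast
  qed
  thus False using not_integrable by simp
qed

text \<open>If \<open>c + a \<ge> 1 + s1 + s2\<close>, three integrable functions together dominate \<open>w e\<^sup>-\<^sup>2\<^sup>\<Phi>\<close>.\<close>

lemma upper_bound_strict:
  fixes G :: "complex^'n \<Rightarrow> complex"
  assumes G: "holo_near X z0 G" and c: "integrable_near X z0 (weight G (\<lambda>z. ereal c * \<Phi> z))"
    and a: "a \<ge> 0" "le_O1 X z0 (log_norm f0) (\<lambda>z. ereal a * \<Phi> z)"
    and s1: "s1 > 0" "\<not> le_O1 X z0 (log_norm G) (\<lambda>z. ereal s1 * \<Phi> z)"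
    and s2: "s2 > 0" "\<not> le_O1 X z0 \<phi>0 (\<lambda>z. ereal s2 * \<Phi> z)"
  shows "c + a < 1 + s1 + s2"
proof (rule ccontr)
  assume "\<not> ?thesis"
  hence ge: "c + a \<ge> 1 + s1 + s2" by simp
  obtain V1 where V1: "open V1" "z0 \<in> V1" "sub_psh X V1 (log_norm G)" using holo_near_sub_psh[OF G] by metis
  obtain V2 where V2: "open V2" "z0 \<in> V2" "sub_psh X V2 \<phi>0" using psh_near_sub_psh[OF \<phi>0] by metis
  let ?u1 = "\<lambda>z. max (\<Phi> z) (ereal (1 / s1) * log_norm G z)"
  let ?u2 = "\<lambda>z. max (\<Phi> z) (ereal (1 / s2) * \<phi>0 z)"
  have I1: "integrable_near X z0 (twist ?u1)" by (rule integrable_twist_max[OF V1(3,1,2) s1])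
  have I2: "integrable_near X z0 (twist ?u2)" by (rule integrable_twist_max[OF V2(3,1,2) s2])
  obtain W M where W: "open W" "z0 \<in> W" "M \<ge> 0" "\<And>z. z \<in> W \<inter> reg_part X \<Longrightarrow> \<Phi> z \<le> ereal M"
    using \<Phi>_bounded_above by metis
  obtain U C where U: "open U" "z0 \<in> U"
    and f0: "\<And>z. z \<in> U \<inter> reg_part X \<Longrightarrow> log_norm f0 z \<le> ereal a * \<Phi> z + ereal C"
    using a(2) unfolding le_O1_def by metis
  let ?N = "W \<inter> U \<inter> V2"
  define K where "K = exp (2 * (C + (a - s2 - 1 + c - s1) * M))"
  have le: "twist \<Phi> z \<le> twist ?u1 z + twist ?u2 z + ennreal K * weight G (\<lambda>z. ereal c * \<Phi> z) z"
    if z: "z \<in> ?N \<inter> reg_part X" for z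
  proof -
    consider (1) "ereal (1 / s1) * log_norm G z \<le> \<Phi> z" | (2) "ereal (1 / s2) * \<phi>0 z \<le> \<Phi> z"
      | (3) "f0 z = 0"
      | (4) "\<Phi> z < ereal (1 / s1) * log_norm G z" "\<Phi> z < ereal (1 / s2) * \<phi>0 z" "f0 z \<noteq> 0"
      by fastforce
    thus ?thesis
    proof cases
      case 1
      have "twist \<Phi> z = twist ?u1 z" using 1 by (simp only: max_absorb1)
      thus ?thesis by (simp add: add.assoc)
    next
      case 2
      have "twist \<Phi> z = twist ?u2 z" using 2 by (simp only: max_absorb1)
      thus ?thesis by (simp add: add.assoc add_increasing)
    next
      case 3
      thus ?thesis by (simp add: weight_0)
    next
      case 4
      have g: "ereal s1 * \<Phi> z < log_norm G z"
        using 4(1) s1(1) by (cases "\<Phi> z"; cases "log_norm G z") (auto simp: field_simps)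
      have h: "ereal s2 * \<Phi> z < \<phi>0 z"
        using 4(2) s2(1) by (cases "\<Phi> z"; cases "\<phi>0 z") (auto simp: field_simps)
      have "\<phi>0 z < \<infinity>" using sub_pshD(2)[OF V2(3)] z by blast
      then obtain y where y: "\<phi>0 z = ereal y" using h by (cases "\<phi>0 z") auto
      have l: "log_norm f0 z = ereal (ln (norm (f0 z)))" using 4(3) by (simp add: log_norm_def)
      have lle: "ereal (ln (norm (f0 z))) \<le> ereal a * \<Phi> z + ereal C" using f0[of z] z l by auto
      have "twist \<Phi> z \<le> ennreal K * weight G (\<lambda>z. ereal c * \<Phi> z) z"
        unfolding K_def
      proof (rule weight_comparison[where s = s1 and \<Phi> = \<Phi> and z = z and G = G and M = M, OF g _ W(3)])
        show "\<Phi> z \<le> ereal M" using W(4) z by blast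
        show "a - s2 - 1 + c - s1 \<ge> 0" using ge by simp
        show "c > 0" if "\<Phi> z = -\<infinity>"
        proof -
          \<comment> \<open>if \<open>a > 0\<close>, then \<open>f0\<close> vanishes where \<open>\<Phi> = -\<infinity>\<close>\<close>
          have "a = 0"
          proof (rule ccontr)
            assume "a \<noteq> 0"
            thus False using lle that a(1) by simp
          qed
          thus ?thesis using ge s1 s2 by simp
        qed
        fix x assume x: "\<Phi> z = ereal x"
        have "ln (norm (f0 z)) \<le> a * x + C" using lle x by simp
        moreover have "s2 * x < y" using h x y by simp
        ultimately have "2 * ln (norm (f0 z)) - 2 * y + (- 2 * x) \<le> 2 * (C + (a - s2 - 1) * x)"
          by (simp add: algebra_simps)
        hence "exp (2 * ln (norm (f0 z)) - 2 * y) * exp (- 2 * x) \<le> exp (2 * (C + (a - s2 - 1) * x))"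
          by (simp add: exp_add[symmetric])
        thus "twist \<Phi> z \<le> ennreal (exp (2 * (C + (a - s2 - 1) * x)))"
          using weight_real[of f0 z \<phi>0 y, OF 4(3) y] x by (simp add: ennreal_mult[symmetric] ennreal_leI)
      qed
      thus ?thesis by (simp add: add_increasing)
    qed
  qed
  have "integrable_near X z0 (twist \<Phi>)"
  proof (rule integrable_near_dominated)
    show "integrable_near X z0 (\<lambda>z. (twist ?u1 z + twist ?u2 z) + ennreal K * weight G (\<lambda>z. ereal c * \<Phi> z) z)"
      by (intro integrable_near_add[OF reg_borel] integrable_near_cmult[OF reg_borel] I1 I2 c)
    show "meas_near X z0 (twist \<Phi>)" by (rule meas_twist[OF psh_near_meas[OF \<Phi>]])
    show "open ?N" "z0 \<in> ?N" using W U V2 by auto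
    show "AE z in vol_measure X. z \<in> ?N \<inter> reg_part X \<longrightarrow>
        twist \<Phi> z \<le> (twist ?u1 z + twist ?u2 z) + ennreal K * weight G (\<lambda>z. ereal c * \<Phi> z) z"
      by (intro AE_I2 impI le)
  qed
  thus False using not_integrable by simp
qed

text \<open>The same comparison with exponent \<open>t = - 1\<close>, as \<open>w e\<^sup>-\<^sup>2\<^sup>\<Phi> = e\<^sup>-\<^sup>2\<^sup>\<Phi>\<close>.\<close>

lemma upper_bound_strict_trivial_weight:
  fixes G :: "complex^'n \<Rightarrow> complex"
  assumes G: "holo_near X z0 G" and c: "integrable_near X z0 (weight G (\<lambda>z. ereal c * \<Phi> z))"
    and U: "open U" "z0 \<in> U" "AE z in vol_measure X. z \<in> U \<inter> reg_part X \<longrightarrow> weight f0 \<phi>0 z = 1"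
    and s1: "s1 > 0" "\<not> le_O1 X z0 (log_norm G) (\<lambda>z. ereal s1 * \<Phi> z)"
  shows "c < 1 + s1"
proof (rule ccontr)
  assume "\<not> ?thesis"
  hence ge: "c \<ge> 1 + s1" by simp
  obtain V1 where V1: "open V1" "z0 \<in> V1" "sub_psh X V1 (log_norm G)" using holo_near_sub_psh[OF G] by metis
  let ?u1 = "\<lambda>z. max (\<Phi> z) (ereal (1 / s1) * log_norm G z)"
  have I1: "integrable_near X z0 (twist ?u1)" by (rule integrable_twist_max[OF V1(3,1,2) s1])
  obtain W M where W: "open W" "z0 \<in> W" "M \<ge> 0" "\<And>z. z \<in> W \<inter> reg_part X \<Longrightarrow> \<Phi> z \<le> ereal M"
    using \<Phi>_bounded_above by metis
  define K where "K = exp (2 * (0 + (- 1 + c - s1) * M))"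
  have le: "twist \<Phi> z \<le> twist ?u1 z + ennreal K * weight G (\<lambda>z. ereal c * \<Phi> z) z"
    if z: "z \<in> W \<inter> reg_part X" and w: "weight f0 \<phi>0 z = 1" for z
  proof (cases "ereal (1 / s1) * log_norm G z \<le> \<Phi> z")
    case True
    hence "twist \<Phi> z = twist ?u1 z" by (simp add: max_absorb1)
    thus ?thesis by simp
  next
    case False
    hence g: "ereal s1 * \<Phi> z < log_norm G z"
      using s1(1) by (cases "\<Phi> z"; cases "log_norm G z") (auto simp: field_simps)
    have "twist \<Phi> z \<le> ennreal K * weight G (\<lambda>z. ereal c * \<Phi> z) z"
      unfolding K_def
    proof (rule weight_comparison[where s = s1 and \<Phi> = \<Phi> and z = z and G = G and M = M, OF g W(4)[OF z] W(3)])
      show "- 1 + c - s1 \<ge> 0" "c > 0" using ge s1 by auto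
      show "twist \<Phi> z \<le> ennreal (exp (2 * (0 + - 1 * x)))" if "\<Phi> z = ereal x" for x
        using that w by simp
    qed
    thus ?thesis by (simp add: add_increasing)
  qed
  have "integrable_near X z0 (twist \<Phi>)"
  proof (rule integrable_near_dominated)
    show "integrable_near X z0 (\<lambda>z. twist ?u1 z + ennreal K * weight G (\<lambda>z. ereal c * \<Phi> z) z)"
      by (intro integrable_near_add[OF reg_borel] integrable_near_cmult[OF reg_borel] I1 c)
    show "meas_near X z0 (twist \<Phi>)" by (rule meas_twist[OF psh_near_meas[OF \<Phi>]])
    show "open (W \<inter> U)" "z0 \<in> W \<inter> U" using W U by auto
    show "AE z in vol_measure X. z \<in> (W \<inter> U) \<inter> reg_part X \<longrightarrow>
        twist \<Phi> z \<le> twist ?u1 z + ennreal K * weight G (\<lambda>z. ereal c * \<Phi> z) z"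
      using U(3)
    proof eventually_elim
      case (elim z)
      show ?case
      proof
        assume z: "z \<in> W \<inter> U \<inter> reg_part X"
        show "twist \<Phi> z \<le> twist ?u1 z + ennreal K * weight G (\<lambda>z. ereal c * \<Phi> z) z"
          by (rule le) (use z elim in auto)
      qed
    qed
  qed
  thus False using not_integrable by simp
qed

lemma lower_bound_mem:
  fixes G :: "complex^'n \<Rightarrow> complex"
  assumes G: "holo_near X z0 G" and a: "a \<ge> 0" "le_O1 X z0 (log_norm G) (\<lambda>z. ereal a * \<Phi> z)"
    and b: "integrable_near X z0 (weight (\<lambda>_. 1 :: complex) (\<lambda>z. ereal b * \<Phi> z))"
  shows "integrable_near X z0 (weight G (\<lambda>z. ereal (a + b) * \<Phi> z))"
proof -
  obtain W M where W: "open W" "z0 \<in> W" "M \<ge> 0" "\<And>z. z \<in> W \<inter> reg_part X \<Longrightarrow> \<Phi> z \<le> ereal M"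
    using \<Phi>_bounded_above by metis
  obtain U C where U: "open U" "z0 \<in> U"
    and g: "\<And>z. z \<in> U \<inter> reg_part X \<Longrightarrow> log_norm G z \<le> ereal a * \<Phi> z + ereal C"
    using a(2) unfolding le_O1_def by metis
  have le: "weight G (\<lambda>z. ereal (a + b) * \<Phi> z) z \<le> ennreal (exp (2 * C)) * weight (\<lambda>_. 1 :: complex) (\<lambda>z. ereal b * \<Phi> z) z"
    if z: "z \<in> (W \<inter> U) \<inter> reg_part X" for z
  proof (cases "G z = 0")
    case False
    hence l: "log_norm G z = ereal (ln (norm (G z)))" by (simp add: log_norm_def)
    have lle: "ereal (ln (norm (G z))) \<le> ereal a * \<Phi> z + ereal C" using g[of z] z l by auto
    show ?thesis
    proof (cases "\<Phi> z")
      case (real x)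
      have 1: "weight G (\<lambda>z. ereal (a + b) * \<Phi> z) z = ennreal (exp (2 * ln (norm (G z)) - 2 * ((a + b) * x)))"
        by (rule weight_real[of G z, OF False]) (simp add: real)
      have 2: "weight (\<lambda>_. 1 :: complex) (\<lambda>z. ereal b * \<Phi> z) z = ennreal (exp (- 2 * (b * x)))"
        by (simp add: weight_def real)
      have "2 * ln (norm (G z)) - 2 * ((a + b) * x) \<le> 2 * C + - 2 * (b * x)"
        using lle real by (simp add: algebra_simps)
      hence "exp (2 * ln (norm (G z)) - 2 * ((a + b) * x)) \<le> exp (2 * C) * exp (- 2 * (b * x))"
        by (simp add: exp_add[symmetric])
      thus ?thesis unfolding 1 2 by (simp add: ennreal_mult[symmetric] ennreal_leI)
    next
      case MInf
      have a0: "a = 0"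
      proof (rule ccontr)
        assume "a \<noteq> 0"
        thus False using lle MInf a(1) by simp
      qed
      hence "ln (norm (G z)) \<le> C" using lle by (simp add: zero_ereal_def[symmetric])
      hence "norm (G z) \<le> exp C" using False by (metis exp_le_cancel_iff exp_ln zero_less_norm_iff)
      hence "(norm (G z))\<^sup>2 \<le> exp (2 * C)" by (metis exp_double norm_ge_zero power_mono)
      thus ?thesis unfolding weight_def a0 add_0 by (intro mult_mono) (auto intro: ennreal_leI)
    next
      case PInf
      thus ?thesis using W(4)[of z] z by auto
    qed
  qed (simp add: weight_0)
  show ?thesis
  proof (rule integrable_near_dominated[OF integrable_near_cmult[OF reg_borel b]])
    show "meas_near X z0 (weight G (\<lambda>z. ereal (a + b) * \<Phi> z))"
      by (rule weight_meas_near[OF holo_near_meas[OF G] meas_near_compose[OF psh_near_meas[OF \<Phi>], of "\<lambda>x. ereal (a + b) * x"]])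
        measurable
    show "open (W \<inter> U)" "z0 \<in> W \<inter> U" using W U by auto
    show "AE z in vol_measure X. z \<in> (W \<inter> U) \<inter> reg_part X \<longrightarrow> weight G (\<lambda>z. ereal (a + b) * \<Phi> z) z
        \<le> ennreal (exp (2 * C)) * weight (\<lambda>_. 1 :: complex) (\<lambda>z. ereal b * \<Phi> z) z"
      by (intro AE_I2 impI le)
  qed
qed

text \<open>As \<open>\<Phi>\<close> is bounded above, \<open>\<Phi> \<le> c \<Phi> + O(1)\<close>.  If \<open>e\<^sup>-\<^sup>2\<^sup>c\<^sup>\<Phi>\<close> were not integrable, maximality would give
\<open>c \<Phi> \<le> \<Phi> + C\<close>, that is, \<open>\<Phi> = -\<infinity>\<close> or \<open>\<Phi> \<ge> - C / (1 - c)\<close> at every point near \<open>z0\<close>.  The set where \<open>\<Phi>\<close> is less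
than this bound is open, and nonempty by \<open>\<Phi>_unbounded_below\<close>, so \<open>\<Phi>\<close> would be identically \<open>-\<infinity>\<close> on an open
set.\<close>

lemma integrable_trivial_weight:
  assumes U: "open U" "z0 \<in> U" "AE z in vol_measure X. z \<in> U \<inter> reg_part X \<longrightarrow> weight f0 \<phi>0 z = 1"
    and c: "0 < c" "c < 1"
  shows "integrable_near X z0 (weight (\<lambda>_. 1 :: complex) (\<lambda>z. ereal c * \<Phi> z))"
proof (rule ccontr)
  let ?u = "\<lambda>z. ereal c * \<Phi> z"
  assume not: "\<not> ?thesis"
  have psh: "psh_near X z0 ?u" by (rule psh_near_scale[OF \<Phi> c(1)])
  have not': "\<not> integrable_near X z0 (twist ?u)"
  proof
    assume i: "integrable_near X z0 (twist ?u)"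
    have m: "meas_near X z0 (weight (\<lambda>_. 1 :: complex) ?u)"
      using meas_near_compose[OF psh_near_meas[OF psh], of "\<lambda>x. ereal_exp (ereal (-2) * x)"]
      by (simp add: weight_def[abs_def])
    have "integrable_near X z0 (weight (\<lambda>_. 1 :: complex) ?u)"
    proof (rule integrable_near_dominated[OF i m U(1,2)])
      show "AE z in vol_measure X. z \<in> U \<inter> reg_part X \<longrightarrow> weight (\<lambda>_. 1 :: complex) ?u z \<le> twist ?u z"
        using U(3) by eventually_elim (simp add: weight_def)
    qed
    thus False using not by simp
  qed
  obtain W M where W: "open W" "z0 \<in> W" "M \<ge> 0" "\<And>z. z \<in> W \<inter> reg_part X \<Longrightarrow> \<Phi> z \<le> ereal M"
    using \<Phi>_bounded_above by metis
  have "le_O1 X z0 \<Phi> ?u"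
  proof (rule le_O1_I[OF W(1,2)])
    fix z assume z: "z \<in> W \<inter> reg_part X"
    show "\<Phi> z \<le> ereal c * \<Phi> z + ereal ((1 - c) * M)"
    proof (cases "\<Phi> z")
      case (real x)
      have "(1 - c) * x \<le> (1 - c) * M" using W(4)[OF z] real c by (intro mult_left_mono) auto
      thus ?thesis using real by (simp add: algebra_simps)
    qed (use W(4)[OF z] c in auto)
  qed
  from maximal[OF psh this not'] obtain U' C where U': "open U'" "z0 \<in> U'"
    and le: "\<And>z. z \<in> U' \<inter> reg_part X \<Longrightarrow> ?u z \<le> \<Phi> z + ereal C" unfolding le_O1_def by metis
  obtain V where V: "open V" "z0 \<in> V" "psh_on X V \<Phi>" using \<Phi> by (auto simp: psh_near_def)
  define K where "K = - C / (1 - c)"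
  have sub: "sub_psh X V \<Phi>" using V(3) by (simp add: psh_on_iff_sub_psh)
  define N where "N = {z \<in> V \<inter> reg_part X. \<Phi> z < ereal K} \<inter> U'"
  have "openin (top_of_set (V \<inter> reg_part X)) (((V \<inter> reg_part X) \<inter> U') \<inter> {z \<in> V \<inter> reg_part X. \<Phi> z < ereal K})"
    by (intro openin_Int openin_open_Int U'(1) sub_pshD(3)[OF sub])
  moreover have "((V \<inter> reg_part X) \<inter> U') \<inter> {z \<in> V \<inter> reg_part X. \<Phi> z < ereal K} = N" by (auto simp: N_def)
  ultimately have oN: "openin (top_of_set (V \<inter> reg_part X)) N" by simp
  have "\<exists>z\<in>(V \<inter> U') \<inter> reg_part X. \<Phi> z < ereal K" by (rule \<Phi>_unbounded_below) (use V U' in auto)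
  hence "N \<noteq> {}" by (auto simp: N_def)
  then obtain z where z: "z \<in> N" "\<Phi> z \<noteq> -\<infinity>" using psh_on_finite_somewhere[OF V(3,1) oN] by blast
  have zU: "z \<in> U' \<inter> reg_part X" "\<Phi> z < ereal K" using z by (auto simp: N_def)
  then obtain x where x: "\<Phi> z = ereal x" using z by (cases "\<Phi> z") auto
  have "x < - C / (1 - c)" using zU(2) x by (simp add: K_def)
  hence "x * (1 - c) < - C / (1 - c) * (1 - c)" using c by (intro mult_strict_right_mono) auto
  hence "x * (1 - c) < - C" using c by simp
  moreover have "c * x \<le> x + C" using le[OF zU(1)] x by simp
  ultimately show False by (simp add: algebra_simps)
qed

end

section \<open>Functions of infinite relative type\<close>

text \<open>Monotone convergence, for the sets where \<open>u\<close> is \<open>-\<infinity>\<close> or at least \<open>- T\<close>.\<close>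

lemma nn_integral_infinite_exhaustion:
  fixes f :: "'a \<Rightarrow> ennreal" and u :: "'a \<Rightarrow> ereal"
  assumes A: "A \<in> sets M" and AM: "space M = UNIV" and f: "f \<in> borel_measurable (restrict_space M A)"
    and u: "u \<in> borel_measurable (restrict_space M A)" and inf: "(\<integral>\<^sup>+ z \<in> A. f z \<partial>M) = \<infinity>"
  shows "\<exists>T\<ge>T0. ennreal L \<le> (\<integral>\<^sup>+ z \<in> {z \<in> A. u z = -\<infinity> \<or> - ereal T \<le> u z}. f z \<partial>M)"
proof -
  define S where "S T = {z \<in> A. u z = -\<infinity> \<or> - ereal T \<le> u z}" for T :: real
  define h where "h n z = f z * indicator (S (real n)) z" for n :: nat and z
  have g: "(\<lambda>z. f z * indicator A z) \<in> borel_measurable M"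
    using f A borel_measurable_restrict_space_iff_ennreal[of A M] AM by auto
  have S: "S T \<in> sets M" for T
  proof -
    have "{z \<in> space (restrict_space M A). u z = -\<infinity> \<or> - ereal T \<le> u z} \<in> sets (restrict_space M A)"
      using u by measurable
    moreover have "{z \<in> space (restrict_space M A). u z = -\<infinity> \<or> - ereal T \<le> u z} = S T"
      by (auto simp: S_def space_restrict_space AM)
    ultimately show ?thesis using sets_restrict_space_iff[of A M "S T"] A AM by auto
  qed
  have hm: "h n \<in> borel_measurable M" for n
  proof -
    have "h n = (\<lambda>z. (f z * indicator A z) * indicator (S (real n)) z)"
      by (auto simp: h_def S_def indicator_def)
    thus ?thesis using borel_measurable_times_ennreal[OF g borel_measurable_indicator[OF S]] by simp
  qed
  have S_mono: "S T \<subseteq> S T'" if "T \<le> T'" for T T'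
  proof
    fix z assume z: "z \<in> S T"
    have "- ereal T' \<le> - ereal T" using that by simp
    thus "z \<in> S T'" using z order_trans[of "- ereal T'" "- ereal T" "u z"] unfolding S_def by blast
  qed
  have inc: "incseq h"
  proof (intro incseq_SucI le_funI)
    show "h n z \<le> h (Suc n) z" for n z
      unfolding h_def using S_mono[of "real n" "real (Suc n)"] by (intro mult_left_mono) (auto simp: indicator_def)
  qed
  have sup: "(SUP n. h n z) = f z * indicator A z" for z
  proof (rule antisym)
    show "(SUP n. h n z) \<le> f z * indicator A z"
      by (rule SUP_least) (auto simp: h_def S_def indicator_def)
    have "\<exists>n::nat. indicator A z \<le> (indicator (S (real n)) z :: ennreal)"
    proof (cases "z \<in> A \<and> u z \<noteq> -\<infinity>")
      case True
      obtain n :: nat where n: "- ereal (real n) \<le> u z"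
      proof (cases "u z")
        case (real r)
        obtain n :: nat where "- r \<le> real n" using real_arch_simple by blast
        thus ?thesis using that[of n] real by simp
      qed (use True that in auto)
      thus ?thesis by (intro exI[of _ n]) (auto simp: S_def indicator_def)
    next
      case False
      thus ?thesis by (intro exI[of _ 0]) (auto simp: S_def indicator_def)
    qed
    then obtain n :: nat where "indicator A z \<le> (indicator (S (real n)) z :: ennreal)" by blast
    hence "f z * indicator A z \<le> h n z" unfolding h_def by (intro mult_left_mono) auto
    also have "\<dots> \<le> (SUP n. h n z)" by (rule SUP_upper) simp
    finally show "f z * indicator A z \<le> (SUP n. h n z)" .
  qed
  have "(SUP n. \<integral>\<^sup>+ z. h n z \<partial>M) = \<infinity>"
    using nn_integral_monotone_convergence_SUP[OF inc hm] inf unfolding sup by simp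
  moreover have "ennreal L < \<infinity>" by simp
  ultimately have "ennreal L < (SUP n. \<integral>\<^sup>+ z. h n z \<partial>M)" by (simp only:)
  then obtain n where n: "ennreal L < (\<integral>\<^sup>+ z. h n z \<partial>M)" unfolding less_SUP_iff by blast
  have "(\<integral>\<^sup>+ z. h n z \<partial>M) \<le> (\<integral>\<^sup>+ z \<in> S (max T0 (real n)). f z \<partial>M)"
    unfolding h_def using S_mono[of "real n" "max T0 (real n)"]
    by (intro nn_integral_mono mult_left_mono) (auto simp: indicator_def)
  hence "ennreal L \<le> (\<integral>\<^sup>+ z \<in> S (max T0 (real n)). f z \<partial>M)" using n by simp
  thus ?thesis unfolding S_def by (intro exI[of _ "max T0 (real n)"]) simp
qed

context zhou_setting begin

text \<open>The choices that can be made once the constant \<open>c\<close> is given.  First \<open>\<epsilon>\<close>: near \<open>z0\<close> there is a point where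
\<open>\<Phi> < - c - n - 1\<close> and \<open>u\<close> is finite, and for small \<open>\<epsilon>\<close> the function \<open>\<epsilon> u - c\<close> exceeds \<open>\<Phi> + n\<close> at this point.
Then \<open>D\<close> and \<open>\<rho>\<close>, from \<open>\<epsilon> u \<le> \<Phi> + O(1)\<close>.  Then \<open>T\<close>, so large that the part of the ball where \<open>u \<ge> - T\<close> or
\<open>u = -\<infinity>\<close> carries as much of the infinite mass of \<open>w e\<^sup>-\<^sup>2\<^sup>\<Phi>\<close> as is prescribed.\<close>

lemma diagonal_step:
  fixes u :: "complex^'n \<Rightarrow> ereal" and n :: nat
  assumes V: "open V" "z0 \<in> V" and sub: "sub_psh X V u"
    and dom: "\<And>\<epsilon>. \<epsilon> > 0 \<Longrightarrow> le_O1 X z0 (\<lambda>z. ereal \<epsilon> * u z) \<Phi>"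
    and dense: "\<And>N. openin (top_of_set (V \<inter> reg_part X)) N \<Longrightarrow> N \<noteq> {} \<Longrightarrow> \<exists>z\<in>N. u z \<noteq> -\<infinity>"
    and E: "E > 0" and c: "c \<ge> 0" and \<rho>0: "\<rho>0 > 0"
  obtains \<epsilon> T D \<rho> where "0 < \<epsilon>" "\<epsilon> \<le> E" "T0 \<le> T" "D0 \<le> D" "0 < \<rho>" "\<rho> \<le> \<rho>0" "\<rho> < 1 / (real n + 1)"
    "\<And>z. z \<in> ball z0 \<rho> \<inter> reg_part X \<Longrightarrow> ereal \<epsilon> * u z + ereal (- c) \<le> \<Phi> z + ereal D"
    "ennreal (real n * exp (2 * D))
       \<le> (\<integral>\<^sup>+ z \<in> {z \<in> ball z0 \<rho> \<inter> reg_part X. u z = -\<infinity> \<or> - ereal T \<le> u z}. twist \<Phi> z \<partial>completion (vol_measure X))"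
    "\<exists>z\<in>ball z0 (1 / (real n + 1)) \<inter> reg_part X. \<Phi> z + ereal (real n) < ereal \<epsilon> * u z + ereal (- c)"
proof -
  let ?M = "completion (vol_measure X)"
  obtain U where U: "open U" "z0 \<in> U" "sub_psh X U \<Phi>" using psh_near_sub_psh[OF \<Phi>] by metis
  \<comment> \<open>a point where \<open>\<Phi>\<close> is very negative but \<open>u\<close> is finite\<close>
  let ?B = "ball z0 (1 / (real n + 1))"
  define N where "N = {z \<in> U \<inter> reg_part X. \<Phi> z < ereal (- c - real n - 1)} \<inter> (?B \<inter> V)"
  obtain T1 where T1: "open T1" "{z \<in> U \<inter> reg_part X. \<Phi> z < ereal (- c - real n - 1)} = (U \<inter> reg_part X) \<inter> T1"
    using sub_pshD(3)[OF U(3)] unfolding openin_open by metis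
  have "N = (V \<inter> reg_part X) \<inter> (U \<inter> T1 \<inter> ?B)" using T1(2) unfolding N_def by blast
  hence oN: "openin (top_of_set (V \<inter> reg_part X)) N"
    using openin_open_Int[of "U \<inter> T1 \<inter> ?B" "V \<inter> reg_part X"] U(1) T1(1) by (simp add: open_Int)
  have "\<exists>z\<in>(U \<inter> ?B \<inter> V) \<inter> reg_part X. \<Phi> z < ereal (- c - real n - 1)"
    by (rule \<Phi>_unbounded_below) (use U V in auto)
  hence "N \<noteq> {}" unfolding N_def by blast
  then obtain y where y: "y \<in> N" "u y \<noteq> -\<infinity>" using dense[OF oN] by blast
  have yB: "y \<in> ?B \<inter> reg_part X" "y \<in> V \<inter> reg_part X" and \<Phi>y: "\<Phi> y < ereal (- c - real n - 1)"
    using y(1) unfolding N_def by blast+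
  have "u y < \<infinity>" by (rule sub_pshD(2)[OF sub yB(2)])
  then obtain r where r: "u y = ereal r" using y(2) by (cases "u y") auto
  define \<epsilon> where "\<epsilon> = min E (1 / (1 + \<bar>r\<bar>))"
  have \<epsilon>: "0 < \<epsilon>" "\<epsilon> \<le> E" using E by (auto simp: \<epsilon>_def)
  have "\<epsilon> * \<bar>r\<bar> \<le> 1 / (1 + \<bar>r\<bar>) * \<bar>r\<bar>" by (intro mult_right_mono) (auto simp: \<epsilon>_def)
  also have "\<dots> \<le> 1" by (simp add: field_simps)
  finally have "\<epsilon> * \<bar>r\<bar> \<le> 1" .
  moreover have "\<epsilon> * (- \<bar>r\<bar>) \<le> \<epsilon> * r" using \<epsilon>(1) by (intro mult_left_mono) auto
  ultimately have "\<epsilon> * r \<ge> -1" by simp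
  hence P3: "\<Phi> y + ereal (real n) < ereal \<epsilon> * u y + ereal (- c)"
    using \<Phi>y r by (cases "\<Phi> y") auto
  obtain U1 C where U1: "open U1" "z0 \<in> U1" and le: "\<And>z. z \<in> U1 \<inter> reg_part X \<Longrightarrow> ereal \<epsilon> * u z \<le> \<Phi> z + ereal C"
    using dom[OF \<epsilon>(1)] unfolding le_O1_def by metis
  define D where "D = max D0 C"
  obtain U2 where U2: "open U2" "z0 \<in> U2"
      "twist \<Phi> \<in> borel_measurable (restrict_space ?M (U2 \<inter> reg_part X))"
    using meas_twist[OF psh_near_meas[OF \<Phi>]] unfolding meas_near_def by metis
  have "open (U1 \<inter> U2 \<inter> V)" "z0 \<in> U1 \<inter> U2 \<inter> V" using U1 U2 V by auto
  then obtain \<rho>1 where \<rho>1: "\<rho>1 > 0" "ball z0 \<rho>1 \<subseteq> U1 \<inter> U2 \<inter> V" by (rule openE)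
  define \<rho> where "\<rho> = min (min \<rho>0 \<rho>1) (1 / (real n + 2))"
  have \<rho>: "0 < \<rho>" "\<rho> \<le> \<rho>0" "\<rho> \<le> \<rho>1" using \<rho>0 \<rho>1 by (auto simp: \<rho>_def)
  have "1 / (real n + 2) < 1 / (real n + 1)" by (intro divide_strict_left_mono) auto
  hence \<rho>n: "\<rho> < 1 / (real n + 1)" by (auto simp: \<rho>_def)
  have sB: "ball z0 \<rho> \<subseteq> U1" "ball z0 \<rho> \<subseteq> U2" "ball z0 \<rho> \<subseteq> V"
    using subset_ball[OF \<rho>(3), of z0] \<rho>1(2) by blast+
  have P1: "ereal \<epsilon> * u z + ereal (- c) \<le> \<Phi> z + ereal D" if z: "z \<in> ball z0 \<rho> \<inter> reg_part X" for z
  proof -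
    have "ereal \<epsilon> * u z + ereal (- c) \<le> (\<Phi> z + ereal C) + ereal 0"
      by (rule add_mono[OF le]) (use z sB c in auto)
    also have "\<dots> \<le> \<Phi> z + ereal D" unfolding add.assoc by (rule add_left_mono) (simp add: D_def)
    finally show ?thesis .
  qed
  let ?A = "ball z0 \<rho> \<inter> reg_part X"
  have A: "?A \<in> sets ?M" by (rule open_Int_reg_part_sets[OF open_ball reg_borel])
  have fA: "twist \<Phi> \<in> borel_measurable (restrict_space ?M ?A)"
    by (rule measurable_restrict_mono[OF U2(3)]) (use sB in blast)
  have uA: "u \<in> borel_measurable (restrict_space ?M ?A)"
    by (rule measurable_restrict_mono[OF sub_pshD(1)[OF sub]]) (use sB in blast)
  have inf: "(\<integral>\<^sup>+ z \<in> ?A. twist \<Phi> z \<partial>?M) = \<infinity>"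
  proof (rule ccontr)
    assume "\<not> ?thesis"
    hence "(\<integral>\<^sup>+ z \<in> ?A. twist \<Phi> z \<partial>?M) < \<infinity>" by (simp add: less_top)
    hence "integrable_near X z0 (twist \<Phi>)"
      unfolding integrable_near_def using fA \<rho>(1) by (intro exI[of _ "ball z0 \<rho>"]) simp
    thus False using not_integrable by contradiction
  qed
  obtain T where T: "T0 \<le> T" "ennreal (real n * exp (2 * D))
       \<le> (\<integral>\<^sup>+ z \<in> {z \<in> ?A. u z = -\<infinity> \<or> - ereal T \<le> u z}. twist \<Phi> z \<partial>?M)"
    using nn_integral_infinite_exhaustion[OF A _ fA uA inf, of T0 "real n * exp (2 * D)"]
    by (auto simp: space_vol_measure)
  show ?thesis
    by (rule that[OF \<epsilon> T(1) _ \<rho>(1,2) \<rho>n P1 T(2)]) (use P3 yB in \<open>auto simp: D_def\<close>)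
qed

text \<open>The tuple is \<open>(\<epsilon>, c, T, D, \<rho>)\<close>; packing it into one argument suits dependent choice.\<close>

definition stage :: "(complex^'n \<Rightarrow> ereal) \<Rightarrow> nat \<Rightarrow> real \<times> real \<times> real \<times> real \<times> real \<Rightarrow> bool" where
  "stage u n = (\<lambda>(\<epsilon>, c, T, D, \<rho>). 0 < \<epsilon> \<and> real n \<le> c \<and> 0 \<le> T \<and> 0 \<le> D \<and> 0 < \<rho> \<and> \<rho> < 1 / (real n + 1) \<and>
     (\<forall>z \<in> ball z0 \<rho> \<inter> reg_part X. ereal \<epsilon> * u z + ereal (- c) \<le> \<Phi> z + ereal D) \<and>
     ennreal (real n * exp (2 * D))
       \<le> (\<integral>\<^sup>+ z \<in> {z \<in> ball z0 \<rho> \<inter> reg_part X. u z = -\<infinity> \<or> - ereal T \<le> u z}. twist \<Phi> z \<partial>completion (vol_measure X)) \<and>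
     (\<exists>z\<in>ball z0 (1 / (real n + 1)) \<inter> reg_part X. \<Phi> z + ereal (real n) < ereal \<epsilon> * u z + ereal (- c)))"

text \<open>Choose successively, by \<open>diagonal_step\<close>, decreasing \<open>\<epsilon>\<^sub>k\<close> and constants with
\<open>c\<^bsub>k+1\<^esub> = c\<^sub>k + \<epsilon>\<^sub>k T\<^sub>k + 1\<close>.  This makes the later functions \<open>\<epsilon>\<^sub>i u - c\<^sub>i\<close> smaller than \<open>\<epsilon>\<^sub>k u - c\<^sub>k\<close> where
\<open>u \<ge> - T\<^sub>k\<close>, so that \<open>\<psi> = max \<Phi> (SUP k. \<epsilon>\<^sub>k u - c\<^sub>k)\<close> is at most \<open>\<Phi> + D\<^sub>k\<close> on the set that carries the prescribed
mass \<open>k e\<^sup>2\<^sup>D\<close>, \<open>D = D\<^sub>k\<close>, of \<open>w e\<^sup>-\<^sup>2\<^sup>\<Phi>\<close> in the ball of radius \<open>\<rho>\<^sub>k\<close>.  Hence \<open>w e\<^sup>-\<^sup>2\<^sup>\<psi>\<close> has mass at least \<open>k\<close> in this ball,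
for all \<open>k\<close>, and is not integrable near \<open>z0\<close>.  On the other hand \<open>\<psi> > \<Phi> + k\<close> at points converging to \<open>z0\<close>.\<close>

lemma no_small_multiples:
  fixes u :: "complex^'n \<Rightarrow> ereal"
  assumes V: "open V" "z0 \<in> V" and sub: "sub_psh X V u"
    and sub_shift: "\<And>\<epsilon> c. \<epsilon> > 0 \<Longrightarrow> sub_psh X V (\<lambda>z. ereal \<epsilon> * u z + ereal (- c))"
    and u0: "\<And>z. z \<in> V \<inter> reg_part X \<Longrightarrow> u z \<le> 0"
    and dom: "\<And>\<epsilon>. \<epsilon> > 0 \<Longrightarrow> le_O1 X z0 (\<lambda>z. ereal \<epsilon> * u z) \<Phi>"
    and dense: "\<And>N. openin (top_of_set (V \<inter> reg_part X)) N \<Longrightarrow> N \<noteq> {} \<Longrightarrow> \<exists>z\<in>N. u z \<noteq> -\<infinity>"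
  shows False
proof -
  let ?M = "completion (vol_measure X)" and ?R = "reg_part X"
  define Q where "Q = (\<lambda>(\<epsilon>::real, c, T, D::real, \<rho>::real) (\<epsilon>'::real, c', T', D', \<rho>').
     \<epsilon>' \<le> \<epsilon> \<and> c' = c + \<epsilon> * T + 1 \<and> T \<le> (T'::real) \<and> D \<le> D' \<and> \<rho>' \<le> \<rho>)"
  have base: "\<exists>x. stage u 0 x"
  proof -
    obtain \<epsilon> T D \<rho> where s: "0 < \<epsilon>" "\<epsilon> \<le> 1" "0 \<le> T" "0 \<le> D" "0 < \<rho>" "\<rho> \<le> 1" "\<rho> < 1 / (real 0 + 1)"
      "\<And>z. z \<in> ball z0 \<rho> \<inter> ?R \<Longrightarrow> ereal \<epsilon> * u z + ereal (- 0) \<le> \<Phi> z + ereal D"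
      "ennreal (real 0 * exp (2 * D))
         \<le> (\<integral>\<^sup>+ z \<in> {z \<in> ball z0 \<rho> \<inter> ?R. u z = -\<infinity> \<or> - ereal T \<le> u z}. twist \<Phi> z \<partial>?M)"
      "\<exists>z\<in>ball z0 (1 / (real 0 + 1)) \<inter> ?R. \<Phi> z + ereal (real 0) < ereal \<epsilon> * u z + ereal (- 0)"
      by (rule diagonal_step[OF V sub dom dense, of 1 0 1 0 0 0]) simp_all
    have "stage u 0 (\<epsilon>, 0, T, D, \<rho>)" unfolding stage_def prod.case using s by (intro conjI ballI) simp_all
    thus ?thesis by blast
  qed
  have step: "\<exists>y. stage u (Suc n) y \<and> Q x y" if x: "stage u n x" for n x
  proof -
    obtain \<epsilon> c T D \<rho> where xe: "x = (\<epsilon>, c, T, D, \<rho>)" by (cases x) auto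
    have p: "0 < \<epsilon>" "real n \<le> c" "0 \<le> T" "0 \<le> D" "0 < \<rho>" using x unfolding xe stage_def by auto
    define c' where "c' = c + \<epsilon> * T + 1"
    have c': "real (Suc n) \<le> c'" "0 \<le> c'" using p by (auto simp: c'_def add_nonneg_nonneg intro: add_increasing2)
    obtain \<epsilon>' T' D' \<rho>' where s: "0 < \<epsilon>'" "\<epsilon>' \<le> \<epsilon>" "T \<le> T'" "D \<le> D'" "0 < \<rho>'" "\<rho>' \<le> \<rho>" "\<rho>' < 1 / (real (Suc n) + 1)"
      "\<And>z. z \<in> ball z0 \<rho>' \<inter> ?R \<Longrightarrow> ereal \<epsilon>' * u z + ereal (- c') \<le> \<Phi> z + ereal D'"
      "ennreal (real (Suc n) * exp (2 * D'))
         \<le> (\<integral>\<^sup>+ z \<in> {z \<in> ball z0 \<rho>' \<inter> ?R. u z = -\<infinity> \<or> - ereal T' \<le> u z}. twist \<Phi> z \<partial>?M)"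
      "\<exists>z\<in>ball z0 (1 / (real (Suc n) + 1)) \<inter> ?R. \<Phi> z + ereal (real (Suc n)) < ereal \<epsilon>' * u z + ereal (- c')"
      by (rule diagonal_step[OF V sub dom dense p(1) c'(2) p(5), of T D "Suc n"])
        (assumption | (rule that; assumption))+
    have "stage u (Suc n) (\<epsilon>', c', T', D', \<rho>')" unfolding stage_def prod.case
      by (intro conjI ballI s(1,5,7,8,9,10) c'(1) order_trans[OF p(3) s(3)] order_trans[OF p(4) s(4)])
    moreover have "Q x (\<epsilon>', c', T', D', \<rho>')" unfolding Q_def xe prod.case c'_def using s by simp
    ultimately show ?thesis by blast
  qed
  obtain F where F: "\<And>n. stage u n (F n)" "\<And>n. Q (F n) (F (Suc n))"
    using dependent_nat_choice[of "stage u" "\<lambda>_. Q", OF base step] by blast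
  define \<epsilon> c T D \<rho> where "\<epsilon> n = fst (F n)" and "c n = fst (snd (F n))" and "T n = fst (snd (snd (F n)))"
    and "D n = fst (snd (snd (snd (F n))))" and "\<rho> n = snd (snd (snd (snd (F n))))" for n
  have Fe: "F n = (\<epsilon> n, c n, T n, D n, \<rho> n)" for n by (simp add: \<epsilon>_def c_def T_def D_def \<rho>_def)
  have st: "0 < \<epsilon> n" "real n \<le> c n" "0 \<le> T n" "0 \<le> D n" "0 < \<rho> n" "\<rho> n < 1 / (real n + 1)"
     "\<And>z. z \<in> ball z0 (\<rho> n) \<inter> ?R \<Longrightarrow> ereal (\<epsilon> n) * u z + ereal (- c n) \<le> \<Phi> z + ereal (D n)"
     "ennreal (real n * exp (2 * D n))
       \<le> (\<integral>\<^sup>+ z \<in> {z \<in> ball z0 (\<rho> n) \<inter> ?R. u z = -\<infinity> \<or> - ereal (T n) \<le> u z}. twist \<Phi> z \<partial>?M)"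
     "\<exists>z\<in>ball z0 (1 / (real n + 1)) \<inter> ?R. \<Phi> z + ereal (real n) < ereal (\<epsilon> n) * u z + ereal (- c n)" for n
    using F(1)[of n] unfolding stage_def Fe prod.case by blast+
  have tr: "\<epsilon> (Suc n) \<le> \<epsilon> n" "c (Suc n) = c n + \<epsilon> n * T n + 1" "T n \<le> T (Suc n)" "D n \<le> D (Suc n)" "\<rho> (Suc n) \<le> \<rho> n" for n
    using F(2)[of n] unfolding Q_def Fe prod.case by blast+
  have D_mono: "D i \<le> D j" if "i \<le> j" for i j using tr(4) that by (rule lift_Suc_mono_le)
  have \<rho>_mono: "\<rho> j \<le> \<rho> i" if "i \<le> j" for i j using tr(5) that by (rule lift_Suc_antimono_le)
  have c_mono: "c i \<le> c j" if "i \<le> j" for i j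
  proof (rule lift_Suc_mono_le[OF _ that])
    show "c n \<le> c (Suc n)" for n unfolding tr(2) using st(1,3)[of n] by simp
  qed
  define v where "v k z = ereal (\<epsilon> k) * u z + ereal (- c k)" for k z
  define W where "W = (\<lambda>z. SUP k. v k z)"
  define \<psi> where "\<psi> z = max (\<Phi> z) (W z)" for z
  have subW: "sub_psh X V W" unfolding W_def
  proof (rule sub_psh_SUP)
    show "sub_psh X V (v k)" for k unfolding v_def[abs_def] by (rule sub_shift[OF st(1)])
    fix k z assume z: "z \<in> V \<inter> ?R"
    have "ereal (\<epsilon> k) * u z \<le> 0" using u0[OF z] st(1)[of k] by (simp add: ereal_mult_le_0_iff)
    hence "v k z \<le> 0 + ereal (- c k)" unfolding v_def by (rule add_right_mono)
    also have "\<dots> \<le> - ereal (real k)" using st(2)[of k] by simp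
    finally show "v k z \<le> - ereal (real k)" .
  qed
  have psh: "psh_near X z0 \<psi>" unfolding \<psi>_def[abs_def] by (rule psh_near_max[OF \<Phi> subW V])
  have \<Phi>\<psi>: "le_O1 X z0 \<Phi> \<psi>" by (rule le_O1_I[of UNIV _ _ _ _ 0]) (auto simp: \<psi>_def)
  have bound: "\<psi> z \<le> \<Phi> z + ereal (D k)"
    if z: "z \<in> V \<inter> ?R" "z \<in> ball z0 (\<rho> k)" "u z = -\<infinity> \<or> - ereal (T k) \<le> u z" for k z
  proof -
    have \<Phi>le: "\<Phi> z + ereal d \<le> \<Phi> z + ereal (D k)" if "d \<le> D k" for d
      by (rule add_left_mono) (use that in simp)
    have vi: "v i z \<le> \<Phi> z + ereal (D k)" if "i \<le> k" for i
    proof -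
      have "z \<in> ball z0 (\<rho> i) \<inter> ?R" using z(1,2) \<rho>_mono[OF that] by auto
      hence "v i z \<le> \<Phi> z + ereal (D i)" unfolding v_def by (rule st(7))
      also have "\<dots> \<le> \<Phi> z + ereal (D k)" by (rule \<Phi>le[OF D_mono[OF that]])
      finally show ?thesis .
    qed
    have "v i z \<le> \<Phi> z + ereal (D k)" for i
    proof (cases "i \<le> k \<or> u z = -\<infinity>")
      case True
      moreover have "v i z = -\<infinity>" if "u z = -\<infinity>" using that st(1)[of i] by (simp add: v_def)
      ultimately show ?thesis using vi by auto
    next
      case False
      \<comment> \<open>later functions are smaller where \<open>u \<ge> - T k\<close>\<close>
      hence ik: "Suc k \<le> i" and uT: "- ereal (T k) \<le> u z" using z(3) by auto
      obtain r where r: "u z = ereal r" using u0[OF z(1)] False by (cases "u z") auto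
      have r1: "r \<le> 0" "- T k \<le> r" using u0[OF z(1)] uT r by auto
      have "\<epsilon> i * r \<le> 0" using st(1)[of i] r1(1) by (simp add: mult_nonneg_nonpos)
      moreover have "\<epsilon> k * (- T k) \<le> \<epsilon> k * r" using st(1)[of k] r1(2) by (intro mult_left_mono) auto
      moreover have "c k + \<epsilon> k * T k + 1 \<le> c i" using c_mono[OF ik] tr(2)[of k] by simp
      ultimately have "v i z \<le> v k z" unfolding v_def r by simp
      thus ?thesis using vi[of k] by auto
    qed
    hence "W z \<le> \<Phi> z + ereal (D k)" unfolding W_def by (rule SUP_least)
    moreover have "\<Phi> z \<le> \<Phi> z + ereal (D k)" using \<Phi>le[OF st(4)[of k]] by (simp add: zero_ereal_def[symmetric])
    ultimately show ?thesis by (simp add: \<psi>_def)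
  qed
  have not: "\<not> integrable_near X z0 (twist \<psi>)"
  proof
    assume "integrable_near X z0 (twist \<psi>)"
    then obtain U where U: "open U" "z0 \<in> U" "twist \<psi> \<in> borel_measurable (restrict_space ?M (U \<inter> ?R))"
      "(\<integral>\<^sup>+ z \<in> U \<inter> ?R. twist \<psi> z \<partial>?M) < \<infinity>" unfolding integrable_near_def by blast
    define J where "J = (\<integral>\<^sup>+ z \<in> U \<inter> ?R. twist \<psi> z \<partial>?M)"
    have UM: "(\<lambda>z. twist \<psi> z * indicator (U \<inter> ?R) z) \<in> borel_measurable ?M"
      using U(3) open_Int_reg_part_sets[OF U(1) reg_borel] borel_measurable_restrict_space_iff_ennreal[of "U \<inter> ?R" ?M]
      by (auto simp: space_vol_measure)
    obtain j where j: "J = ennreal j" "j \<ge> 0" using U(4) unfolding J_def[symmetric] by (cases J) auto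
    have "open (U \<inter> V)" "z0 \<in> U \<inter> V" using U V by auto
    then obtain r where r: "r > 0" "ball z0 r \<subseteq> U \<inter> V" by (rule openE)
    \<comment> \<open>large enough for the ball of radius \<open>\<rho> k\<close> to be in \<open>U\<close> and for the mass \<open>k\<close> to exceed \<open>j\<close>\<close>
    obtain k :: nat where k: "k > 1 / r + j" using reals_Archimedean2 by blast
    have "1 / r < real k + 1" using k j(2) by simp
    hence "1 / (real k + 1) < r" using r(1) by (simp add: field_simps)
    hence "\<rho> k \<le> r" using st(6)[of k] by simp
    hence sub_r: "ball z0 (\<rho> k) \<subseteq> U \<inter> V" using subset_ball[of "\<rho> k" r z0] r(2) by blast
    define S where "S = {z \<in> ball z0 (\<rho> k) \<inter> ?R. u z = -\<infinity> \<or> - ereal (T k) \<le> u z}"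
    have "twist \<Phi> z * indicator S z \<le> ennreal (exp (2 * D k)) * (twist \<psi> z * indicator (U \<inter> ?R) z)" for z
    proof (cases "z \<in> S")
      case True
      hence zU: "z \<in> U \<inter> ?R" "z \<in> V \<inter> ?R" using sub_r by (auto simp: S_def)
      have "\<psi> z \<le> \<Phi> z + ereal (D k)" using True zU by (intro bound) (auto simp: S_def)
      hence "ereal_exp (ereal (-2) * (\<Phi> z + ereal (D k))) \<le> ereal_exp (ereal (-2) * \<psi> z)" by (rule ereal_exp_antimono)
      hence "ereal_exp (ereal (-2) * \<Phi> z) \<le> ennreal (exp (2 * D k)) * ereal_exp (ereal (-2) * \<psi> z)"
        unfolding ereal_exp_shift[of "\<Phi> z" "D k"] by (rule mult_left_mono) simp
      hence "twist \<Phi> z \<le> weight f0 \<phi>0 z * (ennreal (exp (2 * D k)) * ereal_exp (ereal (-2) * \<psi> z))"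
        by (rule mult_left_mono) simp
      thus ?thesis using True zU(1) by (simp add: ac_simps)
    qed simp
    hence "(\<integral>\<^sup>+ z \<in> S. twist \<Phi> z \<partial>?M) \<le> (\<integral>\<^sup>+ z. ennreal (exp (2 * D k)) * (twist \<psi> z * indicator (U \<inter> ?R) z) \<partial>?M)"
      by (rule nn_integral_mono)
    also have "\<dots> = ennreal (exp (2 * D k)) * J" unfolding J_def by (rule nn_integral_cmult[OF UM])
    also have "\<dots> = ennreal (exp (2 * D k) * j)" unfolding j(1) using j(2) by (simp add: ennreal_mult)
    finally have "(\<integral>\<^sup>+ z \<in> S. twist \<Phi> z \<partial>?M) \<le> ennreal (exp (2 * D k) * j)" .
    hence "ennreal (real k * exp (2 * D k)) \<le> ennreal (exp (2 * D k) * j)"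
      using st(8)[of k] unfolding S_def by (rule order_trans[rotated])
    hence "real k * exp (2 * D k) \<le> exp (2 * D k) * j" using j(2) by (subst (asm) ennreal_le_iff) auto
    hence "real k \<le> j" by (simp add: mult.commute)
    moreover have "1 / r > 0" using r by simp
    ultimately show False using k by linarith
  qed
  from maximal[OF psh \<Phi>\<psi> not] obtain U C where U: "open U" "z0 \<in> U"
    and le: "\<And>z. z \<in> U \<inter> ?R \<Longrightarrow> \<psi> z \<le> \<Phi> z + ereal C" unfolding le_O1_def by metis
  obtain r where r: "r > 0" "ball z0 r \<subseteq> U" using U by (rule openE)
  obtain k :: nat where k: "k > 1 / r + \<bar>C\<bar>" using reals_Archimedean2 by blast
  have "1 / r < real k + 1" using k by simp
  hence "1 / (real k + 1) \<le> r" using r(1) by (simp add: field_simps)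
  hence kU: "ball z0 (1 / (real k + 1)) \<subseteq> U" using subset_ball[of "1 / (real k + 1)" r z0] r(2) by blast
  obtain z where z: "z \<in> ball z0 (1 / (real k + 1)) \<inter> ?R" "\<Phi> z + ereal (real k) < v k z"
    using st(9)[of k] unfolding v_def by blast
  have "1 / r > 0" using r by simp
  hence "C \<le> real k" using k by linarith
  hence "\<Phi> z + ereal C \<le> \<Phi> z + ereal (real k)" by (intro add_left_mono) simp
  also have "\<dots> < v k z" by (rule z(2))
  also have "v k z \<le> W z" unfolding W_def by (rule SUP_upper) simp
  also have "W z \<le> \<psi> z" by (simp add: \<psi>_def)
  also have "\<psi> z \<le> \<Phi> z + ereal C" by (rule le) (use z(1) kU in blast)
  finally show False by simp
qed

end

section \<open>Relative types and jumping numbers\<close>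

lemma log_norm_cmult:
  fixes f :: "'a \<Rightarrow> complex"
  shows "log_norm (\<lambda>z. of_real (exp t) * f z) z = log_norm f z + ereal t"
  by (simp add: log_norm_def norm_mult ln_mult)

lemma rel_type_infinite_mem:
  assumes "rel_type X p \<psi> \<phi> = \<infinity>"
  obtains c where "c > B" "0 \<le> c" "le_O1 X p \<psi> (\<lambda>z. ereal c * \<phi> z)"
proof -
  have "ereal B < Sup (ereal ` {c. 0 \<le> c \<and> le_O1 X p \<psi> (\<lambda>z. ereal c * \<phi> z)})"
    using assms unfolding rel_type_def by simp
  then obtain c where "0 \<le> c" "le_O1 X p \<psi> (\<lambda>z. ereal c * \<phi> z)" "ereal B < ereal c"
    unfolding less_Sup_iff by blast
  thus ?thesis by (intro that[of c]) simp_all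
qed

text \<open>There is \<open>c > 1 / \<epsilon>\<close> with \<open>\<psi> \<le> c \<Phi> + O(1)\<close>, and \<open>\<epsilon> c \<Phi> \<le> \<Phi> + O(1)\<close> because \<open>\<Phi>\<close> is bounded above.\<close>

lemma (in zhou_setting) rel_type_infinite_dominated:
  assumes inf: "rel_type X z0 \<psi> \<Phi> = \<infinity>" and \<epsilon>: "\<epsilon> > 0"
    and fin: "open V" "z0 \<in> V" "\<And>z. z \<in> V \<inter> reg_part X \<Longrightarrow> \<psi> z < \<infinity>"
  shows "le_O1 X z0 (\<lambda>z. ereal \<epsilon> * (\<psi> z + ereal t)) \<Phi>"
proof -
  obtain c where c: "c > 1 / \<epsilon>" "0 \<le> c" "le_O1 X z0 \<psi> (\<lambda>z. ereal c * \<Phi> z)"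
    using rel_type_infinite_mem[OF inf] by metis
  have "0 < 1 / \<epsilon>" using \<epsilon> by simp
  hence c0: "c > 0" using c(1) by linarith
  have ec: "\<epsilon> * c > 1" using c(1) \<epsilon> by (simp add: field_simps)
  obtain U C where U: "open U" "z0 \<in> U" and le: "\<And>z. z \<in> U \<inter> reg_part X \<Longrightarrow> \<psi> z \<le> ereal c * \<Phi> z + ereal C"
    using c(3) unfolding le_O1_def by metis
  obtain W M where W: "open W" "z0 \<in> W" "M \<ge> 0" "\<And>z. z \<in> W \<inter> reg_part X \<Longrightarrow> \<Phi> z \<le> ereal M"
    using \<Phi>_bounded_above by metis
  show ?thesis
  proof (rule le_O1_I[of "U \<inter> W \<inter> V"])
    fix z assume z: "z \<in> U \<inter> W \<inter> V \<inter> reg_part X"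
    have zz: "\<psi> z \<le> ereal c * \<Phi> z + ereal C" "\<Phi> z \<le> ereal M" "\<psi> z < \<infinity>" using le[of z] W(4)[of z] fin(3)[of z] z by auto
    show "ereal \<epsilon> * (\<psi> z + ereal t) \<le> \<Phi> z + ereal ((\<epsilon> * c - 1) * M + \<epsilon> * (C + t))"
    proof (cases "\<psi> z")
      case (real l)
      obtain x where x: "\<Phi> z = ereal x" using zz c0 real by (cases "\<Phi> z") auto
      have "(\<epsilon> * c - 1) * x \<le> (\<epsilon> * c - 1) * M" using zz(2) x ec by (intro mult_left_mono) auto
      moreover have "\<epsilon> * l \<le> \<epsilon> * (c * x + C)" using zz(1) real x \<epsilon> by (intro mult_left_mono) auto
      ultimately show ?thesis using real x by (simp add: algebra_simps)
    qed (use zz \<epsilon> in auto)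
  qed (use U W fin in auto)
qed

text \<open>By \<open>irreducible_vanishing\<close> it suffices to find zeros of \<open>G\<close> filling open parts of \<open>X\<close> near \<open>z0\<close>.  Without
them \<open>no_small_multiples\<close> applies to \<open>log |G| - L\<close>, where \<open>L\<close> is chosen such that this function is negative
near \<open>z0\<close>.\<close>

lemma rel_type_infinite_imp_zero:
  fixes \<Omega> X :: "(complex^'n) set" and f0 :: "complex^'n \<Rightarrow> complex^'m"
  assumes X: "open \<Omega>" "analytic_subset \<Omega> X" "pure_dim X d" "irreducible_germ X z0"
    and Z: "zhou_setting X z0 f0 \<phi>0 \<Phi>" and G: "holo_near X z0 G"
    and inf: "rel_type X z0 (log_norm G) \<Phi> = \<infinity>"
  shows "\<exists>W. open W \<and> z0 \<in> W \<and> (\<forall>z\<in>X \<inter> W. G z = 0)"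
proof (rule irreducible_vanishing[OF X G], rule ccontr)
  fix W0 assume W0: "open W0" "z0 \<in> W0"
  assume no: "\<not> (\<exists>q N. q \<in> W0 \<inter> reg_part X \<and> open N \<and> q \<in> N \<and> (\<forall>z\<in>X \<inter> N. G z = 0))"
  interpret zhou_setting X z0 f0 \<phi>0 \<Phi> by (rule Z)
  obtain U g where U: "open U" "z0 \<in> U" "holo_on g U" "\<And>z. z \<in> X \<inter> U \<Longrightarrow> G z = g z"
    using G unfolding holo_near_def by metis
  define L where "L = ln (norm (g z0) + 1)"
  have L: "exp L = norm (g z0) + 1" by (simp add: L_def add_nonneg_pos)
  define V where "V = W0 \<inter> (U \<inter> (\<lambda>z. norm (g z)) -` {..<exp L})"
  have "open (U \<inter> (\<lambda>z. norm (g z)) -` {..<exp L})"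
    by (intro continuous_open_preimage U(1) continuous_intros holo_on_imp_continuous_on[OF U(3)])
  hence V: "open V" "z0 \<in> V" using W0 U(2) L by (auto simp: V_def)
  have VU: "V \<subseteq> U" by (auto simp: V_def)
  have sub: "sub_psh X V (\<lambda>z. log_norm G z + ereal t)" for t
  proof -
    have "sub_psh X V (log_norm (\<lambda>z. of_real (exp t) * G z))"
    proof (rule sub_psh_log_norm[OF V(1)])
      show "holo_on (\<lambda>z. of_real (exp t) * g z) V"
        by (rule holo_on_mult[OF holo_on_const holo_on_subset[OF U(3) VU]])
    qed (use U(4) VU in auto)
    thus ?thesis by (simp add: log_norm_cmult[abs_def])
  qed
  define u where "u z = log_norm G z + ereal (- L)" for z
  show False
  proof (rule no_small_multiples[OF V])
    show "sub_psh X V u" unfolding u_def[abs_def] by (rule sub)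
    show "sub_psh X V (\<lambda>z. ereal \<epsilon> * u z + ereal (- c))" if "\<epsilon> > 0" for \<epsilon> c
    proof -
      have "ereal \<epsilon> * (log_norm G z + ereal (- L - c / \<epsilon>)) = ereal \<epsilon> * u z + ereal (- c)" for z
        using that by (cases "log_norm G z") (auto simp: u_def field_simps)
      thus ?thesis using sub_psh_scale[OF sub that, of "- L - c / \<epsilon>"] by simp
    qed
    show "u z \<le> 0" if z: "z \<in> V \<inter> reg_part X" for z
    proof -
      have "z \<in> X" using z by (simp add: mem_reg_part_iff)
      hence "norm (G z) < exp L" using U(4)[of z] z by (auto simp: V_def)
      hence "log_norm G z < ereal L" by (simp add: log_norm_less_iff)
      thus ?thesis unfolding u_def by (cases "log_norm G z") auto
    qed
    show "le_O1 X z0 (\<lambda>z. ereal \<epsilon> * u z) \<Phi>" if "\<epsilon> > 0" for \<epsilon>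
      unfolding u_def by (rule rel_type_infinite_dominated[OF inf that V log_norm_less_infinity])
    fix N assume N: "openin (top_of_set (V \<inter> reg_part X)) N" "N \<noteq> {}"
    obtain T where T: "open T" "N = (V \<inter> reg_part X) \<inter> T" using N(1) unfolding openin_open by blast
    obtain q where q: "q \<in> N" using N(2) by blast
    have qR: "q \<in> W0 \<inter> reg_part X" using q T(2) by (auto simp: V_def)
    then obtain I U' V' F H where ch: "slice_chart X I U' V' F H" "q \<in> U'" by (auto simp: mem_reg_part_iff)
    have "open (V \<inter> T \<inter> U')" using V T(1) ch(1) by (auto simp: slice_chart_def)
    moreover have "q \<in> V \<inter> T \<inter> U'" using q T(2) ch(2) by blast
    ultimately obtain z where z: "z \<in> X \<inter> (V \<inter> T \<inter> U')" "G z \<noteq> 0" using no qR by blast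
    have "z \<in> reg_part X" using z(1) ch(1) unfolding mem_reg_part_iff by blast
    hence "z \<in> N" using z(1) T(2) by blast
    moreover have "u z \<noteq> -\<infinity>" using z(2) by (simp add: u_def log_norm_def)
    ultimately show "\<exists>z\<in>N. u z \<noteq> -\<infinity>" by blast
  qed
qed

lemma (in zhou_setting) jumping_number_zero:
  assumes G: "holo_near X z0 G" and W: "open W" "z0 \<in> W" "\<And>z. z \<in> X \<inter> W \<Longrightarrow> G z = 0"
  shows "jumping_number X z0 G \<Phi> = \<infinity>"
proof (rule ereal_top)
  fix c :: real
  have "integrable_near X z0 (\<lambda>_. 0)" unfolding integrable_near_def by (intro exI[of _ UNIV]) simp
  hence "integrable_near X z0 (weight G (\<lambda>z. ereal c * \<Phi> z))"
  proof (rule integrable_near_dominated[OF _ _ W(1,2)])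
    show "meas_near X z0 (weight G (\<lambda>z. ereal c * \<Phi> z))"
      by (rule weight_meas_near[OF holo_near_meas[OF G] meas_near_compose[OF psh_near_meas[OF \<Phi>], of "\<lambda>x. ereal c * x"]])
        measurable
    have "weight G (\<lambda>z. ereal c * \<Phi> z) z \<le> 0" if "z \<in> W \<inter> reg_part X" for z
      using W(3)[of z] that by (simp add: mem_reg_part_iff weight_0)
    thus "AE z in vol_measure X. z \<in> W \<inter> reg_part X \<longrightarrow> weight G (\<lambda>z. ereal c * \<Phi> z) z \<le> 0"
      by (intro AE_I2 impI)
  qed
  thus "ereal c \<le> jumping_number X z0 G \<Phi>" unfolding jumping_number_def by (intro Sup_upper) auto
qed

context zhou_setting begin

text \<open>Let the parameters of \<open>upper_bound_strict\<close> tend to the relative types.  If a relative type of \<open>log |G|\<close> or \<open>\<phi>0\<close>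
is \<open>\<infinity>\<close>, or that of \<open>log |f0|\<close> is the supremum \<open>-\<infinity>\<close> of the empty set, the right hand side is \<open>\<infinity>\<close>.\<close>

lemma jumping_number_upper:
  fixes G :: "complex^'n \<Rightarrow> complex"
  assumes G: "holo_near X z0 G"
  shows "jumping_number X z0 G \<Phi>
    \<le> rel_type X z0 (log_norm G) \<Phi> - rel_type X z0 (log_norm f0) \<Phi> + 1 + rel_type X z0 \<phi>0 \<Phi>"
proof -
  let ?g = "rel_type X z0 (log_norm G) \<Phi>" and ?f = "rel_type X z0 (log_norm f0) \<Phi>" and ?h = "rel_type X z0 \<phi>0 \<Phi>"
  define A where "A = {a. 0 \<le> a \<and> le_O1 X z0 (log_norm f0) (\<lambda>z. ereal a * \<Phi> z)}"
  have f: "?f = Sup (ereal ` A)" unfolding rel_type_def A_def ..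
  have g0: "0 \<le> ?g" using holo_near_sub_psh[OF G] rel_type_nonneg z0 by metis
  have h0: "0 \<le> ?h" using psh_near_sub_psh[OF \<phi>0] rel_type_nonneg z0 by metis
  show ?thesis
  proof (cases "?g = \<infinity> \<or> ?h = \<infinity> \<or> A = {}")
    case True
    hence "?g - ?f + 1 + ?h = \<infinity>"
    proof (elim disjE)
      assume "A = {}"
      hence "?f = -\<infinity>" unfolding f by (simp add: bot_ereal_def)
      thus ?thesis using g0 h0 by simp
    qed simp_all
    thus ?thesis by (simp only: ereal_less_eq(1))
  next
    case False
    obtain s where s: "?g = ereal s" "0 \<le> s" using False g0 by (cases ?g) auto
    obtain t where t: "?h = ereal t" "0 \<le> t" using False h0 by (cases ?h) auto
    have le: "c + a \<le> 1 + s + t" if c: "integrable_near X z0 (weight G (\<lambda>z. ereal c * \<Phi> z))" and a: "a \<in> A" for c a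
    proof (rule field_le_epsilon)
      fix e :: real assume e: "e > 0"
      have "c + a < 1 + (s + e / 2) + (t + e / 2)"
      proof (rule upper_bound_strict[OF G c])
        show "0 \<le> a" "le_O1 X z0 (log_norm f0) (\<lambda>z. ereal a * \<Phi> z)" using a by (auto simp: A_def)
        show "\<not> le_O1 X z0 (log_norm G) (\<lambda>z. ereal (s + e / 2) * \<Phi> z)"
          by (rule not_le_O1_rel_type) (use s e in auto)
        show "\<not> le_O1 X z0 \<phi>0 (\<lambda>z. ereal (t + e / 2) * \<Phi> z)"
          by (rule not_le_O1_rel_type) (use t e in auto)
      qed (use s t e in auto)
      thus "c + a \<le> 1 + s + t + e" by simp
    qed
    obtain a0 where a0: "a0 \<in> A" using False by blast
    show ?thesis unfolding jumping_number_def
    proof (rule Sup_least, clarify)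
      fix c assume c: "integrable_near X z0 (weight G (\<lambda>z. ereal c * \<Phi> z))"
      have up: "?f \<le> ereal (1 + s + t - c)" unfolding f
        by (rule Sup_least) (use le[OF c] in \<open>auto simp: algebra_simps\<close>)
      have "ereal a0 \<le> ?f" unfolding f using a0 by (intro Sup_upper) auto
      then obtain r where r: "?f = ereal r" using up by (cases ?f) auto
      have "r \<le> 1 + s + t - c" using up r by simp
      thus "ereal c \<le> ?g - ?f + 1 + ?h" unfolding r s t by (simp add: one_ereal_def)
    qed
  qed
qed

lemma jumping_number_upper_trivial_weight:
  fixes G :: "complex^'n \<Rightarrow> complex"
  assumes G: "holo_near X z0 G"
    and U: "open U" "z0 \<in> U" "AE z in vol_measure X. z \<in> U \<inter> reg_part X \<longrightarrow> weight f0 \<phi>0 z = 1"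
  shows "jumping_number X z0 G \<Phi> \<le> rel_type X z0 (log_norm G) \<Phi> + 1"
proof -
  let ?g = "rel_type X z0 (log_norm G) \<Phi>"
  have g0: "0 \<le> ?g" using holo_near_sub_psh[OF G] rel_type_nonneg z0 by metis
  show ?thesis
  proof (cases "?g = \<infinity>")
    case False
    obtain s where s: "?g = ereal s" "0 \<le> s" using False g0 by (cases ?g) auto
    have le: "c \<le> s + 1" if c: "integrable_near X z0 (weight G (\<lambda>z. ereal c * \<Phi> z))" for c
    proof (rule field_le_epsilon)
      fix e :: real assume e: "e > 0"
      have "c < 1 + (s + e)"
      proof (rule upper_bound_strict_trivial_weight[OF G c U])
        show "\<not> le_O1 X z0 (log_norm G) (\<lambda>z. ereal (s + e) * \<Phi> z)"
          by (rule not_le_O1_rel_type) (use s e in auto)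
      qed (use s e in auto)
      thus "c \<le> s + 1 + e" by simp
    qed
    have "jumping_number X z0 G \<Phi> \<le> ereal (s + 1)" unfolding jumping_number_def
      by (rule Sup_least) (use le in auto)
    thus ?thesis using s by (simp add: one_ereal_def)
  qed simp
qed

lemma jumping_number_one_ge_1:
  assumes U: "open U" "z0 \<in> U" "AE z in vol_measure X. z \<in> U \<inter> reg_part X \<longrightarrow> weight f0 \<phi>0 z = 1"
  shows "1 \<le> jumping_number X z0 (\<lambda>_. 1) \<Phi>"
proof (rule dense_le_bounded[of 0])
  fix x :: ereal assume x: "0 < x" "x < 1"
  then obtain c where c: "x = ereal c" "0 < c" "c < 1" by (cases x) auto
  show "x \<le> jumping_number X z0 (\<lambda>_. 1) \<Phi>"
    unfolding jumping_number_def c(1) using integrable_trivial_weight[OF U c(2,3)] by (intro Sup_upper) auto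
qed simp

lemma jumping_number_lower:
  fixes G :: "complex^'n \<Rightarrow> complex"
  assumes G: "holo_near X z0 G"
    and zero: "rel_type X z0 (log_norm G) \<Phi> = \<infinity> \<Longrightarrow> \<exists>W. open W \<and> z0 \<in> W \<and> (\<forall>z\<in>X \<inter> W. G z = 0)"
  shows "rel_type X z0 (log_norm G) \<Phi> + jumping_number X z0 (\<lambda>_. 1) \<Phi> \<le> jumping_number X z0 G \<Phi>"
proof -
  define A where "A = {a. 0 \<le> a \<and> le_O1 X z0 (log_norm G) (\<lambda>z. ereal a * \<Phi> z)}"
  define B where "B = {b. integrable_near X z0 (weight (\<lambda>_. 1 :: complex) (\<lambda>z. ereal b * \<Phi> z))}"
  have S: "rel_type X z0 (log_norm G) \<Phi> = Sup (ereal ` A)" "jumping_number X z0 (\<lambda>_. 1) \<Phi> = Sup (ereal ` B)"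
    unfolding rel_type_def A_def jumping_number_def B_def by simp_all
  obtain V where V: "open V" "z0 \<in> V" "sub_psh X V (log_norm G)" using holo_near_sub_psh[OF G] by metis
  have "0 \<in> A" using rel_type_0_mem[OF V(3,1,2) z0] by (simp add: A_def)
  hence A: "A \<noteq> {}" by blast
  consider "rel_type X z0 (log_norm G) \<Phi> = \<infinity>" | "B \<noteq> {}" | "rel_type X z0 (log_norm G) \<Phi> \<noteq> \<infinity>" "B = {}" by blast
  thus ?thesis
  proof cases
    case 1
    then obtain W where "open W" "z0 \<in> W" "\<And>z. z \<in> X \<inter> W \<Longrightarrow> G z = 0" using zero by blast
    hence "jumping_number X z0 G \<Phi> = \<infinity>" by (rule jumping_number_zero[OF G])
    thus ?thesis by simp
  next
    case 2
    have "ereal (a + b) \<le> jumping_number X z0 G \<Phi>" if "a \<in> A" "b \<in> B" for a b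
      unfolding jumping_number_def using that lower_bound_mem[OF G, of a b] by (intro Sup_upper) (auto simp: A_def B_def)
    thus ?thesis unfolding S by (rule Sup_ereal_add_le[OF A 2])
  next
    case 3
    hence "jumping_number X z0 (\<lambda>_. 1) \<Phi> = -\<infinity>" unfolding S by (simp add: bot_ereal_def)
    hence "rel_type X z0 (log_norm G) \<Phi> + jumping_number X z0 (\<lambda>_. 1) \<Phi> = -\<infinity>"
      using 3(1) by (cases "rel_type X z0 (log_norm G) \<Phi>") simp_all
    thus ?thesis by (simp only: ereal_less_eq(2))
  qed
qed

end

theorem theorem1p8:
  fixes \<Omega> X :: "(complex^'n) set" and z0 :: "complex^'n" and d :: nat
    and f0 :: "complex^'n \<Rightarrow> complex^'m" and \<phi>0 \<Phi> :: "complex^'n \<Rightarrow> ereal"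
    and G :: "complex^'n \<Rightarrow> complex"
  assumes "open \<Omega>" and "analytic_subset \<Omega> X" and "pure_dim X d"
    and "z0 \<in> X" and "irreducible_germ X z0"
    and "\<forall>i. holo_near X z0 (\<lambda>z. f0 z $ i)"
    and "psh_near X z0 \<phi>0"
    and "integrable_near X z0 (weight f0 \<phi>0)"
    and "local_zhou_weight X z0 f0 \<phi>0 \<Phi>"
    and "holo_near X z0 G"
  shows "(rel_type X z0 (log_norm G) \<Phi> + jumping_number X z0 (\<lambda>_. 1) \<Phi>
            \<le> jumping_number X z0 G \<Phi> \<and>
          jumping_number X z0 G \<Phi>
            \<le> rel_type X z0 (log_norm G) \<Phi> - rel_type X z0 (log_norm f0) \<Phi> + 1
              + rel_type X z0 \<phi>0 \<Phi>) \<and>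
         ((\<exists>U. open U \<and> z0 \<in> U \<and>
             (AE z in vol_measure X. z \<in> U \<inter> reg_part X \<longrightarrow> weight f0 \<phi>0 z = 1)) \<longrightarrow>
          rel_type X z0 (log_norm G) \<Phi> + 1 = jumping_number X z0 G \<Phi>)"
proof -
  have Z: "zhou_setting X z0 f0 \<phi>0 \<Phi>"
    by (rule zhou_setting.intro[OF reg_part_borel[OF assms(1,2)] assms(4,7,8,9)])
  then interpret zhou_setting X z0 f0 \<phi>0 \<Phi> .
  note G = assms(10)
  have lower: "rel_type X z0 (log_norm G) \<Phi> + jumping_number X z0 (\<lambda>_. 1) \<Phi> \<le> jumping_number X z0 G \<Phi>"
    by (rule jumping_number_lower[OF G]) (rule rel_type_infinite_imp_zero[OF assms(1,2,3,5) Z G])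
  have trivial: "rel_type X z0 (log_norm G) \<Phi> + 1 = jumping_number X z0 G \<Phi>"
    if U: "open U" "z0 \<in> U" "AE z in vol_measure X. z \<in> U \<inter> reg_part X \<longrightarrow> weight f0 \<phi>0 z = 1" for U
  proof (rule antisym)
    show "rel_type X z0 (log_norm G) \<Phi> + 1 \<le> jumping_number X z0 G \<Phi>"
      by (rule order_trans[OF add_left_mono[OF jumping_number_one_ge_1[OF U]] lower])
    show "jumping_number X z0 G \<Phi> \<le> rel_type X z0 (log_norm G) \<Phi> + 1"
      by (rule jumping_number_upper_trivial_weight[OF G U])
  qed
  show ?thesis using lower jumping_number_upper[OF G] trivial by blast
qed

end
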